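(* Let $n$ be any integer. There is a differential $D$ (a linear endomorphism of cohomological degree $+1$ with $D^2=0$) on the hairy graph complex $\mathrm{HGC}_{0,n}$ with the following properties: (1) $D$ deforms the standard differential $\delta$: the operation $D-\delta$ decreases the number of hairs by at least one. (2) $D$ preserves the grading on $\mathrm{HGC}_{0,n}$ by the number $(\text{loop order})+(\text{number of hairs})$. (3) $H(\mathrm{HGC}_{0,n},D)=0$. (4) The spectral sequence associated to the filtration of $(\mathrm{HGC}_{0,n},D)$ by number of hairs converges to $H(\mathrm{HGC}_{0,n},D)=0$, and its first page consists of the hairy graph cohomology $H(\mathrm{HGC}_{0,n},\delta)$.
   Context: Work over a field $\mathbb{K}$ of characteristic $0$, with cohomological conventions (differentials have degree $+1$). Hairy graphs. Consider finite connected graphs (multiple edges and loop edges allowed) having no bivalent vertices and at least one univalent vertex. The univalent vertices, with their incident edges, are called hairs; the vertices of valence at least $3$ are called internal. The graph consisting of a single edge joining two univalent vertices is included and has two hairs. The number of hairs is the number of univalent vertices; the loop order is the first Betti number of the graph. The graded space $\mathrm{HGC}_{m,n}$. For integers $m,n$, give each univalent vertex degree $m$, each internal vertex degree $n$ and each edge degree $1-n$. An orientation of a graph is an ordering of the set of all vertices and edges together with a direction of each edge. $\mathrm{HGC}_{m,n}$ is the space of (possibly infinite) $\mathbb{K}$-linear series of isomorphism classes of oriented hairy graphs, modulo the relations: permuting the ordering multiplies by the Koszul sign determined by the degrees; reversing the direction of an edge multiplies by $(-1)^n$. (So a graph with an automorphism acting by $-1$ is zero.) The cohomological degree of a graph is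 the sum of the degrees of its vertices and edges, minus $m$. For fixed number of hairs and loop order the space is finite dimensional, and $\mathrm{HGC}_{m,n}$ is the product of these pieces. Standard differential $\delta$. For a graph $\Gamma$, $\delta\Gamma$ is the sum over internal vertices $v$ and over all ways of splitting $v$ into two internal vertices joined by a new edge, distributing the half-edges at $v$ among the two vertices so that both have valence at least $3$ (the two resulting vertices being unordered). For the sign: one of the two vertices keeps the name $v$, the other is a new vertex $x$, the new edge $\varepsilon$ is directed from $v$ to $x$, and $x,\varepsilon$ are placed, in this order, at the beginning of the ordering. The differential $\delta$ preserves the number of hairs and the loop order. *)

theory Defs
  imports Complex_Main "HOL-Library.Function_Algebras" "HOL-Combinatorics.Permutations"
begin

section \<open>Oriented hairy graphs\<close>

text \<open>
  An isomorphism class of graphs with a total ordering of the set of all vertices and edges and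
  a direction of each edge is the same thing as a list of cells: the list is the ordering, and
  an edge records the positions in that list of its source and its target. (An isomorphism that
  preserves the ordering is unique, so distinct well-formed lists are non-isomorphic.)
\<close>

datatype 'v cell = Vertex | Edge 'v 'v

type_synonym ograph = "nat cell list"

definition verts :: "ograph \<Rightarrow> nat set" where
  "verts \<Gamma> = {v. v < length \<Gamma> \<and> \<Gamma> ! v = Vertex}"

definition edges :: "ograph \<Rightarrow> nat set" where
  "edges \<Gamma> = {e. e < length \<Gamma> \<and> \<Gamma> ! e \<noteq> Vertex}"

definition wf_ograph :: "ograph \<Rightarrow> bool" where
  "wf_ograph \<Gamma> \<longleftrightarrow> (\<forall>s t. Edge s t \<in> set \<Gamma> \<longrightarrow> s \<in> verts \<Gamma> \<and> t \<in> verts \<Gamma>)"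

text \<open>The half-edges at \<open>v\<close>: \<open>(e, False)\<close> is the source half and \<open>(e, True)\<close> the target half of the
  edge \<open>e\<close>. A loop contributes both of its halves, hence counts twice in the valence.\<close>

definition half_edges :: "ograph \<Rightarrow> nat \<Rightarrow> (nat \<times> bool) set" where
  "half_edges \<Gamma> v =
     {(e, False) | e t. e < length \<Gamma> \<and> \<Gamma> ! e = Edge v t} \<union>
     {(e, True) | e s. e < length \<Gamma> \<and> \<Gamma> ! e = Edge s v}"

definition valence :: "ograph \<Rightarrow> nat \<Rightarrow> nat" where
  "valence \<Gamma> v = card (half_edges \<Gamma> v)"

definition connected_ograph :: "ograph \<Rightarrow> bool" where
  "connected_ograph \<Gamma> \<longleftrightarrow>
     (let adj = {(s, t). Edge s t \<in> set \<Gamma>}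
      in \<forall>u\<in>verts \<Gamma>. \<forall>v\<in>verts \<Gamma>. (u, v) \<in> (adj \<union> adj\<inverse>)\<^sup>*)"

definition hairy :: "ograph \<Rightarrow> bool" where
  "hairy \<Gamma> \<longleftrightarrow> wf_ograph \<Gamma> \<and> connected_ograph \<Gamma> \<and>
     (\<forall>v\<in>verts \<Gamma>. valence \<Gamma> v \<noteq> 2) \<and> (\<exists>v\<in>verts \<Gamma>. valence \<Gamma> v = 1)"

definition hairs :: "ograph \<Rightarrow> nat" where
  "hairs \<Gamma> = card {v \<in> verts \<Gamma>. valence \<Gamma> v = 1}"

text \<open>The first Betti number of a connected graph, by Euler's formula.\<close>

definition loop_order :: "ograph \<Rightarrow> nat" where
  "loop_order \<Gamma> = card (edges \<Gamma>) + 1 - card (verts \<Gamma>)"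

definition weight :: "ograph \<Rightarrow> nat" where
  "weight \<Gamma> = loop_order \<Gamma> + hairs \<Gamma>"

definition cell_degree :: "int \<Rightarrow> int \<Rightarrow> ograph \<Rightarrow> nat \<Rightarrow> int" where
  "cell_degree m n \<Gamma> i =
     (case \<Gamma> ! i of Vertex \<Rightarrow> (if valence \<Gamma> i = 1 then m else n) | Edge s t \<Rightarrow> 1 - n)"

definition degree :: "int \<Rightarrow> int \<Rightarrow> ograph \<Rightarrow> int" where
  "degree m n \<Gamma> = (\<Sum>i<length \<Gamma>. cell_degree m n \<Gamma> i) - m"


section \<open>The graded space HGC\<close>

text \<open>Reordering: the cell at position \<open>i\<close> is moved to position \<open>\<sigma> i\<close>.\<close>

definition reorder :: "(nat \<Rightarrow> nat) \<Rightarrow> ograph \<Rightarrow> ograph" where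
  "reorder \<sigma> \<Gamma> = map (\<lambda>j. map_cell \<sigma> (\<Gamma> ! inv \<sigma> j)) [0..<length \<Gamma>]"

definition koszul_sign :: "int \<Rightarrow> int \<Rightarrow> (nat \<Rightarrow> nat) \<Rightarrow> ograph \<Rightarrow> 'k::field" where
  "koszul_sign m n \<sigma> \<Gamma> =
     (\<Prod>(i, j) \<in> {(i, j). i < j \<and> j < length \<Gamma> \<and> \<sigma> j < \<sigma> i}.
        (-1) powi (cell_degree m n \<Gamma> i * cell_degree m n \<Gamma> j))"

definition scale :: "'k::field \<Rightarrow> (ograph \<Rightarrow> 'k) \<Rightarrow> (ograph \<Rightarrow> 'k)" where
  "scale a c = (\<lambda>\<Gamma>. a * c \<Gamma>)"

interpretation series: vector_space scale
  by unfold_locales (auto simp: scale_def fun_eq_iff algebra_simps)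

definition single :: "ograph \<Rightarrow> (ograph \<Rightarrow> 'k::field)" where
  "single \<Gamma> = (\<lambda>\<Gamma>'. if \<Gamma>' = \<Gamma> then 1 else 0)"

definition relators :: "int \<Rightarrow> int \<Rightarrow> (ograph \<Rightarrow> 'k::field) set" where
  "relators m n =
     {single (reorder \<sigma> \<Gamma>) - scale (koszul_sign m n \<sigma> \<Gamma>) (single \<Gamma>) | \<sigma> \<Gamma>.
        hairy \<Gamma> \<and> \<sigma> permutes {..<length \<Gamma>}} \<union>
     {single (\<Gamma>[e := Edge t s]) - scale ((-1) powi n) (single \<Gamma>) | \<Gamma> e s t.
        hairy \<Gamma> \<and> e < length \<Gamma> \<and> \<Gamma> ! e = Edge s t}"

text \<open>Formal, possibly infinite, series of oriented hairy graphs satisfying \<open>P\<close>.\<close>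

definition graph_series :: "(ograph \<Rightarrow> bool) \<Rightarrow> (ograph \<Rightarrow> 'k::field) set" where
  "graph_series P = {c. \<forall>\<Gamma>. c \<Gamma> \<noteq> 0 \<longrightarrow> hairy \<Gamma> \<and> P \<Gamma>}"

definition restrict_series :: "(ograph \<Rightarrow> bool) \<Rightarrow> (ograph \<Rightarrow> 'k::field) \<Rightarrow> (ograph \<Rightarrow> 'k)" where
  "restrict_series P c = (\<lambda>\<Gamma>. if P \<Gamma> then c \<Gamma> else 0)"

text \<open>For a fixed number of hairs and loop order there are only finitely many hairy lists, so the
  relations in each such piece are an ordinary span; the space of all relations is the product of
  these spans.\<close>

definition hgc_rel :: "int \<Rightarrow> int \<Rightarrow> (ograph \<Rightarrow> 'k::field) set" where
  "hgc_rel m n = {c \<in> graph_series (\<lambda>_. True).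
     \<forall>h g. restrict_series (\<lambda>\<Gamma>. hairs \<Gamma> = h \<and> loop_order \<Gamma> = g) c \<in> series.span (relators m n)}"

text \<open>
  \<open>HGC\<^bsub>m,n\<^esub>\<close> is the quotient of \<open>graph_series (\<lambda>_. True)\<close> by \<open>hgc_rel m n\<close>. Throughout, a subspace of
  this quotient is represented by its preimage among the series (hence a subspace containing
  \<open>hgc_rel m n\<close>), and a linear endomorphism by a linear map on series that respects
  \<open>hgc_rel m n\<close>; equations between elements of the quotient are congruences modulo \<open>hgc_rel m n\<close>.
  Below, \<open>hgc_part m n P\<close> is the subspace of series of graphs satisfying \<open>P\<close>.
\<close>

definition hgc_part :: "int \<Rightarrow> int \<Rightarrow> (ograph \<Rightarrow> bool) \<Rightarrow> (ograph \<Rightarrow> 'k::field) set" where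
  "hgc_part m n P = {c + r | c r. c \<in> graph_series P \<and> r \<in> hgc_rel m n}"

definition hgc :: "int \<Rightarrow> int \<Rightarrow> (ograph \<Rightarrow> 'k::field) set" where
  "hgc m n = hgc_part m n (\<lambda>_. True)"

definition hgc_endo :: "int \<Rightarrow> int \<Rightarrow> ((ograph \<Rightarrow> 'k::field) \<Rightarrow> (ograph \<Rightarrow> 'k)) \<Rightarrow> bool" where
  "hgc_endo m n D \<longleftrightarrow> Vector_Spaces.linear scale scale D \<and>
     D ` hgc m n \<subseteq> hgc m n \<and> D ` hgc_rel m n \<subseteq> hgc_rel m n"

definition hgc_differential :: "int \<Rightarrow> int \<Rightarrow> ((ograph \<Rightarrow> 'k::field) \<Rightarrow> (ograph \<Rightarrow> 'k)) \<Rightarrow> bool" where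
  "hgc_differential m n D \<longleftrightarrow> hgc_endo m n D \<and>
     (\<forall>k. D ` hgc_part m n (\<lambda>\<Gamma>. degree m n \<Gamma> = k) \<subseteq> hgc_part m n (\<lambda>\<Gamma>. degree m n \<Gamma> = k + 1)) \<and>
     (\<forall>x\<in>hgc m n. D (D x) \<in> hgc_rel m n)"


section \<open>The standard differential\<close>

text \<open>Splitting \<open>v\<close>: the new vertex \<open>x\<close> is put at position 0, the new edge, directed from \<open>v\<close> to
  \<open>x\<close>, at position 1, and the old cells are shifted by 2. The half-edges in \<open>A\<close> move to \<open>x\<close>.\<close>

definition split_vertex :: "ograph \<Rightarrow> nat \<Rightarrow> (nat \<times> bool) set \<Rightarrow> ograph" where
  "split_vertex \<Gamma> v A = Vertex # Edge (v + 2) 0 #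
     map (\<lambda>e. case \<Gamma> ! e of Vertex \<Rightarrow> Vertex
          | Edge s t \<Rightarrow> Edge (if (e, False) \<in> A then 0 else s + 2) (if (e, True) \<in> A then 0 else t + 2))
       [0..<length \<Gamma>]"

text \<open>Together with the new edge, both vertices must have valence at least 3; in particular
  only internal vertices are split.\<close>

definition splittings :: "ograph \<Rightarrow> (nat \<times> (nat \<times> bool) set) set" where
  "splittings \<Gamma> = {(v, A). v \<in> verts \<Gamma> \<and> A \<subseteq> half_edges \<Gamma> v \<and>
     card A \<ge> 2 \<and> card (half_edges \<Gamma> v - A) \<ge> 2}"

text \<open>Each unordered splitting arises twice, from \<open>A\<close> and from its complement, and the two
  resulting oriented graphs are equal in HGC; hence the factor 1/2. A splitting adds two cells,
  so that the sum below is finite.\<close>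

definition std_diff :: "(ograph \<Rightarrow> 'k::field_char_0) \<Rightarrow> (ograph \<Rightarrow> 'k)" where
  "std_diff c = (\<lambda>\<Gamma>'. \<Sum>\<Gamma> | hairy \<Gamma> \<and> length \<Gamma> + 2 = length \<Gamma>'.
     c \<Gamma> * (of_nat (card {(v, A) \<in> splittings \<Gamma>. split_vertex \<Gamma> v A = \<Gamma>'}) / 2))"


section \<open>Cohomology and the spectral sequence of a filtered complex\<close>

text \<open>
  The following concerns a complex \<open>A k / R\<close>, \<open>k\<close> an integer, with differential induced by \<open>D\<close>.
  All subspaces are given by their preimages, which contain \<open>R\<close>.
\<close>

definition cocycles :: "'v set \<Rightarrow> ('v \<Rightarrow> 'v) \<Rightarrow> 'v set \<Rightarrow> 'v::ab_group_add set" where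
  "cocycles R D A = {x \<in> A. D x \<in> R}"

definition coboundaries :: "'v set \<Rightarrow> ('v \<Rightarrow> 'v) \<Rightarrow> 'v set \<Rightarrow> 'v::ab_group_add set" where
  "coboundaries R D A = {D y + r | y r. y \<in> A \<and> r \<in> R}"

text \<open>The inclusion of \<open>Z\<close> into \<open>Z'\<close> induces an isomorphism from \<open>Z / B\<close> to \<open>Z' / B'\<close>.\<close>

definition incl_induces_iso ::
  "'v set \<Rightarrow> 'v set \<Rightarrow> 'v set \<Rightarrow> 'v::ab_group_add set \<Rightarrow> bool" where
  "incl_induces_iso Z B Z' B' \<longleftrightarrow> Z \<subseteq> Z' \<and> B \<subseteq> B' \<and>
     (\<forall>x\<in>Z. x \<in> B' \<longrightarrow> x \<in> B) \<and> (\<forall>y\<in>Z'. \<exists>x\<in>Z. y - x \<in> B')"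

text \<open>
  For an increasing filtration \<open>F p k\<close> of \<open>A k\<close>, the page \<open>E\<^sub>r\<close> in filtration degree \<open>p\<close> and
  cohomological degree \<open>k\<close> is the quotient \<open>ss_Z D F r p k / ss_B D F r p k\<close>.
\<close>

definition ss_Z :: "('v \<Rightarrow> 'v) \<Rightarrow> (int \<Rightarrow> int \<Rightarrow> 'v set) \<Rightarrow> int \<Rightarrow> int \<Rightarrow> int \<Rightarrow> 'v::ab_group_add set" where
  "ss_Z D F r p k = {x \<in> F p k. D x \<in> F (p - r) (k + 1)}"

definition ss_B :: "('v \<Rightarrow> 'v) \<Rightarrow> (int \<Rightarrow> int \<Rightarrow> 'v set) \<Rightarrow> int \<Rightarrow> int \<Rightarrow> int \<Rightarrow> 'v::ab_group_add set" where
  "ss_B D F r p k =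
     {x + D y | x y. x \<in> ss_Z D F (r - 1) (p - 1) k \<and> y \<in> ss_Z D F (r - 1) (p + r - 1) (k - 1)}"

text \<open>The preimage of the \<open>p\<close>-th step of the filtration induced on the \<open>k\<close>-th cohomology.\<close>

definition cohomology_filt ::
  "'v set \<Rightarrow> ('v \<Rightarrow> 'v) \<Rightarrow> (int \<Rightarrow> 'v set) \<Rightarrow> (int \<Rightarrow> int \<Rightarrow> 'v set) \<Rightarrow> int \<Rightarrow> int \<Rightarrow> 'v::ab_group_add set"
  where
  "cohomology_filt R D A F p k =
     {x + b | x b. x \<in> cocycles R D (F p k) \<and> b \<in> coboundaries R D (A (k - 1))}"

text \<open>Bounded convergence to the cohomology of \<open>A / R\<close>: the induced filtration on each
  cohomology space is finite, and in each bidegree the pages eventually agree with the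
  associated graded of the cohomology.\<close>

definition ss_converges ::
  "'v set \<Rightarrow> ('v \<Rightarrow> 'v) \<Rightarrow> (int \<Rightarrow> 'v set) \<Rightarrow> (int \<Rightarrow> int \<Rightarrow> 'v::ab_group_add set) \<Rightarrow> bool" where
  "ss_converges R D A F \<longleftrightarrow>
     (\<forall>k. \<exists>p. cohomology_filt R D A F p k = cocycles R D (A k)) \<and>
     (\<forall>k. \<exists>p. cohomology_filt R D A F p k = coboundaries R D (A (k - 1))) \<and>
     (\<forall>p k. \<exists>r0. \<forall>r\<ge>r0. incl_induces_iso (ss_Z D F r p k) (ss_B D F r p k)
        (cohomology_filt R D A F p k) (cohomology_filt R D A F (p - 1) k))"

text \<open>
  The hair filtration on the direct factor of \<open>HGC\<^bsub>m,n\<^esub>\<close> of weight \<open>N\<close>. There it is finite; on the full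
  product it is not exhaustive, so convergence is a statement about these factors.
\<close>

definition hgc_piece :: "int \<Rightarrow> int \<Rightarrow> nat \<Rightarrow> int \<Rightarrow> (ograph \<Rightarrow> 'k::field) set" where
  "hgc_piece m n N k = hgc_part m n (\<lambda>\<Gamma>. weight \<Gamma> = N \<and> degree m n \<Gamma> = k)"

definition hgc_filt :: "int \<Rightarrow> int \<Rightarrow> nat \<Rightarrow> int \<Rightarrow> int \<Rightarrow> (ograph \<Rightarrow> 'k::field) set" where
  "hgc_filt m n N p k =
     hgc_part m n (\<lambda>\<Gamma>. weight \<Gamma> = N \<and> degree m n \<Gamma> = k \<and> int (hairs \<Gamma>) \<le> p)"

definition hgc_gr :: "int \<Rightarrow> int \<Rightarrow> nat \<Rightarrow> int \<Rightarrow> int \<Rightarrow> (ograph \<Rightarrow> 'k::field) set" where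
  "hgc_gr m n N p k =
     hgc_part m n (\<lambda>\<Gamma>. weight \<Gamma> = N \<and> degree m n \<Gamma> = k \<and> int (hairs \<Gamma>) = p)"

end

theory Submission
  imports Defs
begin

text \<open>
  Glue all hairs of a graph at one extra vertex. Series of oriented graphs modulo relations are then
  sign-equivariant functions of star graphs (by averaging, in characteristic 0), and the standard
  differential is \<open>(\<delta> \<phi>) G = \<Sum>\<^sub>e \<plusminus> \<phi> (G/e)\<close> over the non-loop edges \<open>e\<close> between internal vertices.
  Define \<open>D\<close> by the same formula, but over all non-loop edges. Contracting an edge at the extra vertex
  strictly increases the number of hairs, so \<open>D - \<delta>\<close> strictly decreases it, whereas the numbers of
  edges and internal vertices, hence weight and degree, behave as for \<open>\<delta>\<close>.

  For acyclicity, cut \<open>G\<close> at a vertex \<open>x\<close> and let \<open>S\<close> be the half-edges at \<open>x\<close> of a component without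
  hairs. The homotopy \<open>(h \<phi>) G\<close> sums \<open>\<plusminus> \<phi>\<close> over the graphs in which such a component, with at least two
  half-edges, is suspended from \<open>x\<close> by a new bridge. In \<open>D h + h D\<close> the mixed terms cancel, up to terms
  evaluating \<open>\<phi>\<close> at graphs with as many edges as \<open>G\<close> but more bridges. The diagonal term counts the
  suspended components and those that can be suspended; together these are all components with at
  least two half-edges, of which there is always one. Thus \<open>D h + h D\<close> is triangular and invertible, and
  it commutes with \<open>D\<close>. In each weight the hair filtration is finite, which gives convergence.
\<close>

text \<open>Functions on star graphs are used because splitting dualises to contraction: every value
  of \<open>Dop\<close> is a finite sum, and an edge at the star is contracted like any other. This
  needs m = 0, where hairs carry neither sign nor degree and may share one unlabelled vertex. A
  contraction removes one internal vertex and one edge, of total degree 1 for every n; hence two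
  contractions anticommute whatever the parity of n. Contracting at the star can disconnect the
  hairy graph; functions are extended by 0 to such graphs. The homotopy inverts the contraction of
  bridges. Contracting a bridge leaves the attachments with at least two half-edges unchanged as
  sets of half-edges, so the mixed terms can be matched one by one. Attachments by a single
  half-edge are excluded because suspending them would create a bivalent vertex. The defect
  \<open>slack\<close>, edges minus bridges, is a natural number, and \<open>lap\<close> at a graph
  sees no larger slack; so inverting it takes finitely many steps at each graph, also for infinite
  series.\<close>

definition inv_sign :: "'k::comm_ring_1 \<Rightarrow> (nat \<Rightarrow> nat) \<Rightarrow> nat set \<Rightarrow> 'k" where
  "inv_sign q s A = (\<Prod>(i, j)\<in>{(i, j). i \<in> A \<and> j \<in> A \<and> i < j}. if s i < s j then 1 else q)"

lemma finite_ordered_pairs: "finite A \<Longrightarrow> finite {(i, j). i \<in> A \<and> j \<in> A \<and> i < (j::nat)}"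
  by (rule finite_subset[of _ "A \<times> A"]) auto

lemma inv_sign_cong: "(\<And>i. i \<in> A \<Longrightarrow> s i = t i) \<Longrightarrow> inv_sign q s A = inv_sign q t A"
  unfolding inv_sign_def by (rule prod.cong) auto

lemma inv_sign_mono: "(\<And>i j. i \<in> A \<Longrightarrow> j \<in> A \<Longrightarrow> i < j \<Longrightarrow> s i < s j) \<Longrightarrow> inv_sign q s A = 1"
  unfolding inv_sign_def by (rule prod.neutral) auto

lemma inv_sign_id [simp]: "inv_sign q (\<lambda>x. x) A = 1" "inv_sign q id A = 1"
  by (rule inv_sign_mono; simp)+

text \<open>For \<open>q\<close> equal to 1 or -1, \<open>inv_sign\<close> is the Koszul sign of
  reordering cells that all have one parity. Since \<open>s\<close> maps the unordered pairs of
  \<open>A\<close> bijectively to those of its image, inversions can be compared pair by pair; a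
  pair inverted twice contributes \<open>q * q = 1\<close>.\<close>

lemma inv_sign_comp:
  assumes s: "inj_on s A" and t: "inj_on t (s ` A)" and q: "q * q = 1"
  shows "inv_sign q (t \<circ> s) A = inv_sign q t (s ` A) * inv_sign q s A"
proof -
  let ?P = "{(i, j). i \<in> A \<and> j \<in> A \<and> i < j}"
  let ?Q = "{(i, j). i \<in> s ` A \<and> j \<in> s ` A \<and> i < j}"
  \<comment> \<open>The image of an unordered pair, written again with the smaller position
    first.\<close>
  let ?f = "\<lambda>(i, j). if s i < s j then (s i, s j) else (s j, s i)"
  have bij: "bij_betw ?f ?P ?Q"
  proof (rule bij_betwI')
    fix a b assume ab: "a \<in> ?P" "b \<in> ?P"
    obtain i j where a: "a = (i, j)" by force
    obtain k l where b: "b = (k, l)" by force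
    show "(?f a = ?f b) = (a = b)"
      using ab s unfolding a b by (auto simp: inj_on_eq_iff split: if_splits)
  next
    fix a assume "a \<in> ?P"
    then obtain i j where a: "a = (i, j)" "i \<in> A" "j \<in> A" "i < j" by auto
    then have "s i \<noteq> s j" using s by (auto simp: inj_on_def)
    then show "?f a \<in> ?Q" using a by auto
  next
    fix b assume "b \<in> ?Q"
    then obtain i j where ij: "i \<in> A" "j \<in> A" "b = (s i, s j)" "s i < s j" by force
    show "\<exists>a\<in>?P. b = ?f a"
    proof (cases "i < j")
      case True then show ?thesis using ij by (intro bexI[of _ "(i, j)"]) auto
    next
      case False
      then have "j < i" using ij by (metis linorder_neqE_nat less_irrefl)
      then show ?thesis using ij by (intro bexI[of _ "(j, i)"]) auto
    qed
  qed
  have "inv_sign q t (s ` A) = (\<Prod>a\<in>?P. case ?f a of (i, j) \<Rightarrow> if t i < t j then 1 else q)"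
    unfolding inv_sign_def by (rule prod.reindex_bij_betw[OF bij, symmetric])
  moreover have "(case a of (i, j) \<Rightarrow> if (t \<circ> s) i < (t \<circ> s) j then 1 else q) =
     (case ?f a of (i, j) \<Rightarrow> if t i < t j then 1 else q) * (case a of (i, j) \<Rightarrow> if s i < s j then 1 else q)"
    if a: "a \<in> ?P" for a
  proof -
    obtain i j where ij: "a = (i, j)" "i \<in> A" "j \<in> A" "i < j" using a by auto
    then have "t (s i) \<noteq> t (s j)" using s t by (auto simp: inj_on_def)
    then show ?thesis using q ij by auto
  qed
  then have "inv_sign q (t \<circ> s) A = (\<Prod>a\<in>?P. (case ?f a of (i, j) \<Rightarrow> if t i < t j then 1 else q) *
      (case a of (i, j) \<Rightarrow> if s i < s j then 1 else q))"
    unfolding inv_sign_def by (rule prod.cong[OF refl])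
  ultimately show ?thesis unfolding prod.distrib by (simp add: inv_sign_def)
qed

text \<open>Move \<open>a\<close> to the front, reorder the rest, and move \<open>s a\<close> from
  the front to its place: the two moves pass exactly the smaller elements of the source and of the
  target.\<close>

lemma inv_sign_insert:
  assumes A: "finite A" "a \<notin> A" and s: "inj_on s (insert a A)" and q: "q * q = 1"
  shows "inv_sign q s (insert a A) =
    inv_sign q s A * (q ^ card {i\<in>A. i < a} * q ^ card {i\<in>A. s i < s a})"
proof -
  let ?r = "\<lambda>(i, j). if s i < s j then 1 else q"
  let ?P = "{(i, j). i \<in> A \<and> j \<in> A \<and> i < j}"
  let ?L = "{i\<in>A. i < a}" and ?R = "{i\<in>A. a < i}"
  have split: "{(i, j). i \<in> insert a A \<and> j \<in> insert a A \<and> i < j} =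
      ?P \<union> ((\<lambda>i. (i, a)) ` ?L \<union> Pair a ` ?R)"
    using A by (auto simp: linorder_neq_iff)
  have A': "A = ?L \<union> ?R" using A(2) by (auto simp: linorder_neq_iff) (metis linorder_neqE_nat)
  have fin: "finite ?P" using A by (simp add: finite_ordered_pairs)
  have "inv_sign q s (insert a A) = prod ?r ?P * (prod ?r ((\<lambda>i. (i, a)) ` ?L) * prod ?r (Pair a ` ?R))"
    unfolding inv_sign_def split using A fin
    by (subst prod.union_disjoint; (subst prod.union_disjoint)?) auto
  also have "prod ?r ((\<lambda>i. (i, a)) ` ?L) = (\<Prod>i\<in>?L. if s i < s a then 1 else q)"
    by (subst prod.reindex) (auto simp: inj_on_def)
  also have "\<dots> = (\<Prod>i\<in>?L. (if i < a then q else 1) * (if s i < s a then q else 1))"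
    using q by (intro prod.cong) auto
  also have "prod ?r (Pair a ` ?R) = (\<Prod>i\<in>?R. if s a < s i then 1 else q)"
    by (subst prod.reindex) (auto simp: inj_on_def)
  also have "\<dots> = (\<Prod>i\<in>?R. (if i < a then q else 1) * (if s i < s a then q else 1))"
  proof (intro prod.cong refl)
    fix i assume i: "i \<in> ?R"
    then have "s i \<noteq> s a" using s A by (auto simp: inj_on_def)
    then show "(if s a < s i then 1 else q) = (if i < a then q else 1) * (if s i < s a then q else 1)"
      using i by auto
  qed
  also have "(\<Prod>i\<in>?L. (if i < a then q else 1) * (if s i < s a then q else 1)) *
      (\<Prod>i\<in>?R. (if i < a then q else 1) * (if s i < s a then q else 1)) =
      (\<Prod>i\<in>?L \<union> ?R. (if i < a then q else 1) * (if s i < s a then q else 1))"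
    by (rule prod.union_disjoint[symmetric]) (use A in auto)
  also have "\<dots> = (\<Prod>i\<in>A. (if i < a then q else 1) * (if s i < s a then q else 1))"
    using A' by simp
  also have "\<dots> = (\<Prod>i\<in>A. if i < a then q else 1) * (\<Prod>i\<in>A. if s i < s a then q else 1)"
    by (rule prod.distrib)
  also have "(\<Prod>i\<in>A. if i < a then q else 1) = q ^ card {i\<in>A. i < a}"
    using A by (simp add: prod.If_cases Int_def)
  also have "(\<Prod>i\<in>A. if s i < s a then q else 1) = q ^ card {i\<in>A. s i < s a}"
    using A by (simp add: prod.If_cases Int_def)
  finally show ?thesis unfolding inv_sign_def .
qed

lemma card_less_image:
  "inj_on s A \<Longrightarrow> card {j \<in> s ` A. j < (c::nat)} = card {i \<in> A. s i < c}"
proof -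
  assume "inj_on s A"
  moreover have "{j \<in> s ` A. j < c} = s ` {i \<in> A. s i < c}" by auto
  ultimately show ?thesis by (metis (no_types, lifting) card_image inj_on_subset mem_Collect_eq subsetI)
qed

lemma card_less_insert:
  "finite A \<Longrightarrow> a \<notin> A \<Longrightarrow> card {i \<in> insert a A. i < (c::nat)} = card {i\<in>A. i < c} + (if a < c then 1 else 0)"
proof -
  assume "finite A" "a \<notin> A"
  moreover have "{i \<in> insert a A. i < c} = (if a < c then insert a {i\<in>A. i < c} else {i\<in>A. i < c})" by auto
  ultimately show ?thesis by auto
qed

section \<open>Star graphs\<close>

text \<open>
  Gluing all hairs of a hairy graph at one extra vertex, the star vertex, gives a star graph. It maps
  each edge to its two ends (source at \<open>False\<close>, target at \<open>True\<close>), where \<open>None\<close> is the star vertex.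
\<close>

type_synonym sgraph = "nat \<rightharpoonup> (bool \<Rightarrow> nat option)"

definition nodes :: "sgraph \<Rightarrow> nat set" where
  "nodes E = {v. \<exists>g p b. E g = Some p \<and> p b = Some v}"

definition halves :: "sgraph \<Rightarrow> nat option \<Rightarrow> (nat \<times> bool) set" where
  "halves E x = {(g, b). \<exists>p. E g = Some p \<and> p b = x}"

text \<open>\<open>F\<close> is the set of edges whose direction is reversed.\<close>

definition act :: "(nat \<Rightarrow> nat) \<Rightarrow> (nat \<Rightarrow> nat) \<Rightarrow> nat set \<Rightarrow> sgraph \<Rightarrow> sgraph" where
  "act s t F E = (\<lambda>g'. if g' \<in> t ` dom E then
     map_option (\<lambda>p b. map_option s (p (b \<noteq> (inv_into (dom E) t g' \<in> F)))) (E (inv_into (dom E) t g'))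
     else None)"

text \<open>The end of \<open>e\<close> at \<open>b\<close> is absorbed by the other end; the edges parallel to \<open>e\<close> become loops.\<close>

definition contr :: "sgraph \<Rightarrow> nat \<Rightarrow> bool \<Rightarrow> sgraph" where
  "contr E e b = (\<lambda>g. if g = e then None else
     map_option (\<lambda>q c. if q c = the (E e) b then the (E e) (\<not> b) else q c) (E g))"

text \<open>The half-edges \<open>S\<close> at \<open>x\<close> move to the new vertex \<open>y\<close>, which the new edge \<open>f\<close> joins to \<open>x\<close>.\<close>

definition expd :: "sgraph \<Rightarrow> nat option \<Rightarrow> (nat \<times> bool) set \<Rightarrow> nat \<Rightarrow> nat \<Rightarrow> sgraph" where
  "expd E x S y f = (\<lambda>g. if g = f then Some (\<lambda>b. if b then Some y else x) else
     map_option (\<lambda>q c. if (g, c) \<in> S then Some y else q c) (E g))"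

lemma nodes_halves: "v \<in> nodes E \<longleftrightarrow> halves E (Some v) \<noteq> {}"
  by (auto simp: nodes_def halves_def)

lemma nodesI: "E g = Some p \<Longrightarrow> p b = Some v \<Longrightarrow> v \<in> nodes E"
  by (auto simp: nodes_def)

lemma in_halves: "(g, b) \<in> halves E x \<longleftrightarrow> (\<exists>p. E g = Some p \<and> p b = x)"
  by (simp add: halves_def)

lemma finite_halves: "finite (dom E) \<Longrightarrow> finite (halves E x)"
  by (rule finite_subset[of _ "dom E \<times> UNIV"]) (auto simp: halves_def)

lemma finite_nodes: "finite (dom E) \<Longrightarrow> finite (nodes E)"
proof -
  assume "finite (dom E)"
  moreover have "nodes E \<subseteq> (\<lambda>(g, b). the (the (E g) b)) ` (dom E \<times> UNIV)"
  proof
    fix v assume "v \<in> nodes E"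
    then obtain g p b where "E g = Some p" "p b = Some v" by (auto simp: nodes_def)
    then show "v \<in> (\<lambda>(g, b). the (the (E g) b)) ` (dom E \<times> UNIV)"
      by (intro image_eqI[of _ _ "(g, b)"]) auto
  qed
  ultimately show ?thesis by (meson finite_SigmaI finite_UNIV finite_imageI finite_subset finite_code)
qed

lemma act_apply: "inj_on t (dom E) \<Longrightarrow> E g = Some p \<Longrightarrow>
    act s t F E (t g) = Some (\<lambda>b. map_option s (p (b \<noteq> (g \<in> F))))"
  by (auto simp: act_def domI inv_into_f_f)

lemma dom_act: "dom (act s t F E) = t ` dom E"
proof -
  have "inv_into (dom E) t g' \<in> dom E" if "g' \<in> t ` dom E" for g' using that by (rule inv_into_into)
  then have "act s t F E g' \<noteq> None \<longleftrightarrow> g' \<in> t ` dom E" for g'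
    unfolding act_def by (cases "g' \<in> t ` dom E") (force simp: domIff)+
  then show ?thesis by (auto simp: domIff)
qed

lemma act_SomeE:
  assumes "act s t F E g' = Some q" "inj_on t (dom E)"
  obtains g p where "E g = Some p" "g' = t g" "q = (\<lambda>b. map_option s (p (b \<noteq> (g \<in> F))))"
proof -
  have "g' \<in> dom (act s t F E)" using assms by auto
  then obtain g p where "E g = Some p" "g' = t g" by (auto simp: dom_act)
  then show thesis using assms that act_apply[of t E g p s F] by auto
qed

lemma act_eqI:
  assumes "inj_on t (dom E)" "dom E' = t ` dom E"
    "\<And>g p. E g = Some p \<Longrightarrow> E' (t g) = Some (\<lambda>b. map_option s (p (b \<noteq> (g \<in> F))))"
  shows "E' = act s t F E"
proof
  fix g'
  show "E' g' = act s t F E g'"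
  proof (cases "g' \<in> t ` dom E")
    case True
    then show ?thesis using assms by (auto simp: act_apply)
  next
    case False
    then show ?thesis using assms(2) dom_act[of s t F E] by (metis domIff)
  qed
qed

lemma act_cong:
  assumes "inj_on t (dom E)" "\<And>v. v \<in> nodes E \<Longrightarrow> s v = s' v" "\<And>g. g \<in> dom E \<Longrightarrow> t g = t' g"
    "\<And>g. g \<in> dom E \<Longrightarrow> g \<in> F \<longleftrightarrow> g \<in> F'"
  shows "act s t F E = act s' t' F' E"
proof (rule act_eqI)
  show "inj_on t' (dom E)" using assms(1,3) by (metis inj_on_cong)
  show "dom (act s t F E) = t' ` dom E" using assms(3) by (auto simp: dom_act)
next
  fix g p assume g: "E g = Some p"
  have "map_option s (p (b \<noteq> (g \<in> F))) = map_option s' (p (b \<noteq> (g \<in> F')))" for b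
    using g assms(2,4) by (auto simp: domI nodesI intro!: option.map_cong)
  moreover have "t' g = t g" using assms(3) g by (auto simp: domI)
  ultimately show "act s t F E (t' g) = Some (\<lambda>b. map_option s' (p (b \<noteq> (g \<in> F'))))"
    using act_apply[OF assms(1) g] by auto
qed

lemma nodes_act: "inj_on t (dom E) \<Longrightarrow> nodes (act s t F E) = s ` nodes E"
proof (intro equalityI subsetI)
  fix v assume t: "inj_on t (dom E)" and "v \<in> nodes (act s t F E)"
  then show "v \<in> s ` nodes E" by (auto simp: nodes_def elim!: act_SomeE)
next
  fix v assume t: "inj_on t (dom E)" and "v \<in> s ` nodes E"
  then obtain g p b w where w: "E g = Some p" "p b = Some w" "v = s w" by (auto simp: nodes_def)
  have "((b \<noteq> (g \<in> F)) \<noteq> (g \<in> F)) = b" by auto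
  then show "v \<in> nodes (act s t F E)"
    using act_apply[OF t w(1), of s F] w unfolding nodes_def
    by (intro CollectI exI[of _ "t g"] exI[of _ "\<lambda>b. map_option s (p (b \<noteq> (g \<in> F)))"] exI[of _ "b \<noteq> (g \<in> F)"]) simp
qed

text \<open>Two reversals of the same edge cancel, hence the symmetric difference.\<close>

lemma act_act:
  assumes "inj_on t (dom E)" "inj_on t' (t ` dom E)"
  shows "act s' t' F' (act s t F E) = act (s' \<circ> s) (t' \<circ> t) {g \<in> dom E. (g \<in> F) \<noteq> (t g \<in> F')} E"
proof (rule act_eqI)
  show "inj_on (t' \<circ> t) (dom E)" using assms by (rule comp_inj_on)
  show "dom (act s' t' F' (act s t F E)) = (t' \<circ> t) ` dom E" by (simp add: dom_act image_comp)
next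
  fix g p assume g: "E g = Some p"
  have t': "inj_on t' (dom (act s t F E))" using assms by (simp add: dom_act)
  have eq: "((b \<noteq> (t g \<in> F')) \<noteq> (g \<in> F)) = (b \<noteq> (g \<in> {g \<in> dom E. (g \<in> F) \<noteq> (t g \<in> F')}))" for b
    using g by auto
  show "act s' t' F' (act s t F E) ((t' \<circ> t) g) =
     Some (\<lambda>b. map_option (s' \<circ> s) (p (b \<noteq> (g \<in> {g \<in> dom E. (g \<in> F) \<noteq> (t g \<in> F')}))))"
    using act_apply[OF t' act_apply[OF assms(1) g, of s F], of s' F'] unfolding eq
    by (simp add: option.map_comp)
qed

lemma act_id': "act id id {} E = E"
  by (rule sym, rule act_eqI) (auto simp: option.map_id)

lemma ex_act_inverse:
  assumes "inj_on s (nodes E)" "inj_on t (dom E)"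
  shows "act (inv_into (nodes E) s) (inv_into (dom E) t) (t ` (F \<inter> dom E)) (act s t F E) = E"
proof (rule sym, rule act_eqI)
  show "inj_on (inv_into (dom E) t) (dom (act s t F E))"
    by (simp add: dom_act inj_on_inv_into)
  show "dom E = inv_into (dom E) t ` dom (act s t F E)"
    using assms by (simp add: dom_act)
next
  fix g' q assume "act s t F E g' = Some q"
  then obtain g p where g: "E g = Some p" "g' = t g" "q = (\<lambda>b. map_option s (p (b \<noteq> (g \<in> F))))"
    using assms by (elim act_SomeE)
  have inv: "inv_into (dom E) t (t g) = g" using assms g by (auto simp: domI)
  have F: "t g \<in> t ` (F \<inter> dom E) \<longleftrightarrow> g \<in> F" 
  proof
    assume "t g \<in> t ` (F \<inter> dom E)"
    then obtain g2 where "t g = t g2" "g2 \<in> F" "g2 \<in> dom E" by auto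
    then show "g \<in> F" using assms(2) g(1) by (metis domI inj_onD)
  qed (use g in auto)
  have "map_option (inv_into (nodes E) s) (map_option s (p b)) = p b" for b
  proof (cases "p b")
    case (Some v)
    then show ?thesis using nodesI[of E g p b v] g(1) Some assms by simp
  qed simp
  moreover have "((b \<noteq> c) \<noteq> c) = b" for b c :: bool by auto
  ultimately show "E (inv_into (dom E) t g') =
      Some (\<lambda>b. map_option (inv_into (nodes E) s) (q (b \<noteq> (g' \<in> t ` (F \<inter> dom E)))))"
    using g inv F by simp
qed

lemma halves_act:
  assumes s: "inj_on s (nodes E)" and t: "inj_on t (dom E)"
    and x: "x = None \<or> (\<exists>v\<in>nodes E. x = Some v)"
  shows "halves (act s t F E) (map_option s x) = (\<lambda>(g, b). (t g, b \<noteq> (g \<in> F))) ` halves E x"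
proof (intro equalityI subsetI)
  fix h assume "h \<in> halves (act s t F E) (map_option s x)"
  then obtain g' b q where h: "h = (g', b)" "act s t F E g' = Some q" "q b = map_option s x" by (cases h) (auto simp: in_halves)
  then obtain g p where g: "E g = Some p" "g' = t g" "q = (\<lambda>b. map_option s (p (b \<noteq> (g \<in> F))))"
    using t by (elim act_SomeE)
  have "p (b \<noteq> (g \<in> F)) = x"
    using h(3) g x s nodesI[of E g p, OF g(1)] by (cases "p (b \<noteq> (g \<in> F))"; cases x) (auto simp: inj_on_eq_iff)
  then have "(g, b \<noteq> (g \<in> F)) \<in> halves E x" using g by (auto simp: in_halves)
  moreover have "h = (\<lambda>(g, b). (t g, b \<noteq> (g \<in> F))) (g, b \<noteq> (g \<in> F))" using h g by auto
  ultimately show "h \<in> (\<lambda>(g, b). (t g, b \<noteq> (g \<in> F))) ` halves E x" by blast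
next
  fix h assume "h \<in> (\<lambda>(g, b). (t g, b \<noteq> (g \<in> F))) ` halves E x"
  then obtain g b p where g: "E g = Some p" "p b = x" "h = (t g, b \<noteq> (g \<in> F))" by (auto simp: halves_def)
  have "((b \<noteq> c) \<noteq> c) = b" for c by auto
  then show "h \<in> halves (act s t F E) (map_option s x)" using g act_apply[OF t g(1), of s F] by (simp add: in_halves)
qed

lemma inj_on_half_map: "inj_on t A \<Longrightarrow> inj_on (\<lambda>(g, b). (t g, b \<noteq> (g \<in> F))) (A \<times> UNIV)"
  by (auto simp: inj_on_def)

lemma card_halves_act:
  assumes "inj_on s (nodes E)" "inj_on t (dom E)" "x = None \<or> (\<exists>v\<in>nodes E. x = Some v)"
  shows "card (halves (act s t F E) (map_option s x)) = card (halves E x)"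
  unfolding halves_act[OF assms]
  by (rule card_image, rule inj_on_subset[OF inj_on_half_map[OF assms(2)]]) (auto simp: halves_def)

section \<open>Separated edge sets and validity\<close>

text \<open>These are the unions of components of the graph cut apart at \<open>x\<close>. Working
  with edge sets lets a loop at \<open>x\<close> be a component of its own, attached by two
  half-edges.\<close>

definition sep :: "sgraph \<Rightarrow> nat option \<Rightarrow> nat set \<Rightarrow> bool" where
  "sep E x C \<longleftrightarrow> C \<subseteq> dom E \<and>
     (\<forall>w g b h c. g \<in> C \<and> (g, b) \<in> halves E w \<and> (h, c) \<in> halves E w \<and> w \<noteq> x \<longrightarrow> h \<in> C)"

text \<open>The last clause says that the hairy graph, from which the star vertex has been removed, is
  connected: \<^term>\<open>sep E x C\<close> means that the edges in \<open>C\<close> meet the other edges only at \<open>x\<close>.\<close>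

definition valid :: "sgraph \<Rightarrow> bool" where
  "valid E \<longleftrightarrow> finite (dom E) \<and> (\<forall>v\<in>nodes E. 3 \<le> card (halves E (Some v))) \<and> halves E None \<noteq> {} \<and>
     (\<forall>C. sep E None C \<longrightarrow> C = {} \<or> C = dom E)"

definition atom :: "sgraph \<Rightarrow> nat option \<Rightarrow> nat set \<Rightarrow> bool" where
  "atom E x C \<longleftrightarrow> sep E x C \<and> C \<noteq> {} \<and> (\<forall>C'. sep E x C' \<longrightarrow> C' \<subseteq> C \<longrightarrow> C' = {} \<or> C' = C)"

text \<open>For \<open>x = None\<close> there is no condition: in a valid graph the only component
  at the star is the whole edge set, attached by all hairs at once, and suspending it produces a
  graph with a single hair.\<close>

definition starfree :: "sgraph \<Rightarrow> nat option \<Rightarrow> nat set \<Rightarrow> bool" where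
  "starfree E x C \<longleftrightarrow> (x = None \<or> (\<forall>g b. (g, b) \<in> halves E None \<longrightarrow> g \<notin> C))"

definition half_part :: "sgraph \<Rightarrow> nat option \<Rightarrow> nat set \<Rightarrow> (nat \<times> bool) set" where
  "half_part E x C = {h \<in> halves E x. fst h \<in> C}"

text \<open>An atom at \<open>x\<close> is a component of what remains when the graph is cut apart at \<open>x\<close>; a member of
  \<open>Sall\<close> is the set of half-edges by which a component without hairs is attached to \<open>x\<close>.\<close>

definition Sall :: "sgraph \<Rightarrow> (nat \<times> bool) set set" where
  "Sall E = {S. \<exists>x C. atom E x C \<and> starfree E x C \<and> S = half_part E x C \<and> S \<noteq> {}}"

lemma sepD: "sep E x C \<Longrightarrow> g \<in> C \<Longrightarrow> (g, b) \<in> halves E w \<Longrightarrow> (h, c) \<in> halves E w \<Longrightarrow> w \<noteq> x \<Longrightarrow> h \<in> C"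
  unfolding sep_def by blast

lemma sepI: "C \<subseteq> dom E \<Longrightarrow>
    (\<And>w g b h c. g \<in> C \<Longrightarrow> (g, b) \<in> halves E w \<Longrightarrow> (h, c) \<in> halves E w \<Longrightarrow> w \<noteq> x \<Longrightarrow> h \<in> C)
   \<Longrightarrow> sep E x C"
  unfolding sep_def by blast

lemma sep_dom [simp]: "sep E x (dom E)" and sep_empty [simp]: "sep E x {}"
  by (auto simp: sep_def in_halves)

lemma sep_subset: "sep E x C \<Longrightarrow> C \<subseteq> dom E" by (simp add: sep_def)

lemma sep_Int: "sep E x C \<Longrightarrow> sep E x C' \<Longrightarrow> sep E x (C \<inter> C')"
  unfolding sep_def by (intro conjI; blast)

text \<open>The closure condition is symmetric in its two half-edges.\<close>

lemma sep_compl: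
  assumes "sep E x C" shows "sep E x (dom E - C)"
proof (rule sepI)
  fix w g b h c
  assume *: "g \<in> dom E - C" "(g, b) \<in> halves E w" "(h, c) \<in> halves E w" "w \<noteq> x"
  then have "h \<notin> C" using sepD[OF assms, of h c w g b] by blast
  then show "h \<in> dom E - C" using * by (auto simp: in_halves)
qed auto

lemma sep_Inter: "(\<And>C. C \<in> X \<Longrightarrow> sep E x C) \<Longrightarrow> X \<noteq> {} \<Longrightarrow> sep E x (\<Inter>X)"
  unfolding sep_def by (intro conjI; blast)

lemma atom_sep: "atom E x C \<Longrightarrow> sep E x C" by (simp add: atom_def)

lemma atom_min: "atom E x C \<Longrightarrow> sep E x C' \<Longrightarrow> C' \<subseteq> C \<Longrightarrow> g \<in> C' \<Longrightarrow> C' = C"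
  unfolding atom_def by blast

lemma atom_in: "atom E x C \<Longrightarrow> sep E x C' \<Longrightarrow> g \<in> C \<Longrightarrow> g \<in> C' \<Longrightarrow> C \<subseteq> C'"
  using atom_min[of E x C "C \<inter> C'" g] sep_Int[of E x C C'] atom_sep[of E x C] by blast

lemma atom_unique: "atom E x C \<Longrightarrow> atom E x C' \<Longrightarrow> g \<in> C \<Longrightarrow> g \<in> C' \<Longrightarrow> C = C'"
  using atom_in[of E x C C' g] atom_in[of E x C' C g] atom_sep by blast

text \<open>Closure under intersection gives a least separated set containing \<open>g\<close>.
  Closure under complement makes it minimal, since a smaller separated set missing \<open>g\<close>
  could be cut away.\<close>

lemma ex_atom:
  assumes "g \<in> dom E" obtains C where "atom E x C" "g \<in> C"
proof -
  let ?C = "\<Inter>{C. sep E x C \<and> g \<in> C}"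
  have sep: "sep E x ?C" by (rule sep_Inter) (use assms sep_dom in blast)+
  have g: "g \<in> ?C" by blast
  have "C' = {} \<or> C' = ?C" if C': "sep E x C'" "C' \<subseteq> ?C" for C'
  proof (cases "g \<in> C'")
    case True then show ?thesis using C' by blast
  next
    case False
    then have "g \<in> ?C \<inter> (dom E - C')" using assms g by blast
    then have "?C \<subseteq> dom E - C'" using sep_compl[OF C'(1)] by blast
    then show ?thesis using C' by blast
  qed
  then have "atom E x ?C" unfolding atom_def using sep g by blast
  then show thesis using g that by blast
qed

lemma SallE:
  assumes "S \<in> Sall E"
  obtains x C where "atom E x C" "starfree E x C" "S = half_part E x C" "S \<noteq> {}"
  using assms unfolding Sall_def by blast

lemma in_half_part: "(g, b) \<in> half_part E x C \<longleftrightarrow> g \<in> C \<and> (g, b) \<in> halves E x"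
  by (auto simp: half_part_def)

lemma halves_unique: "h \<in> halves E w \<Longrightarrow> h \<in> halves E w' \<Longrightarrow> w = w'"
  by (auto simp: halves_def)

lemma halves_dom: "(g, b) \<in> halves E w \<Longrightarrow> g \<in> dom E"
  by (auto simp: halves_def)

lemma dom_halves: "g \<in> dom E \<Longrightarrow> \<exists>w. (g, b) \<in> halves E w"
  by (auto simp: halves_def)

lemma valid_finite: "valid E \<Longrightarrow> finite (dom E)"
  unfolding valid_def by blast

lemma valid_card: "valid E \<Longrightarrow> v \<in> nodes E \<Longrightarrow> 3 \<le> card (halves E (Some v))"
  unfolding valid_def by blast

lemma valid_None: "valid E \<Longrightarrow> halves E None \<noteq> {}"
  unfolding valid_def by blast

lemma valid_prime: "valid E \<Longrightarrow> sep E None C \<Longrightarrow> C = {} \<or> C = dom E"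
  unfolding valid_def by blast

lemma prime_validD: "valid E \<Longrightarrow> sep E None C \<Longrightarrow> g \<in> C \<Longrightarrow> C = dom E"
  unfolding valid_def by blast

section \<open>Contraction of a non-loop edge: the end \<open>y\<close> is absorbed by
  \<open>u\<close>, which may be the star\<close>

locale contraction =
  fixes E :: sgraph and e :: nat and b :: bool and y :: nat and u :: "nat option"
  assumes ey: "(e, b) \<in> halves E (Some y)" and eu: "(e, \<not> b) \<in> halves E u" and noloop: "u \<noteq> Some y"
begin

lemma contr_apply:
  "contr E e b g = (if g = e then None else map_option (\<lambda>q c. if q c = Some y then u else q c) (E g))"
proof -
  have "the (E e) b = Some y" "the (E e) (\<not> b) = u" using ey eu by (auto simp: in_halves)
  then show ?thesis unfolding contr_def by (simp only: if_cancel)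
qed

lemma dom_contr: "dom (contr E e b) = dom E - {e}"
  by (auto simp: contr_apply split: if_splits)

lemma e_dom: "e \<in> dom E" using ey by (rule halves_dom)

lemma halves_contr: "(g, c) \<in> halves (contr E e b) w \<longleftrightarrow>
    g \<noteq> e \<and> w \<noteq> Some y \<and> ((g, c) \<in> halves E w \<or> w = u \<and> (g, c) \<in> halves E (Some y))"
  using noloop by (cases "E g") (auto simp: in_halves contr_apply)

lemma e_halves: "(e, c) \<in> halves E w \<longleftrightarrow> c = b \<and> w = Some y \<or> c = (\<not> b) \<and> w = u"
  using ey eu by (cases "c = b") (auto simp: in_halves)

lemma e_notin: "w \<noteq> u \<Longrightarrow> w \<noteq> Some y \<Longrightarrow> (e, c) \<notin> halves E w"
  by (simp add: e_halves)

lemma halves_contr_other: "w \<noteq> u \<Longrightarrow> w \<noteq> Some y \<Longrightarrow> halves (contr E e b) w = halves E w"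
proof (rule set_eqI)
  fix h :: "nat \<times> bool" assume w: "w \<noteq> u" "w \<noteq> Some y"
  obtain g and c :: bool where h: "h = (g, c)" by force
  show "h \<in> halves (contr E e b) w \<longleftrightarrow> h \<in> halves E w"
    unfolding h halves_contr using w e_notin[OF w, of c] by auto
qed

lemma halves_contr_end: "halves (contr E e b) u = (halves E u - {(e, \<not> b)}) \<union> (halves E (Some y) - {(e, b)})"
proof (rule set_eqI)
  fix h :: "nat \<times> bool"
  obtain g and c :: bool where h: "h = (g, c)" by force
  show "h \<in> halves (contr E e b) u \<longleftrightarrow> h \<in> (halves E u - {(e, \<not> b)}) \<union> (halves E (Some y) - {(e, b)})"
    unfolding h halves_contr using noloop e_halves[of c u] e_halves[of c "Some y"] by auto
qed

text \<open>If \<open>C\<close> meets an end of \<open>e\<close>, closedness at that end puts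
  \<open>e\<close> and then everything at the other end into \<open>C\<close>, so merging the two
  ends creates no new contact.\<close>

lemma sep_contr_other:
  assumes C: "sep E x C" and x: "x \<noteq> u" "x \<noteq> Some y"
  shows "sep (contr E e b) x (C - {e})"
proof (rule sepI)
  show "C - {e} \<subseteq> dom (contr E e b)" using sep_subset[OF C] dom_contr by auto
next
  fix w g c h d
  assume g: "g \<in> C - {e}" "(g, c) \<in> halves (contr E e b) w"
    and h: "(h, d) \<in> halves (contr E e b) w" and w: "w \<noteq> x"
  have eC: "e \<in> C" if "(g, c) \<in> halves E (Some y) \<or> (g, c) \<in> halves E u"
    using that sepD[OF C, of g c _ e] g(1) ey eu x by auto
  show "h \<in> C - {e}"
  proof (cases "w = u")
    case True
    then have "e \<in> C" using g(2) eC unfolding halves_contr by auto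
    then show ?thesis using h True sepD[OF C, of e] ey eu x unfolding halves_contr by blast
  next
    case False
    then show ?thesis using g h sepD[OF C, of g c w h d] w unfolding halves_contr by auto
  qed
qed

lemma sep_lift_other:
  assumes C: "sep (contr E e b) x C'" and x: "x \<noteq> u" "x \<noteq> Some y"
  obtains C where "sep E x C" "C - {e} = C'"
proof -
  \<comment> \<open>\<open>e\<close> belongs to the lifted set exactly when the given set reaches
    the merged vertex.\<close>
  define C where "C = (if \<exists>g\<in>C'. \<exists>c. (g, c) \<in> halves (contr E e b) u then insert e C' else C')"
  have C': "C' \<subseteq> dom E - {e}" using sep_subset[OF C] dom_contr by auto
  have eC: "e \<in> C \<longleftrightarrow> (\<exists>g\<in>C'. \<exists>c. (g, c) \<in> halves (contr E e b) u)"
    using C' by (auto simp: C_def)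
  have sub: "C - {e} = C'" using C' by (auto simp: C_def)
  have uy: "g \<in> C \<Longrightarrow> w = u \<or> w = Some y \<Longrightarrow> (g, c) \<in> halves E w \<Longrightarrow> e \<in> C" for g c w
    using eC sub noloop unfolding halves_contr by (cases "g = e") blast+
  have "sep E x C"
  proof (rule sepI)
    show "C \<subseteq> dom E" using sub C' e_dom by auto
  next
    fix w g c h d
    assume g: "g \<in> C" "(g, c) \<in> halves E w" and h: "(h, d) \<in> halves E w" and w: "w \<noteq> x"
    show "h \<in> C"
    proof (cases "w = u \<or> w = Some y")
      case True
      then have e: "e \<in> C" using uy g by blast
      then obtain g' c' where g': "g' \<in> C'" "(g', c') \<in> halves (contr E e b) u" using eC by blast
      show ?thesis
      proof (cases "h = e")
        case False
        then have "(h, d) \<in> halves (contr E e b) u" using True h noloop by (auto simp: halves_contr)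
        then show ?thesis using sepD[OF C g' _] x sub by blast
      qed (use e in simp)
    next
      case False
      then have "g \<noteq> e" "h \<noteq> e" using g h e_halves by auto
      then show ?thesis using False g h w sub sepD[OF C, of g c w h d] by (auto simp: halves_contr)
    qed
  qed
  then show thesis using sub that by blast
qed

text \<open>Contacts change only at the merged vertex, and there contact is allowed.\<close>

lemma sep_contr_end:
  assumes C: "sep E x C" and x: "x = u \<or> x = Some y" and e: "e \<notin> C"
  shows "sep (contr E e b) u C"
proof (rule sepI)
  show "C \<subseteq> dom (contr E e b)" using sep_subset[OF C] dom_contr e by auto
next
  fix w g c h d
  assume "g \<in> C" "(g, c) \<in> halves (contr E e b) w" "(h, d) \<in> halves (contr E e b) w" "w \<noteq> u"
  then show "h \<in> C" using sepD[OF C, of g c w h d] x by (auto simp: halves_contr)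
qed

lemma sep_lift_end:
  assumes C': "sep (contr E e b) u C'" and C: "sep E x C" and x: "x = u \<or> x = Some y"
    and e: "e \<notin> C" and sub: "C' \<subseteq> C"
  shows "sep E x C'"
proof (rule sepI)
  show "C' \<subseteq> dom E" using sub sep_subset[OF C] by auto
next
  fix w g c h d
  assume g: "g \<in> C'" "(g, c) \<in> halves E w" "(h, d) \<in> halves E w" "w \<noteq> x"
  have gC: "g \<in> C" using g sub by auto
  have w: "w \<noteq> u \<and> w \<noteq> Some y"
  proof (rule ccontr)
    assume "\<not> (w \<noteq> u \<and> w \<noteq> Some y)"
    then have "e \<in> C" using sepD[OF C gC g(2), of e] ey eu g(4) by auto
    then show False using e by simp
  qed
  then have "h \<noteq> e" "g \<noteq> e" using g e_halves by auto
  then show "h \<in> C'" using sepD[OF C' g(1), of c w h d] g w by (auto simp: halves_contr)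
qed

text \<open>At the end of \<open>e\<close> that is not the cut vertex, closedness would force
  \<open>e\<close> into \<open>C\<close>.\<close>

lemma no_ends:
  assumes C: "sep E x C" and x: "x = u \<and> w = Some y \<or> x = Some y \<and> w = u"
    and e: "e \<notin> C" and g: "(g, c) \<in> halves E w"
  shows "g \<notin> C"
proof
  assume "g \<in> C"
  moreover have "w \<noteq> x" using x noloop by auto
  moreover have "\<exists>d. (e, d) \<in> halves E w" using x ey eu by blast
  ultimately show False using sepD[OF C _ g, of e] e by blast
qed

lemma atom_contr_end:
  assumes C: "atom E x C" and x: "x = u \<or> x = Some y" and e: "e \<notin> C"
  shows "atom (contr E e b) u C"
  unfolding atom_def
proof (intro conjI allI impI)
  show "sep (contr E e b) u C" using sep_contr_end[OF atom_sep[OF C] x e] .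
  show "C \<noteq> {}" using C by (simp add: atom_def)
next
  fix C' assume "sep (contr E e b) u C'" "C' \<subseteq> C"
  then have "sep E x C'" using sep_lift_end[OF _ atom_sep[OF C] x e] by blast
  then show "C' = {} \<or> C' = C" using C \<open>C' \<subseteq> C\<close> by (auto simp: atom_def)
qed

end

locale valid_contraction = contraction +
  assumes val: "valid E"
begin

text \<open>\<open>e\<close> can occupy at most two of the at least three half-edges there.\<close>

lemma other_half: assumes "Some v \<in> {u, Some y}" obtains g c where "(g, c) \<in> halves E (Some v)" "g \<noteq> e"
proof -
  have "v \<in> nodes E" using assms ey eu by (auto simp: nodes_halves)
  then have c: "3 \<le> card (halves E (Some v))" using val valid_card by blast
  have "\<not> halves E (Some v) \<subseteq> {(e, True), (e, False)}"
  proof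
    assume "halves E (Some v) \<subseteq> {(e, True), (e, False)}"
    then have "card (halves E (Some v)) \<le> card {(e, True), (e, False)}" by (intro card_mono) auto
    then show False using c by simp
  qed
  then obtain g c where "(g, c) \<in> halves E (Some v)" "(g, c) \<notin> {(e, True), (e, False)}" by auto
  then show thesis using that by (cases c) auto
qed

lemma atom_contr_other:
  assumes C: "atom E x C" and x: "x \<noteq> u" "x \<noteq> Some y"
  shows "atom (contr E e b) x (C - {e})"
  unfolding atom_def
proof (intro conjI allI impI)
  have sC: "sep E x C" using C by (rule atom_sep)
  show "sep (contr E e b) x (C - {e})" using sep_contr_other[OF sC x] .
  obtain g c where g: "(g, c) \<in> halves E (Some y)" "g \<noteq> e" using other_half by blast
  show "C - {e} \<noteq> {}"
  proof (cases "e \<in> C")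
    case True
    then show ?thesis using sepD[OF sC _ ey g(1)] x g by blast
  next
    case False then show ?thesis using C by (auto simp: atom_def)
  qed
  fix C' assume C': "sep (contr E e b) x C'" "C' \<subseteq> C - {e}"
  obtain C1 where C1: "sep E x C1" "C1 - {e} = C'" using sep_lift_other[OF C'(1) x] .
  have "sep E x (C1 \<inter> C)" using C1 sC by (rule_tac sep_Int)
  then have "C1 \<inter> C = {} \<or> C1 \<inter> C = C" using C by (auto simp: atom_def)
  then show "C' = {} \<or> C' = C - {e}" using C1 C' by blast
qed

text \<open>The excluded case is a component based at an end of \<open>e\<close> and containing
  \<open>e\<close>: its attachment then includes a half-edge of \<open>e\<close>, which
  disappears.\<close>

lemma Sall_contr:
  assumes C: "atom E x C" "starfree E x C" "half_part E x C \<noteq> {}" and e: "x = u \<or> x = Some y \<Longrightarrow> e \<notin> C"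
  shows "half_part E x C \<in> Sall (contr E e b)"
proof (cases "x = u \<or> x = Some y")
  case True
  then have at: "atom (contr E e b) u C" using atom_contr_end[OF C(1) _ e] by blast
  have sf: "starfree (contr E e b) u C"
    using C(2) True unfolding starfree_def halves_contr by auto
  have "half_part E x C = half_part (contr E e b) u C"
    using True e no_ends[OF atom_sep[OF C(1)], of "Some y"] no_ends[OF atom_sep[OF C(1)], of u] noloop
    by (auto simp: in_half_part halves_contr)
  then show ?thesis using at sf C(3) unfolding Sall_def by (metis (mono_tags, lifting) mem_Collect_eq)
next
  case False
  then have x: "x \<noteq> u" "x \<noteq> Some y" by auto
  have at: "atom (contr E e b) x (C - {e})" using atom_contr_other[OF C(1) x] .
  have sf: "starfree (contr E e b) x (C - {e})"
  proof (cases "x = None")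
    case False
    have "g \<notin> C - {e}" if *: "g \<noteq> e \<and> None \<noteq> Some y \<and> ((g, c) \<in> halves E None \<or> None = u \<and> (g, c) \<in> halves E (Some y))" for g c
    proof
      have C2: "(g, b) \<in> halves E None \<Longrightarrow> g \<notin> C" for g b using C(2) False by (auto simp: starfree_def)
      assume "g \<in> C - {e}"
      then have u: "u = None" "(g, c) \<in> halves E (Some y)" "g \<in> C" using C2 * by auto
      then have "e \<in> C" using sepD[OF atom_sep[OF C(1)], of g c "Some y" e b] ey x by auto
      then show False using C2 eu u by blast
    qed
    then show ?thesis unfolding starfree_def halves_contr by blast
  qed (simp add: starfree_def)
  have "half_part E x C = half_part (contr E e b) x (C - {e})"
  proof (rule set_eqI)
    fix h :: "nat \<times> bool"
    obtain g and c :: bool where h: "h = (g, c)" by force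
    show "h \<in> half_part E x C \<longleftrightarrow> h \<in> half_part (contr E e b) x (C - {e})"
      unfolding h in_half_part halves_contr_other[OF x] using e_notin[OF x, of c] by auto
  qed
  then show ?thesis using at sf C(3) unfolding Sall_def by (metis (mono_tags, lifting) mem_Collect_eq)
qed

text \<open>Two vertices of valence at least 3 lose one half-edge each, which leaves at least 4 at
  the merged vertex.\<close>

lemma contr_card:
  assumes v: "v \<in> nodes (contr E e b)" shows "3 \<le> card (halves (contr E e b) (Some v))"
proof -
  have fin: "finite (dom E)" using val by (rule valid_finite)
  have c3: "3 \<le> card (halves E (Some v))" if "v \<in> nodes E" for v using valid_card[OF val that] .
  have cy: "2 \<le> card (halves E (Some y) - {(e, b)})"
  proof -
    have "3 \<le> card (halves E (Some y))" using c3[of y] ey by (auto simp: nodes_halves)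
    then show ?thesis using ey by (simp add: card_Diff_singleton)
  qed
  have fin': "finite (dom (contr E e b))" using fin dom_contr by simp
  show ?thesis
  proof (cases "Some v = u")
    case False
    moreover have "v \<noteq> y" using v by (auto simp: nodes_halves halves_contr)
    ultimately have "halves (contr E e b) (Some v) = halves E (Some v)"
      by (intro halves_contr_other) auto
    then show ?thesis using v c3 by (auto simp: nodes_halves)
  next
    case True
    have cu: "2 \<le> card (halves E u - {(e, \<not> b)})"
    proof -
      have "3 \<le> card (halves E u)" using c3[of v] eu True by (auto simp: nodes_halves)
      then show ?thesis using eu by (simp add: card_Diff_singleton)
    qed
    moreover have "card ((halves E u - {(e, \<not> b)}) \<union> (halves E (Some y) - {(e, b)})) =
        card (halves E u - {(e, \<not> b)}) + card (halves E (Some y) - {(e, b)})"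
      by (rule card_Un_disjoint) (use finite_halves[OF fin] noloop in \<open>auto dest: halves_unique\<close>)
    ultimately show ?thesis using True cu cy unfolding halves_contr_end[symmetric] by simp
  qed
qed

lemma contr_None: "halves (contr E e b) None \<noteq> {}"
proof (cases "u = None")
  case True
  obtain g c where "(g, c) \<in> halves E (Some y)" "g \<noteq> e" using other_half by blast
  then have "(g, c) \<in> halves (contr E e b) None" using True by (simp add: halves_contr)
  then show ?thesis by blast
next
  case False
  have "halves E None \<noteq> {}" using val by (rule valid_None)
  then obtain g c where "(g, c) \<in> halves E None" by (metis all_not_in_conv surj_pair)
  then have "(g, c) \<in> halves (contr E e b) None" using False by (auto simp: halves_contr_other)
  then show ?thesis by blast
qed

lemma finite_contr: "finite (dom (contr E e b))"
  using valid_finite[OF val] dom_contr by simp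

text \<open>Valences and the existence of hairs survive every contraction; only connectedness of the
  hairy graph can fail and, by \<open>valid_contr_internal\<close>, only for an edge at the
  star.\<close>

lemma valid_contr_iff_prime:
  "valid (contr E e b) \<longleftrightarrow> (\<forall>C. sep (contr E e b) None C \<longrightarrow> C = {} \<or> C = dom (contr E e b))"
  using contr_card contr_None finite_contr unfolding valid_def by blast

lemma valid_contr_internal:
  assumes "u \<noteq> None" shows "valid (contr E e b)"
  unfolding valid_contr_iff_prime
proof (intro allI impI)
  fix C' assume "sep (contr E e b) None C'"
  then obtain C where "sep E None C" "C - {e} = C'" using assms by (metis option.distinct(1) sep_lift_other)
  then show "C' = {} \<or> C' = dom (contr E e b)" using valid_prime[OF val] dom_contr by blast
qed

lemma nodes_contr: "nodes (contr E e b) = nodes E - {y}"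
proof (intro equalityI subsetI)
  fix v assume "v \<in> nodes (contr E e b)"
  then show "v \<in> nodes E - {y}"
    using eu by (fastforce simp: nodes_halves halves_contr)
next
  fix v assume v: "v \<in> nodes E - {y}"
  show "v \<in> nodes (contr E e b)"
  proof (cases "Some v = u")
    case True
    then obtain g c where "(g, c) \<in> halves E (Some v)" "g \<noteq> e" using other_half by (metis insertI1)
    then have "(g, c) \<in> halves (contr E e b) (Some v)" using v by (simp add: halves_contr)
    then show ?thesis unfolding nodes_halves by blast
  next
    case False
    obtain g c where g: "(g, c) \<in> halves E (Some v)" using v by (auto simp: nodes_halves)
    then have "g \<noteq> e" using e_halves False v by auto
    then have "(g, c) \<in> halves (contr E e b) (Some v)" using g v by (simp add: halves_contr)
    then show ?thesis unfolding nodes_halves by blast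
  qed
qed

end

text \<open>A set separated at the star stays so after contraction, possibly after passing to the
  complement to avoid \<open>e\<close>; a further edge at \<open>y\<close> decides on which side
  \<open>e\<close> lies. This shows that suspensions are valid and, by contraposition, that a
  contraction cannot repair a disconnected graph.\<close>

lemma (in contraction) valid_of_contr:
  assumes fin: "finite (dom E)" and c3: "\<And>v. v \<in> nodes E \<Longrightarrow> 3 \<le> card (halves E (Some v))"
    and None: "halves E None \<noteq> {}" and val: "valid (contr E e b)"
  shows "valid E"
proof -
  have oth: "\<exists>g c. (g, c) \<in> halves E (Some y) \<and> g \<noteq> e"
  proof (rule ccontr)
    assume "\<not> ?thesis"
    then have "halves E (Some y) \<subseteq> {(e, True), (e, False)}" by auto
    then have "card (halves E (Some y)) \<le> card {(e, True), (e, False)}" by (intro card_mono) auto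
    then show False using c3[of y] ey by (auto simp: nodes_halves)
  qed
  then obtain g c where g: "(g, c) \<in> halves E (Some y)" "g \<noteq> e" by blast
  have prime: "sep (contr E e b) None C \<Longrightarrow> C = {} \<or> C = dom E - {e}" for C
    using valid_prime[OF val] dom_contr by metis
  have "C = {} \<or> C = dom E" if C: "sep E None C" for C
  proof (cases "u = None")
    case False
    have "sep (contr E e b) None (C - {e})" using sep_contr_other[OF C] False by auto
    then have "C - {e} = {} \<or> C - {e} = dom E - {e}" using prime by blast
    then show ?thesis
    proof
      assume "C - {e} = {}"
      moreover have "e \<in> C \<Longrightarrow> g \<in> C" using sepD[OF C _ ey g(1)] by simp
      ultimately show ?thesis using g by blast
    next
      assume *: "C - {e} = dom E - {e}"
      then have "g \<in> C" using g(2) halves_dom[OF g(1)] by auto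
      then have "e \<in> C" using sepD[OF C _ g(1) ey] by simp
      then show ?thesis using * e_dom by blast
    qed
  next
    case True
    have triv: "C = {}" if C: "sep E None C" "e \<notin> C" for C
    proof -
      have "sep (contr E e b) None C" using sep_contr_end[OF C(1) _ C(2)] True by simp
      then have "C = {} \<or> C = dom E - {e}" using prime by blast
      then show ?thesis
      proof
        assume *: "C = dom E - {e}"
        then have "g \<in> C" using g(2) halves_dom[OF g(1)] by auto
        then have "e \<in> C" using sepD[OF C(1) _ g(1) ey] by simp
        then show ?thesis using C by blast
      qed
    qed
    show ?thesis
    proof (cases "e \<in> C")
      case True
      then have "dom E - C = {}" using triv[OF sep_compl[OF C]] by blast
      then show ?thesis using sep_subset[OF C] by blast
    next
      case False then show ?thesis using triv[OF C] by blast
    qed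
  qed
  then show ?thesis using fin c3 None unfolding valid_def by blast
qed

context contraction begin

lemma half_part_end:
  assumes C: "sep E x C" and x: "x = u \<or> x = Some y" and e: "e \<notin> C"
  shows "half_part (contr E e b) u C = half_part E x C"
proof (rule set_eqI)
  fix h :: "nat \<times> bool"
  obtain g and c :: bool where h: "h = (g, c)" by force
  have "x = u \<Longrightarrow> g \<in> C \<Longrightarrow> (g, c) \<notin> halves E (Some y)" "x = Some y \<Longrightarrow> g \<in> C \<Longrightarrow> (g, c) \<notin> halves E u"
    using no_ends[OF C _ e, of _ g c] by blast+
  then show "h \<in> half_part (contr E e b) u C \<longleftrightarrow> h \<in> half_part E x C"
    unfolding h in_half_part halves_contr using x e noloop by auto
qed

lemma half_part_other:
  assumes x: "x \<noteq> u" "x \<noteq> Some y"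
  shows "half_part (contr E e b) x (C - {e}) = half_part E x C"
proof (rule set_eqI)
  fix h :: "nat \<times> bool"
  obtain g and c :: bool where h: "h = (g, c)" by force
  show "h \<in> half_part (contr E e b) x (C - {e}) \<longleftrightarrow> h \<in> half_part E x C"
    unfolding h in_half_part halves_contr_other[OF x] using e_notin[OF x, of c] by auto
qed

end

section \<open>Bridges whose side of \<open>y\<close> has no hairs\<close>

locale bridge = valid_contraction +
  assumes br: "{(e, \<not> b)} \<in> Sall E"
begin

lemma near_atom:
  obtains C0 where "atom E u C0" "starfree E u C0" "e \<in> C0"
    "\<And>g c. g \<in> C0 \<Longrightarrow> (g, c) \<in> halves E u \<Longrightarrow> g = e"
proof -
  obtain x C where C: "atom E x C" "starfree E x C" "{(e, \<not> b)} = half_part E x C" using br by (elim SallE)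
  have "(e, \<not> b) \<in> half_part E x C" using C(3) by auto
  then have "(e, \<not> b) \<in> halves E x" "e \<in> C" by (auto simp: in_half_part)
  then have "x = u" using halves_unique[OF _ eu] by auto
  moreover have "g = e" if "g \<in> C" "(g, c) \<in> halves E u" for g c
  proof -
    have "(g, c) \<in> half_part E x C" using that \<open>x = u\<close> by (simp add: in_half_part)
    then show ?thesis using C(3) by auto
  qed
  ultimately show thesis using that[of C] C \<open>e \<in> C\<close> by blast
qed

text \<open>Otherwise the components at \<open>u\<close> and at \<open>y\<close> that contain
  \<open>e\<close> would together be closed everywhere, hence be the whole connected graph, while
  neither meets a hair. For \<open>u = None\<close> the edge \<open>e\<close> would itself bring a
  hair into \<open>C\<close>.\<close>

lemma far_atom:
  assumes C: "atom E (Some y) C" "starfree E (Some y) C"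
  shows "e \<notin> C"
proof
  assume eC: "e \<in> C"
  obtain C0 where C0: "atom E u C0" "starfree E u C0" "e \<in> C0"
    "\<And>g c. g \<in> C0 \<Longrightarrow> (g, c) \<in> halves E u \<Longrightarrow> g = e" using near_atom by blast
  note s = atom_sep[OF C(1)] and s0 = atom_sep[OF C0(1)]
  have nN: "g \<notin> C" if "(g, c) \<in> halves E None" for g c
    using C(2) that by (auto simp: starfree_def)
  have uN: "u \<noteq> None" using nN[of e "\<not> b"] eu eC by metis
  have nN0: "g \<notin> C0" if "(g, c) \<in> halves E None" for g c
    using C0(2) that uN by (auto simp: starfree_def)
  have "sep E None (C \<union> C0)"
  proof (rule sepI)
    show "C \<union> C0 \<subseteq> dom E" using s s0 sep_subset by blast
  next
    fix w g c h d
    assume g: "g \<in> C \<union> C0" "(g, c) \<in> halves E w" "(h, d) \<in> halves E w"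
    show "h \<in> C \<union> C0"
    proof (cases "g \<in> C")
      case True
      show ?thesis
      proof (cases "w = Some y")
        case True
        then show ?thesis using sepD[OF s0 C0(3) ey, of h d] g(3) noloop by auto
      next
        case False
        then show ?thesis using sepD[OF s True g(2,3)] by auto
      qed
    next
      case False
      then have g0: "g \<in> C0" using g by auto
      have "w \<noteq> u" using C0(4)[OF g0, of c] g(2) False eC by auto
      then show ?thesis using sepD[OF s0 g0 g(2,3)] by auto
    qed
  qed
  then have "C \<union> C0 = dom E" using prime_validD[OF val] eC by blast
  moreover obtain g c where g: "(g, c) \<in> halves E None" using valid_None[OF val] by (metis all_not_in_conv surj_pair)
  ultimately show False using nN nN0 halves_dom[OF g] by blast
qed

text \<open>The atom containing \<open>e\<close> is, at \<open>u\<close>, the one attached by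
  \<open>e\<close> alone and, at \<open>y\<close>, one with hairs. Every other component without
  hairs keeps its attachment, literally as a set of half-edges.\<close>

lemma Sall_bridge: "Sall (contr E e b) = Sall E - {{(e, \<not> b)}}"
proof (intro equalityI subsetI)
  fix S assume S: "S \<in> Sall E - {{(e, \<not> b)}}"
  then have "S \<in> Sall E" by simp
  then obtain x C where C: "atom E x C" "starfree E x C" "S = half_part E x C" "S \<noteq> {}" by (rule SallE)
  obtain C0 where C0: "atom E u C0" "e \<in> C0" "\<And>g c. g \<in> C0 \<Longrightarrow> (g, c) \<in> halves E u \<Longrightarrow> g = e"
    using near_atom by blast
  have "e \<notin> C" if x: "x = u \<or> x = Some y"
  proof (cases "x = u")
    case True
    show ?thesis
    proof
      assume "e \<in> C"
      then have "C = C0" using atom_unique[OF _ C0(1), of C e] C0(2) C(1) True by simp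
      have "h = (e, \<not> b)" if h: "h \<in> S" for h
      proof -
        obtain g and c :: bool where h': "h = (g, c)" by force
        have "g = e" using h C0(3)[of g c] True \<open>C = C0\<close> unfolding C(3) h' in_half_part by auto
        moreover have "(g, c) \<in> halves E u" using h True unfolding C(3) h' in_half_part by auto
        ultimately show ?thesis using e_halves[of c u] noloop h' by auto
      qed
      then have "S = {(e, \<not> b)}" using C(4) by auto
      then show False using S by simp
    qed
  next
    case False then show ?thesis using far_atom C x by blast
  qed
  then show "S \<in> Sall (contr E e b)" using Sall_contr C by blast
next
  fix S assume "S \<in> Sall (contr E e b)"
  then obtain x C' where C': "atom (contr E e b) x C'" "starfree (contr E e b) x C'"
    "S = half_part (contr E e b) x C'" "S \<noteq> {}" by (elim SallE)
  then obtain g c where gc: "(g, c) \<in> half_part (contr E e b) x C'" by (metis all_not_in_conv surj_pair)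
  then have g: "g \<in> C'" "(g, c) \<in> halves (contr E e b) x" by (auto simp: in_half_part)
  have ge: "g \<noteq> e" and xy: "x \<noteq> Some y" using g(2) unfolding halves_contr by auto
  have gS: "(g, c) \<in> S" using gc C'(3) by simp
  have "S \<in> Sall E"
  proof (cases "x = u")
    case False
    obtain C where C: "atom E x C" "g \<in> C"
      using ex_atom[of g E x] g(2) halves_dom unfolding halves_contr by metis
    have eq: "C - {e} = C'"
      using atom_unique[OF atom_contr_other[OF C(1) False xy] C'(1), of g] C(2) g(1) ge by auto
    have "starfree E x C"
    proof (cases "x = None")
      case False
      have "h \<notin> C" if h: "(h, d) \<in> halves E None" for h d
      proof
        assume hC: "h \<in> C"
        have N: "h' \<notin> C'" if "(h', d') \<in> halves (contr E e b) None" for h' d'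
          using C'(2) False that by (auto simp: starfree_def)
        show False
        proof (cases "h = e")
          case True
          then have u: "u = None" using h e_halves[of d None] by auto
          obtain g2 c2 where g2: "(g2, c2) \<in> halves E (Some y)" "g2 \<noteq> e" using other_half by blast
          have "g2 \<in> C" using sepD[OF atom_sep[OF C(1)] _ ey g2(1)] xy hC True by simp
          then show False using N[of g2 c2] g2 u eq by (auto simp: halves_contr)
        next
          case False
          then show False using N[of h d] h hC eq by (auto simp: halves_contr)
        qed
      qed
      then show ?thesis unfolding starfree_def by blast
    qed (simp add: starfree_def)
    moreover have "S = half_part E x C" using half_part_other[OF False xy, of C] C'(3) eq by simp
    ultimately show ?thesis using C(1) C'(4) unfolding Sall_def by blast
  next
    case True
    obtain C0 where C0: "atom E u C0" "e \<in> C0" "\<And>g c. g \<in> C0 \<Longrightarrow> (g, c) \<in> halves E u \<Longrightarrow> g = e"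
      using near_atom by blast
    note s0 = atom_sep[OF C0(1)]
    obtain z where z: "z = u \<or> z = Some y" "(g, c) \<in> halves E z" using g(2) True unfolding halves_contr by auto
    obtain C where C: "atom E z C" "g \<in> C" using ex_atom[of g E z] halves_dom[OF z(2)] by metis
    have eC: "e \<notin> C"
    proof
      assume e: "e \<in> C"
      show False
      proof (cases "z = u")
        case True
        then have "C = C0" using atom_unique[OF _ C0(1), of C e] C0(2) C(1) e by simp
        then show False using C0(3) C(2) z(2) True ge by blast
      next
        case False
        then have zy: "z = Some y" using z by auto
        \<comment> \<open>Removing \<open>e\<close> keeps the set closed: besides the allowed vertex
          \<open>y\<close>, \<open>e\<close> only touches \<open>u\<close>, where \<open>C0\<close>
          has no other edge.\<close>
        have "sep E z (C \<inter> C0 - {e})"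
        proof (rule sepI)
          show "C \<inter> C0 - {e} \<subseteq> dom E" using sep_subset[OF s0] by auto
        next
          fix w g c h d
          assume g: "g \<in> C \<inter> C0 - {e}" "(g, c) \<in> halves E w" "(h, d) \<in> halves E w" "w \<noteq> z"
          then have wu: "w \<noteq> u" using C0(3)[of g c] by auto
          have "h \<in> C" using sepD[OF atom_sep[OF C(1)] _ g(2,3,4)] g(1) by auto
          moreover have "h \<in> C0" using sepD[OF s0 _ g(2,3) wu] g(1) by auto
          moreover have "h \<noteq> e" using g(3,4) wu zy e_halves[of d w] by auto
          ultimately show "h \<in> C \<inter> C0 - {e}" by simp
        qed
        moreover have "g \<in> C \<inter> C0 - {e}"
          using C(2) ge sepD[OF s0 C0(2) ey, of g c] z(2) zy noloop by auto
        ultimately have "C \<inter> C0 - {e} = C" using atom_min[OF C(1)] by blast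
        then show False using e by blast
      qed
    qed
    have eq: "C = C'" using atom_unique[OF atom_contr_end[OF C(1) z(1) eC] _ C(2) g(1)] C'(1) True by simp
    have "starfree E z C"
    proof (cases "z = None")
      case False
      have "h \<notin> C" if h: "(h, d) \<in> halves E None" for h d
      proof
        assume hC: "h \<in> C"
        show False
        proof (cases "u = None")
          case True
          then show False using sepD[OF atom_sep[OF C(1)] hC h, of e] eu False eC by auto
        next
          case False
          then have "h \<notin> C'" using C'(2) h True eC hC unfolding starfree_def halves_contr by auto
          then show False using hC eq by simp
        qed
      qed
      then show ?thesis unfolding starfree_def by blast
    qed (simp add: starfree_def)
    moreover have "S = half_part E z C" using half_part_end[OF atom_sep[OF C(1)] z(1) eC] C'(3) True eq by simp
    ultimately show ?thesis using C(1) C'(4) unfolding Sall_def by blast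
  qed
  then show "S \<in> Sall E - {{(e, \<not> b)}}" using gS ge by auto
qed

end

section \<open>Expansion of a vertex, inverse to contraction\<close>

locale expansion =
  fixes E :: sgraph and x :: "nat option" and S :: "(nat \<times> bool) set" and y f :: nat
  assumes Sx: "S \<subseteq> halves E x" and S0: "S \<noteq> {}" and y: "y \<notin> nodes E" and f: "f \<notin> dom E"
begin

lemma xy: "x \<noteq> Some y"
  using Sx S0 y by (auto simp: nodes_halves)

lemma dom_expd: "dom (expd E x S y f) = insert f (dom E)"
  by (auto simp: expd_def split: if_splits)

lemma halves_expd: "(g, c) \<in> halves (expd E x S y f) w \<longleftrightarrow>
    (if g = f then (if c then w = Some y else w = x)
     else (if (g, c) \<in> S then w = Some y else (g, c) \<in> halves E w))"
proof (cases "g = f")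
  case False
  show ?thesis
  proof (cases "(g, c) \<in> S")
    case True
    then have "(g, c) \<in> halves E x" using Sx by blast
    then obtain p where "E g = Some p" "p c = x" by (auto simp: in_halves)
    then show ?thesis using False True by (auto simp: in_halves expd_def)
  qed (use False in \<open>auto simp: in_halves expd_def\<close>)
qed (auto simp: in_halves expd_def)

lemma f_notin: "(f, c) \<notin> S" "(f, c) \<notin> halves E w"
  using Sx f halves_dom[of f c E] by (auto dest: halves_dom)

text \<open>Together with \<open>contr_expd\<close> this derives facts about expansions from those
  about contractions. The new edge points to the new vertex, hence \<open>True\<close>.\<close>

sublocale contraction "expd E x S y f" f True y x
  by unfold_locales (use xy in \<open>auto simp: halves_expd\<close>)

lemma contr_expd: "contr (expd E x S y f) f True = E"
proof
  fix g
  show "contr (expd E x S y f) f True g = E g"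
  proof (cases "g = f \<or> E g = None")
    case True
    then show ?thesis using f unfolding contr_apply by (auto simp: expd_def domIff)
  next
    case False
    then obtain q where q: "E g = Some q" "g \<noteq> f" by auto
    have "q c \<noteq> Some y" for c using y q by (auto simp: nodes_def)
    moreover have "q c = x" if "(g, c) \<in> S" for c
    proof -
      have "(g, c) \<in> halves E x" using Sx that by blast
      then show ?thesis using q by (auto simp: in_halves)
    qed
    ultimately show ?thesis using q unfolding contr_apply by (auto simp: expd_def)
  qed
qed

lemma nodes_expd: "nodes (expd E x S y f) = insert y (nodes E)"
proof (intro equalityI subsetI)
  fix v assume "v \<in> nodes (expd E x S y f)"
  then obtain g c where "(g, c) \<in> halves (expd E x S y f) (Some v)" by (auto simp: nodes_halves)
  then show "v \<in> insert y (nodes E)" using Sx S0 unfolding halves_expd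
    by (fastforce simp: nodes_halves split: if_splits)
next
  fix v assume v: "v \<in> insert y (nodes E)"
  show "v \<in> nodes (expd E x S y f)"
  proof (cases "v = y \<or> Some v = x")
    case True
    then have "(f, v = y) \<in> halves (expd E x S y f) (Some v)" using xy by (auto simp: halves_expd)
    then show ?thesis by (auto simp: nodes_halves)
  next
    case False
    then obtain g c where g: "(g, c) \<in> halves E (Some v)" using v by (auto simp: nodes_halves)
    then have "(g, c) \<notin> S" using False Sx halves_unique by blast
    moreover have "g \<noteq> f" using g f_notin by auto
    ultimately have "(g, c) \<in> halves (expd E x S y f) (Some v)" using g by (simp add: halves_expd)
    then show ?thesis by (auto simp: nodes_halves)
  qed
qed

lemma halves_expd_y: "halves (expd E x S y f) (Some y) = insert (f, True) S"
proof (rule set_eqI)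
  fix h :: "nat \<times> bool"
  obtain g and c :: bool where h: "h = (g, c)" by force
  have "(g, c) \<notin> halves E (Some y)" using y by (auto simp: nodes_halves)
  then show "h \<in> halves (expd E x S y f) (Some y) \<longleftrightarrow> h \<in> insert (f, True) S"
    unfolding h halves_expd using f_notin xy by auto
qed

lemma halves_expd_x: "halves (expd E x S y f) x = insert (f, False) (halves E x - S)"
proof (rule set_eqI)
  fix h :: "nat \<times> bool"
  obtain g and c :: bool where h: "h = (g, c)" by force
  show "h \<in> halves (expd E x S y f) x \<longleftrightarrow> h \<in> insert (f, False) (halves E x - S)"
    unfolding h halves_expd using f_notin xy by auto
qed

lemma halves_expd_other: "w \<noteq> x \<Longrightarrow> w \<noteq> Some y \<Longrightarrow> halves (expd E x S y f) w = halves E w"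
proof (rule set_eqI)
  fix h :: "nat \<times> bool" assume w: "w \<noteq> x" "w \<noteq> Some y"
  obtain g and c :: bool where h: "h = (g, c)" by force
  have "(g, c) \<in> S \<Longrightarrow> (g, c) \<notin> halves E w" using Sx w halves_unique by blast
  then show "h \<in> halves (expd E x S y f) w \<longleftrightarrow> h \<in> halves E w"
    unfolding h halves_expd using f_notin(2)[of c w] w by (metis (full_types))
qed

text \<open>The new edge gives one half-edge back to \<open>x\<close>, so two remaining ones suffice
  for valence 3; \<open>y\<close> carries \<open>S\<close> and the new edge; the star has no valence
  condition.\<close>

lemma valid_expd:
  assumes val: "valid E" and S2: "2 \<le> card S" and x2: "x = None \<or> 2 \<le> card (halves E x - S)"
  shows "valid (expd E x S y f)"
proof (rule valid_of_contr)
  have fin: "finite (dom E)" using val by (rule valid_finite)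
  have finS: "finite S" using Sx finite_halves[OF fin] finite_subset by blast
  show "finite (dom (expd E x S y f))" using fin by (simp add: dom_expd)
  show "halves (expd E x S y f) None \<noteq> {}"
    using valid_None[OF val] halves_expd_x halves_expd_other[of None] by (cases "x = None") auto
  show "valid (contr (expd E x S y f) f True)" using val by (simp add: contr_expd)
  fix v assume "v \<in> nodes (expd E x S y f)"
  then have v: "v = y \<or> v \<in> nodes E" by (simp add: nodes_expd)
  show "3 \<le> card (halves (expd E x S y f) (Some v))"
  proof (cases "v = y")
    case True
    then show ?thesis using S2 finS f_notin by (simp add: halves_expd_y)
  next
    case False
    show ?thesis
    proof (cases "Some v = x")
      case True
      then show ?thesis using x2 f_notin halves_expd_x finite_halves[OF fin, of x] by auto
    next
      case F: False
      then show ?thesis using False v valid_card[OF val] halves_expd_other[of "Some v"] by auto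
    qed
  qed
qed

text \<open>At \<open>y\<close> the new edge meets all of \<open>S\<close> and nothing else, so it
  joins the component that was moved.\<close>

lemma atom_expd:
  assumes C: "atom E x C" "starfree E x C" "S = half_part E x C"
  shows "atom (expd E x S y f) x (insert f C)"
proof -
  note s = atom_sep[OF C(1)]
  have fC: "f \<notin> C" using sep_subset[OF s] f by auto
  have SC: "g \<in> C" if "(g, c) \<in> S" for g c using that C(3) by (simp add: in_half_part)
  have CS: "(g, c) \<in> S" if "g \<in> C" "(g, c) \<in> halves E x" for g c using that C(3) by (simp add: in_half_part)
  show ?thesis
    unfolding atom_def
  proof (intro conjI allI impI)
    show "sep (expd E x S y f) x (insert f C)"
    proof (rule sepI)
      show "insert f C \<subseteq> dom (expd E x S y f)" using sep_subset[OF s] dom_expd by auto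
    next
      fix w g c h d
      assume g: "g \<in> insert f C" "(g, c) \<in> halves (expd E x S y f) w"
        and h: "(h, d) \<in> halves (expd E x S y f) w" and w: "w \<noteq> x"
      show "h \<in> insert f C"
      proof (cases "w = Some y")
        case True
        then show ?thesis using h SC unfolding True halves_expd_y by auto
      next
        case False
        have "g \<noteq> f" using g(2) w False halves_expd[of f c w] by (cases c) auto
        then show ?thesis using g h sepD[OF s, of g c w h d] w unfolding halves_expd_other[OF w False] by auto
      qed
    qed
    show "insert f C \<noteq> {}" by simp
  next
    fix C2 assume C2: "sep (expd E x S y f) x C2" "C2 \<subseteq> insert f C"
    have f_iff: "f \<in> C2 \<longleftrightarrow> g \<in> C2" if "(g, c) \<in> S" for g c
    proof -
      have "(g, c) \<in> halves (expd E x S y f) (Some y)" "(f, True) \<in> halves (expd E x S y f) (Some y)"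
        using that by (auto simp: halves_expd_y)
      then show ?thesis using sepD[OF C2(1)] xy by metis
    qed
    have "sep E x (C2 - {f})"
    proof (rule sepI)
      show "C2 - {f} \<subseteq> dom E" using C2(2) sep_subset[OF s] by auto
    next
      fix w g c h d
      assume g: "g \<in> C2 - {f}" "(g, c) \<in> halves E w" "(h, d) \<in> halves E w" "w \<noteq> x"
      have wy: "w \<noteq> Some y" using g(2) y by (auto simp: nodes_halves)
      have "h \<in> C2" using sepD[OF C2(1), of g c w h d] g halves_expd_other[OF g(4) wy] by auto
      then show "h \<in> C2 - {f}" using g(3) f_notin by auto
    qed
    then have "C2 - {f} = {} \<or> C2 - {f} = C" using C(1) C2(2) unfolding atom_def by blast
    moreover obtain g c where gS: "(g, c) \<in> S" using S0 by (metis all_not_in_conv surj_pair)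
    ultimately show "C2 = {} \<or> C2 = insert f C"
      using f_iff[OF gS] SC[OF gS] fC C2(2) by blast
  qed
qed

text \<open>The whole attachment \<open>S\<close> is replaced by the single half-edge of
  \<open>f\<close> at \<open>x\<close>.\<close>

lemma Sall_f:
  assumes C: "atom E x C" "starfree E x C" "S = half_part E x C"
  shows "{(f, False)} \<in> Sall (expd E x S y f)"
proof -
  note s = atom_sep[OF C(1)]
  have fC: "f \<notin> C" using sep_subset[OF s] f by auto
  have SC: "g \<in> C" if "(g, c) \<in> S" for g c using that C(3) by (simp add: in_half_part)
  have CS: "(g, c) \<in> S" if "g \<in> C" "(g, c) \<in> halves E x" for g c using that C(3) by (simp add: in_half_part)
  have "atom (expd E x S y f) x (insert f C)" by (rule atom_expd) fact+
  moreover have "starfree (expd E x S y f) x (insert f C)"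
  proof (cases "x = None")
    case False
    then have N: "halves (expd E x S y f) None = halves E None" using halves_expd_other[of None] by auto
    show ?thesis using C(2) f_notin(2)[of _ None] unfolding starfree_def N by auto
  qed (simp add: starfree_def)
  moreover have "half_part (expd E x S y f) x (insert f C) = {(f, False)}"
    unfolding half_part_def halves_expd_x using CS fC f_notin by auto
  ultimately show ?thesis unfolding Sall_def mem_Collect_eq by (metis insert_not_empty)
qed

end

section \<open>Attachments with at least two half-edges, suspended or not\<close>

definition base :: "sgraph \<Rightarrow> (nat \<times> bool) set \<Rightarrow> nat option" where
  "base E S = (THE x. S \<subseteq> halves E x)"

definition S2 :: "sgraph \<Rightarrow> (nat \<times> bool) set set" where
  "S2 E = {S \<in> Sall E. 2 \<le> card S}"

text \<open>Attachments that are not yet suspended on a bridge; moving them to a new vertex leaves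
  \<^term>\<open>base E S\<close> with valence at least 3.\<close>

definition red :: "sgraph \<Rightarrow> (nat \<times> bool) set set" where
  "red E = {S \<in> S2 E. base E S = None \<or> 2 \<le> card (halves E (base E S) - S)}"

text \<open>The bridges that cut off a part without hairs.\<close>

definition Br :: "sgraph \<Rightarrow> nat set" where
  "Br E = {e. \<exists>b. {(e, b)} \<in> Sall E}"

lemma baseI: "S \<subseteq> halves E x \<Longrightarrow> S \<noteq> {} \<Longrightarrow> base E S = x"
  unfolding base_def by (rule the_equality) (use halves_unique in blast)+

lemma Sall_base:
  assumes "S \<in> Sall E"
  obtains C where "atom E (base E S) C" "starfree E (base E S) C" "S = half_part E (base E S) C"
    "S \<noteq> {}" "S \<subseteq> halves E (base E S)"
proof -
  obtain x C where C: "atom E x C" "starfree E x C" "S = half_part E x C" "S \<noteq> {}" using assms by (elim SallE)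
  have "S \<subseteq> halves E x" using C by (auto simp: half_part_def)
  then have "base E S = x" using C(4) by (rule baseI)
  then show thesis using that[of C] C \<open>S \<subseteq> halves E x\<close> by simp
qed

lemma finite_Sall: "finite (dom E) \<Longrightarrow> finite (Sall E)"
proof (rule finite_subset[of _ "Pow (dom E \<times> UNIV)"])
  show "Sall E \<subseteq> Pow (dom E \<times> UNIV)" by (force simp: Sall_def half_part_def dest: halves_dom)
qed simp

lemma Br_dom: "Br E \<subseteq> dom E"
proof
  fix e assume "e \<in> Br E"
  then obtain b where "{(e, b)} \<in> Sall E" by (auto simp: Br_def)
  then obtain x C where "{(e, b)} = half_part E x C" by (elim SallE)
  then have "(e, b) \<in> half_part E x C" by auto
  then show "e \<in> dom E" using halves_dom by (simp add: in_half_part) blast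
qed

lemma finite_Br: "finite (dom E) \<Longrightarrow> finite (Br E)"
  using Br_dom finite_subset by blast

text \<open>\<open>e\<close> is no loop, since its other half would be attached too, and its far end
  is not the star, since the component has no hairs.\<close>

lemma Sall_bridgeE:
  assumes val: "valid E" and br: "{(e, c)} \<in> Sall E"
  obtains y u where "bridge E e (\<not> c) y u"
proof -
  obtain x C where C: "atom E x C" "starfree E x C" "{(e, c)} = half_part E x C" using br by (elim SallE)
  have ec: "(e, c) \<in> half_part E x C" using C(3) by auto
  then have ex: "(e, c) \<in> halves E x" "e \<in> C" by (auto simp: in_half_part)
  obtain w where w: "(e, \<not> c) \<in> halves E w" using dom_halves[OF halves_dom[OF ex(1)], of "\<not> c"] by blast
  have wx: "w \<noteq> x"
  proof
    assume "w = x"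
    then have "(e, \<not> c) \<in> half_part E x C" using w ex by (simp add: in_half_part)
    then show False using C(3) by auto
  qed
  have "w \<noteq> None"
  proof
    assume "w = None"
    then have "x \<noteq> None" "(e, \<not> c) \<in> halves E None" using w wx by auto
    then show False using C(2) ex(2) by (auto simp: starfree_def)
  qed
  then obtain y where y: "w = Some y" by auto
  have "bridge E e (\<not> c) y x"
    by unfold_locales (use ex w wx y val br in auto)
  then show thesis by (rule that)
qed

lemma S2_Sall: "S \<in> S2 E \<Longrightarrow> S \<in> Sall E" by (simp add: S2_def)

lemma red_S2: "S \<in> red E \<Longrightarrow> S \<in> S2 E" by (simp add: red_def)

lemma finite_S2: "finite (dom E) \<Longrightarrow> finite (S2 E)"
  by (rule finite_subset[OF _ finite_Sall]) (auto simp: S2_def)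

lemma finite_red: "finite (dom E) \<Longrightarrow> finite (red E)"
  by (rule finite_subset[OF _ finite_S2]) (auto simp: red_def)

lemma S2_nonempty: "S \<in> S2 E \<Longrightarrow> S \<noteq> {}"
  by (auto simp: S2_def)

lemma Sall_sub: "S \<in> Sall E \<Longrightarrow> S \<subseteq> halves E (base E S)"
  by (elim Sall_base)

text \<open>A component attached by one half-edge, based at an end of \<open>e\<close> and
  containing \<open>e\<close>, would be attached by \<open>e\<close> itself and make
  \<open>e\<close> a bridge. So \<open>Sall_contr\<close> applies to all singletons.\<close>

lemma (in valid_contraction) Br_contr_sub:
  assumes "e \<notin> Br E" shows "Br E \<subseteq> Br (contr E e b)"
proof
  fix g assume "g \<in> Br E"
  then obtain c where c: "{(g, c)} \<in> Sall E" by (auto simp: Br_def)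
  then obtain x C where C: "atom E x C" "starfree E x C" "{(g, c)} = half_part E x C" by (elim SallE)
  have "e \<notin> C" if x: "x = u \<or> x = Some y"
  proof
    assume "e \<in> C"
    then have "\<exists>d. (e, d) \<in> half_part E x C" using x ey eu by (auto simp: in_half_part)
    then have "g = e" using C(3) by auto
    then show False using c assms by (auto simp: Br_def)
  qed
  then have "half_part E x C \<in> Sall (contr E e b)" using Sall_contr C by blast
  then show "g \<in> Br (contr E e b)" using C(3) unfolding Br_def by (metis (mono_tags, lifting) mem_Collect_eq)
qed

context bridge begin

text \<open>Contracting a bridge removes only a singleton from \<open>Sall\<close>. Since this index
  set does not move, the sums in \<open>D h\<close> and \<open>h D\<close> can be compared term by
  term.\<close>

lemma S2_contr: "S2 (contr E e b) = S2 E"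
  unfolding S2_def Sall_bridge by auto

lemma Br_contr: "Br (contr E e b) = Br E - {e}"
proof -
  have "{(e, c)} \<notin> Sall (contr E e b)" for c
    using Sall_sub[of "{(e, c)}" "contr E e b"] dom_contr by (auto dest: halves_dom)
  then show ?thesis unfolding Br_def Sall_bridge by auto
qed

text \<open>\<open>S\<close> is still an attachment after the contraction, where \<open>e\<close> no
  longer exists.\<close>

lemma e_notin_S2: assumes "S \<in> S2 E" shows "(e, c) \<notin> S"
proof
  assume e: "(e, c) \<in> S"
  have "S \<in> Sall (contr E e b)" using assms S2_contr S2_Sall by blast
  then have "(e, c) \<in> halves (contr E e b) (base (contr E e b) S)" using e Sall_sub by blast
  then show False by (simp add: halves_contr)
qed

lemma base_contr:
  assumes S: "S \<in> S2 E"
  shows "base (contr E e b) S = (if base E S = Some y then u else base E S)"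
proof -
  have 1: "S \<subseteq> halves E (base E S)" using S S2_Sall Sall_sub by blast
  have 2: "S \<subseteq> halves (contr E e b) (base (contr E e b) S)" using S S2_Sall S2_contr Sall_sub by blast
  obtain g c where g: "(g, c) \<in> S" using S2_nonempty[OF S] by (metis all_not_in_conv surj_pair)
  have a: "(g, c) \<in> halves E (base E S)" using 1 g by blast
  have "(g, c) \<in> halves (contr E e b) (base (contr E e b) S)" using 2 g by blast
  then have "base (contr E e b) S \<noteq> Some y \<and> ((g, c) \<in> halves E (base (contr E e b) S) \<or>
      base (contr E e b) S = u \<and> (g, c) \<in> halves E (Some y))" by (simp add: halves_contr)
  then show ?thesis using a halves_unique[OF a] by metis
qed

text \<open>At the merged vertex the end not carrying \<open>S\<close> contributes at least two
  further half-edges, so \<open>S\<close> can then always be suspended; elsewhere nothing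
  changes.\<close>

lemma red_contr:
  assumes S: "S \<in> S2 E"
  shows "S \<in> red (contr E e b) \<longleftrightarrow> base E S = u \<or> base E S = Some y \<or> S \<in> red E"
proof (cases "base E S = u \<or> base E S = Some y")
  case True
  have fin: "finite (dom E)" using val by (rule valid_finite)
  have fin': "finite (dom (contr E e b))" using fin dom_contr by simp
  have Sb: "S \<subseteq> halves E (base E S)" using S S2_Sall Sall_sub by blast
  have "u = None \<or> 2 \<le> card (halves (contr E e b) u - S)"
  proof (cases "u = None")
    case False
    have c2: "2 \<le> card (halves E (Some v) - {(e, c)})" if "(e, c) \<in> halves E (Some v)" for v c
    proof -
      have "v \<in> nodes E" using that by (auto simp: nodes_halves)
      then have "3 \<le> card (halves E (Some v))" by (rule valid_card[OF val])
      then show ?thesis using that by (simp add: card_Diff_singleton)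
    qed
    have "\<exists>X. X \<subseteq> halves (contr E e b) u - S \<and> 2 \<le> card X"
    proof (cases "base E S = u")
      case True
      then have "halves E (Some y) \<inter> S = {}" using Sb noloop halves_unique by blast
      then show ?thesis using c2[OF ey] unfolding halves_contr_end by blast
    next
      case F: False
      then have "halves E u \<inter> S = {}" using Sb noloop halves_unique True by blast
      moreover obtain v where "u = Some v" using False by auto
      ultimately show ?thesis using c2[of "\<not> b" v] eu unfolding halves_contr_end by blast
    qed
    then show ?thesis using finite_halves[OF fin'] by (meson card_mono finite_Diff le_trans)
  qed simp
  moreover have "base (contr E e b) S = u" using base_contr[OF S] True by auto
  ultimately have "S \<in> red (contr E e b)" using S S2_contr by (simp add: red_def)
  then show ?thesis using True by blast
next
  case False
  then have "base (contr E e b) S = base E S" using base_contr[OF S] by simp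
  moreover have "halves (contr E e b) (base E S) = halves E (base E S)" using False by (intro halves_contr_other) auto
  ultimately show ?thesis using False S S2_contr by (simp add: red_def)
qed

text \<open>A bridge is hair-free on one side only, by \<open>far_atom\<close>; this makes its
  orientation unique in \<open>bb_eq\<close>.\<close>

lemma far_not_Sall: "{(e, b)} \<notin> Sall E"
proof
  assume "{(e, b)} \<in> Sall E"
  then obtain x C where C: "atom E x C" "starfree E x C" "{(e, b)} = half_part E x C" by (elim SallE)
  have "(e, b) \<in> half_part E x C" using C(3) by auto
  then have "e \<in> C" "(e, b) \<in> halves E x" by (auto simp: in_half_part)
  moreover then have "x = Some y" using halves_unique[OF _ ey] by blast
  ultimately show False using far_atom C by blast
qed

end

text \<open>If \<open>S\<close> cannot be suspended, at most one half-edge besides \<open>S\<close>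
  remains at its base. Connectedness to the hairs forces exactly one, and its edge is the bridge
  from which \<open>S\<close> already hangs.\<close>

lemma suspendedE:
  assumes val: "valid E" and S: "S \<in> S2 E" "S \<notin> red E"
  obtains e c w u where "bridge E e c w u" "base E S = Some w" "halves E (Some w) - S = {(e, c)}"
    "valid (contr E e c)"
proof -
  have fin: "finite (dom E)" using val by (rule valid_finite)
  obtain C where C: "atom E (base E S) C" "starfree E (base E S) C" "S = half_part E (base E S) C"
    "S \<noteq> {}" "S \<subseteq> halves E (base E S)" using Sall_base[OF S2_Sall[OF S(1)]] .
  have "base E S \<noteq> None" and lt: "card (halves E (base E S) - S) < 2"
    using S by (auto simp: red_def)
  then obtain w where w: "base E S = Some w" by auto
  have C3: "(g, d) \<in> S \<longleftrightarrow> g \<in> C \<and> (g, d) \<in> halves E (Some w)" for g d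
    using C(3) in_half_part[of g d E "Some w" C] unfolding w by blast
  note s = atom_sep[OF C(1)]
  have N: "g \<notin> C" if "(g, d) \<in> halves E None" for g d
    using C(2) w that by (auto simp: starfree_def)
  obtain g1 c1 where g1: "(g1, c1) \<in> S" using C(4) by (metis all_not_in_conv surj_pair)
  then have g1': "g1 \<in> C" "(g1, c1) \<in> halves E (Some w)" using C3 by blast+
  \<comment> \<open>Otherwise the component, which has no hairs, would be closed everywhere and be
    the whole graph.\<close>
  have "halves E (Some w) - S \<noteq> {}"
  proof
    assume emp: "halves E (Some w) - S = {}"
    have "sep E None C"
    proof (rule sepI)
      show "C \<subseteq> dom E" using sep_subset[OF s] .
    next
      fix w' g b h d assume g: "g \<in> C" "(g, b) \<in> halves E w'" "(h, d) \<in> halves E w'"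
      show "h \<in> C"
      proof (cases "w' = Some w")
        case True
        then have "(h, d) \<in> S" using emp g by blast
        then show ?thesis using C3 by blast
      next
        case False
        then show ?thesis using sepD[OF s g] w by simp
      qed
    qed
    then have "C = dom E" using prime_validD[OF val] g1' by blast
    moreover obtain g c where g: "(g, c) \<in> halves E None" using valid_None[OF val] by (metis all_not_in_conv surj_pair)
    ultimately show False using N halves_dom[OF g] by blast
  qed
  then have "card (halves E (Some w) - S) = 1"
    using lt w finite_halves[OF fin, of "Some w"] by (simp add: Suc_leI card_gt_0_iff order_antisym)
  then obtain h where "halves E (Some w) - S = {h}" by (auto simp: card_1_singleton_iff)
  moreover obtain e and c :: bool where "h = (e, c)" by force
  ultimately have ec: "halves E (Some w) - S = {(e, c)}" by simp
  then have ew: "(e, c) \<in> halves E (Some w)" and eS: "(e, c) \<notin> S" by auto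
  have eC: "e \<notin> C" using eS ew C3 by blast
  obtain u where u: "(e, \<not> c) \<in> halves E u" using dom_halves[OF halves_dom[OF ew], of "\<not> c"] by blast
  have uw: "u \<noteq> Some w"
  proof
    assume "u = Some w"
    moreover have "(e, \<not> c) \<notin> S" using eC C3 by blast
    ultimately have "(e, \<not> c) \<in> halves E (Some w) - S" using u by simp
    then show False unfolding ec by simp
  qed
  have no_u: "(g, d) \<notin> halves E u" if "g \<in> C" for g d
    using sepD[OF s that, of d u e "\<not> c"] u uw w eC by auto
  have at_w: "h \<in> C \<or> h = e" if "(h, d) \<in> halves E (Some w)" for h d
  proof (cases "(h, d) \<in> S")
    case True then show ?thesis using C3 by blast
  next
    case False then show ?thesis using that ec by blast
  qed
  \<comment> \<open>Adding the edge \<open>e\<close> turns the component at \<open>w\<close> into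
    one at the far end \<open>u\<close>, attached by \<open>e\<close> alone.\<close>
  have at: "atom E u (insert e C)"
    unfolding atom_def
  proof (intro conjI allI impI)
    show "sep E u (insert e C)"
    proof (rule sepI)
      show "insert e C \<subseteq> dom E" using sep_subset[OF s] halves_dom[OF ew] by auto
    next
      fix w' g b h d assume g: "g \<in> insert e C" "(g, b) \<in> halves E w'" "(h, d) \<in> halves E w'" "w' \<noteq> u"
      show "h \<in> insert e C"
      proof (cases "w' = Some w")
        case True then show ?thesis using at_w g by auto
      next
        case False
        have "g \<noteq> e"
        proof
          assume ge: "g = e"
          have "w' = Some w" if "b = c" using halves_unique[OF g(2)] ew ge that by simp
          moreover have "w' = u" if "b = (\<not> c)" using halves_unique[OF g(2)] u ge that by simp
          ultimately show False using False g(4) by blast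
        qed
        then show ?thesis using sepD[OF s _ g(2,3)] g(1) False w by auto
      qed
    qed
    show "insert e C \<noteq> {}" by simp
  next
    fix C2 assume C2: "sep E u C2" "C2 \<subseteq> insert e C"
    have iff: "e \<in> C2 \<longleftrightarrow> g1 \<in> C2"
      using sepD[OF C2(1) _ ew g1'(2)] sepD[OF C2(1) _ g1'(2) ew] uw by auto
    have "sep E (Some w) (C2 - {e})"
    proof (rule sepI)
      show "C2 - {e} \<subseteq> dom E" using sep_subset[OF C2(1)] by auto
    next
      fix w' g b h d assume g: "g \<in> C2 - {e}" "(g, b) \<in> halves E w'" "(h, d) \<in> halves E w'" "w' \<noteq> Some w"
      then have gC: "g \<in> C" using C2(2) by auto
      have "h \<in> C" using sepD[OF s gC g(2,3)] w g(4) by simp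
      moreover have "w' \<noteq> u" using no_u[OF gC] g(2) by auto
      then have "h \<in> C2" using sepD[OF C2(1) _ g(2,3)] g(1) by simp
      ultimately show "h \<in> C2 - {e}" using eC by auto
    qed
    then have "C2 - {e} = {} \<or> C2 - {e} = C" using C(1) C2(2) w unfolding atom_def by auto
    then show "C2 = {} \<or> C2 = insert e C" using iff g1'(1) eC C2(2) by blast
  qed
  have sf: "starfree E u (insert e C)"
  proof (cases "u = None")
    case False
    have "(e, d) \<notin> halves E None" for d
    proof
      assume d: "(e, d) \<in> halves E None"
      have "d \<noteq> c" using halves_unique[OF d] ew by blast
      moreover have "d \<noteq> (\<not> c)" using halves_unique[OF d] u False by blast
      ultimately show False by blast
    qed
    then show ?thesis unfolding starfree_def using N by auto
  qed (simp add: starfree_def)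
  have hp: "half_part E u (insert e C) = {(e, \<not> c)}"
  proof (rule set_eqI)
    fix h :: "nat \<times> bool"
    obtain g and d :: bool where h: "h = (g, d)" by force
    have "(e, c) \<notin> halves E u" using ew uw halves_unique by blast
    then have "(e, d) \<in> halves E u \<longleftrightarrow> d = (\<not> c)" using u by (cases "d = c") auto
    then show "h \<in> half_part E u (insert e C) \<longleftrightarrow> h \<in> {(e, \<not> c)}"
      unfolding h in_half_part using no_u[of g d] by auto
  qed
  have br: "{(e, \<not> c)} \<in> Sall E"
    unfolding Sall_def using at sf hp by (metis (mono_tags, lifting) insert_not_empty mem_Collect_eq)
  interpret bridge E e c w u
    by unfold_locales (use ew u uw val br in auto)
  \<comment> \<open>If \<open>e\<close> ends at the star, it is the only edge there; contracting it
    leaves exactly \<open>C\<close>, which is connected because it is an atom.\<close>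
  have "valid (contr E e c)"
  proof (cases "u = None")
    case False then show ?thesis by (rule valid_contr_internal)
  next
    case True
    have "sep E None (insert e C)" using atom_sep[OF at] True by simp
    then have "insert e C = dom E" using prime_validD[OF val] by blast
    then have CE: "C = dom (contr E e c)" using dom_contr eC by auto
    have "atom (contr E e c) u C" using atom_contr_end[OF C(1) _ eC] w by simp
    then show ?thesis unfolding valid_contr_iff_prime using True CE unfolding atom_def
      using sep_subset by metis
  qed
  then show thesis using that[of e c w u] w ec bridge_axioms by blast
qed

text \<open>By \<open>red_contr\<close> the base of \<open>S\<close> must be an end of the
  contracted bridge. It has a single half-edge besides \<open>S\<close>, so this bridge is
  \<open>e0\<close>, and \<open>far_not_Sall\<close> excludes the opposite orientation.\<close>

lemma (in bridge) suspended_unique: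
  assumes S: "S \<in> S2 E" "S \<notin> red E" "S \<in> red (contr E e b)"
    and w: "bridge E e0 c w u0" "base E S = Some w" "halves E (Some w) - S = {(e0, c)}"
  shows "e = e0 \<and> b = c \<and> y = w \<and> u = u0"
proof -
  interpret w: bridge E e0 c w u0 by fact
  have "u = Some w \<or> y = w" using red_contr[OF S(1)] S w(2) by auto
  then have "y = w"
  proof
    assume u: "u = Some w"
    then have "(e, \<not> b) \<in> halves E (Some w) - S" using eu e_notin_S2[OF S(1)] by simp
    then have "(e, \<not> b) = (e0, c)" unfolding w(3) by simp
    then have "e0 = e" "(\<not> c) = b" by auto
    then show ?thesis using w.br far_not_Sall by simp
  qed
  then have "(e, b) \<in> halves E (Some w) - S" using ey e_notin_S2[OF S(1)] by simp
  then have eb: "(e, b) = (e0, c)" unfolding w(3) by simp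
  then have "u = u0" using eu w.eu halves_unique[of "(e, \<not> b)" E u u0] by simp
  then show ?thesis using \<open>y = w\<close> eb by simp
qed

text \<open>Take a component without hairs that has the fewest edges over all cut vertices. Were it
  attached by one half-edge, crossing this bridge would give a smaller one at the far end.\<close>

lemma S2_nonempty_ex:
  assumes val: "valid E" shows "S2 E \<noteq> {}"
proof -
  define P where "P = (\<lambda>(x, C). atom E x C \<and> starfree E x C \<and> half_part E x C \<noteq> {})"
  obtain g0 c0 where g0: "(g0, c0) \<in> halves E None" using valid_None[OF val] by (metis all_not_in_conv surj_pair)
  \<comment> \<open>The whole graph, cut at the star, is a first candidate for the minimum.\<close>
  have "atom E None (dom E)"
    unfolding atom_def using valid_prime[OF val] halves_dom[OF g0] by auto
  moreover have "half_part E None (dom E) \<noteq> {}" using g0 halves_dom[OF g0] unfolding half_part_def by force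
  ultimately have "P (None, dom E)" unfolding P_def by (simp add: starfree_def)
  then obtain xC where xC: "P xC" "\<And>xC'. P xC' \<Longrightarrow> card (snd xC) \<le> card (snd xC')"
    using ex_has_least_nat[of P _ "\<lambda>xC. card (snd xC)"] by blast
  obtain x C where xC': "xC = (x, C)" by force
  have C: "atom E x C" "starfree E x C" "half_part E x C \<noteq> {}" using xC(1) unfolding xC' P_def by auto
  have S: "half_part E x C \<in> Sall E" using C unfolding Sall_def by blast
  note s = atom_sep[OF C(1)]
  have finC: "finite C" using sep_subset[OF s] valid_finite[OF val] finite_subset by blast
  have "\<not> card (half_part E x C) < 2"
  proof
    assume "card (half_part E x C) < 2"
    moreover have "finite (half_part E x C)"
      by (rule finite_subset[OF _ finite_halves[OF valid_finite[OF val], of x]]) (auto simp: half_part_def)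
    ultimately have "card (half_part E x C) = 1" using C(3) by (simp add: Suc_leI card_gt_0_iff order_antisym)
    then obtain h where "half_part E x C = {h}" by (auto simp: card_1_singleton_iff)
    moreover obtain g and c :: bool where "h = (g, c)" by force
    ultimately have gc: "half_part E x C = {(g, c)}" by simp
    then have br: "{(g, c)} \<in> Sall E" using S by simp
    obtain y u where "bridge E g (\<not> c) y u" using Sall_bridgeE[OF val br] .
    then interpret bridge E g "\<not> c" y u .
    have gC: "g \<in> C" and gx: "(g, c) \<in> halves E x" using gc by (auto simp: in_half_part set_eq_iff)
    then have xu: "x = u" using eu halves_unique by auto
    obtain g' d where g': "(g', d) \<in> halves E (Some y)" "g' \<noteq> g" using other_half by blast
    obtain C1 where C1: "atom E (Some y) C1" "g' \<in> C1" using ex_atom[OF halves_dom[OF g'(1)]] by blast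
    \<comment> \<open>In \<open>C\<close> only the bridge \<open>g\<close> touches \<open>x\<close>,
      so without it the set is closed away from \<open>y\<close>.\<close>
    have "sep E (Some y) (C - {g})"
    proof (rule sepI)
      show "C - {g} \<subseteq> dom E" using sep_subset[OF s] by auto
    next
      fix w a b h d'
      assume a: "a \<in> C - {g}" "(a, b) \<in> halves E w" "(h, d') \<in> halves E w" "w \<noteq> Some y"
      have "w \<noteq> x"
      proof
        assume "w = x"
        then have "(a, b) \<in> half_part E x C" using a by (simp add: in_half_part)
        then show False using gc a by auto
      qed
      then have "h \<in> C" using sepD[OF s _ a(2,3)] a(1) by auto
      moreover have "h \<noteq> g" using a(3,4) \<open>w \<noteq> x\<close> xu e_halves[of d' w] by auto
      ultimately show "h \<in> C - {g}" by simp
    qed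
    moreover have "g' \<in> C - {g}"
      using sepD[OF s gC ey g'(1)] xu noloop g'(2) by auto
    ultimately have sub: "C1 \<subseteq> C - {g}" using atom_in[OF C1(1)] C1(2) by blast
    have "h \<notin> C - {g}" if h: "(h, d') \<in> halves E None" for h d'
    proof (cases "x = None")
      case True
      show ?thesis
      proof
        assume hC: "h \<in> C - {g}"
        then have "(h, d') \<in> half_part E x C" using h True by (simp add: in_half_part)
        then show False using gc hC by auto
      qed
    next
      case False
      then show ?thesis using C(2) h by (auto simp: starfree_def)
    qed
    then have "starfree E (Some y) C1" using sub unfolding starfree_def by blast
    moreover have "(g', d) \<in> half_part E (Some y) C1" using g' C1 by (simp add: in_half_part)
    ultimately have "P (Some y, C1)" using C1(1) unfolding P_def by auto
    then have "card C \<le> card C1" using xC(2)[of "(Some y, C1)"] unfolding xC' by simp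
    moreover have "card C1 < card C"
    proof (rule psubset_card_mono[OF finC])
      show "C1 \<subset> C" using sub gC by blast
    qed
    ultimately show False by simp
  qed
  then show ?thesis using S unfolding S2_def by (metis (mono_tags, lifting) empty_iff mem_Collect_eq not_less)
qed

text \<open>\<open>expd\<close> always directs the new edge towards the new vertex, hence the
  reversal if \<open>e\<close> was directed away from \<open>y\<close>.\<close>

lemma (in contraction) expd_contr_full:
  "expd (contr E e b) u (halves E (Some y) - {(e, b)}) y e = (if b then E else act id id {e} E)"
proof -
  let ?S = "halves E (Some y) - {(e, b)}"
  have *: "expd (contr E e b) u ?S y e g = (if g = e then Some (\<lambda>b. if b then Some y else u) else E g)" for g
  proof (cases "g = e \<or> E g = None")
    case False
    then obtain q where q: "E g = Some q" "g \<noteq> e" by auto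
    have "(g, c) \<in> ?S \<longleftrightarrow> q c = Some y" for c
    proof -
      show ?thesis using q by (simp add: in_halves)
    qed
    then show ?thesis using q by (auto simp: expd_def contr_apply)
  qed (auto simp: expd_def contr_apply)
  obtain p where p: "E e = Some p" using e_dom by auto
  have pe: "p b = Some y" "p (\<not> b) = u" using ey eu p by (auto simp: in_halves)
  show ?thesis
  proof (cases b)
    case True
    then show ?thesis using * pe p by (auto simp: fun_eq_iff)
  next
    case False
    have "expd (contr E e b) u ?S y e = act id id {e} E"
    proof (rule act_eqI)
      show "dom (expd (contr E e b) u ?S y e) = id ` dom E" using * e_dom by (auto simp: dom_def)
    next
      fix g q assume "E g = Some q"
      then show "expd (contr E e b) u ?S y e (id g) = Some (\<lambda>b. map_option id (q (b \<noteq> (g \<in> {e}))))"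
        using * pe p False by (auto simp: fun_eq_iff option.map_id)
    qed simp
    then show ?thesis using False by simp
  qed
qed

lemma expansion_S2:
  assumes "S \<in> S2 E" "y \<notin> nodes E" "f \<notin> dom E"
  shows "expansion E (base E S) S y f"
  using assms S2_nonempty[OF assms(1)] Sall_sub[OF S2_Sall[OF assms(1)]] by unfold_locales auto

lemma bridge_expd:
  assumes val: "valid E" and S: "S \<in> red E" and y: "y \<notin> nodes E" and f: "f \<notin> dom E"
  shows "bridge (expd E (base E S) S y f) f True y (base E S)"
proof -
  have S': "S \<in> S2 E" using S by (rule red_S2)
  interpret expansion E "base E S" S y f using expansion_S2[OF S' y f] .
  obtain C where C: "atom E (base E S) C" "starfree E (base E S) C" "S = half_part E (base E S) C"
    using Sall_base[OF S2_Sall[OF S']] .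
  have "valid (expd E (base E S) S y f)"
    by (rule valid_expd[OF val]) (use S in \<open>auto simp: red_def S2_def\<close>)
  then show ?thesis using Sall_f[OF C] by unfold_locales auto
qed

text \<open>Contracting the new bridge gives back \<open>E\<close>, so the statements about
  contracted bridges can be read backwards.\<close>

lemma
  assumes "valid E" "S \<in> red E" "y \<notin> nodes E" "f \<notin> dom E"
  shows S2_expd: "S2 (expd E (base E S) S y f) = S2 E"
    and Br_expd: "Br (expd E (base E S) S y f) = insert f (Br E)"
    and f_notin_Br: "f \<notin> Br E"
proof -
  interpret expansion E "base E S" S y f using expansion_S2[OF red_S2] assms by blast
  interpret b: bridge "expd E (base E S) S y f" f True y "base E S" using bridge_expd assms by blast
  show "S2 (expd E (base E S) S y f) = S2 E" using b.S2_contr unfolding contr_expd by simp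
  have "f \<in> Br (expd E (base E S) S y f)" using b.br by (auto simp: Br_def)
  then show "Br (expd E (base E S) S y f) = insert f (Br E)" using b.Br_contr unfolding contr_expd by blast
  show "f \<notin> Br E" using b.Br_contr unfolding contr_expd by blast
qed

context bridge begin

lemma contraction_expd:
  assumes S: "S \<in> S2 E" and z: "z \<notin> nodes E" and f: "f \<notin> dom E"
  shows "contraction (expd E (base E S) S z f) e b y u"
proof -
  have ef: "e \<noteq> f" using e_dom f by blast
  note eyu = ey eu noloop
  interpret expansion E "base E S" S z f using expansion_S2[OF S z f] .
  show ?thesis using e_notin_S2[OF S] eyu ef by unfold_locales (auto simp: halves_expd)
qed

text \<open>No half-edge of the bridge lies in \<open>S\<close>, so moving \<open>S\<close> away and
  merging the ends of \<open>e\<close> do not interfere; only the base of \<open>S\<close> may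
  change, as in \<open>base_contr\<close>.\<close>

lemma contr_expd_commute:
  assumes S: "S \<in> S2 E" and z: "z \<notin> nodes E" and f: "f \<notin> dom E"
  shows "contr (expd E (base E S) S z f) e b = expd (contr E e b) (base (contr E e b) S) S z f"
proof
  fix g
  interpret c: contraction "expd E (base E S) S z f" e b y u using contraction_expd[OF assms] .
  have zy: "z \<noteq> y" using z ey by (auto simp: nodes_halves)
  have ef: "e \<noteq> f" using f e_dom by auto
  show "contr (expd E (base E S) S z f) e b g = expd (contr E e b) (base (contr E e b) S) S z f g"
    unfolding c.contr_apply base_contr[OF S]
    by (cases "E g"; cases "g = f") (use zy ef in \<open>auto simp: expd_def contr_apply fun_eq_iff\<close>)
qed

text \<open>If \<open>S\<close> hangs from an internal vertex, contracting the new bridge would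
  carry validity back to the contraction of \<open>E\<close>. If it hangs from the star,
  connectedness makes the suspended component everything, so the contraction was connected
  already.\<close>

lemma invalid_expd:
  assumes S: "S \<in> S2 E" and z: "z \<notin> nodes E" and f: "f \<notin> dom E" and inv: "\<not> valid (contr E e b)"
  shows "\<not> valid (contr (expd E (base E S) S z f) e b)"
proof
  let ?G = "contr E e b" and ?x = "base (contr E e b) S"
  assume "valid (contr (expd E (base E S) S z f) e b)"
  then have val': "valid (expd ?G ?x S z f)" using contr_expd_commute[OF S z f] by simp
  have S': "S \<in> S2 ?G" using S S2_contr by simp
  have zf: "z \<notin> nodes ?G" "f \<notin> dom ?G" using z f by (auto simp: nodes_contr dom_contr)
  interpret X: expansion ?G ?x S z f using expansion_S2[OF S' zf] .
  interpret X: valid_contraction "expd ?G ?x S z f" f True z ?x by unfold_locales (rule val')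
  show False
  proof (cases "?x = None")
    case False
    then show False using X.valid_contr_internal X.contr_expd inv by simp
  next
    case True
    obtain C where C: "atom ?G ?x C" "starfree ?G ?x C" "S = half_part ?G ?x C"
      using Sall_base[OF S2_Sall[OF S']] .
    have "atom (expd ?G ?x S z f) ?x (insert f C)" using X.atom_expd[OF C] .
    then have "insert f C = dom (expd ?G ?x S z f)"
      using prime_validD[OF val'] atom_sep True by (metis insertI1)
    then have "C = dom ?G" using X.dom_expd zf(2) sep_subset[OF atom_sep[OF C(1)]] by auto
    then have "valid ?G" unfolding valid_contr_iff_prime using C(1) True sep_subset unfolding atom_def by metis
    then show False using inv by simp
  qed
qed

lemma expd_contr:
  assumes S: "S \<in> S2 E" and y: "base E S = Some y" "halves E (Some y) - S = {(e, b)}"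
  shows "expd (contr E e b) u S y e = (if b then E else act id id {e} E)"
proof -
  have "S \<subseteq> halves E (Some y)" using Sall_sub[OF S2_Sall[OF S]] y by simp
  then have "S = halves E (Some y) - {(e, b)}" using y(2) by blast
  then show ?thesis using expd_contr_full by simp
qed

end

section \<open>Invariance under isomorphisms\<close>

lemma halves_nodes: "(g, b) \<in> halves E (Some v) \<Longrightarrow> v \<in> nodes E"
  by (auto simp: nodes_halves)

definition half_map :: "(nat \<Rightarrow> nat) \<Rightarrow> nat set \<Rightarrow> nat \<times> bool \<Rightarrow> nat \<times> bool" where
  "half_map t F = (\<lambda>(g, b). (t g, b \<noteq> (g \<in> F)))"

locale relabelling =
  fixes E :: sgraph and s t :: "nat \<Rightarrow> nat" and F :: "nat set"
  assumes s: "inj_on s (nodes E)" and t: "inj_on t (dom E)"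
begin

abbreviation "E' \<equiv> act s t F E"

lemma t_mem: "C \<subseteq> dom E \<Longrightarrow> g \<in> dom E \<Longrightarrow> t g \<in> t ` C \<longleftrightarrow> g \<in> C"
  by (rule inj_on_image_mem_iff[OF t])

lemma act_halves: "(g, b) \<in> halves E w \<Longrightarrow> (t g, b \<noteq> (g \<in> F)) \<in> halves E' (map_option s w)"
proof -
  assume "(g, b) \<in> halves E w"
  then obtain p where p: "E g = Some p" "p b = w" by (auto simp: in_halves)
  have "((b \<noteq> c) \<noteq> c) = b" for c by auto
  then show ?thesis using act_apply[OF t p(1), of s F] p(2) by (simp add: in_halves)
qed

lemma act_halvesE:
  assumes "(g', b') \<in> halves E' w'"
  obtains g b w where "(g, b) \<in> halves E w" "g' = t g" "b' = (b \<noteq> (g \<in> F))" "w' = map_option s w"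
proof -
  obtain q where q: "E' g' = Some q" "q b' = w'" using assms by (auto simp: in_halves)
  then obtain g p where g: "E g = Some p" "g' = t g" "q = (\<lambda>b. map_option s (p (b \<noteq> (g \<in> F))))"
    using t by (elim act_SomeE)
  have "(g, b' \<noteq> (g \<in> F)) \<in> halves E (p (b' \<noteq> (g \<in> F)))" using g by (simp add: in_halves)
  then show thesis by (rule that) (use g q in auto)
qed

lemma attached_inj:
  assumes "(g, b) \<in> halves E w" "(h, c) \<in> halves E w'" "map_option s w = map_option s w'"
  shows "w = w'"
  using assms s halves_nodes by (cases w; cases w') (auto dest: inj_onD)

lemma inj_half_map: "inj_on (half_map t F) {h. fst h \<in> dom E}"
  using t by (auto simp: half_map_def inj_on_def)

lemma sep_act: assumes "sep E x C" shows "sep E' (map_option s x) (t ` C)"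
proof (rule sepI)
  show "t ` C \<subseteq> dom E'" using sep_subset[OF assms] by (auto simp: dom_act)
next
  fix w g' b' h' c'
  assume g': "g' \<in> t ` C" "(g', b') \<in> halves E' w" "(h', c') \<in> halves E' w" "w \<noteq> map_option s x"
  obtain g b w1 where g: "(g, b) \<in> halves E w1" "g' = t g" "w = map_option s w1" using g'(2) by (elim act_halvesE)
  obtain h c w2 where h: "(h, c) \<in> halves E w2" "h' = t h" "w = map_option s w2" using g'(3) by (elim act_halvesE)
  have "w1 = w2" using attached_inj g(1,3) h(1,3) by metis
  moreover have "g \<in> C" using g'(1) t_mem[OF sep_subset[OF assms] halves_dom[OF g(1)]] unfolding g(2) by blast
  ultimately have "h \<in> C" using sepD[OF assms _ g(1)] h(1) g(3) g'(4) by auto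
  then show "h' \<in> t ` C" using h(2) by simp
qed

definition "s' = inv_into (nodes E) s"
definition "t' = inv_into (dom E) t"
definition "F' = t ` (F \<inter> dom E)"

lemma inverse: "act s' t' F' E' = E"
  unfolding s'_def t'_def F'_def by (rule ex_act_inverse[OF s t])

text \<open>Applying a one-sided statement also to the inverse gives the equalities and equivalences
  below.\<close>

lemma inverse_relabelling: "relabelling E' s' t'"
  by unfold_locales (use s t in \<open>auto simp: nodes_act dom_act s'_def t'_def inj_on_inv_into\<close>)

lemma t'_t: "g \<in> dom E \<Longrightarrow> t' (t g) = g"
  unfolding t'_def using t by simp

lemma s'_s: "v \<in> nodes E \<Longrightarrow> s' (s v) = v"
  unfolding s'_def using s by simp

lemma sep_act_rev:
  assumes C: "sep E' (map_option s x) C'" and x: "x = None \<or> (\<exists>v\<in>nodes E. x = Some v)"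
  obtains C where "sep E x C" "C' = t ` C"
proof -
  interpret r: relabelling E' s' t' F' by (rule inverse_relabelling)
  have "map_option s' (map_option s x) = x" using x by (auto simp: s'_s)
  then have "sep E x (t' ` C')" using r.sep_act[OF C] inverse by simp
  moreover have "C' = t ` t' ` C'"
  proof -
    have "C' \<subseteq> t ` dom E" using sep_subset[OF C] by (simp add: dom_act)
    then have "t (t' g) = g" if "g \<in> C'" for g using that t'_def f_inv_into_f[of g t "dom E"] by auto
    then show ?thesis by (auto simp: image_iff)
  qed
  ultimately show thesis using that by blast
qed

lemma atom_act:
  assumes C: "atom E x C" and x: "x = None \<or> (\<exists>v\<in>nodes E. x = Some v)"
  shows "atom E' (map_option s x) (t ` C)"
  unfolding atom_def
proof (intro conjI allI impI)
  show "sep E' (map_option s x) (t ` C)" using atom_sep[OF C] by (rule sep_act)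
  show "t ` C \<noteq> {}" using C by (auto simp: atom_def)
  fix C' assume C': "sep E' (map_option s x) C'" "C' \<subseteq> t ` C"
  then obtain C1 where C1: "sep E x C1" "C' = t ` C1" using x by (elim sep_act_rev)
  have "C1 \<subseteq> C"
  proof
    fix g assume g: "g \<in> C1"
    then have "t g \<in> t ` C" using C1 C' by blast
    then obtain h where "h \<in> C" "t g = t h" by auto
    moreover have "g \<in> dom E" "h \<in> dom E"
      using g \<open>h \<in> C\<close> sep_subset[OF C1(1)] sep_subset[OF atom_sep[OF C]] by auto
    ultimately show "g \<in> C" using t by (auto dest: inj_onD)
  qed
  then have "C1 = {} \<or> C1 = C" using C C1(1) unfolding atom_def by blast
  then show "C' = {} \<or> C' = t ` C" using C1(2) by auto
qed

lemma half_part_act: 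
  assumes C: "C \<subseteq> dom E" and g0: "(g0, b0) \<in> halves E x"
  shows "half_part E' (map_option s x) (t ` C) = half_map t F ` half_part E x C"
proof (intro equalityI subsetI)
  fix h assume "h \<in> half_part E' (map_option s x) (t ` C)"
  then obtain g' b' where h: "h = (g', b')" "g' \<in> t ` C" "(g', b') \<in> halves E' (map_option s x)"
    by (cases h) (auto simp: in_half_part)
  then obtain g b w where g: "(g, b) \<in> halves E w" "g' = t g" "b' = (b \<noteq> (g \<in> F))" "map_option s x = map_option s w"
    by (elim act_halvesE)
  have "w = x" using attached_inj[OF g(1) g0] g(4) by simp
  moreover have "g \<in> C" using h(2) t_mem[OF C halves_dom[OF g(1)]] unfolding g(2) by blast
  ultimately have "(g, b) \<in> half_part E x C" using g(1) by (simp add: in_half_part)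
  then show "h \<in> half_map t F ` half_part E x C" using h g by (force simp: half_map_def)
next
  fix h assume "h \<in> half_map t F ` half_part E x C"
  then obtain g b where "(g, b) \<in> half_part E x C" "h = (t g, b \<noteq> (g \<in> F))" by (auto simp: half_map_def)
  then show "h \<in> half_part E' (map_option s x) (t ` C)"
    using act_halves[of g b x] by (simp add: in_half_part)
qed

lemma Sall_act_sub:
  assumes S: "S \<in> Sall E" shows "half_map t F ` S \<in> Sall E'"
proof -
  obtain x C where C: "atom E x C" "starfree E x C" "S = half_part E x C" "S \<noteq> {}" using S by (rule SallE)
  then obtain g0 b0 where g0: "(g0, b0) \<in> half_part E x C" by (metis all_not_in_conv surj_pair)
  then have g0': "(g0, b0) \<in> halves E x" by (simp add: in_half_part)
  then have x: "x = None \<or> (\<exists>v\<in>nodes E. x = Some v)" by (cases x) (auto simp: nodes_halves)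
  have sub: "C \<subseteq> dom E" using sep_subset[OF atom_sep[OF C(1)]] .
  have "starfree E' (map_option s x) (t ` C)"
  proof (cases "x = None")
    case False
    have "g' \<notin> t ` C" if gN: "(g', b') \<in> halves E' None" for g' b'
    proof
      assume g': "g' \<in> t ` C"
      obtain g b w where g: "(g, b) \<in> halves E w" "g' = t g" "None = map_option s w"
        using gN by (rule act_halvesE)
      have "g \<in> C" using g' t_mem[OF sub halves_dom[OF g(1)]] unfolding g(2) by blast
      then show False using C(2) False g(1,3) unfolding starfree_def by auto
    qed
    then show ?thesis unfolding starfree_def by blast
  qed (simp add: starfree_def)
  moreover have "half_map t F ` S = half_part E' (map_option s x) (t ` C)"
    using half_part_act[OF sub g0'] C(3) by simp
  moreover have "half_map t F ` S \<noteq> {}" using C(4) by simp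
  ultimately show ?thesis using atom_act[OF C(1) x] unfolding Sall_def by blast
qed

lemma Sall_sub_dom: "S \<in> Sall E \<Longrightarrow> S \<subseteq> {h. fst h \<in> dom E}"
  using Sall_sub[of S E] halves_dom by fastforce

end

lemma (in relabelling) Sall_act: "Sall E' = (`) (half_map t F) ` Sall E"
proof (intro equalityI subsetI)
  interpret r: relabelling E' s' t' F' by (rule inverse_relabelling)
  fix S' assume S': "S' \<in> Sall E'"
  have S: "half_map t' F' ` S' \<in> Sall E" using r.Sall_act_sub[OF S'] by (simp add: inverse)
  have "half_map t F ` half_map t' F' ` S' = S'"
  proof -
    have "half_map t F (half_map t' F' h) = h" if "h \<in> S'" for h
    proof -
      obtain g' and b :: bool where gb: "h = (g', b)" by force
      have "g' \<in> t ` dom E" using r.Sall_sub_dom[OF S'] that gb unfolding dom_act by force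
      then obtain g where g: "g \<in> dom E" "g' = t g" by blast
      have "t g \<in> F' \<longleftrightarrow> g \<in> F" using g t unfolding F'_def by (auto dest: inj_onD)
      then show ?thesis using gb g by (auto simp: half_map_def t'_t)
    qed
    then show ?thesis by (simp add: image_image)
  qed
  then show "S' \<in> (`) (half_map t F) ` Sall E" using S by (metis image_eqI)
qed (auto intro: Sall_act_sub)

context relabelling begin

lemma base_act: "S \<in> Sall E \<Longrightarrow> base E' (half_map t F ` S) = map_option s (base E S)"
proof (rule baseI)
  assume S: "S \<in> Sall E"
  show "half_map t F ` S \<subseteq> halves E' (map_option s (base E S))"
    using Sall_sub[OF S] act_halves by (auto simp: half_map_def)
  show "half_map t F ` S \<noteq> {}" using S by (auto simp: Sall_def)
qed

lemma card_half_map: "S \<subseteq> {h. fst h \<in> dom E} \<Longrightarrow> card (half_map t F ` S) = card S"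
  by (rule card_image, rule inj_on_subset[OF inj_half_map])

lemma S2_act: "S2 E' = (`) (half_map t F) ` S2 E"
  unfolding S2_def Sall_act using card_half_map[OF Sall_sub_dom] by fastforce

lemma halves_act_eq: "(g0, b0) \<in> halves E x \<Longrightarrow> halves E' (map_option s x) = half_map t F ` halves E x"
proof -
  assume "(g0, b0) \<in> halves E x"
  then have "x = None \<or> (\<exists>v\<in>nodes E. x = Some v)" by (cases x) (auto dest: halves_nodes)
  then show ?thesis unfolding half_map_def by (rule halves_act[OF s t])
qed

lemma red_act: "red E' = (`) (half_map t F) ` red E"
proof -
  have "half_map t F ` S \<in> red E' \<longleftrightarrow> S \<in> red E" if S: "S \<in> S2 E" for S
  proof -
    have S': "S \<in> Sall E" using S by (rule S2_Sall)
    obtain g b where g: "(g, b) \<in> S" using S2_nonempty[OF S] by (metis all_not_in_conv surj_pair)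
    then have gb: "(g, b) \<in> halves E (base E S)" using Sall_sub[OF S'] by blast
    have sub: "halves E (base E S) \<subseteq> {h. fst h \<in> dom E}" by (auto dest: halves_dom)
    have "halves E' (base E' (half_map t F ` S)) - half_map t F ` S = half_map t F ` (halves E (base E S) - S)"
      unfolding base_act[OF S'] halves_act_eq[OF gb]
      by (rule inj_on_image_set_diff[OF inj_half_map, symmetric]) (use sub Sall_sub_dom[OF S'] in auto)
    moreover have "card (half_map t F ` (halves E (base E S) - S)) = card (halves E (base E S) - S)"
      by (rule card_half_map) (use sub in blast)
    moreover have "half_map t F ` S \<in> S2 E'" using S S2_act by blast
    ultimately show ?thesis using S by (simp add: red_def base_act[OF S'])
  qed
  moreover have "red E' \<subseteq> (`) (half_map t F) ` S2 E" using red_S2 S2_act by blast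
  moreover have "red E \<subseteq> S2 E" using red_S2 by blast
  ultimately show ?thesis
  proof (intro equalityI subsetI)
    fix S' assume *: "\<And>S. S \<in> S2 E \<Longrightarrow> (half_map t F ` S \<in> red E') = (S \<in> red E)"
      "red E' \<subseteq> (`) (half_map t F) ` S2 E" "S' \<in> red E'"
    then obtain S where "S \<in> S2 E" "S' = half_map t F ` S" by blast
    then show "S' \<in> (`) (half_map t F) ` red E" using * by blast
  qed blast
qed

lemma inj_image_half_map: "inj_on ((`) (half_map t F)) (Sall E)"
proof (rule inj_onI)
  fix S T assume *: "S \<in> Sall E" "T \<in> Sall E" "half_map t F ` S = half_map t F ` T"
  have "S \<subseteq> {h. fst h \<in> dom E}" "T \<subseteq> {h. fst h \<in> dom E}" using * Sall_sub_dom by auto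
  then show "S = T" using *(3) inj_on_image_eq_iff[OF inj_half_map] by blast
qed

lemma valid_act_imp: assumes val: "valid E" shows "valid E'"
  unfolding valid_def
proof (intro conjI ballI allI impI)
  show "finite (dom E')" using valid_finite[OF val] by (simp add: dom_act)
  fix v' assume "v' \<in> nodes E'"
  then obtain v where v: "v \<in> nodes E" "v' = s v" using nodes_act[OF t] by auto
  have "card (halves E' (map_option s (Some v))) = card (halves E (Some v))"
    by (rule card_halves_act[OF s t]) (use v in simp)
  then show "3 \<le> card (halves E' (Some v'))" using valid_card[OF val v(1)] v(2) by simp
next
  obtain g c where "(g, c) \<in> halves E None" using valid_None[OF val] by (metis all_not_in_conv surj_pair)
  then show "halves E' None \<noteq> {}" using act_halves by fastforce
next
  fix C assume "sep E' None C"
  then have "sep E' (map_option s None) C" by simp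
  then obtain C0 where "sep E None C0" "C = t ` C0" by (rule sep_act_rev) simp
  then show "C = {} \<or> C = dom E'" using valid_prime[OF val, of C0] by (auto simp: dom_act)
qed

end

lemma (in relabelling) valid_act: "valid E' \<longleftrightarrow> valid E"
proof
  interpret r: relabelling E' s' t' F' by (rule inverse_relabelling)
  show "valid E' \<Longrightarrow> valid E" using r.valid_act_imp by (simp add: inverse)
qed (rule valid_act_imp)

context relabelling begin

lemma Br_act: "Br E' = t ` Br E"
proof -
  have "{(e', b')} \<in> (`) (half_map t F) ` Sall E \<longleftrightarrow> (\<exists>e b. {(e, b)} \<in> Sall E \<and> e' = t e \<and> b' = (b \<noteq> (e \<in> F)))" for e' b'
  proof
    assume "{(e', b')} \<in> (`) (half_map t F) ` Sall E"
    then obtain S where S: "S \<in> Sall E" "half_map t F ` S = {(e', b')}" by force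
    have "card S = 1" using card_half_map[OF Sall_sub_dom[OF S(1)]] S(2) by simp
    then obtain h where h: "S = {h}" by (auto simp: card_1_singleton_iff)
    obtain e and b :: bool where eb: "h = (e, b)" by force
    show "\<exists>e b. {(e, b)} \<in> Sall E \<and> e' = t e \<and> b' = (b \<noteq> (e \<in> F))"
      using S unfolding h eb by (intro exI[of _ e] exI[of _ b]) (auto simp: half_map_def)
  next
    assume "\<exists>e b. {(e, b)} \<in> Sall E \<and> e' = t e \<and> b' = (b \<noteq> (e \<in> F))"
    then obtain e b where *: "{(e, b)} \<in> Sall E" "e' = t e" "b' = (b \<noteq> (e \<in> F))" by blast
    then have "{(e', b')} = half_map t F ` {(e, b)}" by (simp add: half_map_def)
    then show "{(e', b')} \<in> (`) (half_map t F) ` Sall E" using *(1) by blast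
  qed
  then show ?thesis unfolding Br_def Sall_act by auto
qed

lemma contraction_act:
  assumes "contraction E e b y u" shows "contraction E' (t e) (b \<noteq> (e \<in> F)) (s y) (map_option s u)"
proof -
  interpret contraction E e b y u by fact
  show ?thesis
  proof
    show "(t e, b \<noteq> (e \<in> F)) \<in> halves E' (Some (s y))" using act_halves[OF ey] by simp
    have "((\<not> b) \<noteq> (e \<in> F)) = (\<not> (b \<noteq> (e \<in> F)))" by auto
    then show "(t e, \<not> (b \<noteq> (e \<in> F))) \<in> halves E' (map_option s u)" using act_halves[OF eu] by simp
    show "map_option s u \<noteq> Some (s y)" using attached_inj[OF eu ey] noloop by auto
  qed
qed

lemma contr_act:
  assumes "contraction E e b y u"
  shows "contr E' (t e) (b \<noteq> (e \<in> F)) = act s t F (contr E e b)"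
proof (rule act_eqI)
  interpret contraction E e b y u by fact
  interpret c: contraction E' "t e" "b \<noteq> (e \<in> F)" "s y" "map_option s u" using contraction_act assms .
  show t2: "inj_on t (dom (contr E e b))" using t by (rule inj_on_subset) (auto simp: dom_contr)
  show "dom (contr E' (t e) (b \<noteq> (e \<in> F))) = t ` dom (contr E e b)"
    unfolding c.dom_contr dom_contr dom_act using t e_dom by (auto dest: inj_onD)
  fix g q assume q: "contr E e b g = Some q"
  then have ge: "g \<noteq> e" by (auto simp: contr_apply)
  then obtain p where p: "E g = Some p" "q = (\<lambda>c. if p c = Some y then u else p c)"
    using q by (auto simp: contr_apply)
  have "t g \<noteq> t e" using ge t p(1) e_dom by (auto dest: inj_onD)
  moreover have "map_option s (p c) = Some (s y) \<longleftrightarrow> p c = Some y" for c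
    using attached_inj[of g c "p c" e b "Some y"] ey p(1) by (auto simp: in_halves)
  ultimately show "contr E' (t e) (b \<noteq> (e \<in> F)) (t g) = Some (\<lambda>b. map_option s (q (b \<noteq> (g \<in> F))))"
    unfolding c.contr_apply using act_apply[OF t p(1), of s F] p(2) by (auto simp: fun_eq_iff)
qed

end

lemma valid_contr_act:
  assumes "valid_contraction E e b y u" "relabelling E s t"
  shows "relabelling (contr E e b) s t"
proof -
  interpret valid_contraction E e b y u by fact
  interpret relabelling E s t undefined by fact
  show ?thesis
    by unfold_locales (rule inj_on_subset[OF s], simp add: nodes_contr, rule inj_on_subset[OF t], simp add: dom_contr)
qed

text \<open>The new vertex and edge are named by freely chosen fresh labels on both sides, which
  will make \<open>xterm\<close> independent of names. \<open>f\<close> is removed from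
  \<open>F\<close> because both expansions direct it in the same way.\<close>

lemma expd_act:
  assumes "expansion E x S y f" "relabelling E s t" "y' \<notin> s ` nodes E" "f' \<notin> t ` dom E"
  shows "expd (act s t F E) (map_option s x) (half_map t F ` S) y' f' =
           act (s(y := y')) (t(f := f')) (F - {f}) (expd E x S y f)"
    and "expansion (act s t F E) (map_option s x) (half_map t F ` S) y' f'"
    and "relabelling (expd E x S y f) (s(y := y')) (t(f := f'))"
proof -
  interpret expansion E x S y f by fact
  interpret r: relabelling E s t F by fact
  have Sd: "S \<subseteq> {h. fst h \<in> dom E}" using Sx halves_dom by fastforce
  show rel: "relabelling (expd E x S y f) (s(y := y')) (t(f := f'))"
  proof
    show "inj_on (s(y := y')) (nodes (expd E x S y f))"
      unfolding nodes_expd using r.s y assms(3) by (auto simp: inj_on_def)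
    show "inj_on (t(f := f')) (dom (expd E x S y f))"
      unfolding dom_expd using r.t f assms(4) by (auto simp: inj_on_def)
  qed
  show exp: "expansion (act s t F E) (map_option s x) (half_map t F ` S) y' f'"
  proof
    show "half_map t F ` S \<subseteq> halves (act s t F E) (map_option s x)"
      using Sx r.act_halves by (auto simp: half_map_def)
  qed (use S0 assms(3,4) nodes_act[OF r.t] in \<open>auto simp: dom_act\<close>)
  show "expd (act s t F E) (map_option s x) (half_map t F ` S) y' f' =
           act (s(y := y')) (t(f := f')) (F - {f}) (expd E x S y f)"
  proof (rule act_eqI)
    show "inj_on (t(f := f')) (dom (expd E x S y f))" using rel by (simp add: relabelling_def)
    show "dom (expd (act s t F E) (map_option s x) (half_map t F ` S) y' f') = t(f := f') ` dom (expd E x S y f)"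
      unfolding expansion.dom_expd[OF exp] dom_expd using f by (auto simp: dom_act)
    fix g q assume q: "expd E x S y f g = Some q"
    show "expd (act s t F E) (map_option s x) (half_map t F ` S) y' f' ((t(f := f')) g) =
        Some (\<lambda>b. map_option (s(y := y')) (q (b \<noteq> (g \<in> F - {f}))))"
    proof (cases "g = f")
      case True
      then have "q = (\<lambda>b. if b then Some y else x)" using q by (simp add: expd_def)
      moreover have "map_option (s(y := y')) x = map_option s x" using xy by (cases x) auto
      ultimately show ?thesis using True by (auto simp: expd_def fun_eq_iff)
    next
      case False
      then obtain p where p: "E g = Some p" "q = (\<lambda>c. if (g, c) \<in> S then Some y else p c)"
        using q by (auto simp: expd_def)
      have tg: "t g \<noteq> f'" using assms(4) p(1) by auto
      have hm: "(t g, c) \<in> half_map t F ` S \<longleftrightarrow> (g, c \<noteq> (g \<in> F)) \<in> S" for c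
      proof
        assume "(t g, c) \<in> half_map t F ` S"
        then obtain g1 c1 where g1: "(g1, c1) \<in> S" "t g = t g1" "c = (c1 \<noteq> (g1 \<in> F))" by (auto simp: half_map_def)
        have "g1 \<in> dom E" using Sd g1(1) by auto
        then have "g = g1" using inj_onD[OF r.t g1(2)] p(1) by auto
        moreover have "(c \<noteq> (g1 \<in> F)) = c1" using g1(3) by auto
        ultimately show "(g, c \<noteq> (g \<in> F)) \<in> S" using g1(1) by simp
      next
        assume "(g, c \<noteq> (g \<in> F)) \<in> S"
        then show "(t g, c) \<in> half_map t F ` S"
          by (rule rev_image_eqI) (auto simp: half_map_def)
      qed
      have "map_option (s(y := y')) (p c) = map_option s (p c)" for c
        using y p(1) by (cases "p c") (auto simp: nodes_def)
      then show ?thesis using False tg p act_apply[OF r.t p(1), of s F] hm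
        by (auto simp: expd_def fun_eq_iff)
    qed
  qed
qed

section \<open>Signs and equivariant functions\<close>

lemma (in contraction) the_end: "the (E e) b = Some y" "the (E e) (\<not> b) = u"
  using ey eu by (auto simp: in_halves)

definition nl :: "sgraph \<Rightarrow> nat set" where
  "nl E = {e \<in> dom E. the (E e) True \<noteq> the (E e) False}"

definition ni :: "sgraph \<Rightarrow> nat set" where
  "ni E = {e \<in> nl E. the (E e) True \<noteq> None \<and> the (E e) False \<noteq> None}"

text \<open>The absorbed end has to be internal; for a non-loop edge at least one end is.\<close>

definition side :: "sgraph \<Rightarrow> nat \<Rightarrow> bool" where
  "side E e = (the (E e) True \<noteq> None)"

definition par :: "sgraph \<Rightarrow> nat \<Rightarrow> nat \<Rightarrow> bool" where
  "par E e f \<longleftrightarrow> range (the (E e)) = range (the (E f))"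

lemma nl_contraction:
  assumes "e \<in> nl E"
  shows "contraction E e (side E e) (the (the (E e) (side E e))) (the (E e) (\<not> side E e))"
proof -
  obtain p where p: "E e = Some p" "p True \<noteq> p False" using assms by (auto simp: nl_def)
  then show ?thesis
    by unfold_locales (cases "p True"; cases "p False"; auto simp: side_def in_halves)+
qed

lemma contraction_nl: "contraction E e b y u \<Longrightarrow> e \<in> nl E"
proof -
  assume "contraction E e b y u"
  then interpret contraction E e b y u .
  show ?thesis using e_dom the_end noloop by (cases b) (auto simp: nl_def)
qed

lemma finite_nl: "finite (dom E) \<Longrightarrow> finite (nl E)" "finite (dom E) \<Longrightarrow> finite (ni E)"
  by (auto simp: nl_def ni_def)

text \<open>\<open>ev\<close> stands for the sign of exchanging two internal vertices, (-1)^n, and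
  \<open>- ev\<close> for that of two edges. Only the square of \<open>ev\<close> is used, so both
  parities of n are treated at once.\<close>

locale hair_sign =
  fixes ev :: "'k::field_char_0"
  assumes ev2: "ev * ev = 1"
begin

lemma ee2: "(- ev) * (- ev) = 1"
  using ev2 by simp

lemma ev_sq: "ev ^ k * ev ^ k = 1" "(- ev) ^ k * (- ev) ^ k = 1"
  using ev2 by (simp_all add: power_mult_distrib[symmetric])

text \<open>The Koszul sign of a relabelling. No factor mixes vertices with edges because n (1 - n)
  is even, and hairs, of degree 0, do not occur.\<close>

definition asg :: "(nat \<Rightarrow> nat) \<Rightarrow> (nat \<Rightarrow> nat) \<Rightarrow> nat set \<Rightarrow> sgraph \<Rightarrow> 'k" where
  "asg s t F E = inv_sign ev s (nodes E) * inv_sign (- ev) t (dom E) * ev ^ card (F \<inter> dom E)"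

text \<open>The sign of moving the vertex \<open>y\<close> to be absorbed and then the edge \<open>e\<close> to the beginning of the
  orderings, with \<open>e\<close> directed towards \<open>y\<close>; vertices have parity \<open>n\<close> and edges \<open>1 - n\<close>.\<close>

definition csg :: "sgraph \<Rightarrow> nat \<Rightarrow> bool \<Rightarrow> 'k" where
  "csg E e b = ev ^ card {v \<in> nodes E. v < the (the (E e) b)} * (- ev) ^ card {g \<in> dom E. g < e} *
     (if b then 1 else ev)"

definition equi :: "(sgraph \<Rightarrow> 'k) \<Rightarrow> bool" where
  "equi \<phi> \<longleftrightarrow> (\<forall>E. \<not> valid E \<longrightarrow> \<phi> E = 0) \<and>
     (\<forall>E s t F. valid E \<longrightarrow> inj_on s (nodes E) \<longrightarrow> inj_on t (dom E) \<longrightarrow> \<phi> (act s t F E) = asg s t F E * \<phi> E)"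

definition cterm :: "(sgraph \<Rightarrow> 'k) \<Rightarrow> sgraph \<Rightarrow> nat \<Rightarrow> bool \<Rightarrow> 'k" where
  "cterm \<phi> E e b = csg E e b * \<phi> (contr E e b)"

definition Dsel :: "(sgraph \<Rightarrow> nat set) \<Rightarrow> (sgraph \<Rightarrow> 'k) \<Rightarrow> sgraph \<Rightarrow> 'k" where
  "Dsel Q \<phi> E = (if valid E then \<Sum>e\<in>Q E. cterm \<phi> E e (side E e) else 0)"

lemma equi_act:
  assumes "equi \<phi>" "relabelling E s t" shows "\<phi> (act s t F E) = asg s t F E * \<phi> E"
proof -
  interpret relabelling E s t F by fact
  show ?thesis using assms(1) s t valid_act unfolding equi_def by (cases "valid E") auto
qed

lemma asg_sq: "asg s t F E * asg s t F E = 1"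
proof -
  have sq: "inv_sign q s A * inv_sign q s A = 1" if "q * q = 1" for q :: 'k and s A
    unfolding inv_sign_def prod.distrib[symmetric] using that by (intro prod.neutral) auto
  have "asg s t F E * asg s t F E = (inv_sign ev s (nodes E) * inv_sign ev s (nodes E)) *
     (inv_sign (- ev) t (dom E) * inv_sign (- ev) t (dom E)) * (ev ^ card (F \<inter> dom E) * ev ^ card (F \<inter> dom E))"
    by (simp add: asg_def mult_ac)
  then show ?thesis using sq[OF ev2] sq[OF ee2] ev_sq by simp
qed

lemma power_card_diff:
  assumes "finite D"
  shows "ev ^ card {g \<in> D. P g \<noteq> Q g} = ev ^ card {g \<in> D. P g} * ev ^ card {g \<in> D. Q g}"
proof -
  have "ev ^ card {g \<in> D. R g} = (\<Prod>g\<in>D. if R g then ev else 1)" for R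
    using assms by (simp add: prod.If_cases Int_def)
  then show ?thesis using ev2 by (simp add: prod.distrib[symmetric]) (rule prod.cong; auto)
qed

lemma asg_comp:
  assumes fin: "finite (dom E)" and r: "relabelling E s t" and r': "relabelling (act s t F E) s' t'"
  shows "asg (s' \<circ> s) (t' \<circ> t) {g \<in> dom E. (g \<in> F) \<noteq> (t g \<in> F')} E =
     asg s' t' F' (act s t F E) * asg s t F E"
proof -
  interpret relabelling E s t F by fact
  interpret r': relabelling "act s t F E" s' t' F' by fact
  have "{g \<in> dom E. (g \<in> F) \<noteq> (t g \<in> F')} \<inter> dom E = {g \<in> dom E. (g \<in> F) \<noteq> (t g \<in> F')}" by auto
  moreover have "card {g \<in> dom E. t g \<in> F'} = card (F' \<inter> t ` dom E)"
  proof -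
    have "F' \<inter> t ` dom E = t ` {g \<in> dom E. t g \<in> F'}" by auto
    then show ?thesis using t by (metis (no_types, lifting) card_image inj_on_subset mem_Collect_eq subsetI)
  qed
  moreover have "{g \<in> dom E. g \<in> F} = F \<inter> dom E" by auto
  moreover have "inj_on s' (s ` nodes E)" "inj_on t' (t ` dom E)"
    using r'.s r'.t by (simp_all add: nodes_act[OF t] dom_act)
  ultimately show ?thesis
    unfolding asg_def nodes_act[OF t] dom_act
    using inv_sign_comp[OF s _ ev2, of s'] inv_sign_comp[OF t _ ee2, of t'] power_card_diff[OF fin, of "\<lambda>g. g \<in> F" "\<lambda>g. t g \<in> F'"]
    by (simp add: mult_ac)
qed

lemma asg_id: "asg id id {} E = 1"
  by (simp add: asg_def)

text \<open>Splitting \<open>y\<close> and \<open>e\<close> off the two orderings by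
  \<open>inv_sign_insert\<close> produces exactly the position signs in \<open>csg\<close> before
  and after the relabelling.\<close>

lemma csg_act:
  assumes vc: "valid_contraction E e b y u" and r: "relabelling E s t"
  shows "csg (act s t F E) (t e) (b \<noteq> (e \<in> F)) * asg s t F (contr E e b) = asg s t F E * csg E e b"
proof -
  interpret valid_contraction E e b y u by fact
  interpret r: relabelling E s t F by fact
  interpret c: contraction "act s t F E" "t e" "b \<noteq> (e \<in> F)" "s y" "map_option s u"
    using r.contraction_act contraction_axioms .
  define A where "A = nodes E - {y}"
  define D where "D = dom E - {e}"
  have fD: "finite (dom E)" using valid_finite[OF val] .
  have fA: "finite A" "finite D" using finite_nodes[OF fD] fD by (auto simp: A_def D_def)
  have nE: "nodes E = insert y A" using ey by (auto simp: A_def dest: halves_nodes)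
  have dE: "dom E = insert e D" using e_dom by (auto simp: D_def)
  have yA: "y \<notin> A" "e \<notin> D" by (auto simp: A_def D_def)
  have s: "inj_on s (insert y A)" and t: "inj_on t (insert e D)" using r.s r.t nE dE by auto
  define al where "al = ev ^ card {i\<in>A. i < y}"
  define be where "be = ev ^ card {i\<in>A. s i < s y}"
  define ga where "ga = (- ev) ^ card {i\<in>D. i < e}"
  define de where "de = (- ev) ^ card {i\<in>D. t i < t e}"
  have 1: "csg E e b = al * ga * (if b then 1 else ev)"
  proof -
    have "{v \<in> nodes E. v < y} = {i\<in>A. i < y}" "{g \<in> dom E. g < e} = {i\<in>D. i < e}"
      using nE dE by auto
    then show ?thesis unfolding csg_def the_end al_def ga_def by simp
  qed
  have 2: "csg (act s t F E) (t e) (b \<noteq> (e \<in> F)) = be * de * (if b \<noteq> (e \<in> F) then 1 else ev)"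
  proof -
    have "card {v \<in> s ` nodes E. v < s y} = card {i\<in>nodes E. s i < s y}"
      "card {g \<in> t ` dom E. g < t e} = card {i\<in>dom E. t i < t e}"
      using card_less_image r.s r.t by auto
    moreover have "{i\<in>nodes E. s i < s y} = {i\<in>A. s i < s y}" "{i\<in>dom E. t i < t e} = {i\<in>D. t i < t e}"
      using nE dE by auto
    ultimately show ?thesis
      unfolding csg_def c.the_end be_def de_def nodes_act[OF r.t] dom_act by (simp only: option.sel)
  qed
  define N where "N = inv_sign ev s A"
  define T where "T = inv_sign (- ev) t D"
  define f where "f = ev ^ card (F \<inter> D)"
  have 3: "asg s t F (contr E e b) = N * T * f"
    unfolding asg_def nodes_contr dom_contr A_def[symmetric] D_def[symmetric] N_def T_def f_def by simp
  have "card (F \<inter> dom E) = card (F \<inter> D) + (if e \<in> F then 1 else 0)"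
    unfolding dE using fA yA by (auto simp: Int_insert_right)
  then have 4: "asg s t F E = (N * (al * be)) * (T * (ga * de)) * (f * (if e \<in> F then ev else 1))"
    unfolding asg_def N_def T_def f_def
    using inv_sign_insert[OF fA(1) yA(1) s ev2] inv_sign_insert[OF fA(2) yA(2) t ee2] nE dE
    by (simp add: al_def be_def ga_def de_def)
  have sq: "al * al = 1" "ga * ga = 1" using ev_sq by (auto simp: al_def ga_def)
  have "(N * (al * be)) * (T * (ga * de)) * (f * (if e \<in> F then ev else 1)) * (al * ga * (if b then 1 else ev)) =
     (al * al) * (ga * ga) * (N * be * T * de * f) * ((if e \<in> F then ev else 1) * (if b then 1 else ev))"
    by (simp add: mult_ac)
  also have "\<dots> = (N * be * T * de * f) * ((if e \<in> F then ev else 1) * (if b then 1 else ev))"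
    unfolding sq by simp
  also have "(if e \<in> F then ev else 1) * (if b then 1 else ev) = (if b \<noteq> (e \<in> F) then 1 else ev)"
    using ev2 by auto
  finally have fin: "N * (al * be) * (T * (ga * de)) * (f * (if e \<in> F then ev else 1)) * (al * ga * (if b then 1 else ev)) =
    N * be * T * de * f * (if b \<noteq> (e \<in> F) then 1 else ev)" .
  show ?thesis unfolding 1 2 3 4 fin by (simp only: mult_ac)
qed

lemma cterm_act:
  assumes eq: "equi \<phi>" and vc: "valid_contraction E e b y u" and r: "relabelling E s t"
  shows "cterm \<phi> (act s t F E) (t e) (b \<noteq> (e \<in> F)) = asg s t F E * cterm \<phi> E e b"
proof -
  interpret valid_contraction E e b y u by fact
  interpret r: relabelling E s t F by fact
  have "\<phi> (contr (act s t F E) (t e) (b \<noteq> (e \<in> F))) = asg s t F (contr E e b) * \<phi> (contr E e b)"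
    unfolding r.contr_act[OF contraction_axioms] using equi_act[OF eq valid_contr_act[OF vc r]] .
  then show ?thesis using csg_act[OF vc r, of F] unfolding cterm_def by (simp add: mult.assoc[symmetric])
qed

text \<open>The two contractions of an internal edge differ by renaming the surviving vertex.
  Exchanging the vertices and reversing the edge each cost \<open>ev\<close>, and these cancel. The
  general \<open>\<Phi>\<close> allows iterated contractions, as in \<open>D2_term\<close>.\<close>

lemma csg_swap:
  assumes vc: "valid_contraction E e b y u" and u: "u = Some x"
    and \<Phi>: "\<And>s. inj_on s (nodes (contr E e b)) \<Longrightarrow>
      \<Phi> (act s id {} (contr E e b)) = asg s id {} (contr E e b) * \<Phi> (contr E e b)"
  shows "csg E e b * \<Phi> (contr E e b) = csg E e (\<not> b) * \<Phi> (contr E e (\<not> b))"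
proof -
  interpret valid_contraction E e b y u by fact
  interpret c: valid_contraction E e "\<not> b" x "Some y"
    by unfold_locales (use ey eu noloop u val in auto)
  define s where "s = (\<lambda>v. if v = x then y else v)"
  have xy: "x \<noteq> y" using noloop u by auto
  have g: "contr E e (\<not> b) = act s id {} (contr E e b)"
  proof (rule act_eqI)
    show "inj_on id (dom (contr E e b))" by simp
    show "dom (contr E e (\<not> b)) = id ` dom (contr E e b)" by (simp add: dom_contr c.dom_contr)
    fix g q assume q: "contr E e b g = Some q"
    then obtain p where p: "g \<noteq> e" "E g = Some p" "q = (\<lambda>c. if p c = Some y then u else p c)"
      by (auto simp: contr_apply split: if_splits)
    have "map_option s (q d) = (if p d = Some x then Some y else p d)" for d
      using p u xy by (cases "p d") (auto simp: s_def)
    then show "contr E e (\<not> b) (id g) = Some (\<lambda>b. map_option s (q (b \<noteq> (g \<in> {}))))"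
      using p by (simp add: c.contr_apply)
  qed
  define A where "A = nodes E - {x, y}"
  have yn: "y \<in> nodes E" and xn: "x \<in> nodes E" using ey eu u by (auto dest: halves_nodes)
  have fA: "finite A" using finite_nodes[OF valid_finite[OF val]] by (simp add: A_def)
  have nc: "nodes (contr E e b) = insert x A" using xn xy by (auto simp: nodes_contr A_def)
  have inj: "inj_on s (insert x A)" by (auto simp: inj_on_def s_def A_def)
  define ax where "ax = ev ^ card {i\<in>A. i < x}"
  define ay where "ay = ev ^ card {i\<in>A. i < y}"
  define K where "K = (- ev) ^ card {g \<in> dom E. g < e}"
  have "{i\<in>A. s i < s x} = {i\<in>A. i < y}" by (auto simp: s_def A_def)
  moreover have "inv_sign ev s A = 1" by (rule inv_sign_mono) (auto simp: s_def A_def)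
  ultimately have a: "asg s id {} (contr E e b) = ax * ay"
    unfolding asg_def nc using inv_sign_insert[OF fA _ inj ev2] by (simp add: ax_def ay_def A_def)
  have nx: "nodes E = insert y (insert x A)" using xn yn by (auto simp: A_def)
  have "card {v \<in> nodes E. v < y} = card {i\<in>A. i < y} + (if x < y then 1 else 0)"
  proof -
    have "{v \<in> nodes E. v < y} = {v \<in> insert x A. v < y}" unfolding nx by auto
    then show ?thesis using card_less_insert[OF fA, of x y] by (simp add: A_def)
  qed
  then have 1: "csg E e b = ay * (if x < y then ev else 1) * K * (if b then 1 else ev)"
    unfolding csg_def the_end ay_def K_def by simp
  have "card {v \<in> nodes E. v < x} = card {i\<in>A. i < x} + (if y < x then 1 else 0)"
  proof -
    have "{v \<in> nodes E. v < x} = {v \<in> insert y A. v < x}" unfolding nx by auto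
    then show ?thesis using card_less_insert[OF fA, of y x] by (simp add: A_def)
  qed
  then have 2: "csg E e (\<not> b) = ax * (if y < x then ev else 1) * K * (if \<not> b then 1 else ev)"
    unfolding csg_def c.the_end ax_def K_def by simp
  have "csg E e (\<not> b) * \<Phi> (contr E e (\<not> b)) =
     (ax * ax) * (ay * ((if y < x then ev else 1) * (if \<not> b then 1 else ev)) * K * \<Phi> (contr E e b))"
    unfolding g using \<Phi>[of s] inj a 2 unfolding nc by (simp add: mult_ac)
  also have "ax * ax = 1" using ev_sq by (simp add: ax_def)
  also have "(if y < x then ev else 1) * (if \<not> b then 1 else ev) = (if x < y then ev else 1) * (if b then 1 else ev)"
    using xy ev2 by auto
  finally show ?thesis unfolding 1 by (simp add: mult_ac)
qed

lemma csg_side: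
  assumes val: "valid E" and c: "contraction E e b y u"
    and \<Phi>: "\<And>s. inj_on s (nodes (contr E e b)) \<Longrightarrow>
      \<Phi> (act s id {} (contr E e b)) = asg s id {} (contr E e b) * \<Phi> (contr E e b)"
  shows "csg E e (side E e) * \<Phi> (contr E e (side E e)) = csg E e b * \<Phi> (contr E e b)"
proof (cases "side E e = b")
  case False
  interpret contraction E e b y u by fact
  interpret valid_contraction E e b y u by unfold_locales (rule val)
  obtain x where "u = Some x" using the_end False by (cases b; cases u) (auto simp: side_def)
  moreover have "side E e = (\<not> b)" using False by auto
  ultimately show ?thesis using csg_swap[of E e b y u x \<Phi>] valid_contraction_axioms \<Phi> by simp
qed simp

lemma cterm_side:
  assumes eq: "equi \<phi>" and val: "valid E" and c: "contraction E e b y u"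
  shows "cterm \<phi> E e (side E e) = cterm \<phi> E e b"
proof -
  interpret contraction E e b y u by fact
  have "\<phi> (act s id {} (contr E e b)) = asg s id {} (contr E e b) * \<phi> (contr E e b)"
    if "inj_on s (nodes (contr E e b))" for s
    using equi_act[OF eq] that by (simp add: relabelling_def)
  then show ?thesis unfolding cterm_def using csg_side[OF val c, of \<phi>] by simp
qed

lemma the_act: "relabelling E s t \<Longrightarrow> e \<in> dom E \<Longrightarrow>
    the (act s t F E (t e)) c = map_option s (the (E e) (c \<noteq> (e \<in> F)))"
  using act_apply[of t E e _ s F] by (auto simp: relabelling_def)

lemma
  assumes r: "relabelling E s t"
  shows nl_act: "nl (act s t F E) = t ` nl E" and ni_act: "ni (act s t F E) = t ` ni E"
proof -
  interpret relabelling E s t F by fact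
  have 1: "t e \<in> nl E' \<longleftrightarrow> e \<in> nl E" "t e \<in> ni E' \<longleftrightarrow> e \<in> ni E" if e: "e \<in> dom E" for e
  proof -
    obtain p where p: "E e = Some p" using e by auto
    have *: "map_option s (p c) = map_option s (p d) \<longleftrightarrow> p c = p d" for c d
      using attached_inj[of e c "p c" e d "p d"] p by (auto simp: in_halves)
    have "t e \<in> dom E'" using e by (simp add: dom_act)
    then show nl: "t e \<in> nl E' \<longleftrightarrow> e \<in> nl E"
      unfolding nl_def mem_Collect_eq the_act[OF r e] using e * p by (cases "e \<in> F") auto
    show "t e \<in> ni E' \<longleftrightarrow> e \<in> ni E"
      unfolding ni_def mem_Collect_eq nl the_act[OF r e] by (cases "e \<in> F") auto
  qed
  have sub: "nl E' \<subseteq> t ` dom E" "ni E' \<subseteq> nl E'" "nl E \<subseteq> dom E" "ni E \<subseteq> nl E"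
    using dom_act[of s t F E] by (auto simp: nl_def ni_def)
  have img: "A' = t ` A" if "A' \<subseteq> t ` dom E" "A \<subseteq> dom E" "\<And>e. e \<in> dom E \<Longrightarrow> t e \<in> A' \<longleftrightarrow> e \<in> A" for A A'
    using that by blast
  show "nl E' = t ` nl E" by (rule img[OF sub(1,3) 1(1)])
  show "ni E' = t ` ni E" by (rule img[OF subset_trans[OF sub(2,1)] subset_trans[OF sub(4,3)] 1(2)])
qed

lemma equi_Dsel:
  assumes eq: "equi \<phi>" and Q: "\<And>E. Q E \<subseteq> nl E"
    and Qa: "\<And>E s t F. relabelling E s t \<Longrightarrow> Q (act s t F E) = t ` Q E"
  shows "equi (Dsel Q \<phi>)"
  unfolding equi_def
proof (intro conjI allI impI)
  fix E F and s t :: "nat \<Rightarrow> nat" assume val: "valid E" and s: "inj_on s (nodes E)" and t: "inj_on t (dom E)"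
  then interpret relabelling E s t F by unfold_locales
  have r: "relabelling E s t" by (rule relabelling_axioms)
  have "Dsel Q \<phi> E' = (\<Sum>e'\<in>t ` Q E. cterm \<phi> E' e' (side E' e'))"
    using valid_act val Qa[OF r] by (simp add: Dsel_def)
  also have "\<dots> = (\<Sum>e\<in>Q E. cterm \<phi> E' (t e) (side E' (t e)))"
    by (rule sum.reindex_cong[of t]) (use t Q[of E] in \<open>auto simp: nl_def intro: inj_on_subset\<close>)
  also have "\<dots> = (\<Sum>e\<in>Q E. asg s t F E * cterm \<phi> E e (side E e))"
  proof (rule sum.cong[OF refl])
    fix e assume "e \<in> Q E"
    then have e: "e \<in> nl E" using Q by auto
    let ?b = "side E e"
    obtain y u where c: "contraction E e ?b y u" using nl_contraction[OF e] by blast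
    then have vc: "valid_contraction E e ?b y u" using val by (simp add: valid_contraction_def valid_contraction_axioms_def)
    have "cterm \<phi> E' (t e) (side E' (t e)) = cterm \<phi> E' (t e) (?b \<noteq> (e \<in> F))"
      using cterm_side[OF eq _ contraction_act[OF c]] valid_act val by simp
    also have "\<dots> = asg s t F E * cterm \<phi> E e ?b" using cterm_act[OF eq vc r] .
    finally show "cterm \<phi> E' (t e) (side E' (t e)) = asg s t F E * cterm \<phi> E e ?b" .
  qed
  finally show "Dsel Q \<phi> E' = asg s t F E * Dsel Q \<phi> E"
    using val by (simp add: Dsel_def sum_distrib_left)
qed (simp add: Dsel_def)

text \<open>\<open>Dop\<close> is the deformed differential and \<open>Dint\<close>, by
  \<open>Tr_std_diff\<close>, the standard one.\<close>

definition "Dop = Dsel nl"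
definition "Dint = Dsel ni"

lemma equi_Dop: "equi \<phi> \<Longrightarrow> equi (Dop \<phi>)"
  unfolding Dop_def by (rule equi_Dsel) (auto simp: nl_act)

lemma Dsel_linear:
  "Dsel Q (\<lambda>E. a * \<phi> E + b * \<psi> E) = (\<lambda>E. a * Dsel Q \<phi> E + b * Dsel Q \<psi> E)"
  by (auto simp: Dsel_def cterm_def fun_eq_iff sum_distrib_left sum.distrib[symmetric] algebra_simps intro!: sum.cong)

section \<open>The square of the differential\<close>

text \<open>Exchanging the two absorbed vertices costs \<open>ev\<close>, exchanging the two edges
  \<open>- ev\<close>; the product is -1 for either parity of n.\<close>

lemma csg_contr_anti:
  assumes vc: "valid_contraction E e b y u" and vc': "valid_contraction E f c z w"
    and ef: "e \<noteq> f" and yz: "y \<noteq> z"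
    and c1: "contraction (contr E e b) f c z w'" and c2: "contraction (contr E f c) e b y u'"
  shows "csg E e b * csg (contr E e b) f c = - (csg E f c * csg (contr E f c) e b)"
proof -
  interpret e: valid_contraction E e b y u by fact
  interpret f: valid_contraction E f c z w by fact
  interpret ef: contraction "contr E e b" f c z w' by fact
  interpret fe: contraction "contr E f c" e b y u' by fact
  define A where "A = nodes E - {y, z}"
  define D where "D = dom E - {e, f}"
  have fD: "finite (dom E)" using valid_finite[OF e.val] .
  have fA: "finite A" "finite D" using finite_nodes[OF fD] fD by (auto simp: A_def D_def)
  have yn: "y \<in> nodes E" "z \<in> nodes E" using e.ey f.ey by (auto dest: halves_nodes)
  have ed: "e \<in> dom E" "f \<in> dom E" using e.e_dom f.e_dom by auto
  have n: "{v \<in> nodes E. v < y} = {v \<in> insert z A. v < y}" "{v \<in> nodes E. v < z} = {v \<in> insert y A. v < z}"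
    "{v \<in> nodes E - {y}. v < z} = {v \<in> A. v < z}" "{v \<in> nodes E - {z}. v < y} = {v \<in> A. v < y}"
    using yn by (auto simp: A_def)
  have d: "{v \<in> dom E. v < e} = {v \<in> insert f D. v < e}" "{v \<in> dom E. v < f} = {v \<in> insert e D. v < f}"
    "{v \<in> dom E - {e}. v < f} = {v \<in> D. v < f}" "{v \<in> dom E - {f}. v < e} = {v \<in> D. v < e}"
    using ed by (auto simp: D_def)
  have nA: "z \<notin> A" "y \<notin> A" "f \<notin> D" "e \<notin> D" by (auto simp: A_def D_def)
  note cl = card_less_insert[OF fA(1) nA(1)] card_less_insert[OF fA(1) nA(2)]
    card_less_insert[OF fA(2) nA(3)] card_less_insert[OF fA(2) nA(4)]
  define P where "P = ev ^ card {v \<in> A. v < y} * ev ^ card {v \<in> A. v < z} * (- ev) ^ card {v \<in> D. v < e} *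
    (- ev) ^ card {v \<in> D. v < f} * (if b then 1 else ev) * (if c then 1 else ev)"
  have 1: "csg E e b * csg (contr E e b) f c = P * ((if z < y then ev else 1) * (if f < e then - ev else 1))"
    unfolding csg_def e.the_end ef.the_end option.sel e.nodes_contr e.dom_contr n d cl P_def
    by (simp add: power_add mult_ac)
  have 2: "csg E f c * csg (contr E f c) e b = P * ((if y < z then ev else 1) * (if e < f then - ev else 1))"
    unfolding csg_def f.the_end fe.the_end option.sel f.nodes_contr f.dom_contr n d cl P_def
    by (simp add: power_add mult_ac)
  have "(if z < y then ev else 1) * (if f < e then - ev else 1) =
     - ((if y < z then ev else 1) * (if e < f then - ev else 1))"
    using ef yz ev2 by auto
  then show ?thesis unfolding 1 2 by simp
qed

end

lemma contraction_contr:
  assumes c1: "contraction E e b y u" and c2: "contraction E f c z w" and yz: "y \<noteq> z" and ef: "e \<noteq> f"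
    and np: "\<not> par E e f"
  shows "contraction (contr E e b) f c z (if w = Some y then u else w)"
proof -
  interpret e: contraction E e b y u by fact
  interpret f: contraction E f c z w by fact
  have np': "\<not> (w = Some y \<and> u = Some z)"
  proof
    assume "w = Some y \<and> u = Some z"
    moreover have "range (the (E e)) = {Some y, u}" "range (the (E f)) = {Some z, w}"
      using e.the_end f.the_end by (cases b; cases c; auto simp: UNIV_bool)+
    ultimately show False using np by (auto simp: par_def)
  qed
  show ?thesis
  proof
    show "(f, c) \<in> halves (contr E e b) (Some z)" using f.ey yz ef by (simp add: e.halves_contr)
    show "(f, \<not> c) \<in> halves (contr E e b) (if w = Some y then u else w)"
      using f.eu ef e.noloop by (auto simp: e.halves_contr)
    show "(if w = Some y then u else w) \<noteq> Some z" using np' f.noloop by auto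
  qed
qed

lemma contr_contr_commute:
  assumes c1: "contraction E e b y u" and c2: "contraction E f c z w" and yz: "y \<noteq> z" and ef: "e \<noteq> f"
    and np: "\<not> par E e f"
  shows "contr (contr E e b) f c = contr (contr E f c) e b"
proof
  fix g
  have np': "\<not> par E f e" using np by (simp add: par_def)
  interpret e: contraction E e b y u by fact
  interpret f: contraction E f c z w by fact
  interpret ef: contraction "contr E e b" f c z "if w = Some y then u else w"
    by (rule contraction_contr) fact+
  interpret fe: contraction "contr E f c" e b y "if u = Some z then w else u"
    by (rule contraction_contr) (use c1 c2 yz ef np' in auto)
  show "contr (contr E e b) f c g = contr (contr E f c) e b g"
  proof (cases "g = e \<or> g = f \<or> E g = None")
    case False
    then obtain q where "E g = Some q" "g \<noteq> e" "g \<noteq> f" by auto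
    then show ?thesis
      unfolding ef.contr_apply fe.contr_apply e.contr_apply f.contr_apply
      using yz e.noloop f.noloop ef.noloop fe.noloop by (auto simp: fun_eq_iff)
  qed (auto simp: ef.contr_apply fe.contr_apply e.contr_apply f.contr_apply)
qed

text \<open>If all internal ends of the two edges coincided, both edges would join one vertex to the
  star and be parallel.\<close>

lemma ex_distinct_ends:
  assumes "e \<in> nl E" "f \<in> nl E" "\<not> par E e f"
  obtains b c y z u w where "contraction E e b y u" "contraction E f c z w" "y \<noteq> z"
proof -
  obtain p q where p: "E e = Some p" "p True \<noteq> p False" and q: "E f = Some q" "q True \<noteq> q False"
    using assms by (auto simp: nl_def)
  have ne: "{p True, p False} \<noteq> {q True, q False}"
    using assms(3) p q by (auto simp: par_def UNIV_bool)
  have "\<exists>b c. p b \<noteq> None \<and> q c \<noteq> None \<and> p b \<noteq> q c"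
  proof (rule ccontr)
    assume "\<not> ?thesis"
    then have *: "p b = None \<or> q c = None \<or> p b = q c" for b c by blast
    show False using *[of True True] *[of True False] *[of False True] *[of False False] p(2) q(2) ne
      by (auto simp: doubleton_eq_iff)
  qed
  then obtain b c where bc: "p b \<noteq> None" "q c \<noteq> None" "p b \<noteq> q c" by blast
  have "p (\<not> b) \<noteq> p b" "q (\<not> c) \<noteq> q c" using p(2) q(2) by (cases b; cases c; simp)+
  then have "contraction E e b (the (p b)) (p (\<not> b))" "contraction E f c (the (q c)) (q (\<not> c))"
    using p(1) q(1) bc by (unfold_locales; auto simp: in_halves)+
  moreover have "the (p b) \<noteq> the (q c)" using bc by auto
  ultimately show thesis using that by blast
qed

text \<open>Merging the ends of \<open>e\<close> turns precisely the edges parallel to it into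
  loops.\<close>

lemma nl_contr:
  assumes "contraction E e b y u"
  shows "nl (contr E e b) = {f \<in> nl E. f \<noteq> e \<and> \<not> par E e f}"
proof -
  interpret contraction E e b y u by fact
  have "f \<in> nl (contr E e b) \<longleftrightarrow> f \<in> nl E \<and> f \<noteq> e \<and> \<not> par E e f" for f
  proof (cases "E f = None \<or> f = e")
    case False
    then obtain q where q: "E f = Some q" "f \<noteq> e" by auto
    have "range (the (E e)) = {Some y, u}" using the_end by (cases b) (auto simp: UNIV_bool)
    moreover have "range (the (E f)) = {q True, q False}" using q by (auto simp: UNIV_bool)
    ultimately have "par E e f \<longleftrightarrow> {Some y, u} = {q True, q False}" by (simp add: par_def)
    moreover have "f \<in> nl (contr E e b) \<longleftrightarrow>
        (if q True = Some y then u else q True) \<noteq> (if q False = Some y then u else q False)"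
      using q by (simp add: nl_def contr_apply domIff)
    moreover have "f \<in> nl E \<longleftrightarrow> q True \<noteq> q False" using q by (simp add: nl_def domIff)
    ultimately show ?thesis using q(2) noloop by (auto simp: doubleton_eq_iff)
  qed (auto simp: nl_def contr_apply)
  then show ?thesis by auto
qed

context hair_sign begin

text \<open>\<open>Dop\<close> absorbs the ends prescribed by \<open>side\<close>;
  \<open>csg_side\<close> trades them for the distinct ends of \<open>ex_distinct_ends\<close>, for
  which the two contractions commute.\<close>

lemma D2_term:
  assumes eq: "equi \<phi>" and val: "valid E" and c1: "contraction E e b y u" and c2: "contraction E f c z w"
    and yz: "y \<noteq> z" and ef: "e \<noteq> f" and np: "\<not> par E e f"
  shows "csg E e (side E e) * (if valid (contr E e (side E e)) then
      cterm \<phi> (contr E e (side E e)) f (side (contr E e (side E e)) f) else 0) =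
    csg E e b * csg (contr E e b) f c * \<phi> (contr (contr E e b) f c)"
proof -
  interpret e: contraction E e b y u by fact
  interpret e: valid_contraction E e b y u by unfold_locales (rule val)
  define \<Phi> where "\<Phi> = (\<lambda>G. if valid G then cterm \<phi> G f (side G f) else 0)"
  let ?G = "contr E e b"
  have cf: "contraction ?G f c z (if w = Some y then u else w)" by (rule contraction_contr) fact+
  have "\<Phi> (act s id {} ?G) = asg s id {} ?G * \<Phi> ?G" if s: "inj_on s (nodes ?G)" for s
  proof (cases "valid ?G")
    case True
    have r: "relabelling ?G s id" using s by unfold_locales auto
    then interpret r: relabelling ?G s id "{}" .
    have f: "f \<in> nl ?G" using contraction_nl[OF cf] .
    then obtain y' u' where c: "contraction ?G f (side ?G f) y' u'" using nl_contraction by blast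
    then have vc: "valid_contraction ?G f (side ?G f) y' u'"
      using True by (simp add: valid_contraction_def valid_contraction_axioms_def)
    have "cterm \<phi> (act s id {} ?G) f (side (act s id {} ?G) f) = cterm \<phi> (act s id {} ?G) f (side ?G f)"
      using cterm_side[OF eq, of "act s id {} ?G" f "side ?G f"] r.contraction_act[OF c] r.valid_act True by simp
    then show ?thesis using cterm_act[OF eq vc r, of "{}"] r.valid_act True by (simp add: \<Phi>_def)
  next
    case False
    have "relabelling ?G s id" using s by unfold_locales auto
    then interpret r: relabelling ?G s id "{}" .
    show ?thesis using False r.valid_act by (simp add: \<Phi>_def)
  qed
  then have "csg E e (side E e) * \<Phi> (contr E e (side E e)) = csg E e b * \<Phi> ?G"
    by (rule csg_side[OF val c1])
  also have "\<Phi> ?G = csg ?G f c * \<phi> (contr ?G f c)"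
  proof (cases "valid ?G")
    case True
    then show ?thesis using cterm_side[OF eq True cf] by (simp add: \<Phi>_def cterm_def)
  next
    case False
    interpret f: contraction ?G f c z "if w = Some y then u else w" by fact
    \<comment> \<open>\<open>?G\<close> has correct valences and hairs, so what fails is
      connectedness, which the second contraction cannot repair. Thus omitting invalid intermediate
      graphs loses nothing.\<close>
    have "\<not> valid (contr ?G f c)"
      using False f.valid_of_contr[OF e.finite_contr e.contr_card e.contr_None] by blast
    then show ?thesis using False eq by (simp add: \<Phi>_def equi_def)
  qed
  finally show ?thesis unfolding \<Phi>_def by (simp add: mult.assoc)
qed

lemma sum_antisym:
  fixes U :: "nat \<Rightarrow> nat \<Rightarrow> 'k"
  assumes anti: "\<And>e f. (e, f) \<in> P \<Longrightarrow> U e f = - U f e" and sym: "\<And>e f. (e, f) \<in> P \<Longrightarrow> (f, e) \<in> P"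
  shows "(\<Sum>(e, f)\<in>P. U e f) = 0"
proof -
  have "(\<Sum>(e, f)\<in>P. U e f) = (\<Sum>(e, f)\<in>P. U f e)"
    by (rule sum.reindex_bij_witness[of _ prod.swap prod.swap]) (use sym in auto)
  also have "\<dots> = (\<Sum>(e, f)\<in>P. - U e f)"
    by (rule sum.cong) (use anti in force)+
  also have "\<dots> = - (\<Sum>(e, f)\<in>P. U e f)" by (simp add: sum_negf case_prod_beta)
  finally show ?thesis by (metis add.inverse_inverse double_zero_sym eq_neg_iff_add_eq_0 zero_eq_1_divide_iff mult_2 mult_eq_0_iff zero_neq_numeral)
qed

text \<open>The iterated sum runs over ordered pairs of non-parallel edges, a symmetric index set on
  which the terms are antisymmetric.\<close>

lemma Dop_Dop:
  assumes eq: "equi \<phi>" shows "Dop (Dop \<phi>) = (\<lambda>_. 0)"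
proof
  fix E
  show "Dop (Dop \<phi>) E = 0"
  proof (cases "valid E")
    case True
    have fin: "finite (nl E)" using finite_nl valid_finite[OF True] by blast
    define U where "U = (\<lambda>e f. csg E e (side E e) * (if valid (contr E e (side E e)) then
      cterm \<phi> (contr E e (side E e)) f (side (contr E e (side E e)) f) else 0))"
    let ?R = "\<lambda>e. {f \<in> nl E. f \<noteq> e \<and> \<not> par E e f}"
    have "Dop (Dop \<phi>) E = (\<Sum>e\<in>nl E. \<Sum>f\<in>?R e. U e f)"
      unfolding Dop_def Dsel_def[of nl "Dsel nl \<phi>"] using True
    proof (simp, intro sum.cong refl)
      fix e assume e: "e \<in> nl E"
      have "nl (contr E e (side E e)) = ?R e" using nl_contr[OF nl_contraction[OF e]] .
      then show "cterm (Dsel nl \<phi>) E e (side E e) = (\<Sum>f\<in>?R e. U e f)"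
        by (simp add: cterm_def[of "Dsel nl \<phi>"] Dsel_def U_def sum_distrib_left)
    qed
    also have "\<dots> = (\<Sum>(e, f)\<in>Sigma (nl E) ?R. U e f)"
      by (rule sum.Sigma) (use fin in auto)
    also have "\<dots> = 0"
    proof (rule sum_antisym)
      fix e f assume ef: "(e, f) \<in> Sigma (nl E) ?R"
      then show "(f, e) \<in> Sigma (nl E) ?R" by (auto simp: par_def)
      have np: "\<not> par E e f" "\<not> par E f e" and ne: "e \<noteq> f" using ef by (auto simp: par_def)
      have "e \<in> nl E" "f \<in> nl E" using ef by auto
      then obtain b c y z u w where c: "contraction E e b y u" "contraction E f c z w" "y \<noteq> z"
        using ex_distinct_ends[OF _ _ np(1)] by metis
      have vc: "valid_contraction E e b y u" "valid_contraction E f c z w"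
        using c True by (auto simp: valid_contraction_def valid_contraction_axioms_def)
      have U1: "U e f = csg E e b * csg (contr E e b) f c * \<phi> (contr (contr E e b) f c)"
        unfolding U_def using D2_term[OF eq True c ne np(1)] .
      have U2: "U f e = csg E f c * csg (contr E f c) e b * \<phi> (contr (contr E f c) e b)"
        unfolding U_def using D2_term[OF eq True c(2,1) c(3)[symmetric] ne[symmetric] np(2)] .
      have cc: "contraction (contr E e b) f c z (if w = Some y then u else w)"
        "contraction (contr E f c) e b y (if u = Some z then w else u)"
        using contraction_contr[OF c ne np(1)] contraction_contr[OF c(2,1) c(3)[symmetric] ne[symmetric] np(2)] .
      show "U e f = - U f e"
        unfolding U1 U2 contr_contr_commute[OF c ne np(1)] csg_contr_anti[OF vc ne c(3) cc] by simp
    qed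
    finally show ?thesis .
  qed (simp add: Dop_def Dsel_def)
qed

end

section \<open>The homotopy\<close>

definition fr :: "nat set \<Rightarrow> nat" where
  "fr A = Suc (Max (insert 0 A))"

lemma fr_notin: "finite A \<Longrightarrow> fr A \<notin> A"
proof
  assume "finite A" "fr A \<in> A"
  then have "fr A \<le> Max (insert 0 A)" by (intro Max_ge) auto
  then show False by (simp add: fr_def)
qed

context hair_sign begin

definition xterm :: "(sgraph \<Rightarrow> 'k) \<Rightarrow> sgraph \<Rightarrow> (nat \<times> bool) set \<Rightarrow> nat \<Rightarrow> nat \<Rightarrow> 'k" where
  "xterm \<phi> E S y f = csg (expd E (base E S) S y f) f True * \<phi> (expd E (base E S) S y f)"

text \<open>\<open>fr\<close> only picks fresh names: by equivariance the terms do not depend on them.\<close>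

definition hop :: "(sgraph \<Rightarrow> 'k) \<Rightarrow> sgraph \<Rightarrow> 'k" where
  "hop \<phi> E = (if valid E then \<Sum>S\<in>red E. xterm \<phi> E S (fr (nodes E)) (fr (dom E)) else 0)"

lemma csg_sq: "csg E e b * csg E e b = 1"
proof -
  have "(if b then 1 else ev) * (if b then 1 else ev) = 1" using ev2 by simp
  moreover have "csg E e b * csg E e b = (ev ^ card {v \<in> nodes E. v < the (the (E e) b)} * ev ^ card {v \<in> nodes E. v < the (the (E e) b)}) *
    ((- ev) ^ card {g \<in> dom E. g < e} * (- ev) ^ card {g \<in> dom E. g < e}) * ((if b then 1 else ev) * (if b then 1 else ev))"
    unfolding csg_def by (simp only: mult_ac)
  ultimately show ?thesis by (simp only: ev_sq mult_1)
qed

lemma csg_expd: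
  assumes "expansion E x S y f"
  shows "csg (expd E x S y f) f True = ev ^ card {v \<in> nodes E. v < y} * (- ev) ^ card {g \<in> dom E. g < f}"
proof -
  interpret expansion E x S y f by fact
  have "{v \<in> insert y (nodes E). v < y} = {v \<in> nodes E. v < y}" "{g \<in> insert f (dom E). g < f} = {g \<in> dom E. g < f}"
    by auto
  then show ?thesis unfolding csg_def the_end option.sel nodes_expd dom_expd by simp
qed

lemma asg_expd:
  assumes exp: "expansion E x S y f" and fin: "finite (dom E)" and r: "relabelling E s t"
    and y': "y' \<notin> s ` nodes E" and f': "f' \<notin> t ` dom E"
  shows "asg (s(y := y')) (t(f := f')) (F - {f}) (expd E x S y f) = asg s t F E *
    (ev ^ card {v \<in> nodes E. v < y} * ev ^ card {v \<in> nodes E. s v < y'} *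
     (- ev) ^ card {g \<in> dom E. g < f} * (- ev) ^ card {g \<in> dom E. t g < f'})"
proof -
  interpret expansion E x S y f by fact
  interpret r: relabelling E s t F by fact
  let ?X = "expd E x S y f" and ?s = "s(y := y')" and ?t = "t(f := f')"
  have fins: "finite (nodes E)" using finite_nodes[OF fin] .
  interpret rX: relabelling ?X ?s ?t "F - {f}" by (rule expd_act(3)[OF exp r y' f'])
  define a b c d where "a = ev ^ card {v \<in> nodes E. v < y}" and "b = ev ^ card {v \<in> nodes E. s v < y'}"
    and "c = (- ev) ^ card {g \<in> dom E. g < f}" and "d = (- ev) ^ card {g \<in> dom E. t g < f'}"
  have "inv_sign ev ?s (insert y (nodes E)) = inv_sign ev ?s (nodes E) * (a * b)"
  proof -
    have "{i \<in> nodes E. ?s i < ?s y} = {v \<in> nodes E. s v < y'}" using y by auto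
    then show ?thesis unfolding a_def b_def
      using inv_sign_insert[OF fins y _ ev2, of ?s] rX.s nodes_expd by simp
  qed
  moreover have "inv_sign ev ?s (nodes E) = inv_sign ev s (nodes E)" by (rule inv_sign_cong) (use y in auto)
  moreover have "inv_sign (- ev) ?t (insert f (dom E)) = inv_sign (- ev) ?t (dom E) * (c * d)"
  proof -
    have "{i \<in> dom E. ?t i < ?t f} = {g \<in> dom E. t g < f'}" using f by auto
    then show ?thesis unfolding c_def d_def
      using inv_sign_insert[OF fin f _ ee2, of ?t] rX.t dom_expd by simp
  qed
  moreover have "inv_sign (- ev) ?t (dom E) = inv_sign (- ev) t (dom E)" by (rule inv_sign_cong) (use f in auto)
  moreover have "(F - {f}) \<inter> insert f (dom E) = F \<inter> dom E" using f by auto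
  ultimately show ?thesis
    unfolding a_def[symmetric] b_def[symmetric] c_def[symmetric] d_def[symmetric]
    unfolding asg_def nodes_expd dom_expd by (simp add: mult_ac)
qed

text \<open>The relabelled suspension is a relabelling of the suspension, by
  \<open>expd_act\<close>; the extra sign in \<open>asg_expd\<close>, from inserting the new vertex
  and edge, is the quotient of the two values of \<open>csg\<close>.\<close>

lemma xterm_act:
  assumes eq: "equi \<phi>" and val: "valid E" and S: "S \<in> red E" and y: "y \<notin> nodes E" and f: "f \<notin> dom E"
    and r: "relabelling E s t" and y': "y' \<notin> s ` nodes E" and f': "f' \<notin> t ` dom E"
  shows "xterm \<phi> (act s t F E) (half_map t F ` S) y' f' = asg s t F E * xterm \<phi> E S y f"
proof -
  interpret r: relabelling E s t F by fact
  have S2: "S \<in> S2 E" using S by (rule red_S2)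
  interpret expansion E "base E S" S y f using expansion_S2[OF S2 y f] .
  let ?X = "expd E (base E S) S y f" and ?s = "s(y := y')" and ?t = "t(f := f')"
  note ea = expd_act(1)[OF expansion_axioms r y' f', of F] expd_act(2)[OF expansion_axioms r y' f', of F]
    expd_act(3)[OF expansion_axioms r y' f']
  have fin: "finite (dom E)" using valid_finite[OF val] .
  define a b c d where "a = ev ^ card {v \<in> nodes E. v < y}" and "b = ev ^ card {v \<in> nodes E. s v < y'}"
    and "c = (- ev) ^ card {g \<in> dom E. g < f}" and "d = (- ev) ^ card {g \<in> dom E. t g < f'}"
  have asg: "asg ?s ?t (F - {f}) ?X = asg s t F E * (a * b * c * d)"
    unfolding a_def b_def c_def d_def by (rule asg_expd[OF expansion_axioms fin r y' f'])
  have "card {v \<in> s ` nodes E. v < y'} = card {v \<in> nodes E. s v < y'}"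
    "card {g \<in> t ` dom E. g < f'} = card {g \<in> dom E. t g < f'}"
    using card_less_image r.s r.t by auto
  then have cs': "csg (expd (act s t F E) (map_option s (base E S)) (half_map t F ` S) y' f') f' True = b * d"
    unfolding csg_expd[OF ea(2)] nodes_act[OF r.t] dom_act b_def d_def by simp
  have cs: "csg ?X f True = a * c"
    unfolding csg_expd[OF expansion_axioms] a_def c_def by simp
  have sq: "b * b = 1" "d * d = 1" using ev_sq by (auto simp: b_def d_def)
  have "xterm \<phi> (act s t F E) (half_map t F ` S) y' f' =
     b * d * \<phi> (act ?s ?t (F - {f}) ?X)"
    unfolding xterm_def r.base_act[OF S2_Sall[OF S2]] cs' unfolding ea(1) ..
  also have "\<dots> = b * d * (asg s t F E * (a * b * c * d) * \<phi> ?X)"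
    using equi_act[OF eq ea(3)] asg by simp
  also have "\<dots> = (b * b) * (d * d) * (asg s t F E * (a * c * \<phi> ?X))" by (simp only: mult_ac)
  also have "\<dots> = asg s t F E * xterm \<phi> E S y f" unfolding sq xterm_def cs by simp
  finally show ?thesis .
qed

lemma relabelling_id: "relabelling E id id"
  by unfold_locales auto

lemma half_map_id: "half_map id {} ` S = S"
  by (force simp: half_map_def)

lemma xterm_indep:
  assumes "equi \<phi>" "valid E" "S \<in> red E" "y \<notin> nodes E" "f \<notin> dom E" "y' \<notin> nodes E" "f' \<notin> dom E"
  shows "xterm \<phi> E S y' f' = xterm \<phi> E S y f"
  using xterm_act[OF assms(1-5) relabelling_id, of y' f' "{}"] assms(6,7)
  by (simp add: act_id' half_map_id asg_id)

lemma equi_hop: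
  assumes eq: "equi \<phi>" shows "equi (hop \<phi>)"
  unfolding equi_def
proof (intro conjI allI impI)
  fix E F and s t :: "nat \<Rightarrow> nat" assume val: "valid E" and s: "inj_on s (nodes E)" and t: "inj_on t (dom E)"
  then interpret relabelling E s t F by unfold_locales
  have r: "relabelling E s t" by (rule relabelling_axioms)
  have fin: "finite (dom E)" "finite (nodes E)" using valid_finite[OF val] finite_nodes by auto
  have inj: "inj_on ((`) (half_map t F)) (red E)"
    by (rule inj_on_subset[OF inj_image_half_map]) (auto dest: red_S2 S2_Sall)
  have "hop \<phi> E' = (\<Sum>S\<in>red E. xterm \<phi> E' (half_map t F ` S) (fr (nodes E')) (fr (dom E')))"
    using valid_act val red_act sum.reindex[OF inj] by (simp add: hop_def)
  also have "\<dots> = (\<Sum>S\<in>red E. asg s t F E * xterm \<phi> E S (fr (nodes E)) (fr (dom E)))"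
  proof (rule sum.cong[OF refl])
    fix S assume "S \<in> red E"
    then show "xterm \<phi> E' (half_map t F ` S) (fr (nodes E')) (fr (dom E')) =
        asg s t F E * xterm \<phi> E S (fr (nodes E)) (fr (dom E))"
      using xterm_act[OF eq val _ fr_notin[OF fin(2)] fr_notin[OF fin(1)] r] fr_notin fin
      by (simp add: nodes_act[OF t] dom_act)
  qed
  finally show "hop \<phi> E' = asg s t F E * hop \<phi> E"
    using val by (simp add: hop_def sum_distrib_left)
qed (simp add: hop_def)

lemma hop_linear:
  "hop (\<lambda>E. a * \<phi> E + b * \<psi> E) = (\<lambda>E. a * hop \<phi> E + b * hop \<psi> E)"
  by (auto simp: hop_def xterm_def fun_eq_iff sum_distrib_left sum.distrib[symmetric] algebra_simps intro!: sum.cong)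

text \<open>For a bridge, the end to be absorbed that fits the locale \<open>bridge\<close>: the one
  on the side without hairs. It may differ from \<open>side\<close>, which \<open>cterm_side\<close>
  permits.\<close>

definition bb :: "sgraph \<Rightarrow> nat \<Rightarrow> bool" where
  "bb E e = (SOME b. {(e, \<not> b)} \<in> Sall E)"

lemma bb_bridge:
  assumes val: "valid E" and e: "e \<in> Br E"
  obtains y u where "bridge E e (bb E e) y u"
proof -
  obtain c where "{(e, c)} \<in> Sall E" using e by (auto simp: Br_def)
  then have "{(e, \<not> (\<not> c))} \<in> Sall E" by simp
  then have "{(e, \<not> bb E e)} \<in> Sall E" unfolding bb_def by (rule someI)
  then obtain y u where "bridge E e (\<not> \<not> bb E e) y u" using Sall_bridgeE[OF val] by blast
  then show thesis using that by simp
qed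

lemma bb_eq: "bridge E e b y u \<Longrightarrow> bb E e = b"
proof -
  assume "bridge E e b y u"
  then interpret bridge E e b y u .
  have "{(e, \<not> bb E e)} \<in> Sall E" unfolding bb_def by (rule someI) (rule br)
  then show ?thesis using far_not_Sall by (cases "bb E e"; cases b) auto
qed

text \<open>In the suspended graph the edges \<open>e\<close> and \<open>f\<close> can be contracted
  in either order, with opposite signs by \<open>csg_contr_anti\<close>. If \<open>G\<close> is
  invalid, so is the other graph by \<open>invalid_expd\<close>, and both terms vanish.\<close>

lemma commute_term:
  assumes eq: "equi \<chi>" and val: "valid E" and S: "S \<in> red E" and e: "e \<in> Br E"
    and y: "y \<notin> nodes E" and f: "f \<notin> dom E"
  defines "G \<equiv> contr E e (bb E e)" and "X \<equiv> expd E (base E S) S y f"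
  shows "csg E e (bb E e) * (if valid G \<and> S \<in> red G then xterm \<chi> G S y f else 0) +
    csg X f True * cterm \<chi> X e (bb E e) = 0"
proof -
  obtain z u where "bridge E e (bb E e) z u" using bb_bridge[OF val e] .
  then interpret bridge E e "bb E e" z u .
  have S2: "S \<in> S2 E" using S by (rule red_S2)
  interpret X: expansion E "base E S" S y f using expansion_S2[OF S2 y f] .
  have bX: "bridge X f True y (base E S)" unfolding X_def using bridge_expd[OF val S y f] .
  have cX: "contraction X e (bb E e) z u" unfolding X_def using contraction_expd[OF S2 y f] .
  have com: "contr X e (bb E e) = expd G (base G S) S y f"
    unfolding X_def G_def using contr_expd_commute[OF S2 y f] .
  have vc: "valid_contraction X f True y (base E S)" using bX by (simp add: bridge_def)
  then have vcX: "valid_contraction X e (bb E e) z u"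
    using cX by (simp add: valid_contraction_def)
  have SG: "S \<in> red G" unfolding G_def using red_contr[OF S2] S by simp
  show ?thesis
  proof (cases "valid G")
    case False
    then have "\<chi> (contr X e (bb E e)) = 0"
      using invalid_expd[OF S2 y f] eq unfolding X_def G_def equi_def by blast
    then show ?thesis using False by (simp add: cterm_def)
  next
    case True
    have zf: "y \<notin> nodes G" "f \<notin> dom G" using y f by (auto simp: nodes_contr dom_contr G_def)
    interpret GX: expansion G "base G S" S y f using expansion_S2[OF red_S2[OF SG] zf] .
    have c1: "contraction (contr X e (bb E e)) f True y (base G S)"
      unfolding com by (rule GX.contraction_axioms)
    have c2: "contraction (contr X f True) e (bb E e) z u"
      unfolding X_def X.contr_expd by (rule contraction_axioms)
    have "e \<noteq> f" using f e_dom by metis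
    moreover have "z \<noteq> y" using y ey by (auto dest: halves_nodes)
    ultimately have anti: "csg X e (bb E e) * csg (contr X e (bb E e)) f True =
       - (csg X f True * csg E e (bb E e))"
      using csg_contr_anti[OF vcX vc _ _ c1 c2] unfolding X_def X.contr_expd by blast
    let ?a = "csg X e (bb E e)" and ?b = "csg (contr X e (bb E e)) f True"
      and ?c = "csg X f True" and ?d = "csg E e (bb E e)"
    have "?d * ?b = ?d * ?b * (?c * ?c) * (?a * ?a)" unfolding csg_sq by simp
    also have "\<dots> = (?a * ?b) * (?c * ?d) * (?c * ?a)" by (simp only: mult_ac)
    also have "\<dots> = - ((?c * ?c) * (?d * ?d) * (?c * ?a))" unfolding anti by (simp add: mult_ac)
    also have "\<dots> = - (?c * ?a)" unfolding csg_sq by simp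
    finally have "?d * ?b = - (?c * ?a)" .
    then show ?thesis using True SG unfolding xterm_def cterm_def com
      by (simp add: mult.assoc[symmetric])
  qed
qed

text \<open>Only contracting the bridge that carries \<open>S\<close> makes \<open>S\<close>
  suspendable. Suspending it again returns \<open>E\<close> up to the direction of that bridge, and
  the two signs cancel.\<close>

lemma suspended_term:
  assumes eq: "equi \<chi>" and val: "valid E" and S: "S \<in> S2 E" "S \<notin> red E"
    and y: "y \<notin> nodes E" and f: "f \<notin> dom E"
  shows "(\<Sum>e\<in>Br E. csg E e (bb E e) * (if valid (contr E e (bb E e)) \<and> S \<in> red (contr E e (bb E e))
     then xterm \<chi> (contr E e (bb E e)) S y f else 0)) = \<chi> E"
proof -
  obtain e0 c w u0 where e0: "bridge E e0 c w u0" "base E S = Some w" "halves E (Some w) - S = {(e0, c)}"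
    "valid (contr E e0 c)" using suspendedE[OF val S] .
  then interpret w: bridge E e0 c w u0 by simp
  have bb0: "bb E e0 = c" using bb_eq[OF e0(1)] .
  have e0B: "e0 \<in> Br E" using w.br by (auto simp: Br_def)
  have fin: "finite (Br E)" using finite_Br[OF valid_finite[OF val]] .
  let ?G = "contr E e0 c"
  have SG: "S \<in> red ?G" using w.red_contr[OF S(1)] e0(2) by simp
  have other: "\<not> S \<in> red (contr E e (bb E e))" if e: "e \<in> Br E" "e \<noteq> e0" for e
  proof
    assume r: "S \<in> red (contr E e (bb E e))"
    obtain z u where "bridge E e (bb E e) z u" using bb_bridge[OF val e(1)] .
    then interpret bridge E e "bb E e" z u .
    show False using suspended_unique[OF S r e0(1-3)] e(2) by simp
  qed
  have base: "base ?G S = u0" using w.base_contr[OF S(1)] e0(2) by simp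
  have fresh: "y \<notin> nodes ?G" "f \<notin> dom ?G" "w \<notin> nodes ?G" "e0 \<notin> dom ?G"
    using y f by (auto simp: w.nodes_contr w.dom_contr)
  have "xterm \<chi> ?G S y f = xterm \<chi> ?G S w e0"
    using xterm_indep[OF eq e0(4) SG fresh(3,4,1,2)] .
  also have "\<dots> = csg E e0 c * \<chi> E"
  proof (cases c)
    case True
    then show ?thesis unfolding xterm_def base using w.expd_contr[OF S(1) e0(2,3)] by simp
  next
    case False
    interpret r: relabelling E id id "{e0}" by (rule relabelling_id)
    have "csg (act id id {e0} E) (id e0) (c \<noteq> (e0 \<in> {e0})) * asg id id {e0} ?G = asg id id {e0} E * csg E e0 c"
      using csg_act[OF _ relabelling_id, of E e0 c w u0 "{e0}"] w.valid_contraction_axioms .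
    moreover have "asg id id {e0} E = ev" using w.e_dom by (simp add: asg_def)
    moreover have "asg id id {e0} ?G = 1" by (simp add: asg_def w.dom_contr)
    ultimately have "csg (act id id {e0} E) e0 True = ev * csg E e0 c" using False by simp
    moreover have "\<chi> (act id id {e0} E) = ev * \<chi> E"
      using equi_act[OF eq relabelling_id, of "{e0}" E] \<open>asg id id {e0} E = ev\<close> by simp
    ultimately have "xterm \<chi> ?G S w e0 = (ev * ev) * (csg E e0 c * \<chi> E)"
      unfolding xterm_def base using w.expd_contr[OF S(1) e0(2,3)] False by (simp add: mult_ac)
    then show ?thesis unfolding ev2 by simp
  qed
  finally have x: "csg E e0 c * xterm \<chi> ?G S y f = \<chi> E"
    by (simp add: mult.assoc[symmetric] csg_sq)
  have "(\<Sum>e\<in>Br E. csg E e (bb E e) * (if valid (contr E e (bb E e)) \<and> S \<in> red (contr E e (bb E e))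
     then xterm \<chi> (contr E e (bb E e)) S y f else 0)) = (\<Sum>e\<in>Br E. if e = e0 then \<chi> E else 0)"
    by (rule sum.cong[OF refl]) (use other x bb0 SG e0(4) in auto)
  also have "\<dots> = \<chi> E" using e0B fin by simp
  finally show ?thesis .
qed

lemma Br_nl: "valid E \<Longrightarrow> Br E \<subseteq> nl E"
proof
  fix e assume "valid E" "e \<in> Br E"
  then obtain z u where "bridge E e (bb E e) z u" by (rule bb_bridge)
  then interpret bridge E e "bb E e" z u .
  show "e \<in> nl E" using contraction_nl[OF contraction_axioms] .
qed

text \<open>\<open>van\<close> discards all terms in which a non-bridge is contracted: the
  suspension adds a bridge, contracting a non-bridge loses none, and the number of edges is
  restored. What remains are pairs of a bridge of \<open>E\<close> and an attachment, and the
  contraction of the new bridge itself.\<close>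

lemma hop_Dop:
  assumes eq: "equi \<chi>" and val: "valid E"
    and van: "\<And>E'. card (dom E') = card (dom E) \<Longrightarrow> card (Br E) < card (Br E') \<Longrightarrow> \<chi> E' = 0"
  shows "Dop (hop \<chi>) E + hop (Dop \<chi>) E = of_nat (card (S2 E)) * \<chi> E"
proof -
  define y f where "y = fr (nodes E)" and "f = fr (dom E)"
  have fin: "finite (dom E)" using valid_finite[OF val] .
  have finn: "finite (nodes E)" using finite_nodes[OF fin] .
  have y: "y \<notin> nodes E" and f: "f \<notin> dom E" unfolding y_def f_def using fr_notin fin finn by auto
  have finB: "finite (Br E)" and finR: "finite (red E)" and finS: "finite (S2 E)"
    using finite_Br finite_red finite_S2 fin by auto
  define W where "W = (\<lambda>e S. csg E e (bb E e) * (if valid (contr E e (bb E e)) \<and> S \<in> red (contr E e (bb E e))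
     then xterm \<chi> (contr E e (bb E e)) S y f else 0))"
  define X where "X = (\<lambda>S. expd E (base E S) S y f)"
  have "Dop (hop \<chi>) E = (\<Sum>e\<in>nl E. cterm (hop \<chi>) E e (side E e))"
    using val by (simp add: Dop_def Dsel_def)
  also have "\<dots> = (\<Sum>e\<in>Br E. cterm (hop \<chi>) E e (side E e))"
  proof (rule sum.mono_neutral_right)
    show "finite (nl E)" using finite_nl fin by blast
    show "Br E \<subseteq> nl E" using Br_nl val .
    show "\<forall>e\<in>nl E - Br E. cterm (hop \<chi>) E e (side E e) = 0"
    proof
      fix e assume e: "e \<in> nl E - Br E"
      obtain z u where "contraction E e (side E e) z u" using nl_contraction e by blast
      then interpret valid_contraction E e "side E e" z u
        using val by (simp add: valid_contraction_def valid_contraction_axioms_def)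
      let ?G = "contr E e (side E e)"
      have "hop \<chi> ?G = 0"
      proof (cases "valid ?G")
        case True
        have finG: "finite (dom ?G)" using valid_finite[OF True] .
        define y' f' where "y' = fr (nodes ?G)" and "f' = fr (dom ?G)"
        have y': "y' \<notin> nodes ?G" and f': "f' \<notin> dom ?G"
          unfolding y'_def f'_def using fr_notin finG finite_nodes by auto
        have "xterm \<chi> ?G S y' f' = 0" if S: "S \<in> red ?G" for S
        proof -
          interpret x: expansion ?G "base ?G S" S y' f' using expansion_S2[OF red_S2[OF S] y' f'] .
          have "card (dom (expd ?G (base ?G S) S y' f')) = card (dom E)"
            unfolding x.dom_expd using f' finG card_Suc_Diff1[OF fin e_dom] unfolding dom_contr
            by (metis card_insert_disjoint)
          moreover have "Br E \<subseteq> Br ?G" using Br_contr_sub e by blast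
          then have "card (Br E) < card (Br (expd ?G (base ?G S) S y' f'))"
            using Br_expd[OF True S y' f'] f_notin_Br[OF True S y' f'] finite_Br[OF finG]
            by (simp add: card_mono less_Suc_eq_le)
          ultimately show ?thesis using van by (simp add: xterm_def)
        qed
        then show ?thesis by (simp add: hop_def y'_def f'_def)
      qed (simp add: hop_def)
      then show "cterm (hop \<chi>) E e (side E e) = 0" by (simp add: cterm_def)
    qed
  qed
  also have "\<dots> = (\<Sum>e\<in>Br E. \<Sum>S\<in>S2 E. W e S)"
  proof (rule sum.cong[OF refl])
    fix e assume e: "e \<in> Br E"
    obtain z u where "bridge E e (bb E e) z u" using bb_bridge[OF val e] .
    then interpret bridge E e "bb E e" z u .
    let ?G = "contr E e (bb E e)"
    have "hop \<chi> ?G = (\<Sum>S\<in>S2 E. if valid ?G \<and> S \<in> red ?G then xterm \<chi> ?G S y f else 0)"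
    proof (cases "valid ?G")
      case True
      have finG: "finite (dom ?G)" using valid_finite[OF True] .
      have yf: "y \<notin> nodes ?G" "f \<notin> dom ?G" using y f by (auto simp: nodes_contr dom_contr)
      have "hop \<chi> ?G = (\<Sum>S\<in>red ?G. xterm \<chi> ?G S y f)"
        unfolding hop_def using True
        by (auto intro!: sum.cong xterm_indep[OF eq True _ yf] fr_notin finG finite_nodes)
      also have "\<dots> = (\<Sum>S\<in>S2 E. if S \<in> red ?G then xterm \<chi> ?G S y f else 0)"
      proof -
        have "{S \<in> S2 E. S \<in> red ?G} = red ?G" using red_S2[of _ ?G] S2_contr by auto
        then show ?thesis using finS by (simp add: sum.inter_filter[symmetric])
      qed
      finally show ?thesis using True by simp
    qed (simp add: hop_def)
    then show "cterm (hop \<chi>) E e (side E e) = (\<Sum>S\<in>S2 E. W e S)"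
      unfolding cterm_side[OF equi_hop[OF eq] val contraction_axioms]
      by (simp add: cterm_def W_def sum_distrib_left)
  qed
  also have "\<dots> = (\<Sum>S\<in>S2 E. \<Sum>e\<in>Br E. W e S)" by (rule sum.swap)
  also have "\<dots> = (\<Sum>S\<in>red E. \<Sum>e\<in>Br E. W e S) + (\<Sum>S\<in>S2 E - red E. \<Sum>e\<in>Br E. W e S)"
    using sum.subset_diff[of "red E" "S2 E"] red_S2 finS by (metis (no_types, lifting) add.commute subsetI)
  \<comment> \<open>Each attachment that already hangs on a bridge contributes
    \<open>\<chi> E\<close> once.\<close>
  also have "(\<Sum>S\<in>S2 E - red E. \<Sum>e\<in>Br E. W e S) = of_nat (card (S2 E - red E)) * \<chi> E"
    using suspended_term[OF eq val _ _ y f] unfolding W_def by simp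
  finally have 1: "Dop (hop \<chi>) E = (\<Sum>S\<in>red E. \<Sum>e\<in>Br E. W e S) + of_nat (card (S2 E - red E)) * \<chi> E" .
  have "hop (Dop \<chi>) E = (\<Sum>S\<in>red E. csg (X S) f True * Dop \<chi> (X S))"
    using val by (simp add: hop_def xterm_def X_def y_def f_def)
  also have "\<dots> = (\<Sum>S\<in>red E. \<chi> E + (\<Sum>e\<in>Br E. csg (X S) f True * cterm \<chi> (X S) e (bb E e)))"
  proof (rule sum.cong[OF refl])
    fix S assume S: "S \<in> red E"
    have S2: "S \<in> S2 E" using S by (rule red_S2)
    interpret x: expansion E "base E S" S y f using expansion_S2[OF S2 y f] .
    interpret bX: bridge "X S" f True y "base E S" unfolding X_def using bridge_expd[OF val S y f] .
    have BX: "Br (X S) = insert f (Br E)" "f \<notin> Br E"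
      unfolding X_def using Br_expd[OF val S y f] f_notin_Br[OF val S y f] by auto
    have "Dop \<chi> (X S) = (\<Sum>e\<in>nl (X S). cterm \<chi> (X S) e (side (X S) e))"
      using bX.val by (simp add: Dop_def Dsel_def)
    also have "\<dots> = (\<Sum>e\<in>Br (X S). cterm \<chi> (X S) e (side (X S) e))"
    proof (rule sum.mono_neutral_right)
      show "finite (nl (X S))" using finite_nl valid_finite[OF bX.val] by blast
      show "Br (X S) \<subseteq> nl (X S)" using Br_nl bX.val .
      show "\<forall>e\<in>nl (X S) - Br (X S). cterm \<chi> (X S) e (side (X S) e) = 0"
      proof
        fix e assume e: "e \<in> nl (X S) - Br (X S)"
        obtain z u where "contraction (X S) e (side (X S) e) z u" using nl_contraction e by blast
        then interpret c: valid_contraction "X S" e "side (X S) e" z u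
          using bX.val by (simp add: valid_contraction_def valid_contraction_axioms_def)
        let ?G = "contr (X S) e (side (X S) e)"
        have "card (dom ?G) = card (dom (X S)) - 1" using c.dom_contr c.e_dom by simp
        also have "\<dots> = card (dom E)" unfolding X_def x.dom_expd using f fin by simp
        finally have "card (dom ?G) = card (dom E)" .
        moreover have "card (Br (X S)) \<le> card (Br ?G)"
          by (rule card_mono[OF finite_Br[OF c.finite_contr]]) (use c.Br_contr_sub e in blast)
        then have "card (Br E) < card (Br ?G)" using BX finB by simp
        ultimately show "cterm \<chi> (X S) e (side (X S) e) = 0" using van by (simp add: cterm_def)
      qed
    qed
    also have "\<dots> = cterm \<chi> (X S) f (side (X S) f) + (\<Sum>e\<in>Br E. cterm \<chi> (X S) e (side (X S) e))"
      using BX finB by simp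
    \<comment> \<open>Contracting the new bridge returns \<open>E\<close>: the diagonal contribution
      of an attachment that can be suspended.\<close>
    also have "cterm \<chi> (X S) f (side (X S) f) = csg (X S) f True * \<chi> E"
      unfolding cterm_side[OF eq bX.val bX.contraction_axioms]
      unfolding cterm_def unfolding X_def x.contr_expd ..
    also have "(\<Sum>e\<in>Br E. cterm \<chi> (X S) e (side (X S) e)) = (\<Sum>e\<in>Br E. cterm \<chi> (X S) e (bb E e))"
    proof (rule sum.cong[OF refl])
      fix e assume e: "e \<in> Br E"
      obtain z u where "bridge E e (bb E e) z u" using bb_bridge[OF val e] .
      then interpret bridge E e "bb E e" z u .
      show "cterm \<chi> (X S) e (side (X S) e) = cterm \<chi> (X S) e (bb E e)"
        using cterm_side[OF eq bX.val] contraction_expd[OF S2 y f] unfolding X_def by blast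
    qed
    finally show "csg (X S) f True * Dop \<chi> (X S) =
        \<chi> E + (\<Sum>e\<in>Br E. csg (X S) f True * cterm \<chi> (X S) e (bb E e))"
      by (simp add: distrib_left sum_distrib_left mult.assoc[symmetric] csg_sq)
  qed
  finally have 2: "hop (Dop \<chi>) E =
      (\<Sum>S\<in>red E. \<chi> E + (\<Sum>e\<in>Br E. csg (X S) f True * cterm \<chi> (X S) e (bb E e)))" .
  have "(\<Sum>S\<in>red E. \<Sum>e\<in>Br E. W e S) + hop (Dop \<chi>) E =
     (\<Sum>S\<in>red E. \<chi> E + (\<Sum>e\<in>Br E. W e S + csg (X S) f True * cterm \<chi> (X S) e (bb E e)))"
    unfolding 2 sum.distrib[symmetric] by (simp add: sum.distrib algebra_simps)
  also have "\<dots> = (\<Sum>S\<in>red E. \<chi> E)"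
    using commute_term[OF eq val _ _ y f] unfolding W_def X_def by simp
  also have "\<dots> = of_nat (card (red E)) * \<chi> E" by simp
  finally have "Dop (hop \<chi>) E + hop (Dop \<chi>) E = of_nat (card (S2 E - red E)) * \<chi> E + of_nat (card (red E)) * \<chi> E"
    unfolding 1 by (simp add: algebra_simps)
  also have "\<dots> = of_nat (card (S2 E - red E) + card (red E)) * \<chi> E" by (simp add: algebra_simps)
  also have "card (S2 E - red E) + card (red E) = card (S2 E)"
    using card_Diff_subset[of "red E" "S2 E"] finR card_mono[OF finS, of "red E"] red_S2 by fastforce
  finally show ?thesis .
qed

section \<open>Acyclicity\<close>

definition lap :: "(sgraph \<Rightarrow> 'k) \<Rightarrow> sgraph \<Rightarrow> 'k" where
  "lap \<phi> E = Dop (hop \<phi>) E + hop (Dop \<phi>) E"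

text \<open>The operator \<open>lap\<close> preserves the number of edges and never removes bridges, so it is triangular
  for \<open>slack\<close>, with diagonal entries \<open>pcount\<close>.\<close>

definition slack :: "sgraph \<Rightarrow> nat" where
  "slack E = card (dom E) - card (Br E)"

definition pcount :: "sgraph \<Rightarrow> 'k" where
  "pcount E = of_nat (card (S2 E))"

text \<open>Characteristic 0 turns the existence of one attachment with two half-edges into
  invertibility of the diagonal.\<close>

lemma pcount_nz: "valid E \<Longrightarrow> pcount E \<noteq> 0"
  using S2_nonempty_ex[of E] finite_S2[OF valid_finite, of E] by (auto simp: pcount_def card_eq_0_iff)

text \<open>With the same number of edges, more bridges mean smaller \<open>slack\<close>, so the
  vanishing assumption supplies the one in \<open>hop_Dop\<close>.\<close>

lemma lap_triangular:
  assumes "equi \<chi>" "valid E" "\<And>E'. slack E' < slack E \<Longrightarrow> \<chi> E' = 0"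
  shows "lap \<chi> E = pcount E * \<chi> E"
  unfolding lap_def pcount_def
proof (rule hop_Dop[OF assms(1,2)])
  fix E' assume *: "card (dom E') = card (dom E)" "card (Br E) < card (Br E')"
  show "\<chi> E' = 0"
  proof (cases "valid E'")
    case True
    have "card (Br E') \<le> card (dom E')" using Br_dom valid_finite[OF True] by (rule card_mono[rotated])
    then have "slack E' < slack E" using * by (simp add: slack_def)
    then show ?thesis by (rule assms(3))
  next
    case False then show ?thesis using assms(1) by (simp add: equi_def)
  qed
qed

lemma equi_lin: "equi \<phi> \<Longrightarrow> equi \<psi> \<Longrightarrow> equi (\<lambda>E. a * \<phi> E + b * \<psi> E)"
  by (simp add: equi_def algebra_simps)

lemma equi_lap: "equi \<phi> \<Longrightarrow> equi (lap \<phi>)"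
  using equi_lin[OF equi_Dop[OF equi_hop] equi_hop[OF equi_Dop], of \<phi> \<phi> 1 1] by (simp add: lap_def[abs_def])

lemma lap_linear: "lap (\<lambda>E. a * \<phi> E + b * \<psi> E) = (\<lambda>E. a * lap \<phi> E + b * lap \<psi> E)"
  by (simp add: lap_def fun_eq_iff hop_linear Dop_def Dsel_linear algebra_simps)

lemma pcount_act: "relabelling E s t \<Longrightarrow> pcount (act s t F E) = pcount E"
proof -
  assume "relabelling E s t"
  then interpret relabelling E s t F .
  have "inj_on ((`) (half_map t F)) (S2 E)"
    by (rule inj_on_subset[OF inj_image_half_map]) (auto dest: S2_Sall)
  then show ?thesis by (simp add: pcount_def S2_act card_image)
qed

lemma slack_act: "relabelling E s t \<Longrightarrow> slack (act s t F E) = slack E"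
proof -
  assume "relabelling E s t"
  then interpret relabelling E s t F .
  have "inj_on t (Br E)" by (rule inj_on_subset[OF t Br_dom])
  then show ?thesis using t by (simp add: slack_def Br_act dom_act card_image)
qed

lemma equi_div: "equi \<phi> \<Longrightarrow> equi (\<lambda>E. \<phi> E / pcount E)"
  unfolding equi_def
proof (intro conjI allI impI)
  fix E F and s t :: "nat \<Rightarrow> nat"
  assume eq: "(\<forall>E. \<not> valid E \<longrightarrow> \<phi> E = 0) \<and>
     (\<forall>E s t F. valid E \<longrightarrow> inj_on s (nodes E) \<longrightarrow> inj_on t (dom E) \<longrightarrow> \<phi> (act s t F E) = asg s t F E * \<phi> E)"
    and v: "valid E" and st: "inj_on s (nodes E)" "inj_on t (dom E)"
  have r: "relabelling E s t" using st by unfold_locales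
  have "\<phi> (act s t F E) = asg s t F E * \<phi> E" using eq v st by blast
  then show "\<phi> (act s t F E) / pcount (act s t F E) = asg s t F E * (\<phi> E / pcount E)"
    unfolding pcount_act[OF r] by simp
qed simp

text \<open>Successive correction by the diagonal: each round makes \<open>lap\<close> correct at
  one more value of \<open>slack\<close> and changes nothing below it.\<close>

fun approx :: "(sgraph \<Rightarrow> 'k) \<Rightarrow> nat \<Rightarrow> sgraph \<Rightarrow> 'k" where
  "approx \<phi> 0 = (\<lambda>_. 0)"
| "approx \<phi> (Suc r) = (\<lambda>E. approx \<phi> r E + (\<phi> E - lap (approx \<phi> r) E) / pcount E)"

lemma equi_approx: "equi \<phi> \<Longrightarrow> equi (approx \<phi> r)"
proof (induction r)
  case (Suc r)
  have "equi (\<lambda>E. 1 * \<phi> E + (-1) * lap (approx \<phi> r) E)"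
    using Suc by (intro equi_lin equi_lap) auto
  then have "equi (\<lambda>E. 1 * approx \<phi> r E + 1 * ((1 * \<phi> E + (-1) * lap (approx \<phi> r) E) / pcount E))"
    using Suc by (intro equi_lin equi_div equi_lap) auto
  then show ?case by simp
qed (simp add: equi_def)

lemma approx_residue:
  assumes eq: "equi \<phi>" shows "slack E < r \<Longrightarrow> lap (approx \<phi> r) E = \<phi> E"
proof (induction r arbitrary: E)
  case (Suc r)
  define \<rho> where "\<rho> = (\<lambda>E. \<phi> E - lap (approx \<phi> r) E)"
  have er: "equi \<rho>"
    using equi_lin[OF eq equi_lap[OF equi_approx[OF eq, of r]], of 1 "-1"] by (simp add: \<rho>_def)
  have van: "\<rho> E' = 0" if "slack E' < r" for E' using Suc.IH[OF that] by (simp add: \<rho>_def)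
  have lin: "lap (approx \<phi> (Suc r)) E = lap (approx \<phi> r) E + lap (\<lambda>E. \<rho> E / pcount E) E"
    using lap_linear[of 1 "approx \<phi> r" 1 "\<lambda>E. \<rho> E / pcount E"] by (simp add: \<rho>_def fun_eq_iff)
  show ?case
  proof (cases "valid E")
    case True
    have "lap (\<lambda>E. \<rho> E / pcount E) E = pcount E * (\<rho> E / pcount E)"
      by (rule lap_triangular[OF equi_div[OF er] True]) (use van Suc.prems in auto)
    then show ?thesis using lin pcount_nz[OF True] by (simp add: \<rho>_def)
  next
    case False
    then show ?thesis using eq equi_lap[OF equi_approx[OF eq, of "Suc r"]] unfolding equi_def by simp
  qed
qed simp

lemma approx_stable:
  assumes eq: "equi \<phi>" shows "slack E < r \<Longrightarrow> r \<le> r' \<Longrightarrow> approx \<phi> r' E = approx \<phi> r E"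
proof (induction "r' - r" arbitrary: r')
  case (Suc d)
  then obtain r2 where r2: "r' = Suc r2" "r \<le> r2" "d = r2 - r" by (cases r') auto
  then show ?case using Suc approx_residue[OF eq, of E r2] by simp
qed simp

text \<open>At \<open>E\<close> the approximations are constant from round
  \<open>Suc (slack E)\<close> on. Taking this stable value graph by graph requires no common bound
  on \<open>slack\<close>, as is needed for infinite series.\<close>

lemma lap_surj:
  assumes eq: "equi \<phi>" obtains \<chi> where "equi \<chi>" "lap \<chi> = \<phi>"
proof -
  define \<chi> where "\<chi> = (\<lambda>E. approx \<phi> (Suc (slack E)) E)"
  have ech: "equi \<chi>"
    unfolding equi_def
  proof (intro conjI allI impI)
    fix E assume "\<not> valid E"
    then show "\<chi> E = 0" using equi_approx[OF eq, of "Suc (slack E)"] unfolding equi_def \<chi>_def by blast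
  next
    fix E F and s t :: "nat \<Rightarrow> nat" assume "inj_on s (nodes E)" "inj_on t (dom E)"
    then have r: "relabelling E s t" by unfold_locales
    show "\<chi> (act s t F E) = asg s t F E * \<chi> E"
      unfolding \<chi>_def slack_act[OF r] by (rule equi_act[OF equi_approx[OF eq] r])
  qed
  have "lap \<chi> E = \<phi> E" for E
  proof (cases "valid E")
    case True
    define R where "R = Suc (slack E)"
    \<comment> \<open>The limit agrees with stage \<open>R\<close> at all graphs of slack at most
      that of \<open>E\<close>, and \<open>lap\<close> at \<open>E\<close> sees no others.\<close>
    define \<delta> where "\<delta> = (\<lambda>E. 1 * \<chi> E + (-1) * approx \<phi> R E)"
    have "equi \<delta>" unfolding \<delta>_def using ech equi_approx[OF eq] by (rule equi_lin)
    moreover have van: "\<delta> E' = 0" if "slack E' < R" for E'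
      using approx_stable[OF eq, of E' "Suc (slack E')" R] that by (simp add: \<delta>_def \<chi>_def)
    ultimately have "lap \<delta> E = pcount E * \<delta> E"
      by (intro lap_triangular True) (simp_all add: R_def)
    then have "lap \<delta> E = 0" using van[of E] by (simp add: R_def)
    moreover have "lap \<delta> E = lap \<chi> E - lap (approx \<phi> R) E"
      unfolding \<delta>_def lap_linear by simp
    ultimately show ?thesis using approx_residue[OF eq, of E R] by (simp add: R_def)
  next
    case False
    then show ?thesis using eq equi_lap[OF ech] unfolding equi_def by simp
  qed
  then show thesis using that[OF ech] by blast
qed

lemma lap_inj:
  assumes eq: "equi \<chi>" and zero: "lap \<chi> = (\<lambda>_. 0)" shows "\<chi> E = 0"
proof (induction "slack E" arbitrary: E rule: less_induct)
  case less
  show ?case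
  proof (cases "valid E")
    case True
    have "lap \<chi> E = pcount E * \<chi> E" by (rule lap_triangular[OF eq True]) (use less in blast)
    then show ?thesis using zero pcount_nz[OF True] by simp
  qed (use eq in \<open>simp add: equi_def\<close>)
qed

text \<open>Write \<open>\<phi> = lap \<chi>\<close>. From \<open>D \<phi> = 0\<close> follows
  \<open>D h D \<chi> = 0\<close>, so \<open>lap\<close> kills \<open>D \<chi>\<close>; injectivity
  gives \<open>D \<chi> = 0\<close>, and therefore \<open>\<phi> = D h \<chi>\<close>.\<close>

lemma acyclic:
  assumes eq: "equi \<phi>" and D: "Dop \<phi> = (\<lambda>_. 0)"
  obtains \<psi> where "equi \<psi>" "Dop \<psi> = \<phi>"
proof -
  obtain \<chi> where \<chi>: "equi \<chi>" "lap \<chi> = \<phi>" using lap_surj[OF eq] .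
  have Dlin: "Dop (\<lambda>E. 1 * \<phi> E + 1 * \<psi> E) = (\<lambda>E. 1 * Dop \<phi> E + 1 * Dop \<psi> E)" for \<phi> \<psi>
    unfolding Dop_def by (rule Dsel_linear)
  have h0: "hop (\<lambda>_. 0) = (\<lambda>_. 0)" by (simp add: hop_def xterm_def fun_eq_iff)
  have "Dop (lap \<chi>) = (\<lambda>E. Dop (Dop (hop \<chi>)) E + Dop (hop (Dop \<chi>)) E)"
    using Dlin[of "Dop (hop \<chi>)" "hop (Dop \<chi>)"] by (simp add: lap_def[abs_def])
  also have "\<dots> = Dop (hop (Dop \<chi>))" using Dop_Dop[OF equi_hop[OF \<chi>(1)]] by simp
  finally have "Dop (hop (Dop \<chi>)) = (\<lambda>_. 0)" using \<chi>(2) D by simp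
  then have "lap (Dop \<chi>) = (\<lambda>_. 0)"
    using Dop_Dop[OF \<chi>(1)] h0 by (simp add: lap_def[abs_def])
  then have "Dop \<chi> = (\<lambda>_. 0)" using lap_inj[OF equi_Dop[OF \<chi>(1)]] by auto
  then have "lap \<chi> E = Dop (hop \<chi>) E" for E using h0 by (simp add: lap_def)
  then have "Dop (hop \<chi>) = \<phi>" using \<chi>(2) by auto
  then show thesis using that equi_hop[OF \<chi>(1)] by blast
qed

end

section \<open>From oriented graphs to star graphs\<close>

definition cend :: "ograph \<Rightarrow> nat \<Rightarrow> bool \<Rightarrow> nat" where
  "cend \<Gamma> e b = (case \<Gamma> ! e of Edge s t \<Rightarrow> if b then t else s | Vertex \<Rightarrow> 0)"

text \<open>Univalent vertices lose their labels, and each survives as a half-edge at the star. The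
  single edge with two hairs becomes a loop at the star.\<close>

definition star :: "ograph \<Rightarrow> sgraph" where
  "star \<Gamma> = (\<lambda>e. if e \<in> edges \<Gamma> then
     Some (\<lambda>b. if valence \<Gamma> (cend \<Gamma> e b) = 1 then None else Some (cend \<Gamma> e b)) else None)"

lemma cell_edge: "e \<in> edges \<Gamma> \<Longrightarrow> \<Gamma> ! e = Edge (cend \<Gamma> e False) (cend \<Gamma> e True)"
  by (cases "\<Gamma> ! e") (auto simp: edges_def cend_def)

lemma edges_finite [simp]: "finite (edges \<Gamma>)" and verts_finite [simp]: "finite (verts \<Gamma>)"
  by (auto simp: edges_def verts_def)

lemma half_edges_iff: "(e, b) \<in> half_edges \<Gamma> v \<longleftrightarrow> e \<in> edges \<Gamma> \<and> cend \<Gamma> e b = v"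
  by (cases "\<Gamma> ! e"; cases b) (auto simp: half_edges_def edges_def cend_def)

lemma finite_half_edges: "finite (half_edges \<Gamma> v)"
  by (rule finite_subset[of _ "edges \<Gamma> \<times> UNIV"]) (auto simp: half_edges_iff)

lemma verts_edges: "verts \<Gamma> \<inter> edges \<Gamma> = {}" "verts \<Gamma> \<union> edges \<Gamma> = {..<length \<Gamma>}"
  by (auto simp: verts_def edges_def)

lemma wf_cend: "wf_ograph \<Gamma> \<Longrightarrow> e \<in> edges \<Gamma> \<Longrightarrow> cend \<Gamma> e b \<in> verts \<Gamma>"
proof -
  assume wf: "wf_ograph \<Gamma>" and e: "e \<in> edges \<Gamma>"
  have "Edge (cend \<Gamma> e False) (cend \<Gamma> e True) \<in> set \<Gamma>"
    using cell_edge[OF e] e by (metis (no_types, lifting) edges_def mem_Collect_eq nth_mem)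
  then show ?thesis using wf by (cases b) (auto simp: wf_ograph_def)
qed

lemma wf_ograph_cend: "wf_ograph \<Gamma> \<longleftrightarrow> (\<forall>e\<in>edges \<Gamma>. \<forall>b. cend \<Gamma> e b \<in> verts \<Gamma>)"
proof
  assume *: "\<forall>e\<in>edges \<Gamma>. \<forall>b. cend \<Gamma> e b \<in> verts \<Gamma>"
  show "wf_ograph \<Gamma>"
    unfolding wf_ograph_def
  proof (intro allI impI)
    fix s t assume "Edge s t \<in> set \<Gamma>"
    then obtain e where e: "e < length \<Gamma>" "\<Gamma> ! e = Edge s t" by (auto simp: in_set_conv_nth)
    then have "e \<in> edges \<Gamma>" by (simp add: edges_def)
    then have "cend \<Gamma> e False \<in> verts \<Gamma>" "cend \<Gamma> e True \<in> verts \<Gamma>" using * by auto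
    then show "s \<in> verts \<Gamma> \<and> t \<in> verts \<Gamma>" using e by (simp add: cend_def)
  qed
qed (auto intro: wf_cend)

lemma dom_star: "dom (star \<Gamma>) = edges \<Gamma>"
  by (auto simp: star_def split: if_splits)

lemma halves_star: "(e, b) \<in> halves (star \<Gamma>) w \<longleftrightarrow>
    e \<in> edges \<Gamma> \<and> w = (if valence \<Gamma> (cend \<Gamma> e b) = 1 then None else Some (cend \<Gamma> e b))"
  by (auto simp: in_halves star_def)

lemma halves_star_Some: "halves (star \<Gamma>) (Some v) = (if valence \<Gamma> v = 1 then {} else half_edges \<Gamma> v)"
proof (rule set_eqI)
  fix h :: "nat \<times> bool"
  obtain e and b :: bool where h: "h = (e, b)" by force
  show "h \<in> halves (star \<Gamma>) (Some v) \<longleftrightarrow> h \<in> (if valence \<Gamma> v = 1 then {} else half_edges \<Gamma> v)"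
    unfolding h halves_star by (auto simp: half_edges_iff)
qed

lemma halves_star_None: "halves (star \<Gamma>) None = (\<Union>v\<in>{v. valence \<Gamma> v = 1}. half_edges \<Gamma> v)"
proof (rule set_eqI)
  fix h :: "nat \<times> bool"
  obtain e and b :: bool where h: "h = (e, b)" by force
  show "h \<in> halves (star \<Gamma>) None \<longleftrightarrow> h \<in> (\<Union>v\<in>{v. valence \<Gamma> v = 1}. half_edges \<Gamma> v)"
    unfolding h halves_star by (auto simp: half_edges_iff)
qed

lemma valence_pos: "0 < valence \<Gamma> v \<longleftrightarrow> half_edges \<Gamma> v \<noteq> {}"
  using finite_half_edges[of \<Gamma> v] by (auto simp: valence_def card_gt_0_iff)

lemma nodes_star: "nodes (star \<Gamma>) = {v. valence \<Gamma> v \<noteq> 1 \<and> 0 < valence \<Gamma> v}"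
proof (rule set_eqI)
  fix v
  show "v \<in> nodes (star \<Gamma>) \<longleftrightarrow> v \<in> {v. valence \<Gamma> v \<noteq> 1 \<and> 0 < valence \<Gamma> v}"
    unfolding mem_Collect_eq valence_pos nodes_halves halves_star_Some by (cases "valence \<Gamma> v = 1") simp_all
qed

definition adj :: "ograph \<Rightarrow> (nat \<times> nat) set" where
  "adj \<Gamma> = {(s, t). Edge s t \<in> set \<Gamma>} \<union> {(s, t). Edge s t \<in> set \<Gamma>}\<inverse>"

lemma connected_adj: "connected_ograph \<Gamma> \<longleftrightarrow> (\<forall>u\<in>verts \<Gamma>. \<forall>v\<in>verts \<Gamma>. (u, v) \<in> (adj \<Gamma>)\<^sup>*)"
  by (simp add: connected_ograph_def adj_def Let_def)

lemma adj_iff: "(u, v) \<in> adj \<Gamma> \<longleftrightarrow> (\<exists>e b. e \<in> edges \<Gamma> \<and> cend \<Gamma> e b = u \<and> cend \<Gamma> e (\<not> b) = v)"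
proof
  assume "(u, v) \<in> adj \<Gamma>"
  then have "Edge u v \<in> set \<Gamma> \<or> Edge v u \<in> set \<Gamma>" by (auto simp: adj_def)
  then obtain e where "e < length \<Gamma>" "\<Gamma> ! e = Edge u v \<or> \<Gamma> ! e = Edge v u" by (metis in_set_conv_nth)
  then have "e \<in> edges \<Gamma> \<and> (cend \<Gamma> e False = u \<and> cend \<Gamma> e True = v \<or> cend \<Gamma> e True = u \<and> cend \<Gamma> e False = v)"
    by (auto simp: edges_def cend_def)
  then show "\<exists>e b. e \<in> edges \<Gamma> \<and> cend \<Gamma> e b = u \<and> cend \<Gamma> e (\<not> b) = v" by (metis (full_types))
next
  assume "\<exists>e b. e \<in> edges \<Gamma> \<and> cend \<Gamma> e b = u \<and> cend \<Gamma> e (\<not> b) = v"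
  then obtain e b where e: "e \<in> edges \<Gamma>" "cend \<Gamma> e b = u" "cend \<Gamma> e (\<not> b) = v" by blast
  have "Edge (cend \<Gamma> e False) (cend \<Gamma> e True) \<in> set \<Gamma>"
    using cell_edge[OF e(1)] e(1) by (metis (no_types, lifting) edges_def mem_Collect_eq nth_mem)
  then show "(u, v) \<in> adj \<Gamma>" using e(2,3) by (cases b) (auto simp: adj_def)
qed

lemma adj_closed:
  assumes "(u, v) \<in> (adj \<Gamma>)\<^sup>*" "u \<in> X" "\<And>e b. e \<in> edges \<Gamma> \<Longrightarrow> cend \<Gamma> e b \<in> X \<Longrightarrow> cend \<Gamma> e (\<not> b) \<in> X"
  shows "v \<in> X"
  using assms(1,2)
proof (induction rule: rtrancl_induct)
  case (step a c)
  then show ?case using assms(3) unfolding adj_iff by blast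
qed

text \<open>The part of \<open>hairy\<close> that does not involve connectedness, with valence 0
  excluded as well; \<open>hairy_iff\<close> leaves the rest to \<open>valid\<close>.\<close>

definition good :: "ograph \<Rightarrow> bool" where
  "good \<Gamma> \<longleftrightarrow> wf_ograph \<Gamma> \<and> (\<forall>v\<in>verts \<Gamma>. valence \<Gamma> v = 1 \<or> 3 \<le> valence \<Gamma> v)"

text \<open>A vertex of valence 0 could not be connected to a univalent one.\<close>

lemma hairy_good: assumes h: "hairy \<Gamma>" shows "good \<Gamma>"
proof -
  have wf: "wf_ograph \<Gamma>" using h by (simp add: hairy_def)
  obtain u where u: "u \<in> verts \<Gamma>" "valence \<Gamma> u = 1" using h by (auto simp: hairy_def)
  have "valence \<Gamma> v = 1 \<or> 3 \<le> valence \<Gamma> v" if v: "v \<in> verts \<Gamma>" for v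
  proof (cases "u = v")
    case False
    have "(v, u) \<in> (adj \<Gamma>)\<^sup>*" using h v u by (auto simp: hairy_def connected_adj)
    then obtain w where "(v, w) \<in> adj \<Gamma>" using False by (metis converse_rtranclE)
    then have "half_edges \<Gamma> v \<noteq> {}" unfolding adj_iff using half_edges_iff by (metis empty_iff)
    then have "0 < valence \<Gamma> v" by (simp add: valence_pos)
    moreover have "valence \<Gamma> v \<noteq> 2" using h v by (auto simp: hairy_def)
    ultimately show ?thesis by linarith
  qed (use u in simp)
  then show ?thesis using wf by (simp add: good_def)
qed

lemma half_edges_verts: "wf_ograph \<Gamma> \<Longrightarrow> (e, b) \<in> half_edges \<Gamma> v \<Longrightarrow> v \<in> verts \<Gamma>"
  using wf_cend by (auto simp: half_edges_iff)

lemma good_nodes: "good \<Gamma> \<Longrightarrow> nodes (star \<Gamma>) = {v \<in> verts \<Gamma>. valence \<Gamma> v \<noteq> 1}"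
proof -
  assume g: "good \<Gamma>"
  have "v \<in> verts \<Gamma>" if "0 < valence \<Gamma> v" for v
    using that g half_edges_verts unfolding valence_pos good_def by fastforce
  moreover have "0 < valence \<Gamma> v" if "v \<in> verts \<Gamma>" "valence \<Gamma> v \<noteq> 1" for v
    using that g unfolding good_def by fastforce
  ultimately show ?thesis unfolding nodes_star by blast
qed

text \<open>A univalent vertex has just one half-edge, so allowing contacts at the star forgets no
  adjacency of the hairy graph: sets separated at the star are unions of connected
  components.\<close>

lemma good_valid_iff:
  assumes g: "good \<Gamma>"
  shows "valid (star \<Gamma>) \<longleftrightarrow> connected_ograph \<Gamma> \<and> (\<exists>v\<in>verts \<Gamma>. valence \<Gamma> v = 1)"
proof -
  have wf: "wf_ograph \<Gamma>" using g by (simp add: good_def)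
  have pos: "half_edges \<Gamma> v \<noteq> {}" if "v \<in> verts \<Gamma>" for v
    using g that unfolding good_def valence_pos[symmetric] by fastforce
  have N: "halves (star \<Gamma>) None \<noteq> {} \<longleftrightarrow> (\<exists>v\<in>verts \<Gamma>. valence \<Gamma> v = 1)"
  proof
    assume "halves (star \<Gamma>) None \<noteq> {}"
    then obtain v h where v: "valence \<Gamma> v = 1" "h \<in> half_edges \<Gamma> v" unfolding halves_star_None by blast
    then have "v \<in> verts \<Gamma>" using half_edges_verts[OF wf] by (cases h) blast
    then show "\<exists>v\<in>verts \<Gamma>. valence \<Gamma> v = 1" using v by blast
  next
    assume "\<exists>v\<in>verts \<Gamma>. valence \<Gamma> v = 1"
    then show "halves (star \<Gamma>) None \<noteq> {}" using pos unfolding halves_star_None by fastforce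
  qed
  have fin: "finite (dom (star \<Gamma>))" by (simp add: dom_star)
  have c3: "3 \<le> card (halves (star \<Gamma>) (Some v))" if "v \<in> nodes (star \<Gamma>)" for v
    using that g unfolding good_nodes[OF g] by (auto simp: halves_star_Some good_def valence_def[symmetric])
  have share: "h \<in> C"
    if C: "sep (star \<Gamma>) None C" and e: "e \<in> C" "h \<in> edges \<Gamma>" "cend \<Gamma> e b = cend \<Gamma> h c" for C e h b c
  proof (cases "valence \<Gamma> (cend \<Gamma> e b) = 1")
    case True
    have eE: "e \<in> edges \<Gamma>" using sep_subset[OF C] e(1) by (auto simp: dom_star)
    have "(e, b) \<in> half_edges \<Gamma> (cend \<Gamma> e b)" "(h, c) \<in> half_edges \<Gamma> (cend \<Gamma> e b)"
      using eE e by (auto simp: half_edges_iff)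
    moreover obtain x where "half_edges \<Gamma> (cend \<Gamma> e b) = {x}"
      using True unfolding valence_def by (auto simp: card_1_singleton_iff)
    ultimately show ?thesis using e(1) by auto
  next
    case False
    have eE: "e \<in> edges \<Gamma>" using sep_subset[OF C] e(1) by (auto simp: dom_star)
    have "(e, b) \<in> halves (star \<Gamma>) (Some (cend \<Gamma> e b))" using False eE by (simp add: halves_star)
    moreover have "(h, c) \<in> halves (star \<Gamma>) (Some (cend \<Gamma> e b))" using False e by (simp add: halves_star)
    ultimately show ?thesis using sepD[OF C e(1)] by blast
  qed
  have conn: "(\<forall>C. sep (star \<Gamma>) None C \<longrightarrow> C = {} \<or> C = dom (star \<Gamma>))" if con: "connected_ograph \<Gamma>"
  proof (intro allI impI)
    fix C assume C: "sep (star \<Gamma>) None C"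
    show "C = {} \<or> C = dom (star \<Gamma>)"
    proof (cases "C = {}")
      case False
      then obtain e where e: "e \<in> C" by blast
      have CE: "C \<subseteq> edges \<Gamma>" using sep_subset[OF C] by (simp add: dom_star)
      define X where "X = {v. \<exists>g\<in>C. \<exists>b. cend \<Gamma> g b = v}"
      have "h \<in> C" if h: "h \<in> edges \<Gamma>" for h
      proof -
        have "(cend \<Gamma> e True, cend \<Gamma> h True) \<in> (adj \<Gamma>)\<^sup>*"
          using con wf_cend[OF wf] e CE h unfolding connected_adj by blast
        moreover have "cend \<Gamma> e True \<in> X" using e by (auto simp: X_def)
        moreover have "cend \<Gamma> g (\<not> b) \<in> X" if g: "g \<in> edges \<Gamma>" "cend \<Gamma> g b \<in> X" for g b
        proof -
          obtain g' b' where g': "g' \<in> C" "cend \<Gamma> g' b' = cend \<Gamma> g b" using g(2) by (auto simp: X_def)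
          have "g \<in> C" using share[OF C g'(1) g(1) g'(2)] .
          then show ?thesis unfolding X_def by blast
        qed
        ultimately have "cend \<Gamma> h True \<in> X" by (rule adj_closed)
        then obtain g b where "g \<in> C" "cend \<Gamma> g b = cend \<Gamma> h True" by (auto simp: X_def)
        then show ?thesis using share[OF C _ h] by blast
      qed
      then show ?thesis using CE by (auto simp: dom_star)
    qed simp
  qed
  have conn': "connected_ograph \<Gamma>" if pr: "\<forall>C. sep (star \<Gamma>) None C \<longrightarrow> C = {} \<or> C = dom (star \<Gamma>)"
    unfolding connected_adj
  proof (intro ballI)
    fix u v assume u: "u \<in> verts \<Gamma>" and v: "v \<in> verts \<Gamma>"
    define C where "C = {g \<in> edges \<Gamma>. (u, cend \<Gamma> g True) \<in> (adj \<Gamma>)\<^sup>*}"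
    have both: "g \<in> C" if "g \<in> edges \<Gamma>" "(u, cend \<Gamma> g b) \<in> (adj \<Gamma>)\<^sup>*" for g b
    proof (cases b)
      case False
      have "(cend \<Gamma> g False, cend \<Gamma> g True) \<in> adj \<Gamma>"
        unfolding adj_iff using that(1) by (intro exI[of _ g] exI[of _ False]) simp
      then show ?thesis using that False by (auto simp: C_def)
    qed (use that in \<open>auto simp: C_def\<close>)
    have both': "(u, cend \<Gamma> g b) \<in> (adj \<Gamma>)\<^sup>*" if "g \<in> C" for g b
    proof (cases b)
      case False
      have "(cend \<Gamma> g True, cend \<Gamma> g False) \<in> adj \<Gamma>"
        unfolding adj_iff using that by (intro exI[of _ g] exI[of _ True]) (simp add: C_def)
      then show ?thesis using that False by (auto simp: C_def)
    qed (use that in \<open>auto simp: C_def\<close>)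
    have "sep (star \<Gamma>) None C"
    proof (rule sepI)
      show "C \<subseteq> dom (star \<Gamma>)" by (auto simp: C_def dom_star)
      fix w g b h c assume *: "g \<in> C" "(g, b) \<in> halves (star \<Gamma>) w" "(h, c) \<in> halves (star \<Gamma>) w" "w \<noteq> None"
      then have "cend \<Gamma> g b = cend \<Gamma> h c" "h \<in> edges \<Gamma>" by (auto simp: halves_star split: if_splits)
      then show "h \<in> C" using both both'[OF *(1), of b] by metis
    qed
    then have or: "C = {} \<or> C = dom (star \<Gamma>)" using pr by blast
    obtain g b where g: "(g, b) \<in> half_edges \<Gamma> u" using pos[OF u] by (metis all_not_in_conv surj_pair)
    have "g \<in> C" using both[of g b] g by (simp add: half_edges_iff)
    then have CE: "C = edges \<Gamma>" using or by (auto simp: dom_star)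
    obtain h c where h: "(h, c) \<in> half_edges \<Gamma> v" using pos[OF v] by (metis all_not_in_conv surj_pair)
    then show "(u, v) \<in> (adj \<Gamma>)\<^sup>*" using both'[of h c] CE by (simp add: half_edges_iff)
  qed
  show ?thesis unfolding valid_def using N fin c3 conn conn' by blast
qed

lemma hairy_iff: "hairy \<Gamma> \<longleftrightarrow> good \<Gamma> \<and> valid (star \<Gamma>)"
proof
  assume "hairy \<Gamma>"
  then show "good \<Gamma> \<and> valid (star \<Gamma>)" using hairy_good good_valid_iff by (auto simp: hairy_def)
next
  assume *: "good \<Gamma> \<and> valid (star \<Gamma>)"
  have "valence \<Gamma> v \<noteq> 2" if "v \<in> verts \<Gamma>" for v using * that by (fastforce simp: good_def)
  then show "hairy \<Gamma>" using * good_valid_iff by (auto simp: hairy_def good_def)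
qed

section \<open>Gradings\<close>

lemma hairs_star: "good \<Gamma> \<Longrightarrow> hairs \<Gamma> = card (halves (star \<Gamma>) None)"
proof -
  assume g: "good \<Gamma>"
  let ?U = "{v \<in> verts \<Gamma>. valence \<Gamma> v = 1}"
  have "{v. valence \<Gamma> v = 1} = ?U"
  proof -
    have "v \<in> verts \<Gamma>" if "valence \<Gamma> v = 1" for v
    proof -
      have "half_edges \<Gamma> v \<noteq> {}" using that valence_pos[of \<Gamma> v] by simp
      then show ?thesis using half_edges_verts[of \<Gamma>] g unfolding good_def by fastforce
    qed
    then show ?thesis by blast
  qed
  then have "card (halves (star \<Gamma>) None) = card (\<Union>v\<in>?U. half_edges \<Gamma> v)" by (simp add: halves_star_None)
  also have "\<dots> = (\<Sum>v\<in>?U. card (half_edges \<Gamma> v))"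
    by (rule card_UN_disjoint) (auto simp: finite_half_edges half_edges_iff)
  also have "\<dots> = card ?U" by (simp add: valence_def)
  finally show ?thesis by (simp add: hairs_def)
qed

lemma card_verts: "good \<Gamma> \<Longrightarrow> card (verts \<Gamma>) = card (nodes (star \<Gamma>)) + hairs \<Gamma>"
proof -
  assume g: "good \<Gamma>"
  have "verts \<Gamma> = nodes (star \<Gamma>) \<union> {v \<in> verts \<Gamma>. valence \<Gamma> v = 1}" unfolding good_nodes[OF g] by blast
  then have "card (verts \<Gamma>) = card (nodes (star \<Gamma>) \<union> {v \<in> verts \<Gamma>. valence \<Gamma> v = 1})" by simp
  also have "\<dots> = card (nodes (star \<Gamma>)) + card {v \<in> verts \<Gamma>. valence \<Gamma> v = 1}"
    by (rule card_Un_disjoint) (auto simp: good_nodes[OF g])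
  finally show ?thesis by (simp add: hairs_def)
qed

lemma length_star: "good \<Gamma> \<Longrightarrow>
    length \<Gamma> = card (nodes (star \<Gamma>)) + card (dom (star \<Gamma>)) + card (halves (star \<Gamma>) None)"
proof -
  assume g: "good \<Gamma>"
  have "length \<Gamma> = card (verts \<Gamma> \<union> edges \<Gamma>)" by (simp add: verts_edges)
  also have "\<dots> = card (verts \<Gamma>) + card (edges \<Gamma>)" by (rule card_Un_disjoint) (auto simp: verts_edges)
  finally show ?thesis using card_verts[OF g] hairs_star[OF g] by (simp add: dom_star)
qed

text \<open>A spanning tree is grown edge by edge. The bound is needed because the subtraction in
  \<open>loop_order\<close> is truncated.\<close>

lemma connected_card_verts:
  assumes wf: "wf_ograph \<Gamma>" and con: "connected_ograph \<Gamma>"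
  shows "card (verts \<Gamma>) \<le> card (edges \<Gamma>) + 1"
proof (cases "verts \<Gamma> = {}")
  case False
  have ex: "\<exists>X Y. X \<subseteq> verts \<Gamma> \<and> card X = Suc k \<and> Y \<subseteq> edges \<Gamma> \<and> card Y = k \<and> (\<forall>e\<in>Y. \<forall>b. cend \<Gamma> e b \<in> X)"
    if "Suc k \<le> card (verts \<Gamma>)" for k
    using that
  proof (induction k)
    case 0
    obtain v where "v \<in> verts \<Gamma>" using False by blast
    then show ?case by (intro exI[of _ "{v}"] exI[of _ "{}"]) auto
  next
    case (Suc k)
    then obtain X Y where XY: "X \<subseteq> verts \<Gamma>" "card X = Suc k" "Y \<subseteq> edges \<Gamma>" "card Y = k"
      "\<forall>e\<in>Y. \<forall>b. cend \<Gamma> e b \<in> X" by auto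
    have "\<exists>e b. e \<in> edges \<Gamma> \<and> cend \<Gamma> e b \<in> X \<and> cend \<Gamma> e (\<not> b) \<notin> X"
    proof (rule ccontr)
      assume "\<not> ?thesis"
      then have cl: "\<And>e b. e \<in> edges \<Gamma> \<Longrightarrow> cend \<Gamma> e b \<in> X \<Longrightarrow> cend \<Gamma> e (\<not> b) \<in> X" by blast
      have "X \<noteq> {}" using XY(2) by auto
      then obtain u where u: "u \<in> X" by blast
      have "v \<in> X" if "v \<in> verts \<Gamma>" for v
        by (rule adj_closed[OF _ u cl]) (use con u XY(1) that in \<open>auto simp: connected_adj\<close>)
      then have "X = verts \<Gamma>" using XY(1) by blast
      then show False using XY(2) Suc.prems by simp
    qed
    then obtain e b where e: "e \<in> edges \<Gamma>" "cend \<Gamma> e b \<in> X" "cend \<Gamma> e (\<not> b) \<notin> X" by blast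
    have "finite X" using XY(1) verts_finite by (rule finite_subset)
    moreover have "finite Y" using XY(3) edges_finite by (rule finite_subset)
    moreover have "e \<notin> Y" using XY(5) e(3) by auto
    moreover have "cend \<Gamma> e c = cend \<Gamma> e b \<or> cend \<Gamma> e c = cend \<Gamma> e (\<not> b)" for c by (cases "c = b") auto
    then have "\<forall>e'\<in>insert e Y. \<forall>c. cend \<Gamma> e' c \<in> insert (cend \<Gamma> e (\<not> b)) X"
      using XY(5) e(2) by (metis insert_iff)
    moreover have "insert (cend \<Gamma> e (\<not> b)) X \<subseteq> verts \<Gamma>" using XY(1) wf_cend[OF wf e(1)] by simp
    moreover have "insert e Y \<subseteq> edges \<Gamma>" using XY(3) e(1) by simp
    moreover have "card (insert (cend \<Gamma> e (\<not> b)) X) = Suc (Suc k)" using XY(2) e(3) \<open>finite X\<close> by simp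
    moreover have "card (insert e Y) = Suc k" using XY(4) \<open>e \<notin> Y\<close> \<open>finite Y\<close> by simp
    ultimately show ?case
      by (intro exI[of _ "insert (cend \<Gamma> e (\<not> b)) X"] exI[of _ "insert e Y"] conjI)
  qed
  obtain k where k: "card (verts \<Gamma>) = Suc k" using False by (metis card_0_eq not0_implies_Suc verts_finite)
  then obtain Y where "Y \<subseteq> edges \<Gamma>" "card Y = k" using ex[of k] by auto
  then show ?thesis using k card_mono[of "edges \<Gamma>" Y] by simp
qed simp

text \<open>The hairs cancel: each counts once as a vertex in Euler's formula and once in
  \<open>hairs\<close>. This is why contracting an edge at the star preserves the weight.\<close>

lemma weight_star:
  assumes h: "hairy \<Gamma>"
  shows "int (weight \<Gamma>) = int (card (dom (star \<Gamma>))) + 1 - int (card (nodes (star \<Gamma>)))"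
proof -
  have "card (verts \<Gamma>) \<le> card (edges \<Gamma>) + 1" using h by (intro connected_card_verts) (auto simp: hairy_def)
  then show ?thesis using card_verts[OF hairy_good[OF h]] by (simp add: weight_def loop_order_def dom_star)
qed

text \<open>With m = 0 neither the hairs nor the final shift by m contribute.\<close>

lemma degree_star:
  assumes g: "good \<Gamma>"
  shows "degree 0 n \<Gamma> = n * int (card (nodes (star \<Gamma>))) + (1 - n) * int (card (dom (star \<Gamma>)))"
proof -
  have "(\<Sum>i<length \<Gamma>. cell_degree 0 n \<Gamma> i) = (\<Sum>i\<in>verts \<Gamma> \<union> edges \<Gamma>. cell_degree 0 n \<Gamma> i)"
    by (simp add: verts_edges)
  also have "\<dots> = (\<Sum>i\<in>verts \<Gamma>. cell_degree 0 n \<Gamma> i) + (\<Sum>i\<in>edges \<Gamma>. cell_degree 0 n \<Gamma> i)"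
    by (rule sum.union_disjoint) (auto simp: verts_edges)
  also have "(\<Sum>i\<in>edges \<Gamma>. cell_degree 0 n \<Gamma> i) = (\<Sum>i\<in>edges \<Gamma>. 1 - n)"
    by (rule sum.cong[OF refl]) (simp add: cell_degree_def cell_edge)
  also have "(\<Sum>i\<in>verts \<Gamma>. cell_degree 0 n \<Gamma> i) = (\<Sum>i\<in>verts \<Gamma>. if i \<in> nodes (star \<Gamma>) then n else 0)"
    by (rule sum.cong[OF refl]) (auto simp: cell_degree_def verts_def good_nodes[OF g])
  also have "\<dots> = (\<Sum>i\<in>nodes (star \<Gamma>). n)"
    unfolding good_nodes[OF g] by (simp add: sum.If_cases Int_def)
  finally show ?thesis by (simp add: degree_def dom_star)
qed

lemma loop_order_star:
  assumes "good \<Gamma>"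
  shows "loop_order \<Gamma> = card (dom (star \<Gamma>)) + 1 - (card (nodes (star \<Gamma>)) + card (halves (star \<Gamma>) None))"
  using card_verts[OF assms] hairs_star[OF assms] by (simp add: loop_order_def dom_star)

section \<open>Reordering and reversal\<close>

text \<open>Common core of \<open>reorder_facts\<close> and \<open>reverse_facts\<close>: a
  bijection of positions that preserves cell types and incidences, with the edges in
  \<open>F\<close> reversed.\<close>

lemma star_iso_good:
  assumes g: "good \<Gamma>" and p: "bij_betw s {..<length \<Gamma>} {..<length \<Gamma>'}"
    and v: "\<And>i. i < length \<Gamma> \<Longrightarrow> s i \<in> verts \<Gamma>' \<longleftrightarrow> i \<in> verts \<Gamma>"
    and e: "\<And>e b. e \<in> edges \<Gamma> \<Longrightarrow> cend \<Gamma>' (s e) b = s (cend \<Gamma> e (b \<noteq> (e \<in> F)))"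
  shows "good \<Gamma>' \<and> star \<Gamma>' = act s s F (star \<Gamma>) \<and> (\<forall>i\<in>verts \<Gamma>. valence \<Gamma>' (s i) = valence \<Gamma> i)"
proof -
  have wf: "wf_ograph \<Gamma>" using g by (simp add: good_def)
  have inj: "inj_on s {..<length \<Gamma>}" using p by (simp add: bij_betw_def)
  have sub: "verts \<Gamma> \<subseteq> {..<length \<Gamma>}" "edges \<Gamma> \<subseteq> {..<length \<Gamma>}" by (auto simp: verts_def edges_def)
  have sE: "s i \<in> edges \<Gamma>' \<longleftrightarrow> i \<in> edges \<Gamma>" if "i < length \<Gamma>" for i
  proof -
    have "s i < length \<Gamma>'" using p that by (auto simp: bij_betw_def)
    then show ?thesis using v[OF that] that by (auto simp: verts_def edges_def)
  qed
  have E': "edges \<Gamma>' = s ` edges \<Gamma>"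
  proof (intro equalityI subsetI)
    fix j assume "j \<in> edges \<Gamma>'"
    moreover then have "j < length \<Gamma>'" by (simp add: edges_def)
    then have "j \<in> s ` {..<length \<Gamma>}" using p by (simp add: bij_betw_def)
    then obtain i where "i < length \<Gamma>" "j = s i" by auto
    ultimately show "j \<in> s ` edges \<Gamma>" using sE by blast
  qed (use sE sub in auto)
  have V': "verts \<Gamma>' = s ` verts \<Gamma>"
  proof (intro equalityI subsetI)
    fix j assume "j \<in> verts \<Gamma>'"
    moreover then have "j < length \<Gamma>'" by (simp add: verts_def)
    then have "j \<in> s ` {..<length \<Gamma>}" using p by (simp add: bij_betw_def)
    then obtain i where "i < length \<Gamma>" "j = s i" by auto
    ultimately show "j \<in> s ` verts \<Gamma>" using v by blast
  qed (use v sub in auto)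
  have ce: "cend \<Gamma> e b \<in> verts \<Gamma>" if "e \<in> edges \<Gamma>" for e b using wf_cend[OF wf that] .
  have val: "valence \<Gamma>' (s i) = valence \<Gamma> i" if i: "i \<in> verts \<Gamma>" for i
  proof -
    have "half_edges \<Gamma>' (s i) = half_map s F ` half_edges \<Gamma> i"
    proof (intro equalityI subsetI)
      fix h assume h: "h \<in> half_edges \<Gamma>' (s i)"
      obtain e' and b :: bool where eb: "h = (e', b)" by force
      then obtain e where e': "e \<in> edges \<Gamma>" "e' = s e" using h E' by (auto simp: half_edges_iff)
      have "s (cend \<Gamma> e (b \<noteq> (e \<in> F))) = s i" using h eb e' e[OF e'(1)] by (simp add: half_edges_iff)
      then have "cend \<Gamma> e (b \<noteq> (e \<in> F)) = i" using inj ce[OF e'(1)] i sub by (auto dest!: inj_onD)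
      then have "(e, b \<noteq> (e \<in> F)) \<in> half_edges \<Gamma> i" using e' by (simp add: half_edges_iff)
      moreover have "h = half_map s F (e, b \<noteq> (e \<in> F))" using eb e' by (auto simp: half_map_def)
      ultimately show "h \<in> half_map s F ` half_edges \<Gamma> i" by blast
    next
      fix h assume "h \<in> half_map s F ` half_edges \<Gamma> i"
      then obtain e b where eb: "(e, b) \<in> half_edges \<Gamma> i" "h = (s e, b \<noteq> (e \<in> F))" by (auto simp: half_map_def)
      then have e': "e \<in> edges \<Gamma>" "cend \<Gamma> e b = i" by (auto simp: half_edges_iff)
      have "((b \<noteq> (e \<in> F)) \<noteq> (e \<in> F)) = b" by auto
      then show "h \<in> half_edges \<Gamma>' (s i)" using eb e' e[OF e'(1), of "b \<noteq> (e \<in> F)"] E' by (simp add: half_edges_iff)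
    qed
    moreover have "inj_on (half_map s F) (half_edges \<Gamma> i)"
    proof (rule inj_onI)
      fix h h' assume h: "h \<in> half_edges \<Gamma> i" "h' \<in> half_edges \<Gamma> i" "half_map s F h = half_map s F h'"
      obtain g and b :: bool where gb: "h = (g, b)" by force
      obtain g' and b' :: bool where gb': "h' = (g', b')" by force
      have "g \<in> {..<length \<Gamma>}" "g' \<in> {..<length \<Gamma>}" using h gb gb' sub(2) by (auto simp: half_edges_iff)
      then have "g = g'" using inj_onD[OF inj, of g g'] h(3) gb gb' by (simp add: half_map_def)
      then show "h = h'" using h(3) gb gb' by (auto simp: half_map_def)
    qed
    ultimately show ?thesis by (simp add: valence_def card_image)
  qed
  have "wf_ograph \<Gamma>'" unfolding wf_ograph_cend E' V' using e ce by auto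
  then have "good \<Gamma>'" using g val unfolding good_def V' by auto
  moreover have "star \<Gamma>' = act s s F (star \<Gamma>)"
  proof (rule act_eqI)
    show "inj_on s (dom (star \<Gamma>))" using inj_on_subset[OF inj sub(2)] by (simp add: dom_star)
    show "dom (star \<Gamma>') = s ` dom (star \<Gamma>)" by (simp add: dom_star E')
    fix g p assume gp: "star \<Gamma> g = Some p"
    then have gE: "g \<in> edges \<Gamma>" using dom_star by auto
    then have "p = (\<lambda>b. if valence \<Gamma> (cend \<Gamma> g b) = 1 then None else Some (cend \<Gamma> g b))"
      using gp by (simp add: star_def)
    then show "star \<Gamma>' (s g) = Some (\<lambda>b. map_option s (p (b \<noteq> (g \<in> F))))"
      using gE E' e[OF gE] val ce[OF gE] by (auto simp: star_def fun_eq_iff)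
  qed
  ultimately show ?thesis using val by blast
qed

lemma reorder_facts:
  assumes g: "good \<Gamma>" and p: "s permutes {..<length \<Gamma>}"
  shows "good (reorder s \<Gamma>) \<and> star (reorder s \<Gamma>) = act s s {} (star \<Gamma>)"
proof -
  have len: "length (reorder s \<Gamma>) = length \<Gamma>" by (simp add: reorder_def)
  have nth: "reorder s \<Gamma> ! s i = map_cell s (\<Gamma> ! i)" if i: "i < length \<Gamma>" for i
  proof -
    have "s i < length \<Gamma>" using permutes_in_image[OF p, of i] i by simp
    moreover have "inv s (s i) = i" using permutes_inverses(2)[OF p] by simp
    ultimately show ?thesis by (simp add: reorder_def)
  qed
  have "good (reorder s \<Gamma>) \<and> star (reorder s \<Gamma>) = act s s {} (star \<Gamma>) \<and>
      (\<forall>i\<in>verts \<Gamma>. valence (reorder s \<Gamma>) (s i) = valence \<Gamma> i)"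
  proof (rule star_iso_good[OF g])
    show "bij_betw s {..<length \<Gamma>} {..<length (reorder s \<Gamma>)}" using permutes_imp_bij[OF p] len by simp
    fix i assume i: "i < length \<Gamma>"
    have "s i < length \<Gamma>" using permutes_in_image[OF p, of i] i by simp
    then show "s i \<in> verts (reorder s \<Gamma>) \<longleftrightarrow> i \<in> verts \<Gamma>"
      using nth[OF i] i len by (cases "\<Gamma> ! i") (auto simp: verts_def)
  next
    fix e b assume e: "e \<in> edges \<Gamma>"
    then have "e < length \<Gamma>" by (simp add: edges_def)
    then show "cend (reorder s \<Gamma>) (s e) b = s (cend \<Gamma> e (b \<noteq> (e \<in> {})))"
    proof -
      obtain a c where ac: "\<Gamma> ! e = Edge a c" using cell_edge[OF e] by blast
      then show ?thesis using nth[OF \<open>e < length \<Gamma>\<close>] by (simp add: cend_def)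
    qed
  qed
  then show ?thesis by blast
qed

lemma reverse_facts:
  assumes g: "good \<Gamma>" and e: "e < length \<Gamma>" "\<Gamma> ! e = Edge s t"
  shows "good (\<Gamma>[e := Edge t s]) \<and> star (\<Gamma>[e := Edge t s]) = act id id {e} (star \<Gamma>)"
proof -
  have "good (\<Gamma>[e := Edge t s]) \<and> star (\<Gamma>[e := Edge t s]) = act id id {e} (star \<Gamma>) \<and>
      (\<forall>i\<in>verts \<Gamma>. valence (\<Gamma>[e := Edge t s]) (id i) = valence \<Gamma> i)"
  proof (rule star_iso_good[OF g])
    show "bij_betw id {..<length \<Gamma>} {..<length (\<Gamma>[e := Edge t s])}" by simp
  next
    fix i assume "i < length \<Gamma>"
    then show "id i \<in> verts (\<Gamma>[e := Edge t s]) \<longleftrightarrow> i \<in> verts \<Gamma>"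
      using e by (cases "i = e") (auto simp: verts_def)
  next
    fix e' b assume "e' \<in> edges \<Gamma>"
    then show "cend (\<Gamma>[e := Edge t s]) (id e') b = id (cend \<Gamma> e' (b \<noteq> (e' \<in> {e})))"
      using e by (cases "e' = e") (auto simp: cend_def)
  qed
  then show ?thesis by blast
qed

section \<open>Symmetrisation\<close>

lemma minus_one_powi: "(- 1 :: 'a::field) powi k = (if even k then 1 else - 1)"
  by (simp add: power_int_minus_left)

text \<open>A vertex and an edge contribute the exponent n (1 - n), which is even or, for a hair, 0.
  Only pairs of internal vertices and pairs of edges remain, of parities n and 1 - n.\<close>

lemma koszul_star:
  assumes g: "good \<Gamma>" and p: "s permutes {..<length \<Gamma>}"
  shows "(koszul_sign 0 n s \<Gamma> :: 'a::field) =
    inv_sign ((- 1) powi n) s (nodes (star \<Gamma>)) * inv_sign (- ((- 1) powi n)) s (dom (star \<Gamma>))"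
proof -
  define K where "K = {(i, j). i < j \<and> j < length \<Gamma> \<and> s j < s i}"
  define f :: "nat \<times> nat \<Rightarrow> 'a" where
    "f = (\<lambda>(i, j). (-1) powi (cell_degree 0 n \<Gamma> i * cell_degree 0 n \<Gamma> j))"
  define A where "A = {(i, j). i \<in> nodes (star \<Gamma>) \<and> j \<in> nodes (star \<Gamma>) \<and> i < j}"
  define B where "B = {(i, j). i \<in> dom (star \<Gamma>) \<and> j \<in> dom (star \<Gamma>) \<and> i < j}"
  have N: "nodes (star \<Gamma>) \<subseteq> {..<length \<Gamma>}" "dom (star \<Gamma>) \<subseteq> {..<length \<Gamma>}"
    "nodes (star \<Gamma>) \<inter> dom (star \<Gamma>) = {}"
    unfolding good_nodes[OF g] dom_star by (auto simp: verts_def edges_def)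
  have finK: "finite K" by (rule finite_subset[of _ "{..<length \<Gamma>} \<times> {..<length \<Gamma>}"]) (auto simp: K_def)
  have finA: "finite A" "finite B"
    unfolding A_def B_def by (rule finite_ordered_pairs; use N finite_subset in blast)+
  have deg: "cell_degree 0 n \<Gamma> i = (if i \<in> nodes (star \<Gamma>) then n else if i \<in> dom (star \<Gamma>) then 1 - n else 0)"
    if "i < length \<Gamma>" for i
    using that unfolding good_nodes[OF g] dom_star
    by (cases "\<Gamma> ! i") (auto simp: cell_degree_def verts_def edges_def)
  have part: "(\<Prod>x\<in>X \<inter> K. f x) = inv_sign q s Y"
    if X: "X = {(i, j). i \<in> Y \<and> j \<in> Y \<and> i < j}" and Y: "Y \<subseteq> {..<length \<Gamma>}" "finite X"
      and q: "\<And>i j. i \<in> Y \<Longrightarrow> j \<in> Y \<Longrightarrow> f (i, j) = q" for X Y q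
  proof -
    have inj: "s i = s j \<Longrightarrow> i = j" for i j using permutes_inj[OF p] by (auto dest: injD)
    have "inv_sign q s Y = (\<Prod>x\<in>X. if x \<in> K then f x else 1)"
      unfolding inv_sign_def X[symmetric]
    proof (rule prod.cong[OF refl])
      fix x assume "x \<in> X"
      then obtain i j where ij: "x = (i, j)" "i \<in> Y" "j \<in> Y" "i < j" by (auto simp: X)
      then have "s i \<noteq> s j" using inj by auto
      moreover have "j < length \<Gamma>" using ij Y by auto
      ultimately show "(case x of (i, j) \<Rightarrow> if s i < s j then 1 else q) = (if x \<in> K then f x else 1)"
        using ij q by (auto simp: K_def)
    qed
    also have "\<dots> = (\<Prod>x\<in>X \<inter> K. f x)" using Y(2) by (simp add: prod.inter_restrict)
    finally show ?thesis by simp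
  qed
  have "koszul_sign 0 n s \<Gamma> = (\<Prod>x\<in>K. f x)" by (simp add: koszul_sign_def K_def f_def)
  also have "\<dots> = (\<Prod>x\<in>(A \<inter> K) \<union> (B \<inter> K). f x)"
  proof (rule prod.mono_neutral_right[OF finK])
    show "\<forall>x\<in>K - (A \<inter> K \<union> B \<inter> K). f x = 1"
    proof
      fix x assume x: "x \<in> K - (A \<inter> K \<union> B \<inter> K)"
      obtain i j where ij: "x = (i, j)" by force
      then have l: "i < j" "j < length \<Gamma>" "i < length \<Gamma>" using x by (auto simp: K_def)
      have "\<not> (i \<in> nodes (star \<Gamma>) \<and> j \<in> nodes (star \<Gamma>))" "\<not> (i \<in> dom (star \<Gamma>) \<and> j \<in> dom (star \<Gamma>))"
        using x ij l(1) by (auto simp: A_def B_def)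
      then have "even (cell_degree 0 n \<Gamma> i * cell_degree 0 n \<Gamma> j)"
        unfolding deg[OF l(2)] deg[OF l(3)] by auto
      then show "f x = 1" using ij by (simp add: f_def minus_one_powi)
    qed
  qed auto
  also have "\<dots> = (\<Prod>x\<in>A \<inter> K. f x) * (\<Prod>x\<in>B \<inter> K. f x)"
    by (rule prod.union_disjoint) (use finA N(3) in \<open>auto simp: A_def B_def\<close>)
  also have "(\<Prod>x\<in>A \<inter> K. f x) = inv_sign ((- 1) powi n) s (nodes (star \<Gamma>))"
  proof (rule part[OF A_def N(1) finA(1)])
    fix i j assume "i \<in> nodes (star \<Gamma>)" "j \<in> nodes (star \<Gamma>)"
    moreover then have "i < length \<Gamma>" "j < length \<Gamma>" using N by auto
    ultimately show "f (i, j) = (- 1) powi n" using deg by (simp add: f_def minus_one_powi)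
  qed
  also have "(\<Prod>x\<in>B \<inter> K. f x) = inv_sign (- ((- 1) powi n)) s (dom (star \<Gamma>))"
  proof (rule part[OF B_def N(2) finA(2)])
    fix i j assume *: "i \<in> dom (star \<Gamma>)" "j \<in> dom (star \<Gamma>)"
    moreover then have "i < length \<Gamma>" "j < length \<Gamma>" using N by auto
    moreover have "i \<notin> nodes (star \<Gamma>)" "j \<notin> nodes (star \<Gamma>)" using * N(3) by blast+
    ultimately show "f (i, j) = - ((- 1) powi n)" using deg by (simp add: f_def minus_one_powi)
  qed
  finally show ?thesis .
qed

text \<open>The isomorphism says nothing about univalent vertices, but their images are forced, as
  each is the end of a single half-edge.\<close>

lemma star_iso_reorder:
  assumes g: "good \<Gamma>" and g': "good \<Gamma>'" and r: "relabelling (star \<Gamma>) s t"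
    and st: "star \<Gamma>' = act s t {} (star \<Gamma>)"
  obtains p where "p permutes {..<length \<Gamma>}" "\<Gamma>' = reorder p \<Gamma>"
    "\<And>v. v \<in> nodes (star \<Gamma>) \<Longrightarrow> p v = s v" "\<And>e. e \<in> edges \<Gamma> \<Longrightarrow> p e = t e"
proof -
  interpret relabelling "star \<Gamma>" s t "{}" by fact
  have wf: "wf_ograph \<Gamma>" "wf_ograph \<Gamma>'" using g g' by (auto simp: good_def)
  have E': "edges \<Gamma>' = t ` edges \<Gamma>" using dom_act[of s t "{}" "star \<Gamma>"] unfolding st[symmetric] dom_star .
  have tE: "t e \<in> edges \<Gamma>'" if "e \<in> edges \<Gamma>" for e using that E' by auto
  have N': "nodes (star \<Gamma>') = s ` nodes (star \<Gamma>)" using st nodes_act[OF t] by simp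
  have ends: "(if valence \<Gamma>' (cend \<Gamma>' (t e) b) = 1 then None else Some (cend \<Gamma>' (t e) b)) =
      map_option s (if valence \<Gamma> (cend \<Gamma> e b) = 1 then None else Some (cend \<Gamma> e b))" if e: "e \<in> edges \<Gamma>" for e b
  proof -
    have "star \<Gamma> e = Some (\<lambda>b. if valence \<Gamma> (cend \<Gamma> e b) = 1 then None else Some (cend \<Gamma> e b))"
      using e by (simp add: star_def)
    from act_apply[OF t this, of s "{}"] have "star \<Gamma>' (t e) =
        Some (\<lambda>b. map_option s (if valence \<Gamma> (cend \<Gamma> e b) = 1 then None else Some (cend \<Gamma> e b)))"
      unfolding st[symmetric] by (simp cong: if_cong)
    then have "(\<lambda>b. if valence \<Gamma>' (cend \<Gamma>' (t e) b) = 1 then None else Some (cend \<Gamma>' (t e) b)) =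
        (\<lambda>b. map_option s (if valence \<Gamma> (cend \<Gamma> e b) = 1 then None else Some (cend \<Gamma> e b)))"
      using tE[OF e] by (simp add: star_def)
    then show ?thesis by (rule fun_cong)
  qed
  have uni: "\<exists>e b. (e, b) \<in> half_edges \<Gamma> i" if "valence \<Gamma> i = 1" for i
    using that valence_pos[of \<Gamma> i] by auto
  have uniq: "h = h'" if "valence \<Delta> i = 1" "h \<in> half_edges \<Delta> i" "h' \<in> half_edges \<Delta> i" for \<Delta> i h h'
    using that unfolding valence_def by (auto simp: card_1_singleton_iff)
  define hf where "hf = (\<lambda>i. SOME h. h \<in> half_edges \<Gamma> i)"
  have hf: "hf i \<in> half_edges \<Gamma> i" if "valence \<Gamma> i = 1" for i
    unfolding hf_def using uni[OF that] by (metis someI)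
  \<comment> \<open>A univalent vertex goes to the corresponding end of the image of its
    edge.\<close>
  define p where "p = (\<lambda>i. if i \<in> edges \<Gamma> then t i else if i \<in> nodes (star \<Gamma>) then s i
    else if i \<in> verts \<Gamma> then cend \<Gamma>' (t (fst (hf i))) (snd (hf i)) else i)"
  have disj: "i \<notin> edges \<Gamma>" if "i \<in> verts \<Gamma>" for i using that verts_edges(1)[of \<Gamma>] by blast
  have pN: "p v = s v" if "v \<in> nodes (star \<Gamma>)" for v
    using that disj unfolding good_nodes[OF g] p_def by auto
  have pU: "p i = cend \<Gamma>' (t e) b \<and> valence \<Gamma>' (p i) = 1 \<and> p i \<in> verts \<Gamma>'"
    if i: "i \<in> verts \<Gamma>" "valence \<Gamma> i = 1" "(e, b) \<in> half_edges \<Gamma> i" for i e b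
  proof -
    have "hf i = (e, b)" using uniq[OF i(2) hf[OF i(2)] i(3)] .
    moreover have "i \<notin> nodes (star \<Gamma>)" using i(2) by (simp add: good_nodes[OF g])
    ultimately have p: "p i = cend \<Gamma>' (t e) b" using i(1) disj by (simp add: p_def)
    have "e \<in> edges \<Gamma>" "cend \<Gamma> e b = i" using i(3) by (auto simp: half_edges_iff)
    then show ?thesis using ends[of e b] i(2) p wf_cend[OF wf(2) tE] by (simp split: if_splits)
  qed
  have pend: "p (cend \<Gamma> e b) = cend \<Gamma>' (t e) b" if e: "e \<in> edges \<Gamma>" for e b
  proof (cases "valence \<Gamma> (cend \<Gamma> e b) = 1")
    case True
    then show ?thesis using pU[OF wf_cend[OF wf(1) e] True, of e b] e by (simp add: half_edges_iff)
  next
    case False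
    then have "cend \<Gamma> e b \<in> nodes (star \<Gamma>)" using wf_cend[OF wf(1) e] by (simp add: good_nodes[OF g])
    then show ?thesis using pN ends[OF e, of b] False by (simp split: if_splits)
  qed
  have cases3: "i \<in> edges \<Gamma> \<or> i \<in> nodes (star \<Gamma>) \<or> (i \<in> verts \<Gamma> \<and> valence \<Gamma> i = 1)" if "i < length \<Gamma>" for i
    using that verts_edges(2)[of \<Gamma>] unfolding good_nodes[OF g] by blast
  have len: "length \<Gamma>' = length \<Gamma>"
  proof -
    have "card (halves (star \<Gamma>') None) = card (halves (star \<Gamma>) None)"
      using card_halves_act[OF s t, of None "{}"] st by simp
    moreover have "card (nodes (star \<Gamma>')) = card (nodes (star \<Gamma>))" using N' s by (simp add: card_image)
    moreover have "card (dom (star \<Gamma>')) = card (dom (star \<Gamma>))"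
      using t st dom_act[of s t "{}" "star \<Gamma>"] by (simp add: card_image)
    ultimately show ?thesis using length_star[OF g] length_star[OF g'] by simp
  qed
  have pv: "p i \<in> verts \<Gamma>'" if "i \<in> verts \<Gamma>" for i
  proof (cases "valence \<Gamma> i = 1")
    case True
    then obtain e b where "(e, b) \<in> half_edges \<Gamma> i" using uni by blast
    then show ?thesis using pU[OF that True] by blast
  next
    case False
    then have i: "i \<in> nodes (star \<Gamma>)" using that by (simp add: good_nodes[OF g])
    then have "s i \<in> nodes (star \<Gamma>')" using N' by blast
    then show ?thesis using pN[OF i] by (simp add: good_nodes[OF g'])
  qed
  have pE: "p e = t e" if "e \<in> edges \<Gamma>" for e using that by (simp add: p_def)
  have lt: "p i < length \<Gamma>" if "i < length \<Gamma>" for i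
  proof -
    have "i \<in> verts \<Gamma> \<union> edges \<Gamma>" using that verts_edges(2)[of \<Gamma>] by blast
    then have "p i \<in> verts \<Gamma>' \<union> edges \<Gamma>'" using pv pE tE by auto
    then show ?thesis using verts_edges(2)[of \<Gamma>'] len by auto
  qed
  have inj: "inj_on p {..<length \<Gamma>}"
  proof (rule inj_onI)
    fix i j assume ij: "i \<in> {..<length \<Gamma>}" "j \<in> {..<length \<Gamma>}" "p i = p j"
    have vE: "i \<in> edges \<Gamma> \<longleftrightarrow> p i \<in> edges \<Gamma>'" if "i < length \<Gamma>" for i
    proof -
      have "i \<in> verts \<Gamma> \<or> i \<in> edges \<Gamma>" using that verts_edges(2)[of \<Gamma>] by blast
      then show ?thesis using pv pE tE verts_edges(1)[of \<Gamma>'] disj by (metis disjoint_iff)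
    qed
    have vN: "i \<in> nodes (star \<Gamma>) \<longleftrightarrow> p i \<in> nodes (star \<Gamma>')" if "i \<in> verts \<Gamma>" for i
    proof (cases "valence \<Gamma> i = 1")
      case True
      then obtain e b where "(e, b) \<in> half_edges \<Gamma> i" using uni by blast
      then have "valence \<Gamma>' (p i) = 1" using pU[OF that True] by blast
      then show ?thesis using True unfolding good_nodes[OF g] good_nodes[OF g'] by simp
    next
      case False
      then have i: "i \<in> nodes (star \<Gamma>)" using that by (simp add: good_nodes[OF g])
      then show ?thesis using N' pN by auto
    qed
    show "i = j"
    proof (cases "i \<in> edges \<Gamma>")
      case True
      then have "j \<in> edges \<Gamma>" using vE ij by auto
      then show ?thesis using True ij pE t by (auto simp: dom_star dest: inj_onD)
    next
      case False
      then have "j \<notin> edges \<Gamma>" using vE[of i] vE[of j] ij by simp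
      then have v: "i \<in> verts \<Gamma>" "j \<in> verts \<Gamma>" using False ij by (auto simp: verts_def edges_def)
      show ?thesis
      proof (cases "i \<in> nodes (star \<Gamma>)")
        case True
        then have "j \<in> nodes (star \<Gamma>)" using vN v ij by auto
        then show ?thesis using True ij pN s by (auto dest: inj_onD)
      next
        case False
        then have "j \<notin> nodes (star \<Gamma>)" using vN v ij by auto
        then have u: "valence \<Gamma> i = 1" "valence \<Gamma> j = 1" using False v by (auto simp: good_nodes[OF g])
        obtain e b where e: "(e, b) \<in> half_edges \<Gamma> i" using uni u by blast
        obtain f c where f: "(f, c) \<in> half_edges \<Gamma> j" using uni u by blast
        have ef: "e \<in> edges \<Gamma>" "f \<in> edges \<Gamma>" using e f by (auto simp: half_edges_iff)
        have "(t e, b) \<in> half_edges \<Gamma>' (p i)" "(t f, c) \<in> half_edges \<Gamma>' (p i)"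
          using pU[OF v(1) u(1) e] pU[OF v(2) u(2) f] ij(3) tE[OF ef(1)] tE[OF ef(2)] by (auto simp: half_edges_iff)
        then have "(t e, b) = (t f, c)" using uniq pU[OF v(1) u(1) e] by blast
        then have "e = f" "b = c" using ef t by (auto simp: dom_star dest: inj_onD)
        then show ?thesis using e f by (simp add: half_edges_iff)
      qed
    qed
  qed
  have perm: "p permutes {..<length \<Gamma>}"
  proof (rule bij_imp_permutes)
    have "p ` {..<length \<Gamma>} \<subseteq> {..<length \<Gamma>}" using lt by auto
    then show "bij_betw p {..<length \<Gamma>} {..<length \<Gamma>}"
      using inj by (simp add: bij_betw_def endo_inj_surj)
    fix i assume "i \<notin> {..<length \<Gamma>}"
    then show "p i = i" unfolding p_def good_nodes[OF g] by (auto simp: verts_def edges_def)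
  qed
  have "\<Gamma>' = reorder p \<Gamma>"
  proof (rule nth_equalityI)
    show "length \<Gamma>' = length (reorder p \<Gamma>)" using len by (simp add: reorder_def)
    fix j assume j: "j < length \<Gamma>'"
    have "j \<in> p ` {..<length \<Gamma>}" using permutes_image[OF perm] j len by simp
    then obtain i where i: "i < length \<Gamma>" "j = p i" by auto
    have "inv p j = i" using permutes_inverses(2)[OF perm] i by simp
    then have r: "reorder p \<Gamma> ! j = map_cell p (\<Gamma> ! i)" using j len by (simp add: reorder_def)
    show "\<Gamma>' ! j = reorder p \<Gamma> ! j"
    proof (cases "i \<in> edges \<Gamma>")
      case True
      then have "\<Gamma>' ! j = Edge (cend \<Gamma>' (t i) False) (cend \<Gamma>' (t i) True)"
        using cell_edge[OF tE[OF True]] i pE by simp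
      moreover have "\<Gamma> ! i = Edge (cend \<Gamma> i False) (cend \<Gamma> i True)" using cell_edge[OF True] .
      ultimately show ?thesis unfolding r using pend[OF True] by simp
    next
      case False
      then have iv: "i \<in> verts \<Gamma>" using i verts_edges(2)[of \<Gamma>] by auto
      then have "\<Gamma>' ! j = Vertex" using pv i by (simp add: verts_def)
      then show ?thesis unfolding r using iv by (simp add: verts_def)
    qed
  qed
  then show thesis using that[of p] perm pN pE by blast
qed

text \<open>Internal vertices take the first \<open>N\<close> positions, edges the next
  \<open>M\<close>, and every half-edge at the star gets a univalent vertex of its own behind
  them.\<close>

lemma realize:
  assumes val: "valid G"
  obtains \<Gamma> s t where "hairy \<Gamma>" "relabelling G s t" "star \<Gamma> = act s t {} G"
proof -
  define N M H where "N = card (nodes G)" and "M = card (dom G)" and "H = card (halves G None)"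
  have fin: "finite (dom G)" using valid_finite[OF val] .
  obtain s where s: "bij_betw s (nodes G) {0..<N}"
    using ex_bij_betw_finite_nat[OF finite_nodes[OF fin]] by (auto simp: N_def)
  obtain t0 where t0: "bij_betw t0 (dom G) {0..<M}"
    using ex_bij_betw_finite_nat[OF fin] by (auto simp: M_def)
  obtain r0 where r0: "bij_betw r0 (halves G None) {0..<H}"
    using ex_bij_betw_finite_nat[OF finite_halves[OF fin]] by (auto simp: H_def)
  define t where "t = (\<lambda>g. N + t0 g)"
  define r where "r = (\<lambda>h. N + M + r0 h)"
  have si: "inj_on s (nodes G)" and sl: "v \<in> nodes G \<Longrightarrow> s v < N" for v
    using s by (auto simp: bij_betw_def)
  have ti: "inj_on t (dom G)" using t0 by (auto simp: bij_betw_def inj_on_def t_def)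
  have t0l: "g \<in> dom G \<Longrightarrow> t0 g < M" for g using t0 bij_betwE by fastforce
  have tl: "g \<in> dom G \<Longrightarrow> N \<le> t g \<and> t g < N + M" for g using t0l by (simp add: t_def)
  have ri: "inj_on r (halves G None)" using r0 by (auto simp: bij_betw_def inj_on_def r_def)
  have rl: "h \<in> halves G None \<Longrightarrow> N + M \<le> r h \<and> r h < N + M + H" for h
    using r0 bij_betwE[OF r0] by (fastforce simp: r_def)
  have rs: "\<exists>h\<in>halves G None. r h = i" if "N + M \<le> i" "i < N + M + H" for i
  proof -
    have "i - (N + M) \<in> r0 ` halves G None" using r0 that by (auto simp: bij_betw_def)
    then obtain h where "h \<in> halves G None" "r0 h = i - (N + M)" by auto
    then show ?thesis using that by (intro bexI[of _ h]) (auto simp: r_def)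
  qed
  have ss: "\<exists>v\<in>nodes G. s v = i" if "i < N" for i
  proof -
    have "i \<in> s ` nodes G" using s that by (simp add: bij_betw_def)
    then show ?thesis by auto
  qed
  have ts: "\<exists>g\<in>dom G. t g = i" if "N \<le> i" "i < N + M" for i
  proof -
    have "i - N \<in> t0 ` dom G" using t0 that by (auto simp: bij_betw_def)
    then obtain g where "g \<in> dom G" "i - N = t0 g" by (rule imageE)
    then show ?thesis using that by (intro bexI[of _ g]) (simp add: t_def \<open>i - N = t0 g\<close>[symmetric])
  qed
  define pos where "pos = (\<lambda>g b. case the (G g) b of None \<Rightarrow> r (g, b) | Some v \<Rightarrow> s v)"
  define \<Gamma> where "\<Gamma> = map (\<lambda>i. if N \<le> i \<and> i < N + M then
     Edge (pos (inv_into (dom G) t i) False) (pos (inv_into (dom G) t i) True) else Vertex) [0..<N + M + H]"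
  have len: "length \<Gamma> = N + M + H" by (simp add: \<Gamma>_def)
  have nth: "\<Gamma> ! i = (if N \<le> i \<and> i < N + M then
     Edge (pos (inv_into (dom G) t i) False) (pos (inv_into (dom G) t i) True) else Vertex)" if "i < N + M + H" for i
    unfolding \<Gamma>_def using that by simp
  have E: "edges \<Gamma> = {N..<N + M}" unfolding edges_def len by (auto simp: nth split: if_splits)
  have tE: "edges \<Gamma> = t ` dom G"
  proof (intro equalityI subsetI)
    fix i assume "i \<in> edges \<Gamma>"
    then have "N \<le> i" "i < N + M" by (auto simp: E)
    then show "i \<in> t ` dom G" using ts by (metis imageI)
  next
    fix i assume "i \<in> t ` dom G"
    then obtain g where "g \<in> dom G" "i = t g" by (rule imageE)
    then show "i \<in> edges \<Gamma>" using tl[of g] by (simp add: E)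
  qed
  have V: "verts \<Gamma> = {..<N} \<union> {N + M..<N + M + H}"
    unfolding verts_def len by (auto simp: nth split: if_splits)
  have ce: "cend \<Gamma> (t g) b = pos g b" if g: "g \<in> dom G" for g b
  proof -
    have "\<Gamma> ! t g = Edge (pos g False) (pos g True)"
      unfolding \<Gamma>_def using tl[OF g] ti g by simp
    then show ?thesis by (simp add: cend_def)
  qed
  have pos_None: "pos g b = r (g, b) \<and> N + M \<le> pos g b \<and> pos g b < N + M + H" if "(g, b) \<in> halves G None" for g b
    using that rl by (auto simp: pos_def in_halves)
  have pos_Some: "pos g b = s v \<and> pos g b < N" if "(g, b) \<in> halves G (Some v)" for g b v
    using that sl halves_nodes[OF that] by (auto simp: pos_def in_halves)
  have hcase: "(g, b) \<in> halves G None \<or> (\<exists>v. (g, b) \<in> halves G (Some v))" if "g \<in> dom G" for g b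
    using dom_halves[OF that, of b] by (metis not_Some_eq)
  have hs: "half_edges \<Gamma> (s v) = (\<lambda>(g, b). (t g, b)) ` halves G (Some v)" if v: "v \<in> nodes G" for v
  proof (intro equalityI subsetI)
    fix h assume h: "h \<in> half_edges \<Gamma> (s v)"
    obtain e and b :: bool where eb: "h = (e, b)" by force
    have "e \<in> t ` dom G" using h eb tE by (simp add: half_edges_iff)
    then obtain g where g: "g \<in> dom G" "e = t g" by blast
    have g3: "pos g b = s v" using h eb ce[OF g(1)] g(2) by (simp add: half_edges_iff)
    have "(g, b) \<notin> halves G None" using pos_None[of g b] g3 sl[OF v] by auto
    then obtain w where w: "(g, b) \<in> halves G (Some w)" using hcase[OF g(1)] by blast
    then have "w = v" using pos_Some[OF w] g3 si v halves_nodes[OF w] by (auto dest: inj_onD)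
    then show "h \<in> (\<lambda>(g, b). (t g, b)) ` halves G (Some v)" using w eb g(2) by (intro image_eqI[of _ _ "(g, b)"]) auto
  next
    fix h assume "h \<in> (\<lambda>(g, b). (t g, b)) ` halves G (Some v)"
    then obtain g b where g: "(g, b) \<in> halves G (Some v)" "h = (t g, b)" by auto
    then show "h \<in> half_edges \<Gamma> (s v)" using halves_dom[OF g(1)] tE ce pos_Some[OF g(1)] by (auto simp: half_edges_iff)
  qed
  have vs: "valence \<Gamma> (s v) = card (halves G (Some v))" if v: "v \<in> nodes G" for v
    unfolding valence_def hs[OF v]
    by (rule card_image) (auto simp: inj_on_def dest!: halves_dom intro: inj_onD[OF ti])
  have vr: "valence \<Gamma> (r h) = 1" if h: "h \<in> halves G None" for h
  proof -
    obtain g and b :: bool where gb: "h = (g, b)" by force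
    have "half_edges \<Gamma> (r h) = {(t g, b)}"
    proof (intro equalityI subsetI)
      fix h' assume h': "h' \<in> half_edges \<Gamma> (r h)"
      obtain e and c :: bool where ec: "h' = (e, c)" by force
      have "e \<in> t ` dom G" using h' ec tE by (simp add: half_edges_iff)
      then obtain g' where g': "g' \<in> dom G" "e = t g'" by blast
      have g3: "pos g' c = r h" using h' ec ce[OF g'(1)] g'(2) by (simp add: half_edges_iff)
      have "(g', c) \<in> halves G None"
        using hcase[OF g'(1), of c] pos_Some[of g' c] g3 rl[OF h] by fastforce
      then have "(g', c) = h" using pos_None[of g' c] g3 ri h by (auto dest: inj_onD)
      then show "h' \<in> {(t g, b)}" using gb ec g' by simp
    next
      fix h' assume "h' \<in> {(t g, b)}"
      then show "h' \<in> half_edges \<Gamma> (r h)"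
        using gb h halves_dom[of g b] tE ce pos_None[of g b] by (auto simp: half_edges_iff)
    qed
    then show ?thesis by (simp add: valence_def)
  qed
  have "wf_ograph \<Gamma>"
    unfolding wf_ograph_cend tE
  proof (intro ballI allI)
    fix e b assume "e \<in> t ` dom G"
    then obtain g where g: "g \<in> dom G" "e = t g" by auto
    have "pos g b < N \<or> (N + M \<le> pos g b \<and> pos g b < N + M + H)"
      using hcase[OF g(1), of b] pos_None[of g b] pos_Some[of g b] by blast
    then show "cend \<Gamma> e b \<in> verts \<Gamma>" using ce[OF g(1)] g(2) by (auto simp: V)
  qed
  moreover have "valence \<Gamma> i = 1 \<or> 3 \<le> valence \<Gamma> i" if i: "i \<in> verts \<Gamma>" for i
  proof (cases "i < N")
    case True
    then obtain v where "v \<in> nodes G" "s v = i" using ss by blast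
    then show ?thesis using vs valid_card[OF val] by auto
  next
    case False
    then have "N + M \<le> i" "i < N + M + H" using i by (auto simp: V)
    then obtain h where "h \<in> halves G None" "r h = i" using rs by blast
    then show ?thesis using vr[of h] by simp
  qed
  ultimately have good: "good \<Gamma>" by (simp add: good_def)
  have st: "star \<Gamma> = act s t {} G"
  proof (rule act_eqI[OF ti])
    show "dom (star \<Gamma>) = t ` dom G" by (simp add: dom_star tE)
    fix g q assume gq: "G g = Some q"
    then have g: "g \<in> dom G" by auto
    have "(if valence \<Gamma> (pos g b) = 1 then None else Some (pos g b)) = map_option s (q b)" for b
    proof (cases "q b")
      case None
      then have "(g, b) \<in> halves G None" using gq by (simp add: in_halves)
      then show ?thesis using pos_None vr None by simp
    next
      case (Some v)
      then have h: "(g, b) \<in> halves G (Some v)" using gq by (simp add: in_halves)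
      then have "3 \<le> valence \<Gamma> (pos g b)" using pos_Some[OF h] vs valid_card[OF val] halves_nodes[OF h] by simp
      then show ?thesis using pos_Some[OF h] Some by simp
    qed
    then show "star \<Gamma> (t g) = Some (\<lambda>b. map_option s (q (b \<noteq> (g \<in> {}))))"
      using g tE ce[OF g] by (simp add: star_def cong: if_cong)
  qed
  have rel: "relabelling G s t" using si ti by unfold_locales
  then interpret relabelling G s t "{}" .
  have "valid (star \<Gamma>)" using valid_act val st by simp
  then have "hairy \<Gamma>" using good by (simp add: hairy_iff)
  then show thesis using that rel st by blast
qed

lemma finite_good_lists: "finite {\<Gamma>. good \<Gamma> \<and> length \<Gamma> \<le> B}"
proof (rule finite_subset)
  let ?X = "insert Vertex ((\<lambda>(s, t). Edge s t) ` ({..<B} \<times> {..<B}))"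
  show "{\<Gamma>. good \<Gamma> \<and> length \<Gamma> \<le> B} \<subseteq> {\<Gamma>. set \<Gamma> \<subseteq> ?X \<and> length \<Gamma> \<le> B}"
  proof (intro subsetI CollectI conjI)
    fix \<Gamma> x assume \<Gamma>: "\<Gamma> \<in> {\<Gamma>. good \<Gamma> \<and> length \<Gamma> \<le> B}" and x: "x \<in> set \<Gamma>"
    then have wf: "wf_ograph \<Gamma>" and len: "length \<Gamma> \<le> B" by (auto simp: good_def)
    show "x \<in> ?X"
    proof (cases x)
      case (Edge s t)
      then have "s \<in> verts \<Gamma>" "t \<in> verts \<Gamma>" using wf x by (auto simp: wf_ograph_def)
      then have "s < B" "t < B" using len by (auto simp: verts_def)
      then show ?thesis using Edge by force
    qed simp
  qed simp
  show "finite {\<Gamma>. set \<Gamma> \<subseteq> ?X \<and> length \<Gamma> \<le> B}" by (rule finite_lists_length_le) simp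
qed

text \<open>Every edge has two half-edges, and every internal vertex uses at least three of
  them.\<close>

lemma valid_edge_bound:
  assumes val: "valid G" shows "card (halves G None) + 3 * card (nodes G) \<le> 2 * card (dom G)"
proof -
  have fin: "finite (dom G)" using valid_finite[OF val] .
  have finn: "finite (nodes G)" using finite_nodes[OF fin] .
  have "3 * card (nodes G) = (\<Sum>v\<in>nodes G. 3)" by simp
  also have "\<dots> \<le> (\<Sum>v\<in>nodes G. card (halves G (Some v)))"
    by (rule sum_mono) (use valid_card[OF val] in auto)
  also have "\<dots> = card (\<Union>v\<in>nodes G. halves G (Some v))"
    by (rule card_UN_disjoint[symmetric]) (use finn finite_halves[OF fin] in \<open>auto simp: in_halves\<close>)
  finally have "card (halves G None) + 3 * card (nodes G) \<le>
      card (halves G None) + card (\<Union>v\<in>nodes G. halves G (Some v))" by simp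
  also have "\<dots> = card (halves G None \<union> (\<Union>v\<in>nodes G. halves G (Some v)))"
    by (rule card_Un_disjoint[symmetric]) (use finn finite_halves[OF fin] in \<open>auto simp: in_halves\<close>)
  also have "\<dots> \<le> card (dom G \<times> (UNIV :: bool set))"
    by (rule card_mono) (use fin in \<open>auto dest: halves_dom\<close>)
  also have "\<dots> = 2 * card (dom G)" by (simp add: card_cartesian_product)
  finally show ?thesis .
qed

text \<open>With V internal vertices and D edges, g + h + V = D + 1 and h + 3 V <= 2 D give V <= 2 g
  + h - 2 and D <= 3 g + 2 h - 3. So there are at most 5 g + 4 h cells; the factor 10 is
  generous.\<close>

lemma finite_piece: "finite {\<Gamma>. hairy \<Gamma> \<and> hairs \<Gamma> = h \<and> loop_order \<Gamma> = g}"
proof (rule finite_subset[OF _ finite_good_lists[of "10 * g + 10 * h"]], intro subsetI CollectI conjI)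
  fix \<Gamma> assume "\<Gamma> \<in> {\<Gamma>. hairy \<Gamma> \<and> hairs \<Gamma> = h \<and> loop_order \<Gamma> = g}"
  then have \<Gamma>: "hairy \<Gamma>" "hairs \<Gamma> = h" "loop_order \<Gamma> = g" by auto
  show g: "good \<Gamma>" using \<Gamma>(1) by (rule hairy_good)
  have "int (g + h) = int (card (dom (star \<Gamma>))) + 1 - int (card (nodes (star \<Gamma>)))"
    using weight_star[OF \<Gamma>(1)] \<Gamma> by (simp add: weight_def)
  then have "g + h + card (nodes (star \<Gamma>)) = card (dom (star \<Gamma>)) + 1" by presburger
  moreover have "h + 3 * card (nodes (star \<Gamma>)) \<le> 2 * card (dom (star \<Gamma>))"
    using valid_edge_bound[of "star \<Gamma>"] \<Gamma> hairs_star[OF g] by (simp add: hairy_iff)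
  moreover have "length \<Gamma> = card (nodes (star \<Gamma>)) + card (dom (star \<Gamma>)) + h"
    using length_star[OF g] hairs_star[OF g] \<Gamma>(2) by simp
  moreover have "L \<le> 10 * g + 10 * h" if "g + h + V = D + 1" "h + 3 * V \<le> 2 * D" "L = V + D + h" for V D L :: nat
    using that by linarith
  ultimately show "length \<Gamma> \<le> 10 * g + 10 * h" by blast
qed

context hair_sign begin

lemma asg_cong:
  assumes "\<And>v. v \<in> nodes E \<Longrightarrow> s v = s' v" "\<And>g. g \<in> dom E \<Longrightarrow> t g = t' g" "F \<inter> dom E = F' \<inter> dom E"
  shows "asg s t F E = asg s' t' F' E"
  unfolding asg_def assms(3) using inv_sign_cong[of "nodes E" s s' ev] inv_sign_cong[of "dom E" t t' "- ev"] assms(1,2)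
  by simp

end

locale hgc_sign = fixes n :: int and ev :: "'k::field_char_0"
  assumes ev_n: "ev = (- 1) powi n"

sublocale hgc_sign \<subseteq> hair_sign ev
  by unfold_locales (simp add: ev_n minus_one_powi)

section \<open>Labellings: isomorphisms from a star graph to those of oriented graphs\<close>

type_synonym labelling = "ograph \<times> (nat \<Rightarrow> nat) \<times> (nat \<Rightarrow> nat) \<times> nat set"

text \<open>The oriented graphs realising \<open>G\<close>, each with an isomorphism; \<open>s\<close> and \<open>t\<close> are made extensional
  so that there are finitely many.\<close>

definition lab :: "sgraph \<Rightarrow> labelling set" where
  "lab G = {(\<Gamma>, s, t, F). hairy \<Gamma> \<and> s \<in> extensional (nodes G) \<and> t \<in> extensional (dom G) \<and>
     relabelling G s t \<and> F \<subseteq> dom G \<and> star \<Gamma> = act s t F G}"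

lemma labD: "(\<Gamma>, s, t, F) \<in> lab G \<Longrightarrow> hairy \<Gamma> \<and> s \<in> extensional (nodes G) \<and> t \<in> extensional (dom G) \<and>
     relabelling G s t \<and> F \<subseteq> dom G \<and> star \<Gamma> = act s t F G"
  by (simp add: lab_def)

lemma lab_valid: "(\<Gamma>, s, t, F) \<in> lab G \<Longrightarrow> valid G"
  using relabelling.valid_act[of G s t F] by (auto simp: lab_def hairy_iff)

lemma iso_cards:
  assumes "relabelling G s t" "G' = act s t F G"
  shows "card (nodes G') = card (nodes G)" "card (dom G') = card (dom G)"
    "card (halves G' None) = card (halves G None)"
proof -
  interpret relabelling G s t F by fact
  show "card (nodes G') = card (nodes G)" "card (dom G') = card (dom G)"
    unfolding assms(2) nodes_act[OF t] dom_act using s t by (auto simp: card_image)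
  show "card (halves G' None) = card (halves G None)"
    unfolding assms(2) using card_halves_act[OF s t, of None F] by simp
qed

lemma finite_lab: "finite (lab G)"
proof (cases "valid G")
  case True
  have fin: "finite (dom G)" using valid_finite[OF True] .
  define B where "B = card (nodes G) + card (dom G) + card (halves G None)"
  have "lab G \<subseteq> {\<Gamma>. good \<Gamma> \<and> length \<Gamma> \<le> B} \<times> (nodes G \<rightarrow>\<^sub>E {..<B}) \<times> (dom G \<rightarrow>\<^sub>E {..<B}) \<times> Pow (dom G)"
  proof (rule subsetI)
    fix x assume x: "x \<in> lab G"
    obtain \<Gamma> s t F where xx: "x = (\<Gamma>, s, t, F)" by (metis surj_pair)
    have l: "hairy \<Gamma>" "s \<in> extensional (nodes G)" "t \<in> extensional (dom G)" "relabelling G s t"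
      "F \<subseteq> dom G" "star \<Gamma> = act s t F G" using labD x unfolding xx by blast+
    interpret relabelling G s t F by fact
    have g: "good \<Gamma>" using l(1) by (rule hairy_good)
    have len: "length \<Gamma> = B" using length_star[OF g] iso_cards[OF l(4,6)] by (simp add: B_def)
    have "s ` nodes G \<subseteq> {..<B}"
      using nodes_act[OF t, of s F] l(6) good_nodes[OF g] len by (auto simp: verts_def)
    moreover have "t ` dom G \<subseteq> {..<B}"
      using dom_act[of s t F G] unfolding l(6)[symmetric] dom_star len[symmetric] by (auto simp: edges_def)
    ultimately have "s \<in> nodes G \<rightarrow>\<^sub>E {..<B}" "t \<in> dom G \<rightarrow>\<^sub>E {..<B}" using l(2,3) by (simp_all only: PiE_iff image_subset_iff simp_thms)
    then show "x \<in> {\<Gamma>. good \<Gamma> \<and> length \<Gamma> \<le> B} \<times> (nodes G \<rightarrow>\<^sub>E {..<B}) \<times> (dom G \<rightarrow>\<^sub>E {..<B}) \<times> Pow (dom G)"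
      unfolding xx using g len l(5) by simp
  qed
  moreover have "finite ({\<Gamma>. good \<Gamma> \<and> length \<Gamma> \<le> B} \<times> (nodes G \<rightarrow>\<^sub>E {..<B}) \<times> (dom G \<rightarrow>\<^sub>E {..<B}) \<times> Pow (dom G))"
    using fin finite_nodes[OF fin] finite_good_lists by (intro finite_cartesian_product finite_PiE) auto
  ultimately show ?thesis by (rule finite_subset)
next
  case False
  then have "lab G = {}" using lab_valid by fastforce
  then show ?thesis by simp
qed

lemma act_restrict:
  assumes "inj_on t (dom G)" "F \<inter> dom G = F' \<inter> dom G"
  shows "act (restrict s (nodes G)) (restrict t (dom G)) F G = act s t F' G"
  by (rule sym, rule act_cong) (use assms in auto)

lemma relabelling_restrict: "relabelling G (restrict s (nodes G)) (restrict t (dom G)) \<longleftrightarrow> relabelling G s t"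
  by (simp add: relabelling_def)

lemma relabelling_comp:
  assumes "relabelling G a b" "relabelling (act a b P G) s t"
  shows "relabelling G (s \<circ> a) (t \<circ> b)"
proof -
  interpret relabelling G a b P by fact
  interpret r: relabelling "act a b P G" s t P by fact
  show ?thesis using s t r.s r.t comp_inj_on unfolding nodes_act[OF t] dom_act by unfold_locales blast+
qed

text \<open>Precomposition with an isomorphism from \<open>G\<close> to \<open>act a b P G\<close>;
  \<open>restrict\<close> keeps the maps extensional, and reversals combine by symmetric
  difference.\<close>

definition lab_pull :: "(nat \<Rightarrow> nat) \<Rightarrow> (nat \<Rightarrow> nat) \<Rightarrow> nat set \<Rightarrow> sgraph \<Rightarrow> labelling \<Rightarrow> labelling" where
  "lab_pull a b P G = (\<lambda>(\<Gamma>, s, t, F). (\<Gamma>, restrict (s \<circ> a) (nodes G), restrict (t \<circ> b) (dom G),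
     {g \<in> dom G. (g \<in> P) \<noteq> (b g \<in> F)}))"

lemma lab_pull:
  assumes r: "relabelling G a b" and x: "x \<in> lab (act a b P G)"
  shows "lab_pull a b P G x \<in> lab G"
proof -
  interpret relabelling G a b P by fact
  obtain \<Gamma> s' t' F where xx: "x = (\<Gamma>, s', t', F)" by (metis surj_pair)
  have l: "hairy \<Gamma>" "relabelling E' s' t'" "star \<Gamma> = act s' t' F E'" using labD x unfolding xx by blast+
  have rc: "relabelling G (s' \<circ> a) (t' \<circ> b)" using relabelling_comp[OF r l(2)] .
  have "star \<Gamma> = act (s' \<circ> a) (t' \<circ> b) {g \<in> dom G. (g \<in> P) \<noteq> (b g \<in> F)} G"
    unfolding l(3) by (rule act_act) (use t l(2) in \<open>auto simp: relabelling_def dom_act\<close>)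
  also have "\<dots> = act (restrict (s' \<circ> a) (nodes G)) (restrict (t' \<circ> b) (dom G)) {g \<in> dom G. (g \<in> P) \<noteq> (b g \<in> F)} G"
    by (rule act_restrict[symmetric]) (use rc in \<open>auto simp: relabelling_def\<close>)
  finally show ?thesis unfolding xx lab_pull_def lab_def using l(1) rc relabelling_restrict by auto
qed

lemma inj_lab_pull:
  assumes r: "relabelling G a b"
  shows "inj_on (lab_pull a b P G) (lab (act a b P G))"
proof (rule inj_onI)
  interpret relabelling G a b P by fact
  fix x y assume x: "x \<in> lab E'" and y: "y \<in> lab E'" and eq: "lab_pull a b P G x = lab_pull a b P G y"
  obtain \<Gamma> s1 t1 F where xx: "x = (\<Gamma>, s1, t1, F)" by (metis surj_pair)
  obtain \<Delta> s2 t2 F2 where yy: "y = (\<Delta>, s2, t2, F2)" by (metis surj_pair)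
  have e: "\<Gamma> = \<Delta>" "restrict (s1 \<circ> a) (nodes G) = restrict (s2 \<circ> a) (nodes G)"
    "restrict (t1 \<circ> b) (dom G) = restrict (t2 \<circ> b) (dom G)"
    "{g \<in> dom G. (g \<in> P) \<noteq> (b g \<in> F)} = {g \<in> dom G. (g \<in> P) \<noteq> (b g \<in> F2)}"
    using eq unfolding xx yy lab_pull_def by auto
  have l: "s1 \<in> extensional (a ` nodes G)" "t1 \<in> extensional (b ` dom G)" "F \<subseteq> b ` dom G"
    "s2 \<in> extensional (a ` nodes G)" "t2 \<in> extensional (b ` dom G)" "F2 \<subseteq> b ` dom G"
    using labD x y unfolding xx yy nodes_act[OF t, of a P, symmetric] dom_act[of a b P G, symmetric] by blast+
  have "s1 = s2"
  proof (rule extensionalityI[OF l(1,4)])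
    fix v assume "v \<in> a ` nodes G"
    then obtain w where "w \<in> nodes G" "v = a w" by auto
    then show "s1 v = s2 v" using fun_cong[OF e(2), of w] by simp
  qed
  moreover have "t1 = t2"
  proof (rule extensionalityI[OF l(2,5)])
    fix v assume "v \<in> b ` dom G"
    then obtain w where "w \<in> dom G" "v = b w" by auto
    then show "t1 v = t2 v" using fun_cong[OF e(3), of w] by simp
  qed
  moreover have "F = F2"
  proof -
    have "b g \<in> F \<longleftrightarrow> b g \<in> F2" if "g \<in> dom G" for g
      using e(4) that unfolding set_eq_iff mem_Collect_eq by blast
    then show ?thesis using l(3,6) by blast
  qed
  ultimately show "x = y" using e(1) xx yy by simp
qed

lemma card_lab_act:
  assumes r: "relabelling G a b" shows "card (lab (act a b P G)) = card (lab G)"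
proof (rule antisym)
  interpret relabelling G a b P by fact
  show "card (lab E') \<le> card (lab G)"
    using lab_pull[OF r] by (intro card_inj_on_le[OF inj_lab_pull[OF r] _ finite_lab]) blast
  have "card (lab (act s' t' F' E')) \<le> card (lab E')"
    using lab_pull[OF inverse_relabelling] by (intro card_inj_on_le[OF inj_lab_pull[OF inverse_relabelling] _ finite_lab]) blast
  then show "card (lab G) \<le> card (lab E')" by (simp add: inverse)
qed

lemma bij_lab_pull:
  assumes r: "relabelling G a b"
  shows "bij_betw (lab_pull a b P G) (lab (act a b P G)) (lab G)"
proof -
  have "lab_pull a b P G ` lab (act a b P G) = lab G"
    by (rule card_subset_eq[OF finite_lab]) (use lab_pull[OF r] card_lab_act[OF r] card_image[OF inj_lab_pull[OF r]] in auto)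
  then show ?thesis using inj_lab_pull[OF r] by (simp add: bij_betw_def)
qed

definition lab_of :: "sgraph \<Rightarrow> ograph \<Rightarrow> labelling set" where
  "lab_of G \<Gamma> = {x \<in> lab G. fst x = \<Gamma>}"

lemma finite_lab_of: "finite (lab_of G \<Gamma>)"
  using finite_lab by (simp add: lab_of_def)

text \<open>Postcomposition: a labelling by one oriented graph becomes a labelling by the isomorphic
  graph \<open>\<Delta>\<close>.\<close>

definition lab_push :: "ograph \<Rightarrow> (nat \<Rightarrow> nat) \<Rightarrow> (nat \<Rightarrow> nat) \<Rightarrow> nat set \<Rightarrow> sgraph \<Rightarrow> labelling \<Rightarrow> labelling" where
  "lab_push \<Delta> a b P G = (\<lambda>(\<Gamma>, s, t, F). (\<Delta>, restrict (a \<circ> s) (nodes G), restrict (b \<circ> t) (dom G),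
     {g \<in> dom G. (g \<in> F) \<noteq> (t g \<in> P)}))"

lemma lab_push:
  assumes r: "relabelling (star \<Gamma>) a b" and \<Delta>: "hairy \<Delta>" "star \<Delta> = act a b P (star \<Gamma>)" and x: "x \<in> lab_of G \<Gamma>"
  shows "lab_push \<Delta> a b P G x \<in> lab_of G \<Delta>"
proof -
  obtain s t F where xx: "x = (\<Gamma>, s, t, F)" using x unfolding lab_of_def by (metis (mono_tags, lifting) mem_Collect_eq prod.collapse)
  have l: "hairy \<Gamma>" "relabelling G s t" "star \<Gamma> = act s t F G" using labD x unfolding xx lab_of_def by blast+
  interpret relabelling G s t F by fact
  have rc: "relabelling G (a \<circ> s) (b \<circ> t)" using relabelling_comp[OF l(2)] r l(3) by metis
  have "star \<Delta> = act (a \<circ> s) (b \<circ> t) {g \<in> dom G. (g \<in> F) \<noteq> (t g \<in> P)} G"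
    unfolding \<Delta>(2) l(3) by (rule act_act) (use t r in \<open>auto simp: relabelling_def l(3) dom_act\<close>)
  also have "\<dots> = act (restrict (a \<circ> s) (nodes G)) (restrict (b \<circ> t) (dom G)) {g \<in> dom G. (g \<in> F) \<noteq> (t g \<in> P)} G"
    by (rule act_restrict[symmetric]) (use rc in \<open>auto simp: relabelling_def\<close>)
  finally show ?thesis unfolding xx lab_push_def lab_of_def lab_def using \<Delta>(1) rc relabelling_restrict by auto
qed

lemma inj_lab_push:
  assumes r: "relabelling (star \<Gamma>) a b"
  shows "inj_on (lab_push \<Delta> a b P G) (lab_of G \<Gamma>)"
proof (rule inj_onI)
  interpret relabelling "star \<Gamma>" a b P by fact
  fix x y assume x: "x \<in> lab_of G \<Gamma>" and y: "y \<in> lab_of G \<Gamma>" and eq: "lab_push \<Delta> a b P G x = lab_push \<Delta> a b P G y"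
  obtain s1 t1 F where xx: "x = (\<Gamma>, s1, t1, F)" using x unfolding lab_of_def by (metis (mono_tags, lifting) mem_Collect_eq prod.collapse)
  obtain s2 t2 F2 where yy: "y = (\<Gamma>, s2, t2, F2)" using y unfolding lab_of_def by (metis (mono_tags, lifting) mem_Collect_eq prod.collapse)
  have e: "restrict (a \<circ> s1) (nodes G) = restrict (a \<circ> s2) (nodes G)"
    "restrict (b \<circ> t1) (dom G) = restrict (b \<circ> t2) (dom G)"
    "{g \<in> dom G. (g \<in> F) \<noteq> (t1 g \<in> P)} = {g \<in> dom G. (g \<in> F2) \<noteq> (t2 g \<in> P)}"
    using eq unfolding xx yy lab_push_def by auto
  have l: "s1 \<in> extensional (nodes G)" "t1 \<in> extensional (dom G)" "F \<subseteq> dom G" "relabelling G s1 t1" "star \<Gamma> = act s1 t1 F G"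
    "s2 \<in> extensional (nodes G)" "t2 \<in> extensional (dom G)" "F2 \<subseteq> dom G" "relabelling G s2 t2" "star \<Gamma> = act s2 t2 F2 G"
    using labD x y unfolding xx yy lab_of_def by blast+
  have n: "nodes (star \<Gamma>) = s1 ` nodes G" "nodes (star \<Gamma>) = s2 ` nodes G" "dom (star \<Gamma>) = t1 ` dom G" "dom (star \<Gamma>) = t2 ` dom G"
    using l(4,9) nodes_act[of t1 G s1 F] nodes_act[of t2 G s2 F2] dom_act[of s1 t1 F G] dom_act[of s2 t2 F2 G]
    unfolding l(5)[symmetric] l(10)[symmetric] by (auto simp: relabelling_def)
  have "s1 = s2"
  proof (rule extensionalityI[OF l(1,6)])
    fix v assume v: "v \<in> nodes G"
    then have "a (s1 v) = a (s2 v)" using fun_cong[OF e(1), of v] by simp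
    moreover have "s1 v \<in> nodes (star \<Gamma>)" using n(1) v by blast
    moreover have "s2 v \<in> nodes (star \<Gamma>)" using n(2) v by blast
    ultimately show "s1 v = s2 v" using s by (auto dest: inj_onD)
  qed
  moreover have t12: "t1 = t2"
  proof (rule extensionalityI[OF l(2,7)])
    fix v assume v: "v \<in> dom G"
    then have "b (t1 v) = b (t2 v)" using fun_cong[OF e(2), of v] by simp
    moreover have "t1 v \<in> dom (star \<Gamma>)" using n(3) v by blast
    moreover have "t2 v \<in> dom (star \<Gamma>)" using n(4) v by blast
    ultimately show "t1 v = t2 v" using inj_onD[OF t] by blast
  qed
  moreover have "F = F2"
  proof -
    have "g \<in> F \<longleftrightarrow> g \<in> F2" if "g \<in> dom G" for g
      using e(3) that unfolding set_eq_iff mem_Collect_eq t12 by blast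
    then show ?thesis using l(3,8) by blast
  qed
  ultimately show "x = y" using xx yy by simp
qed

lemma bij_lab_push:
  assumes r: "relabelling (star \<Gamma>) a b" and h: "hairy \<Gamma>" "hairy \<Delta>" and \<Delta>: "star \<Delta> = act a b P (star \<Gamma>)"
  shows "bij_betw (lab_push \<Delta> a b P G) (lab_of G \<Gamma>) (lab_of G \<Delta>)"
proof -
  interpret relabelling "star \<Gamma>" a b P by fact
  have le: "card (lab_of G \<Gamma>) \<le> card (lab_of G \<Delta>)"
    using lab_push[OF r h(2) \<Delta>] by (intro card_inj_on_le[OF inj_lab_push[OF r] _ finite_lab_of]) blast
  have inv: "star \<Gamma> = act s' t' F' (star \<Delta>)" using inverse \<Delta> by simp
  have ri: "relabelling (star \<Delta>) s' t'" using inverse_relabelling \<Delta> by simp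
  have "card (lab_of G \<Delta>) \<le> card (lab_of G \<Gamma>)"
    using lab_push[OF ri h(1) inv] by (intro card_inj_on_le[OF inj_lab_push[OF ri] _ finite_lab_of]) blast
  then have "lab_push \<Delta> a b P G ` lab_of G \<Gamma> = lab_of G \<Delta>"
    using lab_push[OF r h(2) \<Delta>] le card_image[OF inj_lab_push[OF r]]
    by (intro card_subset_eq[OF finite_lab_of]) auto
  then show ?thesis using inj_lab_push[OF r] by (simp add: bij_betw_def)
qed

text \<open>Inverting isomorphisms is injective. The resulting symmetry serves to exchange the two
  sums in \<open>Sec_Tr_rel\<close>.\<close>

lemma card_lab_of_le:
  assumes True: "hairy \<Gamma>"
  shows "card (lab_of (star \<Gamma>) \<Delta>) \<le> card (lab_of (star \<Delta>) \<Gamma>)"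
proof -
  define \<Phi> :: "labelling \<Rightarrow> labelling" where
    "\<Phi> = (\<lambda>(_, s, t, F). (\<Gamma>, restrict (inv_into (nodes (star \<Gamma>)) s) (nodes (star \<Delta>)),
      restrict (inv_into (dom (star \<Gamma>)) t) (dom (star \<Delta>)), t ` F))"
  have props: "\<exists>s t F. x = (\<Delta>, s, t, F) \<and> s \<in> extensional (nodes (star \<Gamma>)) \<and> t \<in> extensional (dom (star \<Gamma>)) \<and>
      relabelling (star \<Gamma>) s t \<and> F \<subseteq> dom (star \<Gamma>) \<and> star \<Delta> = act s t F (star \<Gamma>) \<and> hairy \<Delta> \<and> hairy \<Gamma> \<and>
      nodes (star \<Delta>) = s ` nodes (star \<Gamma>) \<and> dom (star \<Delta>) = t ` dom (star \<Gamma>)" if x: "x \<in> lab_of (star \<Gamma>) \<Delta>" and "good \<Gamma>" for x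
  proof -
    obtain s t F where xx: "x = (\<Delta>, s, t, F)" using x unfolding lab_of_def by (metis (mono_tags, lifting) mem_Collect_eq prod.collapse)
    have xl: "(\<Delta>, s, t, F) \<in> lab (star \<Gamma>)" using x unfolding xx lab_of_def by simp
    note l = labD[OF xl]
    then have i: "inj_on t (dom (star \<Gamma>))" by (simp add: relabelling_def)
    have "hairy \<Gamma>" using lab_valid[OF xl] that(2) by (simp add: hairy_iff)
    then show ?thesis using xx l nodes_act[OF i, of s F] dom_act[of s t F "star \<Gamma>"] by auto
  qed
  note g = hairy_good[OF True]
  have "\<Phi> x \<in> lab_of (star \<Delta>) \<Gamma>" if x: "x \<in> lab_of (star \<Gamma>) \<Delta>" for x
  proof -
    obtain s t F where l: "x = (\<Delta>, s, t, F)" "s \<in> extensional (nodes (star \<Gamma>))" "t \<in> extensional (dom (star \<Gamma>))"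
        "relabelling (star \<Gamma>) s t" "F \<subseteq> dom (star \<Gamma>)" "star \<Delta> = act s t F (star \<Gamma>)" "hairy \<Delta>" "hairy \<Gamma>"
        "nodes (star \<Delta>) = s ` nodes (star \<Gamma>)" "dom (star \<Delta>) = t ` dom (star \<Gamma>)"
      using props[OF x g] by (elim exE conjE) (rule that)
    interpret r: relabelling "star \<Gamma>" s t F by fact
    have F': "r.F' = t ` F" unfolding r.F'_def using l(5) by (simp add: Int_absorb2)
    have ri: "relabelling (star \<Delta>) r.s' r.t'" using r.inverse_relabelling l(6) by simp
    have "star \<Gamma> = act r.s' r.t' (t ` F) (star \<Delta>)" using r.inverse unfolding F' l(6)[symmetric] by simp
    also have "\<dots> = act (restrict r.s' (nodes (star \<Delta>))) (restrict r.t' (dom (star \<Delta>))) (t ` F) (star \<Delta>)"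
      by (rule act_restrict[symmetric]) (use ri in \<open>auto simp: relabelling_def\<close>)
    finally have st: "star \<Gamma> = act (restrict r.s' (nodes (star \<Delta>))) (restrict r.t' (dom (star \<Delta>))) (t ` F) (star \<Delta>)" .
    have eq: "\<Phi> x = (\<Gamma>, restrict r.s' (nodes (star \<Delta>)), restrict r.t' (dom (star \<Delta>)), t ` F)"
      unfolding \<Phi>_def l(1) r.s'_def r.t'_def by simp
    have "t ` F \<subseteq> dom (star \<Delta>)" unfolding l(10) using l(5) by blast
    moreover have "relabelling (star \<Delta>) (restrict r.s' (nodes (star \<Delta>))) (restrict r.t' (dom (star \<Delta>)))"
      using ri relabelling_restrict by blast
    ultimately show ?thesis unfolding eq lab_of_def lab_def using True st by simp
  qed
  moreover have "inj_on \<Phi> (lab_of (star \<Gamma>) \<Delta>)"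
  proof (rule inj_onI)
    fix x y assume x: "x \<in> lab_of (star \<Gamma>) \<Delta>" and y: "y \<in> lab_of (star \<Gamma>) \<Delta>" and eq: "\<Phi> x = \<Phi> y"
    obtain s1 t1 F1 where l1: "x = (\<Delta>, s1, t1, F1)" "s1 \<in> extensional (nodes (star \<Gamma>))" "t1 \<in> extensional (dom (star \<Gamma>))"
        "relabelling (star \<Gamma>) s1 t1" "F1 \<subseteq> dom (star \<Gamma>)" "star \<Delta> = act s1 t1 F1 (star \<Gamma>)" "hairy \<Delta>" "hairy \<Gamma>"
        "nodes (star \<Delta>) = s1 ` nodes (star \<Gamma>)" "dom (star \<Delta>) = t1 ` dom (star \<Gamma>)"
      using props[OF x g] by (elim exE conjE) (rule that)
    obtain s2 t2 F2 where l2: "y = (\<Delta>, s2, t2, F2)" "s2 \<in> extensional (nodes (star \<Gamma>))" "t2 \<in> extensional (dom (star \<Gamma>))"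
        "relabelling (star \<Gamma>) s2 t2" "F2 \<subseteq> dom (star \<Gamma>)" "star \<Delta> = act s2 t2 F2 (star \<Gamma>)" "hairy \<Delta>" "hairy \<Gamma>"
        "nodes (star \<Delta>) = s2 ` nodes (star \<Gamma>)" "dom (star \<Delta>) = t2 ` dom (star \<Gamma>)"
      using props[OF y g] by (elim exE conjE) (rule that)
    have e: "restrict (inv_into (nodes (star \<Gamma>)) s1) (nodes (star \<Delta>)) = restrict (inv_into (nodes (star \<Gamma>)) s2) (nodes (star \<Delta>))"
      "restrict (inv_into (dom (star \<Gamma>)) t1) (dom (star \<Delta>)) = restrict (inv_into (dom (star \<Gamma>)) t2) (dom (star \<Delta>))"
      "t1 ` F1 = t2 ` F2"
      using eq unfolding l1(1) l2(1) \<Phi>_def by auto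
    have gen: "f v = f2 v" if "restrict (inv_into N f) (f ` N) = restrict (inv_into N f2) (f ` N)" "f ` N = f2 ` N"
      "inj_on f N" "v \<in> N" for f f2 :: "nat \<Rightarrow> nat" and N v
    proof -
      have "inv_into N f2 (f v) = v" using fun_cong[OF that(1), of "f v"] that(3,4) by simp
      moreover have "f2 (inv_into N f2 (f v)) = f v" by (rule f_inv_into_f) (use that in auto)
      ultimately show ?thesis by simp
    qed
    have "s1 = s2"
      by (rule extensionalityI[OF l1(2) l2(2)], rule gen[where f = s1 and ?f2.0 = s2 and N = "nodes (star \<Gamma>)"])
        (use e(1) l1(4,9) l2(9) in \<open>auto simp: relabelling_def\<close>)
    moreover have t12: "t1 = t2"
    proof (rule extensionalityI[OF l1(3) l2(3)], rule gen[where f = t1 and ?f2.0 = t2 and N = "dom (star \<Gamma>)"])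
      show "restrict (inv_into (dom (star \<Gamma>)) t1) (t1 ` dom (star \<Gamma>)) = restrict (inv_into (dom (star \<Gamma>)) t2) (t1 ` dom (star \<Gamma>))"
        using e(2) unfolding l1(10) .
      show "t1 ` dom (star \<Gamma>) = t2 ` dom (star \<Gamma>)" using l1(10) l2(10) by (rule trans[OF sym])
      show "inj_on t1 (dom (star \<Gamma>))" using l1(4) by (simp add: relabelling_def)
    qed
    moreover have "F1 = F2"
      using inj_on_image_eq_iff[OF relabelling.t[OF l2(4)] l1(5) l2(5)] e(3) unfolding t12 by simp
    ultimately show "x = y" using l1(1) l2(1) by simp
  qed
  ultimately show ?thesis by (intro card_inj_on_le[OF _ _ finite_lab_of]) blast+
qed

lemma card_lab_of_sym:
  "hairy \<Gamma> \<Longrightarrow> hairy \<Delta> \<Longrightarrow> card (lab_of (star \<Gamma>) \<Delta>) = card (lab_of (star \<Delta>) \<Gamma>)"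
  by (simp add: antisym card_lab_of_le)

lemma sum_fun_apply: "(\<Sum>i\<in>A. f i) x = (\<Sum>i\<in>A. f i x)"
  by (induction A rule: infinite_finite_induct) auto

context hgc_sign begin

definition lsg :: "sgraph \<Rightarrow> labelling \<Rightarrow> 'k" where
  "lsg G = (\<lambda>(\<Gamma>, s, t, F). asg s t F G)"

text \<open>\<open>Tr\<close> maps series modulo relations isomorphically onto equivariant functions; \<open>Sec\<close> is the inverse.\<close>

definition Tr :: "(ograph \<Rightarrow> 'k) \<Rightarrow> sgraph \<Rightarrow> 'k" where
  "Tr c G = (\<Sum>x\<in>lab G. lsg G x * c (fst x))"

definition Sec :: "(sgraph \<Rightarrow> 'k) \<Rightarrow> ograph \<Rightarrow> 'k" where
  "Sec \<phi> \<Gamma> = (if hairy \<Gamma> then \<phi> (star \<Gamma>) / of_nat (card (lab (star \<Gamma>))) else 0)"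

lemma Tr_linear: "Tr (\<lambda>\<Gamma>. a * c \<Gamma> + b * d \<Gamma>) = (\<lambda>G. a * Tr c G + b * Tr d G)"
  by (auto simp: Tr_def fun_eq_iff sum_distrib_left sum.distrib[symmetric] algebra_simps intro!: sum.cong)

lemma Tr_invalid: "\<not> valid G \<Longrightarrow> Tr c G = 0"
proof -
  assume "\<not> valid G"
  then have "lab G = {}" using lab_valid by fastforce
  then show ?thesis by (simp add: Tr_def)
qed

lemma asg_comp_fin:
  assumes "finite (dom G)" "relabelling G a b" "relabelling (act a b P G) s t"
  shows "asg (restrict (s \<circ> a) (nodes G)) (restrict (t \<circ> b) (dom G)) {g \<in> dom G. (g \<in> P) \<noteq> (b g \<in> F)} G =
    asg s t F (act a b P G) * asg a b P G"
proof -
  have "asg (restrict (s \<circ> a) (nodes G)) (restrict (t \<circ> b) (dom G)) {g \<in> dom G. (g \<in> P) \<noteq> (b g \<in> F)} G =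
     asg (s \<circ> a) (t \<circ> b) {g \<in> dom G. (g \<in> P) \<noteq> (b g \<in> F)} G"
    by (rule asg_cong) auto
  then show ?thesis using asg_comp[OF assms] by simp
qed

lemma Tr_act:
  assumes r: "relabelling G a b" shows "Tr c (act a b P G) = asg a b P G * Tr c G"
proof (cases "valid G")
  case True
  interpret relabelling G a b P by fact
  have fin: "finite (dom G)" using valid_finite[OF True] .
  have "Tr c G = (\<Sum>x\<in>lab E'. lsg G (lab_pull a b P G x) * c (fst (lab_pull a b P G x)))"
    unfolding Tr_def by (rule sum.reindex_bij_betw[OF bij_lab_pull[OF r], symmetric])
  also have "\<dots> = (\<Sum>x\<in>lab E'. asg a b P G * (lsg E' x * c (fst x)))"
  proof (rule sum.cong[OF refl])
    fix x assume x: "x \<in> lab E'"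
    obtain \<Gamma> s t F where xx: "x = (\<Gamma>, s, t, F)" by (metis surj_pair)
    have "relabelling E' s t" using labD x unfolding xx by blast
    then show "lsg G (lab_pull a b P G x) * c (fst (lab_pull a b P G x)) = asg a b P G * (lsg E' x * c (fst x))"
      using asg_comp_fin[OF fin r, of P s t F] by (simp add: xx lab_pull_def lsg_def)
  qed
  also have "\<dots> = asg a b P G * Tr c E'" by (simp add: Tr_def sum_distrib_left)
  finally have "asg a b P G * Tr c G = (asg a b P G * asg a b P G) * Tr c E'" by simp
  then show ?thesis by (simp add: asg_sq)
next
  case False
  interpret relabelling G a b P by fact
  show ?thesis using False valid_act by (simp add: Tr_invalid)
qed

lemma equi_Tr: "equi (Tr c)"
  unfolding equi_def using Tr_invalid Tr_act by (auto simp: relabelling_def)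

lemma lab_nonempty: "valid G \<Longrightarrow> lab G \<noteq> {}"
proof -
  assume val: "valid G"
  obtain \<Gamma> s t where \<Gamma>: "hairy \<Gamma>" "relabelling G s t" "star \<Gamma> = act s t {} G" using realize[OF val] .
  have "star \<Gamma> = act (restrict s (nodes G)) (restrict t (dom G)) {} G"
    unfolding \<Gamma>(3) by (rule act_restrict[symmetric]) (use \<Gamma>(2) in \<open>auto simp: relabelling_def\<close>)
  then have "(\<Gamma>, restrict s (nodes G), restrict t (dom G), {}) \<in> lab G"
    unfolding lab_def using \<Gamma> relabelling_restrict by auto
  then show ?thesis by blast
qed

text \<open>\<open>realize\<close> provides a labelling, and characteristic 0 makes the divisor in
  \<open>Sec\<close> invertible.\<close>

lemma card_lab_nz: "valid G \<Longrightarrow> (of_nat (card (lab G)) :: 'k) \<noteq> 0"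
  using lab_nonempty finite_lab by (simp add: card_eq_0_iff)

lemma lab_card_star: "(\<Gamma>, s, t, F) \<in> lab G \<Longrightarrow> card (lab (star \<Gamma>)) = card (lab G)"
  using card_lab_act[of G s t F] labD[of \<Gamma> s t F G] by simp

text \<open>By equivariance every labelling contributes the same amount: its sign \<open>asg\<close>
  occurs twice.\<close>

lemma Tr_Sec:
  assumes eq: "equi \<phi>" shows "Tr (Sec \<phi>) = \<phi>"
proof
  fix G
  show "Tr (Sec \<phi>) G = \<phi> G"
  proof (cases "valid G")
    case True
    have "Tr (Sec \<phi>) G = (\<Sum>x\<in>lab G. \<phi> G / of_nat (card (lab G)))"
      unfolding Tr_def
    proof (rule sum.cong[OF refl])
      fix x assume x: "x \<in> lab G"
      obtain \<Gamma> s t F where xx: "x = (\<Gamma>, s, t, F)" by (metis surj_pair)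
      have l: "hairy \<Gamma>" "relabelling G s t" "star \<Gamma> = act s t F G" using labD x unfolding xx by blast+
      have "\<phi> (star \<Gamma>) = asg s t F G * \<phi> G" unfolding l(3) by (rule equi_act[OF eq l(2)])
      then have "asg s t F G * \<phi> (star \<Gamma>) = \<phi> G" by (simp add: mult.assoc[symmetric] asg_sq)
      then show "lsg G x * Sec \<phi> (fst x) = \<phi> G / of_nat (card (lab G))"
        using l(1) lab_card_star[of \<Gamma> s t F G] x by (simp add: xx lsg_def Sec_def)
    qed
    also have "\<dots> = \<phi> G" using card_lab_nz[OF True] by simp
    finally show ?thesis .
  next
    case False
    then show ?thesis using eq by (simp add: Tr_invalid equi_def)
  qed
qed

lemma Sec_series: "Sec \<phi> \<in> graph_series (\<lambda>_. True)"
  by (auto simp: graph_series_def Sec_def)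

section \<open>The relations\<close>

lemma Tr_single: "Tr (single \<Gamma>) G = (\<Sum>x\<in>lab_of G \<Gamma>. lsg G x)"
proof -
  have "Tr (single \<Gamma>) G = (\<Sum>x\<in>lab G. if fst x = \<Gamma> then lsg G x else 0)"
    unfolding Tr_def by (rule sum.cong) (auto simp: single_def)
  also have "\<dots> = (\<Sum>x\<in>lab_of G \<Gamma>. lsg G x)"
    unfolding lab_of_def by (rule sum.inter_filter[symmetric, OF finite_lab])
  finally show ?thesis .
qed

lemma Tr_single_iso:
  assumes r: "relabelling (star \<Gamma>) a b" and h: "hairy \<Gamma>" "hairy \<Delta>" and \<Delta>: "star \<Delta> = act a b P (star \<Gamma>)"
  shows "Tr (single \<Delta>) G = asg a b P (star \<Gamma>) * Tr (single \<Gamma>) G"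
proof (cases "valid G")
  case True
  have fin: "finite (dom G)" using valid_finite[OF True] .
  have "Tr (single \<Delta>) G = (\<Sum>x\<in>lab_of G \<Gamma>. lsg G (lab_push \<Delta> a b P G x))"
    unfolding Tr_single by (rule sum.reindex_bij_betw[OF bij_lab_push[OF assms], symmetric])
  also have "\<dots> = (\<Sum>x\<in>lab_of G \<Gamma>. asg a b P (star \<Gamma>) * lsg G x)"
  proof (rule sum.cong[OF refl])
    fix x assume x: "x \<in> lab_of G \<Gamma>"
    obtain s t F where xx: "x = (\<Gamma>, s, t, F)" using x unfolding lab_of_def by (metis (mono_tags, lifting) mem_Collect_eq prod.collapse)
    have l: "relabelling G s t" "star \<Gamma> = act s t F G" using labD x unfolding xx lab_of_def by blast+
    have "relabelling (act s t F G) a b" using r l(2) by simp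
    then show "lsg G (lab_push \<Delta> a b P G x) = asg a b P (star \<Gamma>) * lsg G x"
      using asg_comp_fin[OF fin l(1), of F a b P] by (simp add: xx lab_push_def lsg_def l(2))
  qed
  finally show ?thesis by (simp add: Tr_single sum_distrib_left)
qed (simp add: Tr_invalid)

lemma Tr_scale: "Tr (scale a c) = (\<lambda>G. a * Tr c G)"
  using Tr_linear[of a c 0 c] by (simp add: scale_def)

lemma Tr_diff: "Tr (c - d) = (\<lambda>G. Tr c G - Tr d G)"
  using Tr_linear[of 1 c "-1" d] by (simp add: fun_diff_def)

lemma Tr_add: "Tr (c + d) = (\<lambda>G. Tr c G + Tr d G)"
  using Tr_linear[of 1 c 1 d] by (simp add: plus_fun_def)

lemma asg_rev: "\<Gamma> ! e = Edge s t \<Longrightarrow> e < length \<Gamma> \<Longrightarrow> asg id id {e} (star \<Gamma>) = ev"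
  by (simp add: asg_def dom_star edges_def)

text \<open>Reordering and reversal are unified: both relate two oriented graphs by an isomorphism
  of star graphs, with coefficient \<open>asg\<close>.\<close>

lemma relators_cases:
  fixes x :: "ograph \<Rightarrow> 'k"
  assumes "x \<in> relators 0 n"
  obtains \<Gamma> \<Delta> a b P where "hairy \<Gamma>" "hairy \<Delta>" "relabelling (star \<Gamma>) a b" "star \<Delta> = act a b P (star \<Gamma>)"
    "x = single \<Delta> - scale (asg a b P (star \<Gamma>)) (single \<Gamma>)"
proof -
  consider (perm) \<sigma> \<Gamma> where "x = single (reorder \<sigma> \<Gamma>) - scale (koszul_sign 0 n \<sigma> \<Gamma>) (single \<Gamma>)"
      "hairy \<Gamma>" "\<sigma> permutes {..<length \<Gamma>}"
    | (rev) \<Gamma> e s t where "x = single (\<Gamma>[e := Edge t s]) - scale ((-1) powi n) (single \<Gamma>)"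
      "hairy \<Gamma>" "e < length \<Gamma>" "\<Gamma> ! e = Edge s t"
    using assms unfolding relators_def by blast
  then show thesis
  proof cases
    case perm
    have g: "good \<Gamma>" using perm(2) by (rule hairy_good)
    have r: "good (reorder \<sigma> \<Gamma>)" "star (reorder \<sigma> \<Gamma>) = act \<sigma> \<sigma> {} (star \<Gamma>)" using reorder_facts[OF g perm(3)] by auto
    have inj: "inj_on \<sigma> X" for X using permutes_inj[OF perm(3)] by (rule inj_on_subset) simp
    have rel: "relabelling (star \<Gamma>) \<sigma> \<sigma>" by unfold_locales (rule inj)+
    have "hairy (reorder \<sigma> \<Gamma>)"
      using r perm(2) relabelling.valid_act[OF rel, of "{}"] by (simp add: hairy_iff)
    moreover have "koszul_sign 0 n \<sigma> \<Gamma> = asg \<sigma> \<sigma> {} (star \<Gamma>)"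
      unfolding asg_def unfolding ev_n using koszul_star[OF g perm(3), of n] by simp
    ultimately show thesis using that[OF perm(2) _ rel r(2)] perm(1) by simp
  next
    case rev
    have g: "good \<Gamma>" using rev(2) by (rule hairy_good)
    have r: "good (\<Gamma>[e := Edge t s])" "star (\<Gamma>[e := Edge t s]) = act id id {e} (star \<Gamma>)"
      using reverse_facts[OF g rev(3,4)] by auto
    have "hairy (\<Gamma>[e := Edge t s])"
      using r rev(2) relabelling.valid_act[OF relabelling_id[of "star \<Gamma>"], of "{e}"] by (simp add: hairy_iff)
    then show thesis using that[OF rev(2) _ relabelling_id r(2)] rev(1) asg_rev[OF rev(4,3)] ev_n by simp
  qed
qed

lemma Tr_relator: "x \<in> relators 0 n \<Longrightarrow> Tr x = (\<lambda>_. 0)"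
  by (elim relators_cases) (auto simp: Tr_diff Tr_scale Tr_single_iso)

lemma Tr_span: "x \<in> series.span (relators 0 n) \<Longrightarrow> Tr x = (\<lambda>_. 0)"
proof (induction rule: series.span_induct_alt)
  case base
  show ?case by (simp add: Tr_def fun_eq_iff)
next
  case (step c x y)
  then show ?case unfolding Tr_add Tr_scale using Tr_relator by simp
qed

lemma lab_hairs_loops:
  assumes "(\<Gamma>, s, t, F) \<in> lab G"
  shows "hairs \<Gamma> = card (halves G None)"
    "loop_order \<Gamma> = card (dom G) + 1 - (card (nodes G) + card (halves G None))"
proof -
  have l: "hairy \<Gamma>" "relabelling G s t" "star \<Gamma> = act s t F G" using labD[OF assms] by auto
  have g: "good \<Gamma>" using l(1) by (rule hairy_good)
  show "hairs \<Gamma> = card (halves G None)"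
    "loop_order \<Gamma> = card (dom G) + 1 - (card (nodes G) + card (halves G None))"
    using hairs_star[OF g] loop_order_star[OF g] iso_cards[OF l(2,3)] by auto
qed

text \<open>Relations are spans only piece by piece. But all graphs labelling \<open>G\<close> share
  their hairs and loop order, so \<open>Tr c G\<close> sees a single piece of
  \<open>c\<close>.\<close>

lemma Tr_hgc_rel:
  assumes c: "c \<in> hgc_rel 0 n" shows "Tr c = (\<lambda>_. 0)"
proof
  fix G
  define P where "P = (\<lambda>\<Gamma>. hairs \<Gamma> = card (halves G None) \<and>
    loop_order \<Gamma> = card (dom G) + 1 - (card (nodes G) + card (halves G None)))"
  have "restrict_series P c \<in> series.span (relators 0 n)"
    using c unfolding hgc_rel_def P_def by blast
  then have "Tr (restrict_series P c) G = 0" using Tr_span by metis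
  moreover have "Tr (restrict_series P c) G = Tr c G"
    unfolding Tr_def
  proof (rule sum.cong[OF refl])
    fix x assume x: "x \<in> lab G"
    obtain \<Gamma> s t F where xx: "x = (\<Gamma>, s, t, F)" by (metis surj_pair)
    have "P \<Gamma>" using lab_hairs_loops[of \<Gamma> s t F G] x unfolding xx P_def by blast
    then show "lsg G x * restrict_series P c (fst x) = lsg G x * c (fst x)" by (simp add: xx restrict_series_def)
  qed
  ultimately show "Tr c G = 0" by simp
qed

lemma span_iso_trans:
  assumes "x - scale a y \<in> series.span R" "y - scale b z \<in> series.span R"
  shows "x - scale (a * b) z \<in> series.span R"
proof -
  have "(x - scale a y) + scale a (y - scale b z) \<in> series.span R"
    using assms by (intro series.span_add series.span_scale)
  moreover have "(x - scale a y) + scale a (y - scale b z) = x - scale (a * b) z"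
    by (simp add: scale_def fun_eq_iff algebra_simps)
  ultimately show ?thesis by simp
qed

lemma flip_rel:
  assumes h: "hairy \<Gamma>" and F: "finite F"
  shows "F \<subseteq> edges \<Gamma> \<Longrightarrow> \<exists>\<Delta>. hairy \<Delta> \<and> star \<Delta> = act id id F (star \<Gamma>) \<and>
    single \<Delta> - scale (ev ^ card F) (single \<Gamma>) \<in> series.span (relators 0 n)"
  using F
proof (induction F rule: finite_induct)
  case empty
  have "single \<Gamma> - scale (ev ^ card {}) (single \<Gamma>) = 0" by (simp add: scale_def fun_eq_iff)
  then have "single \<Gamma> - scale (ev ^ card {}) (single \<Gamma>) \<in> series.span (relators 0 n)" by (simp add: series.span_zero)
  moreover have "star \<Gamma> = act id id {} (star \<Gamma>)" using act_id' by (rule sym)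
  ultimately show ?case using h by blast
next
  case (insert e F)
  then obtain \<Delta> where \<Delta>: "hairy \<Delta>" "star \<Delta> = act id id F (star \<Gamma>)"
    "single \<Delta> - scale (ev ^ card F) (single \<Gamma>) \<in> series.span (relators 0 n)" by blast
  have "edges \<Delta> = edges \<Gamma>" using dom_act[of id id F "star \<Gamma>"] unfolding \<Delta>(2)[symmetric] dom_star by simp
  then have e: "e \<in> edges \<Delta>" using insert.prems by simp
  then obtain s t where st: "\<Delta> ! e = Edge s t" using cell_edge by blast
  have el: "e < length \<Delta>" using e by (simp add: edges_def)
  have g: "good \<Delta>" using \<Delta>(1) by (rule hairy_good)
  let ?\<Delta> = "\<Delta>[e := Edge t s]"
  have r: "good ?\<Delta>" "star ?\<Delta> = act id id {e} (star \<Delta>)" using reverse_facts[OF g el st] by auto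
  have hd: "hairy ?\<Delta>" using r \<Delta>(1) relabelling.valid_act[OF relabelling_id[of "star \<Delta>"], of "{e}"] by (simp add: hairy_iff)
  have "star ?\<Delta> = act (id \<circ> id) (id \<circ> id) {g \<in> dom (star \<Gamma>). (g \<in> F) \<noteq> (id g \<in> {e})} (star \<Gamma>)"
    unfolding r(2) \<Delta>(2) by (rule act_act) auto
  also have "{g \<in> dom (star \<Gamma>). (g \<in> F) \<noteq> (id g \<in> {e})} = insert e F"
    using insert.hyps insert.prems by (auto simp: dom_star)
  finally have st': "star ?\<Delta> = act id id (insert e F) (star \<Gamma>)" by (simp only: id_o)
  have "single ?\<Delta> - scale ev (single \<Delta>) \<in> relators 0 n"
    unfolding relators_def using \<Delta>(1) el st ev_n by blast
  then have "single ?\<Delta> - scale (ev * ev ^ card F) (single \<Gamma>) \<in> series.span (relators 0 n)"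
    by (rule span_iso_trans[OF series.span_base \<Delta>(3)])
  moreover have "ev * ev ^ card F = ev ^ card (insert e F)" using insert.hyps by simp
  ultimately show ?case using hd st' by metis
qed

text \<open>Converse to \<open>relators_cases\<close>: the isomorphism is decomposed into reversals,
  one edge at a time, followed by the reordering from \<open>star_iso_reorder\<close>.\<close>

lemma iso_rel:
  assumes h: "hairy \<Gamma>" "hairy \<Delta>" and r: "relabelling (star \<Gamma>) s t" and F: "F \<subseteq> dom (star \<Gamma>)"
    and st: "star \<Delta> = act s t F (star \<Gamma>)"
  shows "single \<Delta> - scale (asg s t F (star \<Gamma>)) (single \<Gamma>) \<in> series.span (relators 0 n)"
proof -
  have FE: "F \<subseteq> edges \<Gamma>" using F by (simp add: dom_star)
  then have "finite F" using finite_subset edges_finite by blast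
  then obtain \<Gamma>' where \<Gamma>': "hairy \<Gamma>'" "star \<Gamma>' = act id id F (star \<Gamma>)"
    "single \<Gamma>' - scale (ev ^ card F) (single \<Gamma>) \<in> series.span (relators 0 n)"
    using flip_rel[OF h(1)] FE by blast
  interpret relabelling "star \<Gamma>" s t F by fact
  have "act s t {} (star \<Gamma>') = act (s \<circ> id) (t \<circ> id) {g \<in> dom (star \<Gamma>). (g \<in> F) \<noteq> (id g \<in> {})} (star \<Gamma>)"
    unfolding \<Gamma>'(2) by (rule act_act) (use t in auto)
  also have "{g \<in> dom (star \<Gamma>). (g \<in> F) \<noteq> (id g \<in> {})} = F" using F by auto
  finally have st': "star \<Delta> = act s t {} (star \<Gamma>')" using st by simp
  have nd: "nodes (star \<Gamma>') = nodes (star \<Gamma>)" "dom (star \<Gamma>') = dom (star \<Gamma>)"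
    unfolding \<Gamma>'(2) by (simp_all add: nodes_act dom_act)
  have r': "relabelling (star \<Gamma>') s t" unfolding relabelling_def nd using s t by blast
  obtain p where p: "p permutes {..<length \<Gamma>'}" "\<Delta> = reorder p \<Gamma>'"
    "\<And>v. v \<in> nodes (star \<Gamma>') \<Longrightarrow> p v = s v" "\<And>e. e \<in> edges \<Gamma>' \<Longrightarrow> p e = t e"
    using star_iso_reorder[OF hairy_good[OF \<Gamma>'(1)] hairy_good[OF h(2)] r' st'] by blast
  have "koszul_sign 0 n p \<Gamma>' = inv_sign ev p (nodes (star \<Gamma>')) * inv_sign (- ev) p (dom (star \<Gamma>'))"
    using koszul_star[OF hairy_good[OF \<Gamma>'(1)] p(1), of n] ev_n by simp
  also have "inv_sign ev p (nodes (star \<Gamma>')) = inv_sign ev s (nodes (star \<Gamma>))"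
    using p(3) unfolding nd by (rule inv_sign_cong)
  also have "inv_sign (- ev) p (dom (star \<Gamma>')) = inv_sign (- ev) t (dom (star \<Gamma>))"
    using p(4) unfolding nd dom_star[symmetric] by (rule inv_sign_cong)
  finally have k: "koszul_sign 0 n p \<Gamma>' * ev ^ card F = asg s t F (star \<Gamma>)"
    using F by (simp add: asg_def Int_absorb2)
  have "single \<Delta> - scale (koszul_sign 0 n p \<Gamma>') (single \<Gamma>') \<in> relators 0 n"
    unfolding relators_def p(2) using \<Gamma>'(1) p(1) by blast
  then have "single \<Delta> - scale (koszul_sign 0 n p \<Gamma>' * ev ^ card F) (single \<Gamma>) \<in> series.span (relators 0 n)"
    by (rule span_iso_trans[OF series.span_base \<Gamma>'(3)])
  then show ?thesis unfolding k .
qed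

lemma restrict_expand:
  assumes c: "c \<in> graph_series (\<lambda>_. True)" and fin: "finite {\<Gamma>. hairy \<Gamma> \<and> P \<Gamma>}"
  shows "restrict_series P c = (\<Sum>\<Gamma>\<in>{\<Gamma>. hairy \<Gamma> \<and> P \<Gamma>}. scale (c \<Gamma>) (single \<Gamma>))"
proof
  fix \<Delta>
  have "(\<Sum>\<Gamma>\<in>{\<Gamma>. hairy \<Gamma> \<and> P \<Gamma>}. scale (c \<Gamma>) (single \<Gamma>)) \<Delta> =
      (\<Sum>\<Gamma>\<in>{\<Gamma>. hairy \<Gamma> \<and> P \<Gamma>}. if \<Delta> = \<Gamma> then c \<Gamma> else 0)"
    unfolding sum_fun_apply by (rule sum.cong) (auto simp: scale_def single_def)
  also have "\<dots> = (if hairy \<Delta> \<and> P \<Delta> then c \<Delta> else 0)" using fin by simp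
  also have "\<dots> = restrict_series P c \<Delta>" using c by (auto simp: restrict_series_def graph_series_def)
  finally show "restrict_series P c \<Delta> = (\<Sum>\<Gamma>\<in>{\<Gamma>. hairy \<Gamma> \<and> P \<Gamma>}. scale (c \<Gamma>) (single \<Gamma>)) \<Delta>" by simp
qed

text \<open>Averaging a graph over its relabellings does not change its class.\<close>

lemma Sec_Tr_rel:
  assumes c: "c \<in> graph_series (\<lambda>_. True)"
  shows "Sec (Tr c) - c \<in> hgc_rel 0 n"
  unfolding hgc_rel_def
proof (intro CollectI conjI allI)
  have "Sec (Tr c) \<Gamma> - c \<Gamma> \<noteq> 0 \<Longrightarrow> hairy \<Gamma>" for \<Gamma>
  proof (rule ccontr)
    assume *: "Sec (Tr c) \<Gamma> - c \<Gamma> \<noteq> 0" "\<not> hairy \<Gamma>"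
    then have "c \<Gamma> = 0" "Sec (Tr c) \<Gamma> = 0" using c by (auto simp: graph_series_def Sec_def)
    then show False using * by simp
  qed
  then show s: "Sec (Tr c) - c \<in> graph_series (\<lambda>_. True)" by (auto simp: graph_series_def)
  fix h g
  define P where "P = (\<lambda>\<Gamma>. hairs \<Gamma> = h \<and> loop_order \<Gamma> = g)"
  define A where "A = {\<Gamma>. hairy \<Gamma> \<and> P \<Gamma>}"
  have fin: "finite A" unfolding A_def P_def using finite_piece[of h g] .
  define m where "m = (\<lambda>\<Gamma>. of_nat (card (lab (star \<Gamma>))) :: 'k)"
  have fstA: "fst x \<in> A" if x: "x \<in> lab (star \<Gamma>)" and \<Gamma>: "\<Gamma> \<in> A" for x \<Gamma>
  proof -
    obtain \<Delta> s t F where xx: "x = (\<Delta>, s, t, F)" by (metis surj_pair)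
    have g: "good \<Gamma>" using \<Gamma> hairy_good by (simp add: A_def)
    have "P \<Gamma>" using \<Gamma> by (simp add: A_def)
    then have "P \<Delta>" using lab_hairs_loops[of \<Delta> s t F "star \<Gamma>"] x hairs_star[OF g] loop_order_star[OF g]
      unfolding xx P_def by metis
    then show ?thesis using labD[of \<Delta> s t F] x unfolding xx A_def by simp
  qed
  \<comment> \<open>By \<open>iso_rel\<close>, \<open>lsg\<close> times \<open>\<Gamma>\<close> is
    the labelling graph modulo relations.\<close>
  have t1: "scale (Sec (Tr c) \<Gamma>) (single \<Gamma>) - (\<Sum>x\<in>lab (star \<Gamma>). scale (c (fst x) / m \<Gamma>) (single (fst x)))
      \<in> series.span (relators 0 n)" if \<Gamma>: "\<Gamma> \<in> A" for \<Gamma>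
  proof -
    have h: "hairy \<Gamma>" using \<Gamma> by (simp add: A_def)
    have "scale (Sec (Tr c) \<Gamma>) (single \<Gamma>) = (\<Sum>x\<in>lab (star \<Gamma>). scale (c (fst x) / m \<Gamma> * lsg (star \<Gamma>) x) (single \<Gamma>))"
      using h by (auto simp: fun_eq_iff sum_fun_apply scale_def Sec_def Tr_def m_def sum_divide_distrib sum_distrib_right intro!: sum.cong)
    then have "scale (Sec (Tr c) \<Gamma>) (single \<Gamma>) - (\<Sum>x\<in>lab (star \<Gamma>). scale (c (fst x) / m \<Gamma>) (single (fst x))) =
      (\<Sum>x\<in>lab (star \<Gamma>). scale (- (c (fst x) / m \<Gamma>)) (single (fst x) - scale (lsg (star \<Gamma>) x) (single \<Gamma>)))"
      by (auto simp: sum_subtractf[symmetric] fun_eq_iff scale_def algebra_simps sum_fun_apply intro!: sum.cong)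
    moreover have "single (fst x) - scale (lsg (star \<Gamma>) x) (single \<Gamma>) \<in> series.span (relators 0 n)" if x: "x \<in> lab (star \<Gamma>)" for x
    proof -
      obtain \<Delta> s t F where xx: "x = (\<Delta>, s, t, F)" by (metis surj_pair)
      show ?thesis using iso_rel[OF h] labD x unfolding xx lsg_def by fastforce
    qed
    ultimately show ?thesis by (metis (no_types, lifting) series.span_sum series.span_scale)
  qed
  have "(\<Sum>\<Gamma>\<in>A. \<Sum>x\<in>lab (star \<Gamma>). scale (c (fst x) / m \<Gamma>) (single (fst x))) =
      (\<Sum>\<Gamma>\<in>A. \<Sum>\<Delta>\<in>A. \<Sum>x\<in>lab_of (star \<Gamma>) \<Delta>. scale (c (fst x) / m \<Gamma>) (single (fst x)))"
  proof (rule sum.cong[OF refl])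
    fix \<Gamma> assume "\<Gamma> \<in> A"
    then have "fst ` lab (star \<Gamma>) \<subseteq> A" using fstA by blast
    then show "(\<Sum>x\<in>lab (star \<Gamma>). scale (c (fst x) / m \<Gamma>) (single (fst x))) =
      (\<Sum>\<Delta>\<in>A. \<Sum>x\<in>lab_of (star \<Gamma>) \<Delta>. scale (c (fst x) / m \<Gamma>) (single (fst x)))"
      unfolding lab_of_def by (rule sum.group[OF finite_lab fin, symmetric])
  qed
  \<comment> \<open>Collects the coefficient of each labelling graph \<open>\<Delta>\<close>. Since
    isomorphic graphs have equally many labellings and \<open>lab_of\<close> is symmetric, it is the
    average of the constant \<open>c \<Delta>\<close> over
    \<open>lab (star \<Delta>)\<close>.\<close>
  also have "\<dots> = (\<Sum>\<Delta>\<in>A. \<Sum>\<Gamma>\<in>A. \<Sum>x\<in>lab_of (star \<Gamma>) \<Delta>. scale (c (fst x) / m \<Gamma>) (single (fst x)))"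
    by (rule sum.swap)
  also have "\<dots> = (\<Sum>\<Delta>\<in>A. scale (c \<Delta>) (single \<Delta>))"
  proof (rule sum.cong[OF refl])
    fix \<Delta> assume \<Delta>: "\<Delta> \<in> A"
    then have hd: "hairy \<Delta>" by (simp add: A_def)
    have "(\<Sum>\<Gamma>\<in>A. \<Sum>x\<in>lab_of (star \<Gamma>) \<Delta>. scale (c (fst x) / m \<Gamma>) (single (fst x))) =
        (\<Sum>\<Gamma>\<in>A. \<Sum>x\<in>lab_of (star \<Delta>) \<Gamma>. scale (c \<Delta> / m \<Delta>) (single \<Delta>))"
    proof (rule sum.cong[OF refl])
      fix \<Gamma> assume \<Gamma>: "\<Gamma> \<in> A"
      then have hg: "hairy \<Gamma>" by (simp add: A_def)
      have "(\<Sum>x\<in>lab_of (star \<Gamma>) \<Delta>. scale (c (fst x) / m \<Gamma>) (single (fst x))) =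
          (\<Sum>x\<in>lab_of (star \<Gamma>) \<Delta>. scale (c \<Delta> / m \<Delta>) (single \<Delta>))"
      proof (rule sum.cong[OF refl])
        fix x assume x: "x \<in> lab_of (star \<Gamma>) \<Delta>"
        then obtain s t F where xx: "x = (\<Delta>, s, t, F)" unfolding lab_of_def by (metis (mono_tags, lifting) mem_Collect_eq prod.collapse)
        have "m \<Delta> = m \<Gamma>" using lab_card_star[of \<Delta> s t F "star \<Gamma>"] x unfolding xx lab_of_def m_def by simp
        then show "scale (c (fst x) / m \<Gamma>) (single (fst x)) = scale (c \<Delta> / m \<Delta>) (single \<Delta>)" using xx by simp
      qed
      also have "\<dots> = (\<Sum>x\<in>lab_of (star \<Delta>) \<Gamma>. scale (c \<Delta> / m \<Delta>) (single \<Delta>))"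
        using card_lab_of_sym[OF hg hd] by (simp add: fun_eq_iff sum_fun_apply)
      finally show "(\<Sum>x\<in>lab_of (star \<Gamma>) \<Delta>. scale (c (fst x) / m \<Gamma>) (single (fst x))) =
         (\<Sum>x\<in>lab_of (star \<Delta>) \<Gamma>. scale (c \<Delta> / m \<Delta>) (single \<Delta>))" .
    qed
    also have "\<dots> = (\<Sum>x\<in>lab (star \<Delta>). scale (c \<Delta> / m \<Delta>) (single \<Delta>))"
    proof -
      have "fst ` lab (star \<Delta>) \<subseteq> A" using fstA[OF _ \<Delta>] by blast
      then show ?thesis unfolding lab_of_def by (rule sum.group[OF finite_lab fin])
    qed
    also have "\<dots> = scale (c \<Delta>) (single \<Delta>)"
      using card_lab_nz[of "star \<Delta>"] hd by (simp add: fun_eq_iff sum_fun_apply scale_def m_def hairy_iff)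
    finally show "(\<Sum>\<Gamma>\<in>A. \<Sum>x\<in>lab_of (star \<Gamma>) \<Delta>. scale (c (fst x) / m \<Gamma>) (single (fst x))) = scale (c \<Delta>) (single \<Delta>)" .
  qed
  finally have eq: "(\<Sum>\<Gamma>\<in>A. \<Sum>x\<in>lab (star \<Gamma>). scale (c (fst x) / m \<Gamma>) (single (fst x))) = (\<Sum>\<Delta>\<in>A. scale (c \<Delta>) (single \<Delta>))" .
  have "restrict_series P (Sec (Tr c) - c) = restrict_series P (Sec (Tr c)) - restrict_series P c"
    by (simp add: restrict_series_def fun_eq_iff)
  also have "\<dots> = (\<Sum>\<Gamma>\<in>A. scale (Sec (Tr c) \<Gamma>) (single \<Gamma>)) - (\<Sum>\<Delta>\<in>A. scale (c \<Delta>) (single \<Delta>))"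
    using restrict_expand[OF Sec_series, of P "Tr c"] restrict_expand[OF c, of P] fin unfolding A_def by simp
  also have "\<dots> = (\<Sum>\<Gamma>\<in>A. scale (Sec (Tr c) \<Gamma>) (single \<Gamma>) - (\<Sum>x\<in>lab (star \<Gamma>). scale (c (fst x) / m \<Gamma>) (single (fst x))))"
    unfolding sum_subtractf eq ..
  also have "\<dots> \<in> series.span (relators 0 n)" using t1 by (rule series.span_sum)
  finally show "restrict_series (\<lambda>\<Gamma>. hairs \<Gamma> = h \<and> loop_order \<Gamma> = g) (Sec (Tr c) - c) \<in> series.span (relators 0 n)"
    unfolding P_def .
qed

text \<open>If \<open>Tr c\<close> vanishes, the element \<open>Sec (Tr c) - c\<close> from
  \<open>Sec_Tr_rel\<close> is \<open>- c\<close>.\<close>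

lemma hgc_rel_iff: "c \<in> hgc_rel 0 n \<longleftrightarrow> c \<in> graph_series (\<lambda>_. True) \<and> Tr c = (\<lambda>_. 0)"
proof
  assume "c \<in> hgc_rel 0 n"
  then show "c \<in> graph_series (\<lambda>_. True) \<and> Tr c = (\<lambda>_. 0)" using Tr_hgc_rel by (auto simp: hgc_rel_def)
next
  assume c: "c \<in> graph_series (\<lambda>_. True) \<and> Tr c = (\<lambda>_. 0)"
  have "Sec (\<lambda>_. 0) = 0" by (simp add: Sec_def fun_eq_iff)
  then have m: "- c \<in> hgc_rel 0 n" using Sec_Tr_rel[of c] c by simp
  have "restrict_series P c \<in> series.span (relators 0 n)" if "restrict_series P (- c) \<in> series.span (relators 0 n)" for P
  proof -
    have "restrict_series P c = scale (- 1) (restrict_series P (- c))" by (simp add: restrict_series_def scale_def fun_eq_iff)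
    then show ?thesis using series.span_scale[OF that, of "- 1"] by simp
  qed
  then show "c \<in> hgc_rel 0 n" using m c unfolding hgc_rel_def by blast
qed

end

section \<open>The standard differential\<close>

text \<open>The shift of the old cells in \<open>split_vertex\<close>.\<close>

definition sh :: "nat \<Rightarrow> nat" where "sh i = i + 2"

lemma sh_inj: "inj_on sh X" by (simp add: inj_on_def sh_def)

lemma split_nth:
  "length (split_vertex \<Gamma> v A) = length \<Gamma> + 2"
  "split_vertex \<Gamma> v A ! 0 = Vertex"
  "split_vertex \<Gamma> v A ! 1 = Edge (v + 2) 0"
  "e < length \<Gamma> \<Longrightarrow> split_vertex \<Gamma> v A ! (e + 2) = (case \<Gamma> ! e of Vertex \<Rightarrow> Vertex
     | Edge s t \<Rightarrow> Edge (if (e, False) \<in> A then 0 else s + 2) (if (e, True) \<in> A then 0 else t + 2))"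
  by (simp_all add: split_vertex_def) (cases "\<Gamma> ! e"; simp add: split_vertex_def)

lemma split_cases: "i < length \<Gamma> + 2 \<Longrightarrow> i = 0 \<or> i = 1 \<or> (\<exists>j<length \<Gamma>. i = j + 2)"
  by presburger

lemma split_edges: "edges (split_vertex \<Gamma> v A) = insert 1 (sh ` edges \<Gamma>)"
proof (intro equalityI subsetI)
  fix i assume "i \<in> edges (split_vertex \<Gamma> v A)"
  then have i: "i < length \<Gamma> + 2" "split_vertex \<Gamma> v A ! i \<noteq> Vertex" by (auto simp: edges_def split_nth)
  consider "i = 0" | "i = 1" | j where "j < length \<Gamma>" "i = j + 2" using split_cases[OF i(1)] by blast
  then show "i \<in> insert 1 (sh ` edges \<Gamma>)"
  proof cases
    case 3
    then have "\<Gamma> ! j \<noteq> Vertex" using i(2) split_nth(4)[of j \<Gamma> v A] by auto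
    then show ?thesis using 3 by (auto simp: edges_def sh_def)
  qed (use i split_nth(2) in auto)
next
  fix i assume "i \<in> insert 1 (sh ` edges \<Gamma>)"
  then consider "i = 1" | j where "j \<in> edges \<Gamma>" "i = j + 2" by (auto simp: sh_def)
  then show "i \<in> edges (split_vertex \<Gamma> v A)"
  proof cases
    case 1
    then show ?thesis using split_nth(3)[of \<Gamma> v A] by (simp add: edges_def split_nth(1))
  next
    case 2
    then have "j < length \<Gamma>" by (simp add: edges_def)
    then show ?thesis using 2 split_nth(4)[of j \<Gamma> v A] cell_edge[OF 2(1)]
      by (auto simp: edges_def split_nth(1) split: cell.splits)
  qed
qed

lemma split_verts: "verts (split_vertex \<Gamma> v A) = insert 0 (sh ` verts \<Gamma>)"
proof -
  let ?L = "{..<length \<Gamma> + 2}"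
  have L: "?L = insert 0 (insert 1 (sh ` {..<length \<Gamma>}))"
    using split_cases[of _ \<Gamma>] by (auto simp: sh_def image_iff)
  have "verts (split_vertex \<Gamma> v A) = ?L - edges (split_vertex \<Gamma> v A)"
    by (auto simp: verts_def edges_def split_nth(1))
  also have "\<dots> = insert 0 (sh ` ({..<length \<Gamma>} - edges \<Gamma>))"
    unfolding L split_edges by (auto simp: sh_def)
  also have "{..<length \<Gamma>} - edges \<Gamma> = verts \<Gamma>" by (auto simp: verts_def edges_def)
  finally show ?thesis .
qed

lemma split_cend:
  "cend (split_vertex \<Gamma> v A) 1 b = (if b then 0 else v + 2)"
  "e \<in> edges \<Gamma> \<Longrightarrow> cend (split_vertex \<Gamma> v A) (e + 2) b = (if (e, b) \<in> A then 0 else cend \<Gamma> e b + 2)"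
proof -
  show "cend (split_vertex \<Gamma> v A) 1 b = (if b then 0 else v + 2)"
    using split_nth(3)[of \<Gamma> v A] by (simp add: cend_def)
  assume e: "e \<in> edges \<Gamma>"
  then have "e < length \<Gamma>" by (simp add: edges_def)
  then show "cend (split_vertex \<Gamma> v A) (e + 2) b = (if (e, b) \<in> A then 0 else cend \<Gamma> e b + 2)"
  proof -
    obtain s t where "\<Gamma> ! e = Edge s t" using cell_edge[OF e] by blast
    then show ?thesis using split_nth(4)[OF \<open>e < length \<Gamma>\<close>, of v A] by (simp add: cend_def)
  qed
qed

lemma splittingsD:
  "(v, A) \<in> splittings \<Gamma> \<Longrightarrow> v \<in> verts \<Gamma> \<and> A \<subseteq> half_edges \<Gamma> v \<and> 2 \<le> card A \<and> 2 \<le> card (half_edges \<Gamma> v - A)"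
  by (simp add: splittings_def)

lemma splitting_valence:
  assumes "(v, A) \<in> splittings \<Gamma>" shows "4 \<le> valence \<Gamma> v"
proof -
  have d: "A \<subseteq> half_edges \<Gamma> v" "2 \<le> card A" "2 \<le> card (half_edges \<Gamma> v - A)" using splittingsD[OF assms] by auto
  have "card (half_edges \<Gamma> v - A) = card (half_edges \<Gamma> v) - card A"
    by (rule card_Diff_subset) (rule finite_subset[OF d(1) finite_half_edges], rule d(1))
  then show ?thesis using d by (simp add: valence_def)
qed

lemma split_half_edges:
  assumes A: "A \<subseteq> half_edges \<Gamma> v"
  shows "half_edges (split_vertex \<Gamma> v A) 0 = insert (1, True) (half_map sh {} ` A)"
    "half_edges (split_vertex \<Gamma> v A) (w + 2) =
      (if w = v then insert (1, False) (half_map sh {} ` (half_edges \<Gamma> v - A)) else half_map sh {} ` half_edges \<Gamma> w)"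
proof -
  have AE: "e \<in> edges \<Gamma> \<and> cend \<Gamma> e b = v" if "(e, b) \<in> A" for e b using A that by (auto simp: half_edges_iff)
  have 1: "(i, b) \<in> half_edges (split_vertex \<Gamma> v A) j \<longleftrightarrow>
      (i = 1 \<and> j = (if b then 0 else v + 2)) \<or> (\<exists>e\<in>edges \<Gamma>. i = e + 2 \<and> j = (if (e, b) \<in> A then 0 else cend \<Gamma> e b + 2))" for i b j
    unfolding half_edges_iff split_edges using split_cend(1)[of \<Gamma> v A b] split_cend(2)[of _ \<Gamma> v A b]
    by (auto simp: sh_def)
  have im: "(i, b) \<in> half_map sh {} ` X \<longleftrightarrow> (\<exists>e. i = e + 2 \<and> (e, b) \<in> X)" for i b X
    by (force simp: half_map_def sh_def)
  show "half_edges (split_vertex \<Gamma> v A) 0 = insert (1, True) (half_map sh {} ` A)"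
  proof (rule set_eqI)
    fix h :: "nat \<times> bool"
    obtain i and b :: bool where h: "h = (i, b)" by force
    show "h \<in> half_edges (split_vertex \<Gamma> v A) 0 \<longleftrightarrow> h \<in> insert (1, True) (half_map sh {} ` A)"
      unfolding h 1 insert_iff im using AE by (auto split: if_splits)
  qed
  show "half_edges (split_vertex \<Gamma> v A) (w + 2) =
      (if w = v then insert (1, False) (half_map sh {} ` (half_edges \<Gamma> v - A)) else half_map sh {} ` half_edges \<Gamma> w)"
  proof (rule set_eqI)
    fix h :: "nat \<times> bool"
    obtain i and b :: bool where h: "h = (i, b)" by force
    show "h \<in> half_edges (split_vertex \<Gamma> v A) (w + 2) \<longleftrightarrow>
       h \<in> (if w = v then insert (1, False) (half_map sh {} ` (half_edges \<Gamma> v - A)) else half_map sh {} ` half_edges \<Gamma> w)"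
    proof (cases "w = v")
      case True
      then show ?thesis unfolding h 1 using AE by (auto simp: im half_edges_iff split: if_splits)
    next
      case False
      then show ?thesis unfolding h 1 using AE by (auto simp: im half_edges_iff split: if_splits)
    qed
  qed
qed

lemma card_half_map_sh: "card (half_map sh {} ` X) = card X"
  by (rule card_image) (auto simp: inj_on_def half_map_def sh_def)

lemma split_valence:
  assumes A: "(v, A) \<in> splittings \<Gamma>"
  shows "3 \<le> valence (split_vertex \<Gamma> v A) 0" "3 \<le> valence (split_vertex \<Gamma> v A) (v + 2)"
    "w \<noteq> v \<Longrightarrow> valence (split_vertex \<Gamma> v A) (w + 2) = valence \<Gamma> w"
proof -
  have d: "A \<subseteq> half_edges \<Gamma> v" "2 \<le> card A" "2 \<le> card (half_edges \<Gamma> v - A)" using splittingsD[OF A] by auto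
  have fin: "finite A" by (rule finite_subset[OF d(1) finite_half_edges])
  have n1: "(1, b) \<notin> half_map sh {} ` X" for b X by (auto simp: half_map_def sh_def)
  show "3 \<le> valence (split_vertex \<Gamma> v A) 0"
    unfolding valence_def split_half_edges(1)[OF d(1)] using fin n1 d(2) by (simp add: card_half_map_sh)
  show "3 \<le> valence (split_vertex \<Gamma> v A) (v + 2)"
    unfolding valence_def split_half_edges(2)[OF d(1)] using n1 d(3) finite_half_edges[of \<Gamma> v] by (simp add: card_half_map_sh)
  show "w \<noteq> v \<Longrightarrow> valence (split_vertex \<Gamma> v A) (w + 2) = valence \<Gamma> w"
    unfolding valence_def split_half_edges(2)[OF d(1)] by (simp add: card_half_map_sh)
qed

lemma split_expansion:
  assumes A: "(v, A) \<in> splittings \<Gamma>"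
  shows "expansion (act sh sh {} (star \<Gamma>)) (Some (v + 2)) (half_map sh {} ` A) 0 1"
proof -
  have d: "A \<subseteq> half_edges \<Gamma> v" "2 \<le> card A" using splittingsD[OF A] by auto
  have rel: "relabelling (star \<Gamma>) sh sh" by unfold_locales (rule sh_inj)+
  interpret relabelling "star \<Gamma>" sh sh "{}" by (rule rel)
  have "halves (star \<Gamma>) (Some v) = half_edges \<Gamma> v" using splitting_valence[OF A] by (simp add: halves_star_Some)
  then have "A \<subseteq> halves (star \<Gamma>) (Some v)" using d by simp
  then have "half_map sh {} ` A \<subseteq> halves E' (Some (v + 2))"
    using act_halves[of _ _ "Some v"] by (fastforce simp: half_map_def sh_def)
  moreover have "A \<noteq> {}" using d(2) by auto
  ultimately show ?thesis
    by unfold_locales (auto simp: nodes_act[OF sh_inj] dom_act sh_def)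
qed

text \<open>By \<open>split_valence\<close> neither part of the split vertex is univalent and all
  other valences are kept, so no old half-edge moves to or from the star.\<close>

lemma split_star:
  assumes g: "good \<Gamma>" and A: "(v, A) \<in> splittings \<Gamma>"
  shows "star (split_vertex \<Gamma> v A) = expd (act sh sh {} (star \<Gamma>)) (Some (v + 2)) (half_map sh {} ` A) 0 1"
proof
  fix i
  let ?\<Gamma> = "split_vertex \<Gamma> v A"
  have d: "A \<subseteq> half_edges \<Gamma> v" using splittingsD[OF A] by auto
  have vv: "valence \<Gamma> v \<noteq> 1" using splitting_valence[OF A] by simp
  note sv = split_valence[OF A]
  show "star ?\<Gamma> i = expd (act sh sh {} (star \<Gamma>)) (Some (v + 2)) (half_map sh {} ` A) 0 1 i"
  proof (cases "i = 1")
    case True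
    have "star ?\<Gamma> 1 = Some (\<lambda>b. if b then Some 0 else Some (v + 2))"
    proof -
      have "(if valence ?\<Gamma> (cend ?\<Gamma> 1 b) = 1 then None else Some (cend ?\<Gamma> 1 b)) = (if b then Some 0 else Some (v + 2))" for b
        using sv(1,2) split_cend(1)[of \<Gamma> v A b] by auto
      then show ?thesis unfolding star_def split_edges by (simp only: insertI1 if_True)
    qed
    then show ?thesis unfolding True expd_def by (simp only: simp_thms if_True)
  next
    case i1: False
    show ?thesis
    proof (cases "i \<in> sh ` edges \<Gamma>")
      case True
      then obtain e where e: "e \<in> edges \<Gamma>" "i = sh e" by auto
      then have i: "i = e + 2" by (simp add: sh_def)
      have st: "star \<Gamma> e = Some (\<lambda>b. if valence \<Gamma> (cend \<Gamma> e b) = 1 then None else Some (cend \<Gamma> e b))"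
        using e by (simp add: star_def)
      have ac: "act sh sh {} (star \<Gamma>) i =
          Some (\<lambda>b. map_option sh (if valence \<Gamma> (cend \<Gamma> e b) = 1 then None else Some (cend \<Gamma> e b)))"
        using act_apply[of sh "star \<Gamma>", OF sh_inj st, of sh "{}"] e(2) by (simp cong: if_cong)
      have eqn: "(if valence ?\<Gamma> (cend ?\<Gamma> i b) = 1 then None else Some (cend ?\<Gamma> i b)) =
         (if (i, b) \<in> half_map sh {} ` A then Some 0 else map_option sh (if valence \<Gamma> (cend \<Gamma> e b) = 1 then None else Some (cend \<Gamma> e b)))" for b
      proof -
        have m: "(i, b) \<in> half_map sh {} ` A \<longleftrightarrow> (e, b) \<in> A" unfolding i by (force simp: half_map_def sh_def)
        have c: "cend ?\<Gamma> i b = (if (e, b) \<in> A then 0 else cend \<Gamma> e b + 2)" unfolding i using split_cend(2)[OF e(1)] .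
        show ?thesis
        proof (cases "(e, b) \<in> A")
          case True
          then show ?thesis using m c sv(1) by simp
        next
          case False
          show ?thesis
          proof (cases "cend \<Gamma> e b = v")
            case True
            then show ?thesis using m c False sv(2) vv by (simp add: sh_def)
          next
            case F: False
            then show ?thesis using m c False sv(3)[OF F] by (simp add: sh_def)
          qed
        qed
      qed
      have "i \<in> edges ?\<Gamma>" using e by (simp add: split_edges)
      then have "star ?\<Gamma> i = Some (\<lambda>b. if valence ?\<Gamma> (cend ?\<Gamma> i b) = 1 then None else Some (cend ?\<Gamma> i b))"
        unfolding star_def by (simp only: if_True)
      then show ?thesis unfolding eqn expd_def ac using i1
        by (simp only: if_False option.map)
    next
      case False
      then have "i \<notin> edges ?\<Gamma>" using i1 by (simp add: split_edges)
      moreover have "act sh sh {} (star \<Gamma>) i = None" using False dom_act[of sh sh "{}" "star \<Gamma>"] dom_star by (metis domIff)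
      ultimately show ?thesis using i1 by (simp add: star_def expd_def)
    qed
  qed
qed

lemma split_good:
  assumes g: "good \<Gamma>" and A: "(v, A) \<in> splittings \<Gamma>" shows "good (split_vertex \<Gamma> v A)"
proof -
  let ?\<Gamma> = "split_vertex \<Gamma> v A"
  have wf: "wf_ograph \<Gamma>" using g by (simp add: good_def)
  have v: "v \<in> verts \<Gamma>" using splittingsD[OF A] by auto
  have "cend ?\<Gamma> i b \<in> verts ?\<Gamma>" if i: "i \<in> edges ?\<Gamma>" for i b
  proof (cases "i = 1")
    case True
    then show ?thesis using v split_cend(1)[of \<Gamma> v A b] by (auto simp: split_verts sh_def)
  next
    case False
    then obtain e where e: "e \<in> edges \<Gamma>" "i = e + 2" using i by (auto simp: split_edges sh_def)
    then show ?thesis using split_cend(2)[OF e(1), of v A b] wf_cend[OF wf e(1), of b] by (auto simp: split_verts sh_def)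
  qed
  then have "wf_ograph ?\<Gamma>" by (simp add: wf_ograph_cend)
  moreover have "valence ?\<Gamma> i = 1 \<or> 3 \<le> valence ?\<Gamma> i" if i: "i \<in> verts ?\<Gamma>" for i
  proof (cases "i = 0")
    case True then show ?thesis using split_valence(1)[OF A] by simp
  next
    case False
    then obtain w where w: "w \<in> verts \<Gamma>" "i = w + 2" using i by (auto simp: split_verts sh_def)
    show ?thesis
    proof (cases "w = v")
      case True then show ?thesis using split_valence(2)[OF A] w by simp
    next
      case False then show ?thesis using split_valence(3)[OF A False] w g by (simp add: good_def)
    qed
  qed
  ultimately show ?thesis by (simp add: good_def)
qed

lemma finite_splittings: "finite {(v, A) \<in> splittings \<Gamma>. split_vertex \<Gamma> v A = \<Delta>}"
proof (rule finite_subset)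
  show "{(v, A) \<in> splittings \<Gamma>. split_vertex \<Gamma> v A = \<Delta>} \<subseteq> verts \<Gamma> \<times> Pow (edges \<Gamma> \<times> UNIV)"
    by (auto simp: splittings_def half_edges_iff)
qed auto

lemma ni_contraction:
  assumes "e \<in> ni G"
  shows "contraction G e b (the (the (G e) b)) (Some (the (the (G e) (\<not> b))))"
proof -
  obtain p where p: "G e = Some p" "p True \<noteq> p False" "p True \<noteq> None" "p False \<noteq> None"
    using assms by (auto simp: ni_def nl_def)
  then have "p b \<noteq> None" "p (\<not> b) \<noteq> None" "p (\<not> b) \<noteq> p b" by (cases b; simp)+
  then show ?thesis using p(1) by unfold_locales (auto simp: in_halves)
qed

text \<open>The bijection underlying \<open>Tr_std_diff\<close>: realising a contraction of \<open>G\<close> at \<open>(e, b)\<close> amounts to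
  realising \<open>G\<close> as a splitting, with \<open>e\<close> as the new edge.\<close>

definition lab_split :: "sgraph \<Rightarrow> (nat \<times> bool) \<times> labelling \<Rightarrow> labelling \<times> ograph \<times> nat \<times> (nat \<times> bool) set" where
  "lab_split G = (\<lambda>((e, b), (\<Gamma>, s, t, F)).
     let y = the (the (G e) b); v = s (the (the (G e) (\<not> b)));
         A = half_map t F ` (halves G (Some y) - {(e, b)})
     in ((split_vertex \<Gamma> v A, restrict ((sh \<circ> s)(y := 0)) (nodes G), restrict ((sh \<circ> t)(e := 1)) (dom G),
          F \<union> (if b then {} else {e})), \<Gamma>, v, A))"

definition split_index :: "sgraph \<Rightarrow> (labelling \<times> ograph \<times> nat \<times> (nat \<times> bool) set) set" where
  "split_index G = {(x, \<Gamma>, v, A). x \<in> lab G \<and> hairy \<Gamma> \<and> (v, A) \<in> splittings \<Gamma> \<and> split_vertex \<Gamma> v A = fst x}"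

definition contr_index :: "sgraph \<Rightarrow> ((nat \<times> bool) \<times> labelling) set" where
  "contr_index G = (SIGMA (e, b):ni G \<times> UNIV. lab (contr G e b))"

lemma inv_sign_sh: "inv_sign q (sh \<circ> s) A = inv_sign q s A"
  by (simp add: inv_sign_def sh_def)

lemma half_map_comp: "half_map sh {} ` half_map t F ` X = half_map (sh \<circ> t) F ` X"
  by (simp add: image_image half_map_def case_prod_beta)

context hgc_sign begin

text \<open>The new vertex and edge sit at positions 0 and 1, before all shifted cells. Hence
  inserting them costs just the signs of the positions of \<open>y\<close> and \<open>e\<close> in
  \<open>G\<close>, and with the direction of \<open>e\<close> this is \<open>csg\<close>.\<close>

lemma lab_split:
  assumes val: "valid G" and e: "e \<in> ni G" and x: "(\<Gamma>, s, t, F) \<in> lab (contr G e b)"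
  shows "lab_split G ((e, b), (\<Gamma>, s, t, F)) \<in> split_index G \<and>
    lsg G (fst (lab_split G ((e, b), (\<Gamma>, s, t, F)))) = csg G e b * asg s t F (contr G e b)"
proof -
  define y where "y = the (the (G e) b)"
  define z where "z = the (the (G e) (\<not> b))"
  have "contraction G e b y (Some z)" unfolding y_def z_def using ni_contraction[OF e] .
  then interpret valid_contraction G e b y "Some z"
    using val by (simp add: valid_contraction_def valid_contraction_axioms_def)
  let ?G = "contr G e b"
  define S where "S = halves G (Some y) - {(e, b)}"
  define v where "v = s z"
  define A where "A = half_map t F ` S"
  have l: "hairy \<Gamma>" "relabelling ?G s t" "F \<subseteq> dom ?G" "star \<Gamma> = act s t F ?G" using labD[OF x] by auto
  interpret r: relabelling ?G s t F by fact
  have fin: "finite (dom ?G)" by (rule finite_contr)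
  have g: "good \<Gamma>" using l(1) by (rule hairy_good)
  have c2: "2 \<le> card (halves G (Some w) - {(e, c)})" if "(e, c) \<in> halves G (Some w)" for w c
  proof -
    have "3 \<le> card (halves G (Some w))" by (rule valid_card[OF val halves_nodes[OF that]])
    then show ?thesis using that by (simp add: card_Diff_singleton)
  qed
  have Sc: "2 \<le> card S" unfolding S_def by (rule c2[OF ey])
  then have S0: "S \<noteq> {}" by auto
  have hz: "halves ?G (Some z) = (halves G (Some z) - {(e, \<not> b)}) \<union> S" unfolding S_def by (rule halves_contr_end)
  have Ssub: "S \<subseteq> halves ?G (Some z)" unfolding hz by blast
  have rest: "halves ?G (Some z) - S = halves G (Some z) - {(e, \<not> b)}"
    unfolding hz using noloop halves_unique[of _ G "Some y" "Some z"] unfolding S_def by blast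
  have exp: "expansion ?G (Some z) S y e"
    using Ssub S0 by unfold_locales (auto simp: nodes_contr dom_contr)
  have ex: "expd ?G (Some z) S y e = (if b then G else act id id {e} G)"
    unfolding S_def by (rule expd_contr_full)
  obtain g0 c0 where g0: "(g0, c0) \<in> halves ?G (Some z)" using S0 Ssub by fastforce
  have zn: "z \<in> nodes ?G" using halves_nodes[OF g0] .
  have vn: "v \<in> nodes (star \<Gamma>)" unfolding v_def l(4) nodes_act[OF r.t] using zn by blast
  then have vv: "v \<in> verts \<Gamma>" "valence \<Gamma> v \<noteq> 1" by (auto simp: good_nodes[OF g])
  have he: "half_edges \<Gamma> v = half_map t F ` halves ?G (Some z)"
    using r.halves_act_eq[OF g0] vv(2) unfolding l(4)[symmetric] by (simp add: halves_star_Some v_def)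
  have hd: "halves ?G (Some z) \<subseteq> {h. fst h \<in> dom ?G}" by (auto dest: halves_dom)
  have cA: "card A = card S" unfolding A_def by (rule r.card_half_map) (use Ssub hd in blast)
  have "half_edges \<Gamma> v - A = half_map t F ` (halves ?G (Some z) - S)"
    unfolding he A_def by (rule inj_on_image_set_diff[OF r.inj_half_map, symmetric]) (use Ssub hd in auto)
  then have "card (half_edges \<Gamma> v - A) = card (halves ?G (Some z) - S)"
    using r.card_half_map[of "halves ?G (Some z) - S"] hd by auto
  then have sp: "(v, A) \<in> splittings \<Gamma>"
    unfolding splittings_def using vv(1) Ssub Sc cA rest c2[OF eu] he by (auto simp: A_def)
  let ?\<Gamma> = "split_vertex \<Gamma> v A"
  have rel2: "relabelling ?G (sh \<circ> s) (sh \<circ> t)"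
    by unfold_locales (rule comp_inj_on[OF r.s sh_inj], rule comp_inj_on[OF r.t sh_inj])
  have fr: "0 \<notin> (sh \<circ> s) ` nodes ?G" "1 \<notin> (sh \<circ> t) ` dom ?G" by (auto simp: sh_def)
  let ?s = "(sh \<circ> s)(y := 0)" and ?t = "(sh \<circ> t)(e := 1)" and ?F = "F \<union> (if b then {} else {e})"
  have eF: "e \<notin> F" "F - {e} = F" using l(3) dom_contr by auto
  have "act sh sh {} (star \<Gamma>) = act (sh \<circ> s) (sh \<circ> t) {g \<in> dom ?G. (g \<in> F) \<noteq> (t g \<in> {})} ?G"
    unfolding l(4) by (rule act_act[OF r.t sh_inj])
  also have "{g \<in> dom ?G. (g \<in> F) \<noteq> (t g \<in> {})} = F" using l(3) by blast
  finally have ac2: "act sh sh {} (star \<Gamma>) = act (sh \<circ> s) (sh \<circ> t) F ?G" .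
  have "star ?\<Gamma> = expd (act (sh \<circ> s) (sh \<circ> t) F ?G) (map_option (sh \<circ> s) (Some z)) (half_map (sh \<circ> t) F ` S) 0 1"
    unfolding split_star[OF g sp] ac2 unfolding A_def half_map_comp v_def by (simp only: option.map comp_apply sh_def)
  also have "\<dots> = act ?s ?t F (if b then G else act id id {e} G)"
    using expd_act(1)[OF exp rel2 fr, of F] unfolding ex eF(2) .
  finally have st0: "star ?\<Gamma> = act ?s ?t F (if b then G else act id id {e} G)" .
  have nd: "nodes G = insert y (nodes ?G)" "dom G = insert e (dom ?G)"
    using halves_nodes[OF ey] e_dom by (auto simp: nodes_contr dom_contr)
  have rel: "relabelling G ?s ?t"
    using expd_act(3)[OF exp rel2 fr] unfolding relabelling_def expansion.nodes_expd[OF exp] expansion.dom_expd[OF exp] nd .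
  have flip: "{g \<in> dom G. (g \<in> {e}) \<noteq> (id g \<in> F)} = F \<union> {e}" using l(3) eF e_dom dom_contr by auto
  have st: "star ?\<Gamma> = act ?s ?t ?F G"
  proof (cases b)
    case False
    have "act ?s ?t F (act id id {e} G) = act (?s \<circ> id) (?t \<circ> id) {g \<in> dom G. (g \<in> {e}) \<noteq> (id g \<in> F)} G"
      by (rule act_act) (use rel in \<open>auto simp: relabelling_def\<close>)
    then show ?thesis unfolding st0 flip using False by (simp only: if_False o_id)
  qed (use st0 in simp)
  have "hairy ?\<Gamma>"
    using split_good[OF g sp] relabelling.valid_act[OF rel, of ?F] st val by (simp add: hairy_iff)
  moreover have "star ?\<Gamma> = act (restrict ?s (nodes G)) (restrict ?t (dom G)) ?F G"
    unfolding st by (rule act_restrict[symmetric]) (use rel in \<open>auto simp: relabelling_def\<close>)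
  moreover have "?F \<subseteq> dom G" using l(3) e_dom dom_contr by auto
  ultimately have mem: "(?\<Gamma>, restrict ?s (nodes G), restrict ?t (dom G), ?F) \<in> lab G"
    unfolding lab_def using rel relabelling_restrict by auto
  have ls: "lab_split G ((e, b), (\<Gamma>, s, t, F)) = ((?\<Gamma>, restrict ?s (nodes G), restrict ?t (dom G), ?F), \<Gamma>, v, A)"
    unfolding lab_split_def by (simp add: Let_def y_def[symmetric] z_def[symmetric] v_def S_def A_def)
  have ax: "asg ?s ?t F (if b then G else act id id {e} G) = asg s t F ?G *
      (ev ^ card {v \<in> nodes ?G. v < y} * (- ev) ^ card {g \<in> dom ?G. g < e})"
  proof -
    have "{v \<in> nodes ?G. (sh \<circ> s) v < 0} = {}" "{g \<in> dom ?G. (sh \<circ> t) g < 1} = {}" by (auto simp: sh_def)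
    moreover have "asg (sh \<circ> s) (sh \<circ> t) F ?G = asg s t F ?G" by (simp add: asg_def inv_sign_sh)
    ultimately show ?thesis
      using asg_expd[OF exp fin rel2 fr, of F] unfolding ex eF(2) by (simp only: card.empty power_0 mult_1_right)
  qed
  have cs: "csg G e b = ev ^ card {v \<in> nodes ?G. v < y} * (- ev) ^ card {g \<in> dom ?G. g < e} * (if b then 1 else ev)"
  proof -
    have "{v \<in> nodes G. v < y} = {v \<in> nodes ?G. v < y}" "{g \<in> dom G. g < e} = {g \<in> dom ?G. g < e}" using nd by auto
    then show ?thesis unfolding csg_def the_end by simp
  qed
  have "asg (restrict ?s (nodes G)) (restrict ?t (dom G)) ?F G = asg ?s ?t ?F G" by (rule asg_cong) auto
  also have "\<dots> = asg s t F ?G * csg G e b"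
  proof (cases b)
    case True
    then show ?thesis using ax cs by simp
  next
    case False
    have "asg (?s \<circ> id) (?t \<circ> id) {g \<in> dom G. (g \<in> {e}) \<noteq> (id g \<in> F)} G = asg ?s ?t F (act id id {e} G) * asg id id {e} G"
      by (rule asg_comp[OF valid_finite[OF val] relabelling_id])
        (use rel in \<open>simp add: relabelling_def nodes_act dom_act\<close>)
    moreover have "asg id id {e} G = ev" using e_dom by (simp add: asg_def)
    ultimately have "asg ?s ?t ?F G = asg ?s ?t F (act id id {e} G) * ev"
      unfolding flip using False by (simp only: if_False o_id)
    then show ?thesis using ax cs False by simp
  qed
  finally have "lsg G (fst (lab_split G ((e, b), (\<Gamma>, s, t, F)))) = csg G e b * asg s t F ?G"
    unfolding ls lsg_def by simp
  moreover have "lab_split G ((e, b), (\<Gamma>, s, t, F)) \<in> split_index G"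
    unfolding ls split_index_def using mem l(1) sp by simp
  ultimately show ?thesis by blast
qed

lemma inj_lab_split: "inj_on (lab_split G) (contr_index G)"
proof (rule inj_onI)
  fix j1 j2 assume j: "j1 \<in> contr_index G" "j2 \<in> contr_index G" "lab_split G j1 = lab_split G j2"
  obtain e1 b1 \<Gamma>1 s1 t1 F1 where j1: "j1 = ((e1, b1), (\<Gamma>1, s1, t1, F1))" by (metis surj_pair)
  obtain e2 b2 \<Gamma>2 s2 t2 F2 where j2: "j2 = ((e2, b2), (\<Gamma>2, s2, t2, F2))" by (metis surj_pair)
  have m: "e1 \<in> ni G" "(\<Gamma>1, s1, t1, F1) \<in> lab (contr G e1 b1)" "e2 \<in> ni G" "(\<Gamma>2, s2, t2, F2) \<in> lab (contr G e2 b2)"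
    using j(1,2) unfolding j1 j2 contr_index_def by auto
  let ?y1 = "the (the (G e1) b1)" and ?y2 = "the (the (G e2) b2)"
  have q: "\<Gamma>1 = \<Gamma>2" "restrict ((sh \<circ> s1)(?y1 := 0)) (nodes G) = restrict ((sh \<circ> s2)(?y2 := 0)) (nodes G)"
    "restrict ((sh \<circ> t1)(e1 := 1)) (dom G) = restrict ((sh \<circ> t2)(e2 := 1)) (dom G)"
    "F1 \<union> (if b1 then {} else {e1}) = F2 \<union> (if b2 then {} else {e2})"
    using j(3) unfolding j1 j2 lab_split_def by (simp_all add: Let_def)
  have ed: "e1 \<in> dom G" using m(1) by (simp add: ni_def nl_def)
  have e: "e1 = e2"
  proof (rule ccontr)
    assume "e1 \<noteq> e2"
    then have "1 = sh (t2 e1)" using fun_cong[OF q(3), of e1] ed by simp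
    then show False by (simp add: sh_def)
  qed
  have F: "F1 \<subseteq> dom (contr G e1 b1)" "F2 \<subseteq> dom (contr G e2 b2)" using labD[OF m(2)] labD[OF m(4)] by auto
  then have nF: "e1 \<notin> F1" "e1 \<notin> F2" using e by (auto simp: contr_def split: if_splits)
  have b: "b1 = b2" using q(4) nF unfolding e by (auto split: if_splits)
  have "F1 = F2" using q(4) nF unfolding e b by (auto split: if_splits)
  interpret contraction G e1 b1 ?y1 "Some (the (the (G e1) (\<not> b1)))" using ni_contraction[OF m(1)] .
  have l: "s1 \<in> extensional (nodes (contr G e1 b1))" "t1 \<in> extensional (dom (contr G e1 b1))"
    "s2 \<in> extensional (nodes (contr G e1 b1))" "t2 \<in> extensional (dom (contr G e1 b1))"
    using labD[OF m(2)] labD[OF m(4)] unfolding e b by auto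
  have "s1 = s2"
  proof (rule extensionalityI[OF l(1,3)])
    fix w assume w: "w \<in> nodes (contr G e1 b1)"
    then obtain g c where gc: "(g, c) \<in> halves (contr G e1 b1) (Some w)" by (auto simp: nodes_halves)
    then have "w \<noteq> ?y1" "w \<in> nodes G" using halves_contr eu by (auto dest: halves_nodes)
    then show "s1 w = s2 w" using fun_cong[OF q(2), of w] e b by (simp add: sh_def)
  qed
  moreover have "t1 = t2"
  proof (rule extensionalityI[OF l(2,4)])
    fix g assume "g \<in> dom (contr G e1 b1)"
    then have "g \<noteq> e1" "g \<in> dom G" using dom_contr by auto
    then show "t1 g = t2 g" using fun_cong[OF q(3), of g] e by (simp add: sh_def)
  qed
  ultimately show "j1 = j2" unfolding j1 j2 using q(1) e b \<open>F1 = F2\<close> by simp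
qed

text \<open>The contracted edge and its absorbed end are the preimages of positions 1 and 0; undoing
  the shift by 2 on all other cells gives the labelling of the contraction.\<close>

lemma surj_lab_split:
  assumes val: "valid G" and k: "k \<in> split_index G" shows "k \<in> lab_split G ` contr_index G"
proof -
  obtain \<Gamma>' s t F \<Gamma> v A where kk: "k = ((\<Gamma>', s, t, F), \<Gamma>, v, A)" by (metis surj_pair)
  have m: "(\<Gamma>', s, t, F) \<in> lab G" "hairy \<Gamma>" "(v, A) \<in> splittings \<Gamma>" "\<Gamma>' = split_vertex \<Gamma> v A"
    using k unfolding kk split_index_def by auto
  have l: "s \<in> extensional (nodes G)" "t \<in> extensional (dom G)" "relabelling G s t" "F \<subseteq> dom G" "star \<Gamma>' = act s t F G"
    using labD[OF m(1)] by auto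
  have g: "good \<Gamma>" using m(2) by (rule hairy_good)
  interpret r: relabelling G s t F by fact
  let ?X = "act sh sh {} (star \<Gamma>)" and ?S = "half_map sh {} ` A"
  interpret X: expansion ?X "Some (v + 2)" ?S 0 1 by (rule split_expansion[OF m(3)])
  have st: "act s t F G = expd ?X (Some (v + 2)) ?S 0 1" using l(5) split_star[OF g m(3)] m(4) by simp
  have "(1, True) \<in> halves (act s t F G) (Some 0)" unfolding st by (rule X.ey)
  then obtain e c w where e: "(e, c) \<in> halves G w" "1 = t e" "True = (c \<noteq> (e \<in> F))" "Some 0 = map_option s w"
    by (rule r.act_halvesE)
  then obtain y where y: "w = Some y" "s y = 0" by (cases w) auto
  define b where "b = (e \<notin> F)"
  have cb: "c = b" using e(3) by (auto simp: b_def)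
  have eb: "(True \<noteq> (e \<in> F)) = b" "(b \<noteq> (e \<in> F)) = True" by (auto simp: b_def)
  have "(1, False) \<in> halves (act s t F G) (Some (v + 2))" unfolding st using X.eu by simp
  then obtain e' c' w' where e': "(e', c') \<in> halves G w'" "1 = t e'" "False = (c' \<noteq> (e' \<in> F))" "Some (v + 2) = map_option s w'"
    by (rule r.act_halvesE)
  have ee: "e' = e" using inj_onD[OF r.t, of e' e] e(1,2) e'(1,2) halves_dom by metis
  have cb': "c' = (\<not> b)" using e'(3) ee by (auto simp: b_def)
  obtain z where z: "w' = Some z" "s z = v + 2" using e'(4) by (cases w') auto
  have yz: "z \<noteq> y" using y(2) z(2) by auto
  interpret c: contraction G e b y "Some z"
    by unfold_locales (use e(1) e'(1) y(1) z(1) cb cb' ee yz in auto)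
  interpret c: valid_contraction G e b y "Some z" by unfold_locales (rule val)
  let ?G = "contr G e b"
  have the: "the (the (G e) b) = y" "the (the (G e) (\<not> b)) = z" using c.the_end by simp_all
  have "the (G e) True \<noteq> None \<and> the (G e) False \<noteq> None" using c.the_end by (cases b) simp_all
  then have eni: "e \<in> ni G" using contraction_nl[OF c.contraction_axioms] by (simp add: ni_def)
  have "contr (act s t F G) (t e) (b \<noteq> (e \<in> F)) = act s t F ?G" by (rule r.contr_act[OF c.contraction_axioms])
  then have shst: "?X = act s t F ?G" unfolding eb(2) e(2)[symmetric] st using X.contr_expd by simp
  \<comment> \<open>The truncated subtraction is exact where it is used: all remaining positions lie
    in the range of \<open>sh\<close>.\<close>
  define dn where "dn = (\<lambda>i::nat. i - 2)"
  have dsh: "dn \<circ> sh = id" by (simp add: dn_def sh_def fun_eq_iff)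
  have nG: "nodes G = insert y (nodes ?G)" "dom G = insert e (dom ?G)"
    using c.ey c.e_dom by (auto simp: c.nodes_contr c.dom_contr dest: halves_nodes)
  have relG: "relabelling ?G s t" by (rule valid_contr_act[OF c.valid_contraction_axioms l(3)])
  interpret rG: relabelling ?G s t F by (rule relG)
  have s2: "\<exists>j. s u = sh j" if "u \<in> nodes ?G" for u
  proof -
    have "s u \<in> nodes ?X" unfolding shst nodes_act[OF rG.t] using that by blast
    then show ?thesis unfolding nodes_act[OF sh_inj] by auto
  qed
  have t2: "\<exists>j. t g = sh j" if "g \<in> dom ?G" for g
  proof -
    have "t g \<in> dom ?X" unfolding shst dom_act using that by blast
    then show ?thesis unfolding dom_act by auto
  qed
  have dnsh: "dn (sh j) = j" "sh j - 2 = j" for j by (simp_all add: dn_def sh_def)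
  have sd: "sh (dn (s u)) = s u" if "u \<in> nodes ?G" for u using s2[OF that] dnsh by auto
  have td: "sh (dn (t g)) = t g" if "g \<in> dom ?G" for g using t2[OF that] dnsh by auto
  have reld: "relabelling ?G (dn \<circ> s) (dn \<circ> t)"
  proof
    show "inj_on (dn \<circ> s) (nodes ?G)" using rG.s sd unfolding inj_on_def comp_def by metis
    show "inj_on (dn \<circ> t) (dom ?G)" using rG.t td unfolding inj_on_def comp_def by metis
  qed
  define F0 where "F0 = F - {e}"
  have F0: "F0 = F \<inter> dom ?G" using l(4) unfolding F0_def nG(2) using c.dom_contr by auto
  have "star \<Gamma> = act dn dn {} ?X"
  proof -
    have "act dn dn {} ?X = act (dn \<circ> sh) (dn \<circ> sh) {g \<in> dom (star \<Gamma>). (g \<in> {}) \<noteq> (sh g \<in> {})} (star \<Gamma>)"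
      by (rule act_act[OF sh_inj]) (auto simp: inj_on_def dnsh)
    then show ?thesis unfolding dsh using act_id'[of "star \<Gamma>"] by simp
  qed
  also have "\<dots> = act (dn \<circ> s) (dn \<circ> t) {g \<in> dom ?G. (g \<in> F) \<noteq> (t g \<in> {})} ?G"
    unfolding shst by (rule act_act[OF rG.t]) (rule inj_on_inverseI[where g = sh], use td in auto)
  also have "{g \<in> dom ?G. (g \<in> F) \<noteq> (t g \<in> {})} = F0" using F0 by blast
  also have "act (dn \<circ> s) (dn \<circ> t) F0 ?G = act (restrict (dn \<circ> s) (nodes ?G)) (restrict (dn \<circ> t) (dom ?G)) F0 ?G"
    by (rule act_restrict[symmetric]) (use reld in \<open>auto simp: relabelling_def\<close>)
  finally have stG: "star \<Gamma> = act (restrict (dn \<circ> s) (nodes ?G)) (restrict (dn \<circ> t) (dom ?G)) F0 ?G" .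
  let ?x = "(\<Gamma>, restrict (dn \<circ> s) (nodes ?G), restrict (dn \<circ> t) (dom ?G), F0)"
  have xl: "?x \<in> lab ?G"
    unfolding lab_def using m(2) reld relabelling_restrict F0 stG by auto
  have zn: "z \<in> nodes ?G" using c.eu yz by (auto simp: c.nodes_contr dest: halves_nodes)
  have "restrict ((sh \<circ> restrict (dn \<circ> s) (nodes ?G))(y := 0)) (nodes G) = s"
    by (rule extensionalityI[of _ "nodes G"]) (use l(1) y(2) sd nG(1) in auto)
  moreover have "restrict ((sh \<circ> restrict (dn \<circ> t) (dom ?G))(e := 1)) (dom G) = t"
    by (rule extensionalityI[of _ "dom G"]) (use l(2) e(2) td nG(2) in auto)
  moreover have "F0 \<union> (if b then {} else {e}) = F" unfolding F0_def b_def by auto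
  moreover have "restrict (dn \<circ> s) (nodes ?G) z = v" using zn z(2) by (simp add: dn_def)
  moreover have "half_map (restrict (dn \<circ> t) (dom ?G)) F0 ` (halves G (Some y) - {(e, b)}) = A"
  proof -
    let ?S' = "halves G (Some y) - {(e, b)}"
    have Sd: "fst h \<in> dom ?G" if "h \<in> ?S'" for h
    proof -
      obtain g d where h: "h = (g, d)" by force
      then have "g \<noteq> e" using that c.e_halves[of d "Some y"] c.noloop by auto
      then show ?thesis using h that halves_dom[of g d G] c.dom_contr by auto
    qed
    have i: "inj_on (half_map t F) (halves G (Some y))"
      by (rule inj_on_subset[OF r.inj_half_map]) (auto dest: halves_dom)
    have "half_map t F ` halves G (Some y) = insert (1, True) ?S"
      using r.halves_act_eq[OF c.ey] X.halves_expd_y unfolding st using y(2) by simp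
    moreover have "half_map t F (e, b) = (1, True)" using e(2) eb(2) by (simp add: half_map_def)
    moreover have "(1, True) \<notin> ?S" by (auto simp: half_map_def sh_def)
    ultimately have "half_map t F ` ?S' = ?S" using inj_on_image_set_diff[OF i, of "halves G (Some y)" "{(e, b)}"] c.ey by auto
    moreover have "half_map t F ` ?S' = half_map sh {} ` half_map (restrict (dn \<circ> t) (dom ?G)) F0 ` ?S'"
      unfolding half_map_comp
    proof (rule image_cong[OF refl])
      fix h assume h: "h \<in> ?S'"
      obtain g d where gd: "h = (g, d)" by force
      have "g \<in> dom ?G" using Sd[OF h] gd by simp
      then show "half_map t F h = half_map (sh \<circ> restrict (dn \<circ> t) (dom ?G)) F0 h"
        using gd td F0 by (simp add: half_map_def)
    qed
    ultimately have "half_map sh {} ` half_map (restrict (dn \<circ> t) (dom ?G)) F0 ` ?S' = half_map sh {} ` A" by simp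
    moreover have "inj (half_map sh {})" by (auto simp: inj_def half_map_def sh_def)
    ultimately show ?thesis by (simp add: inj_image_eq_iff)
  qed
  ultimately have "lab_split G ((e, b), ?x) = k"
    unfolding lab_split_def kk by (simp add: Let_def the m(4))
  moreover have "((e, b), ?x) \<in> contr_index G" unfolding contr_index_def using eni xl by simp
  ultimately show ?thesis by (metis image_eqI)
qed

lemma bij_lab_split: "valid G \<Longrightarrow> bij_betw (lab_split G) (contr_index G) (split_index G)"
  unfolding bij_betw_def
proof (intro conjI equalityI subsetI inj_lab_split)
  fix k assume "valid G" "k \<in> lab_split G ` contr_index G"
  then show "k \<in> split_index G" using lab_split by (auto simp: contr_index_def)
qed (rule surj_lab_split)

lemma Tr_std_diff_split:
  "Tr (std_diff c) G = (\<Sum>k\<in>split_index G. lsg G (fst k) * c (fst (snd k)) / 2)"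
proof -
  define H where "H = (\<lambda>x::labelling. {\<Gamma>. hairy \<Gamma> \<and> length \<Gamma> + 2 = length (fst x)})"
  define sp where "sp = (\<lambda>\<Gamma> x. {(v, A) \<in> splittings \<Gamma>. split_vertex \<Gamma> v A = fst (x::labelling)})"
  have finH: "finite (H x)" for x
    unfolding H_def by (rule finite_subset[OF _ finite_good_lists[of "length (fst x)"]]) (auto dest: hairy_good)
  have fsp: "finite (sp \<Gamma> x)" for \<Gamma> x unfolding sp_def by (rule finite_splittings)
  have "std_diff c (fst x) = (\<Sum>\<Gamma>\<in>H x. \<Sum>k\<in>sp \<Gamma> x. c \<Gamma> / 2)" for x
    unfolding std_diff_def H_def sp_def by (rule sum.cong) (auto simp: mult.commute)
  then have "Tr (std_diff c) G = (\<Sum>x\<in>lab G. \<Sum>\<Gamma>\<in>H x. \<Sum>k\<in>sp \<Gamma> x. lsg G x * c \<Gamma> / 2)"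
    unfolding Tr_def by (simp add: sum_distrib_left mult_ac)
  also have "\<dots> = (\<Sum>x\<in>lab G. \<Sum>(\<Gamma>, k)\<in>Sigma (H x) (\<lambda>\<Gamma>. sp \<Gamma> x). lsg G x * c \<Gamma> / 2)"
    by (rule sum.cong[OF refl], rule sum.Sigma) (use finH fsp in auto)
  also have "\<dots> = (\<Sum>(x, \<Gamma>k)\<in>Sigma (lab G) (\<lambda>x. Sigma (H x) (\<lambda>\<Gamma>. sp \<Gamma> x)). case \<Gamma>k of (\<Gamma>, k) \<Rightarrow> lsg G x * c \<Gamma> / 2)"
    by (rule sum.Sigma) (use finite_lab finH fsp in auto)
  also have "Sigma (lab G) (\<lambda>x. Sigma (H x) (\<lambda>\<Gamma>. sp \<Gamma> x)) = split_index G"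
    by (auto simp: split_index_def H_def sp_def split_nth(1))
  also have "(\<Sum>(x, \<Gamma>k)\<in>split_index G. case \<Gamma>k of (\<Gamma>, k) \<Rightarrow> lsg G x * c \<Gamma> / 2) =
      (\<Sum>k\<in>split_index G. lsg G (fst k) * c (fst (snd k)) / 2)"
    by (simp add: case_prod_beta)
  finally show ?thesis .
qed

text \<open>The two choices of the absorbed end of an internal edge give equal terms, which matches
  the factor 1/2 in \<open>std_diff\<close>.\<close>

lemma Tr_std_diff: "Tr (std_diff c) = Dint (Tr c)"
proof
  fix G
  show "Tr (std_diff c) G = Dint (Tr c) G"
  proof (cases "valid G")
    case True
    have fin: "finite (ni G)" using finite_nl valid_finite[OF True] by blast
    have "Dint (Tr c) G = (\<Sum>e\<in>ni G. cterm (Tr c) G e (side G e))"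
      using True by (simp add: Dint_def Dsel_def)
    also have "\<dots> = (\<Sum>e\<in>ni G. \<Sum>b\<in>UNIV. cterm (Tr c) G e b / 2)"
    proof (rule sum.cong[OF refl])
      fix e assume e: "e \<in> ni G"
      have side: "cterm (Tr c) G e b = cterm (Tr c) G e (side G e)" for b
        using cterm_side[OF equi_Tr True ni_contraction[OF e, of b]] by simp
      have "(\<Sum>b\<in>UNIV. cterm (Tr c) G e b / 2) = (\<Sum>b\<in>(UNIV :: bool set). cterm (Tr c) G e (side G e) / 2)"
        by (rule sum.cong[OF refl]) (subst side, rule refl)
      then show "cterm (Tr c) G e (side G e) = (\<Sum>b\<in>UNIV. cterm (Tr c) G e b / 2)"
        by simp
    qed
    also have "\<dots> = (\<Sum>(e, b)\<in>ni G \<times> UNIV. cterm (Tr c) G e b / 2)"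
      by (rule sum.cartesian_product)
    also have "\<dots> = (\<Sum>eb\<in>ni G \<times> UNIV. \<Sum>x\<in>(case eb of (e, b) \<Rightarrow> lab (contr G e b)).
        csg G (fst eb) (snd eb) * lsg (contr G (fst eb) (snd eb)) x * c (fst x) / 2)"
      by (rule sum.cong) (auto simp: cterm_def Tr_def sum_distrib_left sum_divide_distrib mult.assoc)
    also have "\<dots> = (\<Sum>(eb, x)\<in>contr_index G. csg G (fst eb) (snd eb) * lsg (contr G (fst eb) (snd eb)) x * c (fst x) / 2)"
      unfolding contr_index_def by (rule sum.Sigma) (use fin finite_lab in auto)
    also have "\<dots> = (\<Sum>j\<in>contr_index G. lsg G (fst (lab_split G j)) * c (fst (snd (lab_split G j))) / 2)"
    proof (rule sum.cong[OF refl])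
      fix j assume j: "j \<in> contr_index G"
      obtain e b \<Gamma> s t F where jj: "j = ((e, b), (\<Gamma>, s, t, F))" by (metis surj_pair)
      have m: "e \<in> ni G" "(\<Gamma>, s, t, F) \<in> lab (contr G e b)" using j unfolding jj contr_index_def by auto
      have "fst (snd (lab_split G j)) = \<Gamma>" unfolding jj lab_split_def by (simp add: Let_def)
      then show "(case j of (eb, x) \<Rightarrow> csg G (fst eb) (snd eb) * lsg (contr G (fst eb) (snd eb)) x * c (fst x) / 2) =
          lsg G (fst (lab_split G j)) * c (fst (snd (lab_split G j))) / 2"
        using lab_split[OF True m] unfolding jj by (simp add: lsg_def[of "contr G e b"])
    qed
    also have "\<dots> = (\<Sum>k\<in>split_index G. lsg G (fst k) * c (fst (snd k)) / 2)"
      by (rule sum.reindex_bij_betw[OF bij_lab_split[OF True]])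
    finally show ?thesis unfolding Tr_std_diff_split by simp
  next
    case False
    then show ?thesis by (simp add: Tr_invalid Dint_def Dsel_def)
  qed
qed

lemma std_diff_series: "std_diff c \<in> graph_series (\<lambda>_. True)"
  unfolding graph_series_def
proof (intro CollectI allI impI conjI TrueI)
  fix \<Gamma>' assume "std_diff c \<Gamma>' \<noteq> 0"
  then obtain \<Gamma> where \<Gamma>: "hairy \<Gamma>" "card {(v, A) \<in> splittings \<Gamma>. split_vertex \<Gamma> v A = \<Gamma>'} \<noteq> 0"
    unfolding std_diff_def by (elim sum.not_neutral_contains_not_neutral) auto
  then have "{(v, A) \<in> splittings \<Gamma>. split_vertex \<Gamma> v A = \<Gamma>'} \<noteq> {}" by (metis card.empty)
  then obtain v A where A: "(v, A) \<in> splittings \<Gamma>" "split_vertex \<Gamma> v A = \<Gamma>'" by auto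
  have g: "good \<Gamma>" using \<Gamma>(1) by (rule hairy_good)
  interpret X: expansion "act sh sh {} (star \<Gamma>)" "Some (v + 2)" "half_map sh {} ` A" 0 1 by (rule split_expansion[OF A(1)])
  have rel: "relabelling (star \<Gamma>) sh sh" by unfold_locales (rule sh_inj)+
  interpret r: relabelling "star \<Gamma>" sh sh "{}" by (rule rel)
  have v1: "valence \<Gamma> v \<noteq> 1" using splitting_valence[OF A(1)] by simp
  have d: "A \<subseteq> half_edges \<Gamma> v" "2 \<le> card A" "2 \<le> card (half_edges \<Gamma> v - A)" using splittingsD[OF A(1)] by auto
  have hv: "halves (star \<Gamma>) (Some v) = half_edges \<Gamma> v" using v1 by (simp add: halves_star_Some)
  obtain g0 c0 where "(g0, c0) \<in> halves (star \<Gamma>) (Some v)" using d(1,2) hv by (metis card.empty card_mono finite_half_edges not_numeral_le_zero subset_empty surj_pair all_not_in_conv le_zero_eq)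
  then have "halves (act sh sh {} (star \<Gamma>)) (Some (v + 2)) = half_map sh {} ` half_edges \<Gamma> v"
    using r.halves_act_eq[of g0 c0 "Some v"] hv by (simp add: sh_def)
  moreover have "inj (half_map sh {})" by (auto simp: inj_def half_map_def sh_def)
  ultimately have "halves (act sh sh {} (star \<Gamma>)) (Some (v + 2)) - half_map sh {} ` A = half_map sh {} ` (half_edges \<Gamma> v - A)"
    by (simp add: image_set_diff)
  then have "valid (expd (act sh sh {} (star \<Gamma>)) (Some (v + 2)) (half_map sh {} ` A) 0 1)"
    using \<Gamma>(1) r.valid_act d(2,3) by (intro X.valid_expd) (simp_all add: hairy_iff card_half_map_sh)
  then show "hairy \<Gamma>'" using split_star[OF g A(1)] split_good[OF g A(1)] A(2) by (simp add: hairy_iff)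
qed

end

section \<open>The spectral sequence of the hair filtration\<close>

text \<open>\<open>P p\<close> stands for the series of graphs whose hairs \<open>h\<close>, weight \<open>w\<close> and degree \<open>k\<close> satisfy \<open>p h w k\<close>,
  modulo relations; \<open>D\<close> is the deformed and \<open>d\<close> the standard differential.\<close>

locale hair_graded =
  fixes P :: "(nat \<Rightarrow> int \<Rightarrow> int \<Rightarrow> bool) \<Rightarrow> 'v::ab_group_add set" and D d :: "'v \<Rightarrow> 'v"
  assumes zero: "0 \<in> P p"
    and add: "x \<in> P p \<Longrightarrow> y \<in> P p \<Longrightarrow> x + y \<in> P p"
    and diff: "x \<in> P p \<Longrightarrow> y \<in> P p \<Longrightarrow> x - y \<in> P p"
    and mono: "x \<in> P p \<Longrightarrow> (\<And>h w k. p h w k \<Longrightarrow> int h \<le> w \<Longrightarrow> q h w k) \<Longrightarrow> x \<in> P q"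
    and inter: "x \<in> P p \<Longrightarrow> x \<in> P q \<Longrightarrow> x \<in> P (\<lambda>h w k. p h w k \<and> q h w k)"
    and split: "x \<in> P r \<Longrightarrow> (\<And>h w k. r h w k \<Longrightarrow> p h w k \<or> q h w k) \<Longrightarrow> \<exists>a\<in>P p. \<exists>b\<in>P q. x = a + b"
    and D_add: "D (x + y) = D x + D y"
    and D_part: "x \<in> P p \<Longrightarrow> (\<And>h h' w k. p h' w k \<Longrightarrow> h \<le> h' \<Longrightarrow> q h w (k + 1)) \<Longrightarrow> D x \<in> P q"
    and d_part: "x \<in> P p \<Longrightarrow> (\<And>h w k. p h w k \<Longrightarrow> q h w (k + 1)) \<Longrightarrow> d x \<in> P q"
    and Dd_part: "x \<in> P p \<Longrightarrow> (\<And>h h' w k. p h' w k \<Longrightarrow> h < h' \<Longrightarrow> q h w (k + 1)) \<Longrightarrow> D x - d x \<in> P q"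
    and DD: "D (D x) \<in> P (\<lambda>h w k. False)"
    and exact: "x \<in> P (\<lambda>h w k. True) \<Longrightarrow> D x \<in> P (\<lambda>h w k. False) \<Longrightarrow>
      \<exists>y\<in>P (\<lambda>h w k. True). D y - x \<in> P (\<lambda>h w k. False)"
begin

abbreviation R :: "'v set" where "R \<equiv> P (\<lambda>h w k. False)"

abbreviation piece :: "nat \<Rightarrow> int \<Rightarrow> 'v set" where
  "piece N k \<equiv> P (\<lambda>h w l. w = int N \<and> l = k)"

abbreviation filt :: "nat \<Rightarrow> int \<Rightarrow> int \<Rightarrow> 'v set" where
  "filt N p k \<equiv> P (\<lambda>h w l. w = int N \<and> l = k \<and> int h \<le> p)"

abbreviation gr :: "nat \<Rightarrow> int \<Rightarrow> int \<Rightarrow> 'v set" where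
  "gr N p k \<equiv> P (\<lambda>h w l. w = int N \<and> l = k \<and> int h = p)"

text \<open>Keeps \<open>p - 1\<close> visible in \<open>filt N (p - 1) k\<close>; the simplifier
  would turn the bound into a strict inequality.\<close>

declare zle_diff1_eq [simp del]

lemma R_part: "x \<in> R \<Longrightarrow> x \<in> P p"
  by (erule mono) simp

lemma R_disj: "x \<in> P p \<Longrightarrow> x \<in> P q \<Longrightarrow> (\<And>h w k. p h w k \<Longrightarrow> q h w k \<Longrightarrow> False) \<Longrightarrow> x \<in> R"
  by (rule mono[OF inter[of x p q]]) auto

lemma D_R: "x \<in> R \<Longrightarrow> D x \<in> R"
  by (rule D_part)

lemma D_diff: "D (x - y) = D x - D y"
  using D_add[of "x - y" y] by (simp add: eq_diff_eq)

text \<open>Cut a primitive \<open>y\<close> down to the wanted weights and degrees. The discarded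
  part maps to other ones, so \<open>D a - x\<close> lies both in and outside \<open>p\<close>,
  hence in \<open>R\<close>.\<close>

lemma exact_part:
  assumes x: "x \<in> P (\<lambda>h w k. p w k)" and Dx: "D x \<in> R"
  shows "\<exists>y\<in>P (\<lambda>h w k. p w (k + 1)). D y - x \<in> R"
proof -
  have "x \<in> P (\<lambda>h w k. True)" using x by (rule mono) simp
  then obtain y where y: "y \<in> P (\<lambda>h w k. True)" "D y - x \<in> R" using exact Dx by blast
  obtain a b where ab: "a \<in> P (\<lambda>h w k. p w (k + 1))" "b \<in> P (\<lambda>h w k. \<not> p w (k + 1))" "y = a + b"
    using split[OF y(1), of "\<lambda>h w k. p w (k + 1)" "\<lambda>h w k. \<not> p w (k + 1)"] by blast
  have "D a \<in> P (\<lambda>h w k. p w k)" using ab(1) by (rule D_part)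
  then have 1: "D a - x \<in> P (\<lambda>h w k. p w k)" using x by (rule diff)
  have "D b \<in> P (\<lambda>h w k. \<not> p w k)" using ab(2) by (rule D_part)
  then have "D y - x - D b \<in> P (\<lambda>h w k. \<not> p w k)" using diff R_part[OF y(2)] by blast
  moreover have "D y - x - D b = D a - x" by (simp add: ab(3) D_add)
  ultimately have "D a - x \<in> P (\<lambda>h w k. \<not> p w k)" by simp
  then have "D a - x \<in> R" by (rule R_disj[OF 1]) simp
  then show ?thesis using ab(1) by blast
qed

lemma cocycles_exact:
  assumes q: "\<And>w k. q w k \<longleftrightarrow> p w (k + 1)"
  shows "cocycles R D (P (\<lambda>h w k. p w k)) = coboundaries R D (P (\<lambda>h w k. q w k))"
proof (intro equalityI subsetI)
  fix x assume "x \<in> cocycles R D (P (\<lambda>h w k. p w k))"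
  then obtain y where y: "y \<in> P (\<lambda>h w k. q w k)" "D y - x \<in> R"
    using exact_part[of x p] unfolding q by (auto simp: cocycles_def)
  have "x - D y \<in> R" using diff[OF zero y(2)] by simp
  moreover have "x = D y + (x - D y)" by simp
  ultimately show "x \<in> coboundaries R D (P (\<lambda>h w k. q w k))" using y(1) unfolding coboundaries_def by blast
next
  fix x assume "x \<in> coboundaries R D (P (\<lambda>h w k. q w k))"
  then obtain y r where y: "y \<in> P (\<lambda>h w k. q w k)" "r \<in> R" "x = D y + r" by (auto simp: coboundaries_def)
  have "D y \<in> P (\<lambda>h w k. p w k)" using y(1) by (rule D_part) (simp add: q)
  moreover have "D x \<in> R" unfolding y(3) D_add using DD D_R[OF y(2)] by (rule add)
  ultimately show "x \<in> cocycles R D (P (\<lambda>h w k. p w k))"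
    unfolding cocycles_def y(3) using add R_part[OF y(2)] by blast
qed

lemma cocycles_piece: "cocycles R D (piece N k) = coboundaries R D (piece N (k - 1))"
  by (rule cocycles_exact) auto

lemma coboundaries_add:
  assumes "x \<in> coboundaries R D (P p)" "y \<in> coboundaries R D (P p)"
  shows "x + y \<in> coboundaries R D (P p)"
proof -
  obtain a r b t where *: "a \<in> P p" "r \<in> R" "x = D a + r" "b \<in> P p" "t \<in> R" "y = D b + t"
    using assms by (auto simp: coboundaries_def)
  have "x + y = D (a + b) + (r + t)" unfolding * D_add by (simp add: add_ac)
  then show ?thesis unfolding coboundaries_def using add[OF *(1,4)] add[OF *(2,5)] by blast
qed

lemma filt_piece: "x \<in> filt N p k \<Longrightarrow> x \<in> piece N k"
  by (erule mono) auto

text \<open>\<open>mono\<close> supplies \<open>int h \<le> w\<close>: the hairs never exceed the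
  weight, so the filtration is exhausted at step \<open>N\<close>.\<close>

lemma filt_full: "int N \<le> p \<Longrightarrow> x \<in> piece N k \<Longrightarrow> x \<in> filt N p k"
  by (erule mono) auto

lemma filt_empty: "p < 0 \<Longrightarrow> x \<in> filt N p k \<Longrightarrow> x \<in> R"
  by (erule mono) auto

lemma D_zero: "D 0 = 0"
  using D_add[of 0 0] by simp

text \<open>All cocycles are coboundaries, so every step of the induced filtration on cohomology is
  zero.\<close>

lemma cohomology_filt_eq:
  "cohomology_filt R D (piece N) (filt N) p k = coboundaries R D (piece N (k - 1))" (is "?l = ?B")
proof (intro equalityI subsetI)
  fix x assume "x \<in> ?l"
  then obtain a b where ab: "a \<in> cocycles R D (filt N p k)" "b \<in> ?B" "x = a + b"
    by (auto simp: cohomology_filt_def)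
  have "a \<in> cocycles R D (piece N k)" using ab(1) filt_piece by (auto simp: cocycles_def)
  then show "x \<in> ?B" unfolding ab(3) cocycles_piece using ab(2) by (rule coboundaries_add)
next
  fix b assume "b \<in> ?B"
  moreover have "0 \<in> cocycles R D (filt N p k)" by (simp add: cocycles_def zero D_zero)
  moreover have "b = 0 + b" by simp
  ultimately show "b \<in> ?l" unfolding cohomology_filt_def by blast
qed

lemma converges: "ss_converges R D (piece N) (filt N)"
  unfolding ss_converges_def cohomology_filt_eq cocycles_piece
proof (intro conjI allI exI impI)
  fix p k r :: int
  let ?B = "coboundaries R D (piece N (k - 1))"
  \<comment> \<open>The bound makes \<open>p - r\<close> negative, so that cycles of the page are
    cocycles, and \<open>p + r - 1\<close> at least \<open>N\<close>, so that its boundaries come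
    from the whole piece.\<close>
  assume "max (p + 1) (int N - p + 1) \<le> r"
  then have r: "p - r < 0" "int N \<le> p + r - 1" by auto
  have cocycle: "x \<in> ?B" if "x \<in> filt N q k" "D x \<in> filt N (p - r) (k + 1)" for x q
    unfolding cocycles_piece[symmetric] cocycles_def
    using filt_piece[OF that(1)] filt_empty[OF r(1) that(2)] by simp
  show "incl_induces_iso (ss_Z D (filt N) r p k) (ss_B D (filt N) r p k) ?B ?B"
    unfolding incl_induces_iso_def
  proof (intro conjI ballI impI subsetI)
    fix x assume "x \<in> ss_Z D (filt N) r p k"
    then show "x \<in> ?B" using cocycle by (auto simp: ss_Z_def)
  next
    fix x assume "x \<in> ss_B D (filt N) r p k"
    then obtain a y where ay: "a \<in> ss_Z D (filt N) (r - 1) (p - 1) k"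
        "y \<in> ss_Z D (filt N) (r - 1) (p + r - 1) (k - 1)" "x = a + D y"
      by (auto simp: ss_B_def)
    have "p - 1 - (r - 1) = p - r" by simp
    then have "a \<in> ?B" using ay(1) cocycle unfolding ss_Z_def by auto
    moreover have "y \<in> piece N (k - 1)" using ay(2) filt_piece by (auto simp: ss_Z_def)
    then have "D y + 0 \<in> ?B" unfolding coboundaries_def using zero by blast
    ultimately show "x \<in> ?B" unfolding ay(3) using coboundaries_add by fastforce
  next
    fix x assume x: "x \<in> ss_Z D (filt N) r p k" "x \<in> ?B"
    then obtain y t where yt: "y \<in> piece N (k - 1)" "t \<in> R" "x = D y + t" by (auto simp: coboundaries_def)
    have "D y = x - t" using yt(3) by simp
    moreover have "x - t \<in> filt N p k" using x(1) R_part[OF yt(2)] by (auto simp: ss_Z_def intro: diff)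
    moreover have "p + r - 1 - (r - 1) = p" "k - 1 + 1 = k" by simp_all
    ultimately have "y \<in> ss_Z D (filt N) (r - 1) (p + r - 1) (k - 1)"
      unfolding ss_Z_def using filt_full[OF r(2) yt(1)] by auto
    moreover have "t \<in> ss_Z D (filt N) (r - 1) (p - 1) k"
      unfolding ss_Z_def using R_part[OF yt(2)] R_part[OF D_R[OF yt(2)]] by blast
    moreover have "x = t + D y" using yt(3) by simp
    ultimately show "x \<in> ss_B D (filt N) r p k" unfolding ss_B_def by blast
  next
    fix y assume "y \<in> ?B"
    moreover have "0 \<in> ss_Z D (filt N) r p k" by (simp add: ss_Z_def zero D_zero)
    ultimately show "\<exists>x\<in>ss_Z D (filt N) r p k. y - x \<in> ?B" by (metis diff_zero)
  qed
qed (rule refl)+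

lemma D_filt: "x \<in> filt N p k \<Longrightarrow> D x \<in> filt N p (k + 1)"
  by (erule D_part) auto

lemma Dd_filt: "x \<in> filt N p k \<Longrightarrow> D x - d x \<in> filt N (p - 1) (k + 1)"
  by (erule Dd_part) auto

lemma gr_filt: "x \<in> gr N p k \<Longrightarrow> x \<in> filt N p k"
  by (erule mono) auto

lemma d_gr: "x \<in> gr N p k \<Longrightarrow> d x \<in> gr N p (k + 1)"
  by (erule d_part) auto

lemma gr_filt_R: "x \<in> gr N p k \<Longrightarrow> x \<in> filt N (p - 1) k \<Longrightarrow> x \<in> R"
  by (erule R_disj, assumption) auto

lemma filt_split:
  assumes "x \<in> filt N p k"
  obtains a b where "a \<in> gr N p k" "b \<in> filt N (p - 1) k" "x = a + b"
proof -
  have "\<exists>a\<in>gr N p k. \<exists>b\<in>filt N (p - 1) k. x = a + b" using assms by (rule split) auto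
  then show thesis using that by blast
qed

lemma ss_B_1: "ss_B D (filt N) 1 p k = {x + D y | x y. x \<in> filt N (p - 1) k \<and> y \<in> filt N p (k - 1)}"
proof -
  have "ss_Z D (filt N) 0 q l = filt N q l" for q l using D_filt by (auto simp: ss_Z_def)
  then show ?thesis by (simp add: ss_B_def)
qed

text \<open>Modulo \<open>filt N (p - 1)\<close> the operators \<open>D\<close> and \<open>d\<close>
  agree, and \<open>d\<close> preserves the hairs. So a class on the page is represented by its
  component with exactly \<open>p\<close> hairs.\<close>

lemma first_page:
  "incl_induces_iso (cocycles R d (gr N p k)) (coboundaries R d (gr N p (k - 1)))
     (ss_Z D (filt N) 1 p k) (ss_B D (filt N) 1 p k)"
  unfolding incl_induces_iso_def
proof (intro conjI ballI impI subsetI)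
  fix x assume "x \<in> cocycles R d (gr N p k)"
  then have x: "x \<in> filt N p k" "d x \<in> R" using gr_filt by (auto simp: cocycles_def)
  have "D x - d x + d x \<in> filt N (p - 1) (k + 1)" using Dd_filt[OF x(1)] R_part[OF x(2)] by (rule add)
  then show "x \<in> ss_Z D (filt N) 1 p k" using x(1) by (simp add: ss_Z_def)
next
  fix x assume "x \<in> coboundaries R d (gr N p (k - 1))"
  then obtain y r where y: "y \<in> gr N p (k - 1)" "r \<in> R" "x = d y + r" by (auto simp: coboundaries_def)
  have "D y - d y \<in> filt N (p - 1) (k - 1 + 1)" using Dd_filt gr_filt y(1) by blast
  then have "r - (D y - d y) \<in> filt N (p - 1) k" using R_part[OF y(2)] by (simp add: diff)
  moreover have "x = r - (D y - d y) + D y" using y(3) by simp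
  ultimately show "x \<in> ss_B D (filt N) 1 p k" unfolding ss_B_1 using gr_filt[OF y(1)] by blast
next
  fix x assume x: "x \<in> cocycles R d (gr N p k)" "x \<in> ss_B D (filt N) 1 p k"
  obtain a y where ay: "a \<in> filt N (p - 1) k" "y \<in> filt N p (k - 1)" "x = a + D y"
    using x(2) unfolding ss_B_1 by blast
  obtain y1 y2 where y: "y1 \<in> gr N p (k - 1)" "y2 \<in> filt N (p - 1) (k - 1)" "y = y1 + y2"
    using filt_split[OF ay(2)] .
  have "D y1 - d y1 \<in> filt N (p - 1) (k - 1 + 1)" "D y2 \<in> filt N (p - 1) (k - 1 + 1)"
    using Dd_filt gr_filt y(1) D_filt[OF y(2)] by blast+
  then have "a + (D y1 - d y1) + D y2 \<in> filt N (p - 1) k" using ay(1) by (simp add: add)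
  moreover have eq: "x - d y1 = a + (D y1 - d y1) + D y2" using ay(3) y(3) by (simp add: D_add)
  moreover have "x - d y1 \<in> gr N p k" using x(1) d_gr[OF y(1)] by (simp add: cocycles_def diff)
  ultimately have "x - d y1 \<in> R" using gr_filt_R by metis
  moreover have "x = d y1 + (x - d y1)" by simp
  ultimately show "x \<in> coboundaries R d (gr N p (k - 1))" unfolding coboundaries_def using y(1) by blast
next
  fix y assume "y \<in> ss_Z D (filt N) 1 p k"
  then have Dy: "y \<in> filt N p k" "D y \<in> filt N (p - 1) (k + 1)" by (auto simp: ss_Z_def)
  obtain y1 y2 where y: "y1 \<in> gr N p k" "y2 \<in> filt N (p - 1) k" "y = y1 + y2"
    using filt_split[OF Dy(1)] .
  have "D y - D y2 - (D y1 - d y1) \<in> filt N (p - 1) (k + 1)"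
    by (rule diff[OF diff[OF Dy(2) D_filt[OF y(2)]] Dd_filt[OF gr_filt[OF y(1)]]])
  moreover have "d y1 = D y - D y2 - (D y1 - d y1)" using y(3) by (simp add: D_add)
  ultimately have "d y1 \<in> R" using gr_filt_R[OF d_gr[OF y(1)]] by metis
  then have "y1 \<in> cocycles R d (gr N p k)" using y(1) by (simp add: cocycles_def)
  moreover have "y - y1 = y2 + D 0" using y(3) D_zero by simp
  then have "y - y1 \<in> ss_B D (filt N) 1 p k" unfolding ss_B_1 using y(2) zero by blast
  ultimately show "\<exists>x\<in>cocycles R d (gr N p k). y - x \<in> ss_B D (filt N) 1 p k" by blast
qed

end

section \<open>Hairs, weight and degree\<close>

definition wt :: "sgraph \<Rightarrow> int" where
  "wt G = int (card (dom G)) + 1 - int (card (nodes G))"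

definition hr :: "sgraph \<Rightarrow> nat" where
  "hr G = card (halves G None)"

text \<open>On a realisation the weight exceeds the number of hairs by the loop order, a natural
  number.\<close>

lemma hr_le_wt:
  assumes "valid G" shows "int (hr G) \<le> wt G"
proof -
  obtain \<Gamma> s t where r: "hairy \<Gamma>" "relabelling G s t" "star \<Gamma> = act s t {} G" using realize[OF assms] .
  have "int (weight \<Gamma>) = wt G" "hairs \<Gamma> = hr G"
    using weight_star[OF r(1)] hairs_star[OF hairy_good[OF r(1)]] iso_cards[OF r(2,3)]
    by (simp_all add: wt_def hr_def)
  then show ?thesis by (simp add: weight_def)
qed

text \<open>An edge at the star trades its own hair for the at least two other half-edges of the
  absorbed vertex.\<close>

lemma contraction_stats:
  assumes val: "valid G" and e: "e \<in> nl G"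
  defines "G' \<equiv> contr G e (side G e)"
  shows "card (nodes G) = Suc (card (nodes G'))" "card (dom G) = Suc (card (dom G'))"
    "e \<in> ni G \<Longrightarrow> hr G' = hr G" "e \<notin> ni G \<Longrightarrow> hr G < hr G'"
proof -
  define y where "y = the (the (G e) (side G e))"
  define u where "u = the (G e) (\<not> side G e)"
  have "contraction G e (side G e) y u" unfolding y_def u_def using nl_contraction[OF e] .
  then interpret valid_contraction G e "side G e" y u
    using val by (simp add: valid_contraction_def valid_contraction_axioms_def)
  have fin: "finite (dom G)" using valid_finite[OF val] .
  have yn: "y \<in> nodes G" using halves_nodes[OF ey] .
  show "card (nodes G) = Suc (card (nodes G'))"
    unfolding G'_def nodes_contr using yn finite_nodes[OF fin] by (metis card_Suc_Diff1)
  show "card (dom G) = Suc (card (dom G'))"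
    unfolding G'_def dom_contr using e_dom fin by (metis card_Suc_Diff1)
  have u: "u = None \<longleftrightarrow> e \<notin> ni G" using e the_end by (cases "side G e") (auto simp: ni_def)
  show "hr G' = hr G" if "e \<in> ni G"
    using halves_contr_other[of None] that u unfolding hr_def G'_def by auto
  show "hr G < hr G'" if "e \<notin> ni G"
  proof -
    have uN: "u = None" using that u by simp
    have fh: "finite (halves G w)" for w using fin by (rule finite_halves)
    have "hr G' = card (halves G None - {(e, \<not> side G e)}) + card (halves G (Some y) - {(e, side G e)})"
      unfolding hr_def G'_def halves_contr_end[unfolded uN]
      by (rule card_Un_disjoint) (use fh halves_unique[of _ G None "Some y"] in auto)
    moreover have "card (halves G None - {(e, \<not> side G e)}) = hr G - 1" "1 \<le> hr G"
      using eu fh unfolding uN hr_def by (auto simp: card_Diff_singleton Suc_le_eq card_gt_0_iff)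
    moreover have "card (halves G (Some y) - {(e, side G e)}) = card (halves G (Some y)) - 1"
      using ey by (simp add: card_Diff_singleton)
    ultimately show ?thesis using valid_card[OF val yn] by linarith
  qed
qed

context hgc_sign begin

definition dg :: "sgraph \<Rightarrow> int" where
  "dg G = n * int (card (nodes G)) + (1 - n) * int (card (dom G))"

text \<open>The support is tested on \<open>Tr c\<close> rather than on \<open>c\<close>, so that
  the relations are included and \<open>part p\<close> is the preimage of a subspace of the
  quotient.\<close>

definition part :: "(nat \<Rightarrow> int \<Rightarrow> int \<Rightarrow> bool) \<Rightarrow> (ograph \<Rightarrow> 'k) set" where
  "part p = {c \<in> graph_series (\<lambda>_. True). \<forall>G. valid G \<longrightarrow> \<not> p (hr G) (wt G) (dg G) \<longrightarrow> Tr c G = 0}"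

definition Dhair :: "(ograph \<Rightarrow> 'k) \<Rightarrow> (ograph \<Rightarrow> 'k)" where
  "Dhair c = Sec (Dop (Tr c))"

lemma star_stats:
  assumes "hairy \<Gamma>"
  shows "hairs \<Gamma> = hr (star \<Gamma>)" "int (weight \<Gamma>) = wt (star \<Gamma>)" "degree 0 n \<Gamma> = dg (star \<Gamma>)"
  using weight_star[OF assms] hairs_star[OF hairy_good[OF assms]] degree_star[OF hairy_good[OF assms]]
  by (simp_all add: wt_def hr_def dg_def)

lemma lab_stats:
  assumes "(\<Gamma>, s, t, F) \<in> lab G"
  shows "hairs \<Gamma> = hr G" "int (weight \<Gamma>) = wt G" "degree 0 n \<Gamma> = dg G"
proof -
  have l: "hairy \<Gamma>" "relabelling G s t" "star \<Gamma> = act s t F G" using labD[OF assms] by auto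
  show "hairs \<Gamma> = hr G" "int (weight \<Gamma>) = wt G" "degree 0 n \<Gamma> = dg G"
    using star_stats[OF l(1)] iso_cards[OF l(2,3)] by (simp_all add: wt_def hr_def dg_def)
qed

lemma Tr_restrict:
  "Tr (restrict_series (\<lambda>\<Gamma>. p (hairs \<Gamma>) (int (weight \<Gamma>)) (degree 0 n \<Gamma>)) c) G =
     (if p (hr G) (wt G) (dg G) then Tr c G else 0)"
proof -
  have "restrict_series (\<lambda>\<Gamma>. p (hairs \<Gamma>) (int (weight \<Gamma>)) (degree 0 n \<Gamma>)) c (fst x) =
      (if p (hr G) (wt G) (dg G) then c (fst x) else 0)" if "x \<in> lab G" for x
  proof -
    obtain \<Gamma> s t F where "x = (\<Gamma>, s, t, F)" by (metis surj_pair)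
    then show ?thesis using lab_stats[of \<Gamma> s t F G] that by (simp add: restrict_series_def)
  qed
  then show ?thesis unfolding Tr_def by simp
qed

lemma series_simps:
  "0 \<in> graph_series P" "c \<in> graph_series P \<Longrightarrow> c' \<in> graph_series P \<Longrightarrow> c + c' \<in> graph_series P"
  "c \<in> graph_series P \<Longrightarrow> c' \<in> graph_series P \<Longrightarrow> c - c' \<in> graph_series P"
  "c \<in> graph_series P \<Longrightarrow> restrict_series Q c \<in> graph_series P"
  by (auto simp: graph_series_def restrict_series_def) (metis add_0 | metis diff_zero diff_0 neg_equal_0_iff_equal)+

lemma rel_part: "hgc_rel 0 n = part (\<lambda>h w k. False)"
  by (auto simp: hgc_rel_iff part_def Tr_invalid fun_eq_iff) (metis Tr_invalid)

text \<open>\<open>Sec (Tr c)\<close> is a representative of \<open>c\<close> whose own support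
  satisfies the condition.\<close>

lemma part_eq: "hgc_part 0 n (\<lambda>\<Gamma>. p (hairs \<Gamma>) (int (weight \<Gamma>)) (degree 0 n \<Gamma>)) = part p" (is "hgc_part 0 n ?p = _")
proof (intro equalityI subsetI)
  fix c :: "ograph \<Rightarrow> 'k" assume "c \<in> hgc_part 0 n ?p"
  then obtain a r where ar: "a \<in> graph_series ?p" "r \<in> hgc_rel 0 n" "c = a + r" by (auto simp: hgc_part_def)
  have r: "r \<in> graph_series (\<lambda>_. True)" "Tr r = (\<lambda>_. 0)" using ar(2) by (simp_all add: hgc_rel_iff)
  have a: "a \<in> graph_series (\<lambda>_. True)" using ar(1) by (auto simp: graph_series_def)
  have "restrict_series ?p a = a" using ar(1) by (auto simp: restrict_series_def graph_series_def fun_eq_iff)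
  then have "Tr a G = 0" if "\<not> p (hr G) (wt G) (dg G)" for G
    using Tr_restrict[of p a G] that by simp
  then show "c \<in> part p"
    unfolding part_def using series_simps(2)[OF a r(1)] by (simp add: ar(3) Tr_add r(2) del: plus_fun_apply)
next
  fix c assume c: "c \<in> part p"
  then have c: "c \<in> graph_series (\<lambda>_. True)" "\<And>G. valid G \<Longrightarrow> \<not> p (hr G) (wt G) (dg G) \<Longrightarrow> Tr c G = 0"
    by (auto simp: part_def)
  have "Sec (Tr c) \<Gamma> \<noteq> 0 \<Longrightarrow> hairy \<Gamma> \<and> ?p \<Gamma>" for \<Gamma>
    using c(2)[of "star \<Gamma>"] star_stats[of \<Gamma>] hairy_iff[of \<Gamma>] by (auto simp: Sec_def split: if_splits)
  then have "Sec (Tr c) \<in> graph_series ?p" by (simp add: graph_series_def)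
  moreover have "c - Sec (Tr c) \<in> hgc_rel 0 n"
    unfolding hgc_rel_iff using series_simps(3)[OF c(1) Sec_series] by (simp add: Tr_diff Tr_Sec equi_Tr)
  moreover have "c = Sec (Tr c) + (c - Sec (Tr c))" by simp
  ultimately show "c \<in> hgc_part 0 n ?p" unfolding hgc_part_def by blast
qed

lemma Tr_Dhair: "Tr (Dhair c) = Dop (Tr c)"
  unfolding Dhair_def by (rule Tr_Sec[OF equi_Dop[OF equi_Tr]])

lemma Dhair_series: "Dhair c \<in> graph_series (\<lambda>_. True)"
  unfolding Dhair_def by (rule Sec_series)

lemma Dhair_linear: "Vector_Spaces.linear scale scale Dhair"
proof -
  have L: "Dhair (\<lambda>\<Gamma>. a * x \<Gamma> + b * y \<Gamma>) = (\<lambda>\<Gamma>. a * Dhair x \<Gamma> + b * Dhair y \<Gamma>)" for a b x y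
    unfolding Dhair_def Tr_linear Dop_def Dsel_linear
    by (simp add: Sec_def fun_eq_iff add_divide_distrib)
  have "Dhair (x + y) = Dhair x + Dhair y" for x y
    using L[of 1 x 1 y] by (simp add: plus_fun_def)
  moreover have "Dhair (scale a x) = scale a (Dhair x)" for a x
    using L[of a x 0 x] by (simp add: scale_def)
  ultimately show ?thesis
    unfolding Vector_Spaces.linear_iff using series.vector_space_axioms by blast
qed

text \<open>One lemma for \<open>D\<close>, \<delta> and their difference, which sum over all
  non-loop edges, the internal ones, and those at the star. \<open>r\<close> records what a
  contraction does to the hairs; weight and degree change in the same way for all edges.\<close>

lemma Dsel_part:
  assumes c: "c \<in> part p" and c': "c' \<in> graph_series (\<lambda>_. True)" "Tr c' = Dsel Q (Tr c)"
    and Q: "\<And>G e. valid G \<Longrightarrow> e \<in> Q G \<Longrightarrow> e \<in> nl G \<and> r (hr G) (hr (contr G e (side G e)))"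
    and q: "\<And>h h' w k. p h' w k \<Longrightarrow> r h h' \<Longrightarrow> q h w (k + 1)"
  shows "c' \<in> part q"
  unfolding part_def
proof (intro CollectI conjI allI impI c'(1))
  fix G assume G: "valid G" "\<not> q (hr G) (wt G) (dg G)"
  have "Tr c (contr G e (side G e)) = 0" if e: "e \<in> Q G" for e
  proof (rule ccontr)
    let ?G = "contr G e (side G e)"
    assume nz: "Tr c ?G \<noteq> 0"
    then have v: "valid ?G" using Tr_invalid by blast
    have "p (hr ?G) (wt ?G) (dg ?G)" using nz v c by (auto simp: part_def)
    moreover have "wt G = wt ?G" "dg G = dg ?G + 1"
      using contraction_stats(1,2)[OF G(1)] Q[OF G(1) e] by (auto simp: wt_def dg_def algebra_simps)
    ultimately show False using q Q[OF G(1) e] G(2) by metis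
  qed
  then show "Tr c' G = 0" unfolding c'(2) Dsel_def cterm_def by simp
qed

lemma graded: "hair_graded part Dhair std_diff"
proof
  show "Dhair (x + y) = Dhair x + Dhair y" for x y
    using Dhair_linear by (simp add: Vector_Spaces.linear_iff)
  show "0 \<in> part p" for p
    using Tr_scale[of 0 0] by (auto simp: part_def series_simps(1) scale_def Tr_def)
next
  fix x y :: "ograph \<Rightarrow> 'k" and p assume "x \<in> part p" "y \<in> part p"
  then show "x + y \<in> part p" "x - y \<in> part p"
    unfolding part_def by (auto simp: Tr_add Tr_diff series_simps(2,3) simp del: plus_fun_apply minus_apply)
next
  fix x :: "ograph \<Rightarrow> 'k" and p q
  assume "x \<in> part p" "\<And>h w k. p h w k \<Longrightarrow> int h \<le> w \<Longrightarrow> q h w k"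
  then show "x \<in> part q" using hr_le_wt unfolding part_def by blast
next
  fix x :: "ograph \<Rightarrow> 'k" and p q
  assume "x \<in> part p" "x \<in> part q"
  then show "x \<in> part (\<lambda>h w k. p h w k \<and> q h w k)" unfolding part_def by blast
next
  fix x :: "ograph \<Rightarrow> 'k" and r p q
  assume x: "x \<in> part r" and r: "\<And>h w k. r h w k \<Longrightarrow> p h w k \<or> q h w k"
  define a where "a = restrict_series (\<lambda>\<Gamma>. p (hairs \<Gamma>) (int (weight \<Gamma>)) (degree 0 n \<Gamma>)) x"
  have x': "x \<in> graph_series (\<lambda>_. True)" "\<And>G. valid G \<Longrightarrow> \<not> r (hr G) (wt G) (dg G) \<Longrightarrow> Tr x G = 0"
    using x by (auto simp: part_def)
  have ser: "a \<in> graph_series (\<lambda>_. True)" unfolding a_def using x'(1) by (rule series_simps(4))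
  have Tra: "Tr a G = (if p (hr G) (wt G) (dg G) then Tr x G else 0)" for G unfolding a_def by (rule Tr_restrict)
  have "a \<in> part p" unfolding part_def using ser by (simp add: Tra)
  moreover have "x - a \<in> part q"
    unfolding part_def using series_simps(3)[OF x'(1) ser] r x'(2) by (auto simp: Tr_diff Tra simp del: minus_apply)
  moreover have "x = a + (x - a)" by simp
  ultimately show "\<exists>a\<in>part p. \<exists>b\<in>part q. x = a + b" by blast
next
  fix x :: "ograph \<Rightarrow> 'k" and p q
  assume x: "x \<in> part p" and q: "\<And>h h' w k. p h' w k \<Longrightarrow> h \<le> h' \<Longrightarrow> q h w (k + 1)"
  show "Dhair x \<in> part q"
  proof (rule Dsel_part[OF x Dhair_series, where r = "(\<le>)"])
    show "Tr (Dhair x) = Dsel nl (Tr x)" using Tr_Dhair by (simp add: Dop_def)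
  next
    fix G e assume "valid G" "e \<in> nl G"
    then show "e \<in> nl G \<and> hr G \<le> hr (contr G e (side G e))"
      using contraction_stats(3,4)[of G e] by (cases "e \<in> ni G") auto
  qed (rule q)
next
  fix x :: "ograph \<Rightarrow> 'k" and p q
  assume x: "x \<in> part p" and q: "\<And>h w k. p h w k \<Longrightarrow> q h w (k + 1)"
  show "std_diff x \<in> part q"
  proof (rule Dsel_part[OF x std_diff_series, where r = "(=)"])
    show "Tr (std_diff x) = Dsel ni (Tr x)" using Tr_std_diff by (simp add: Dint_def)
  next
    fix G e assume "valid G" "e \<in> ni G"
    then show "e \<in> nl G \<and> hr G = hr (contr G e (side G e))"
      using contraction_stats(3)[of G e] by (simp add: ni_def)
  qed (simp add: q)
next
  fix x :: "ograph \<Rightarrow> 'k" and p q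
  assume x: "x \<in> part p" and q: "\<And>h h' w k. p h' w k \<Longrightarrow> h < h' \<Longrightarrow> q h w (k + 1)"
  show "Dhair x - std_diff x \<in> part q"
  proof (rule Dsel_part[OF x series_simps(3)[OF Dhair_series std_diff_series], where r = "(<)"])
    \<comment> \<open>The difference sums over the non-loop edges at the star, which strictly raise
      the number of hairs.\<close>
    have "Dop (Tr x) G - Dint (Tr x) G = Dsel (\<lambda>G. nl G - ni G) (Tr x) G" for G
    proof (cases "valid G")
      case True
      have "finite (nl G)" using finite_nl valid_finite[OF True] by blast
      moreover have "ni G \<subseteq> nl G" by (auto simp: ni_def)
      ultimately show ?thesis unfolding Dop_def Dint_def Dsel_def using True by (simp add: sum_diff)
    qed (simp add: Dop_def Dint_def Dsel_def)
    then show "Tr (Dhair x - std_diff x) = Dsel (\<lambda>G. nl G - ni G) (Tr x)"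
      unfolding Tr_diff Tr_Dhair Tr_std_diff by blast
  next
    fix G e assume "valid G" "e \<in> nl G - ni G"
    then show "e \<in> nl G \<and> hr G < hr (contr G e (side G e))"
      using contraction_stats(4)[of G e] by simp
  qed (rule q)
next
  show "Dhair (Dhair x) \<in> part (\<lambda>h w k. False)" for x :: "ograph \<Rightarrow> 'k"
    unfolding rel_part[symmetric] hgc_rel_iff Tr_Dhair using Dhair_series Dop_Dop[OF equi_Tr] by blast
next
  fix x :: "ograph \<Rightarrow> 'k"
  assume x: "x \<in> part (\<lambda>h w k. True)" and Dx: "Dhair x \<in> part (\<lambda>h w k. False)"
  have "Dop (Tr x) = (\<lambda>_. 0)" using Dx unfolding rel_part[symmetric] hgc_rel_iff Tr_Dhair by blast
  then obtain \<psi> where \<psi>: "equi \<psi>" "Dop \<psi> = Tr x" using acyclic[OF equi_Tr] by blast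
  have "Sec \<psi> \<in> part (\<lambda>h w k. True)" unfolding part_def using Sec_series by blast
  moreover have "Dhair (Sec \<psi>) - x \<in> part (\<lambda>h w k. False)"
  proof -
    have "x \<in> graph_series (\<lambda>_. True)" using x by (simp add: part_def)
    then show ?thesis
      unfolding rel_part[symmetric] hgc_rel_iff Tr_diff Tr_Dhair Tr_Sec[OF \<psi>(1)] \<psi>(2)
      using series_simps(3)[OF Dhair_series] by auto
  qed
  ultimately show "\<exists>y\<in>part (\<lambda>h w k. True). Dhair y - x \<in> part (\<lambda>h w k. False)" by blast
qed

end

theorem theorem1:
  fixes n :: int
  shows "\<exists>D :: (ograph \<Rightarrow> 'k::field_char_0) \<Rightarrow> (ograph \<Rightarrow> 'k).
    hgc_differential 0 n D \<and>
    (\<forall>p. \<forall>x \<in> hgc_part 0 n (\<lambda>\<Gamma>. hairs \<Gamma> = p).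
        D x - std_diff x \<in> hgc_part 0 n (\<lambda>\<Gamma>. hairs \<Gamma> < p)) \<and>
    (\<forall>N. \<forall>x \<in> hgc 0 n.
        D (restrict_series (\<lambda>\<Gamma>. weight \<Gamma> = N) x) - restrict_series (\<lambda>\<Gamma>. weight \<Gamma> = N) (D x)
          \<in> hgc_rel 0 n) \<and>
    cocycles (hgc_rel 0 n) D (hgc 0 n) = coboundaries (hgc_rel 0 n) D (hgc 0 n) \<and>
    (\<forall>N. ss_converges (hgc_rel 0 n) D (hgc_piece 0 n N) (hgc_filt 0 n N) \<and>
       (\<forall>k. cocycles (hgc_rel 0 n) D (hgc_piece 0 n N k)
              = coboundaries (hgc_rel 0 n) D (hgc_piece 0 n N (k - 1))) \<and>
       (\<forall>p k. incl_induces_iso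
          (cocycles (hgc_rel 0 n) std_diff (hgc_gr 0 n N p k))
          (coboundaries (hgc_rel 0 n) std_diff (hgc_gr 0 n N p (k - 1)))
          (ss_Z D (hgc_filt 0 n N) 1 p k) (ss_B D (hgc_filt 0 n N) 1 p k)))"
proof -
  interpret s: hgc_sign n "(- 1) powi n :: 'k" by unfold_locales (rule refl)
  interpret g: hair_graded s.part s.Dhair std_diff by (rule s.graded)
  have full: "hgc 0 n = s.part (\<lambda>h w k. True)"
    using s.part_eq[of "\<lambda>h w k. True"] by (simp add: hgc_def)
  have degr: "hgc_part 0 n (\<lambda>\<Gamma>. degree 0 n \<Gamma> = k) = s.part (\<lambda>h w l. l = k)" for k
    using s.part_eq[of "\<lambda>h w l. l = k"] by simp
  have hrs: "hgc_part 0 n (\<lambda>\<Gamma>. hairs \<Gamma> = p) = s.part (\<lambda>h w l. h = p)"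
    "hgc_part 0 n (\<lambda>\<Gamma>. hairs \<Gamma> < p) = s.part (\<lambda>h w l. h < p)" for p
    using s.part_eq[of "\<lambda>h w l. h = p"] s.part_eq[of "\<lambda>h w l. h < p"] by simp_all
  have pcs: "hgc_piece 0 n N = g.piece N" "hgc_filt 0 n N = g.filt N" "hgc_gr 0 n N = g.gr N" for N
  proof -
    show "hgc_piece 0 n N = g.piece N"
      unfolding hgc_piece_def using s.part_eq[of "\<lambda>h w l. w = int N \<and> l = k" for k] by (intro ext) simp
    show "hgc_filt 0 n N = g.filt N"
      unfolding hgc_filt_def using s.part_eq[of "\<lambda>h w l. w = int N \<and> l = k \<and> int h \<le> p" for k p] by (intro ext) simp
    show "hgc_gr 0 n N = g.gr N"
      unfolding hgc_gr_def using s.part_eq[of "\<lambda>h w l. w = int N \<and> l = k \<and> int h = p" for k p] by (intro ext) simp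
  qed
  have "hgc_differential 0 n s.Dhair"
    unfolding hgc_differential_def hgc_endo_def full degr s.rel_part
  proof (intro conjI allI ballI s.Dhair_linear g.DD)
    show "s.Dhair ` s.part (\<lambda>h w k. True) \<subseteq> s.part (\<lambda>h w k. True)"
      by (intro image_subsetI, erule g.D_part) simp
    show "s.Dhair ` s.part (\<lambda>h w k. False) \<subseteq> s.part (\<lambda>h w k. False)"
      using g.D_R by blast
    show "s.Dhair ` s.part (\<lambda>h w l. l = k) \<subseteq> s.part (\<lambda>h w l. l = k + 1)" for k
      by (intro image_subsetI, erule g.D_part) simp
  qed
  moreover have "s.Dhair x - std_diff x \<in> s.part (\<lambda>h w l. h < p)" if "x \<in> s.part (\<lambda>h w l. h = p)" for p x
    using that by (rule g.Dd_part) simp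
  moreover have "s.Dhair (restrict_series (\<lambda>\<Gamma>. weight \<Gamma> = N) x) - restrict_series (\<lambda>\<Gamma>. weight \<Gamma> = N) (s.Dhair x)
      \<in> s.part (\<lambda>h w k. False)" (is "?y \<in> _") if x: "x \<in> s.part (\<lambda>h w k. True)" for N x
  proof -
    let ?r = "restrict_series (\<lambda>\<Gamma>. weight \<Gamma> = N) :: (ograph \<Rightarrow> 'k) \<Rightarrow> _"
    have Tr: "s.Tr (?r c) G = (if wt G = int N then s.Tr c G else 0)" for c G
      using s.Tr_restrict[of "\<lambda>h w k. w = int N" c G] by simp
    have r: "?r c \<in> s.part (\<lambda>h w k. w = int N)" "c - ?r c \<in> s.part (\<lambda>h w k. w \<noteq> int N)"
      if "c \<in> s.part (\<lambda>h w k. True)" for c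
    proof -
      have c: "c \<in> graph_series (\<lambda>_. True)" using that by (simp add: s.part_def)
      note s.series_simps(4)[OF c] s.series_simps(3)[OF c s.series_simps(4)[OF c]]
      then show "?r c \<in> s.part (\<lambda>h w k. w = int N)" "c - ?r c \<in> s.part (\<lambda>h w k. w \<noteq> int N)"
        unfolding s.part_def by (auto simp: s.Tr_diff Tr simp del: minus_apply)
    qed
    have Dx: "s.Dhair x \<in> s.part (\<lambda>h w k. True)" using x by (rule g.D_part) simp
    have "s.Dhair (?r x) \<in> s.part (\<lambda>h w k. w = int N)" using r(1)[OF x] by (rule g.D_part) simp
    then have 1: "?y \<in> s.part (\<lambda>h w k. w = int N)" using r(1)[OF Dx] by (rule g.diff)
    \<comment> \<open>The commutator of \<open>D\<close> with the projection to weight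
      \<open>N\<close> has weight \<open>N\<close>. Written with the complementary projections, it
      also has only weights other than \<open>N\<close>, and so vanishes modulo relations.\<close>
    have "s.Dhair (x - ?r x) \<in> s.part (\<lambda>h w k. w \<noteq> int N)" using r(2)[OF x] by (rule g.D_part) simp
    then have "s.Dhair x - ?r (s.Dhair x) - s.Dhair (x - ?r x) \<in> s.part (\<lambda>h w k. w \<noteq> int N)"
      by (rule g.diff[OF r(2)[OF Dx]])
    moreover have "s.Dhair x - ?r (s.Dhair x) - s.Dhair (x - ?r x) = ?y" unfolding g.D_diff by simp
    ultimately have "?y \<in> s.part (\<lambda>h w k. w \<noteq> int N)" by simp
    then show ?thesis by (rule g.R_disj[OF 1]) simp
  qed
  moreover have "cocycles (s.part (\<lambda>h w k. False)) s.Dhair (s.part (\<lambda>h w k. True)) =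
      coboundaries (s.part (\<lambda>h w k. False)) s.Dhair (s.part (\<lambda>h w k. True))"
    using g.cocycles_exact[of "\<lambda>w k. True" "\<lambda>w k. True"] by simp
  ultimately show ?thesis
    unfolding full hrs s.rel_part pcs
    by (intro exI[of _ s.Dhair] conjI allI ballI g.converges g.cocycles_piece g.first_page) blast+
qed

end
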